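(* Let $K$ be a perfect field over $\mathbb{F}_q$, $r>0$ an integer, $\bar K$ an algebraic closure of $K$, $\bar{\mathbb{F}}$ the algebraic closure of $\mathbb{F}_q$ in $\bar K$, $J$ a formal Drinfeld motive of height $r$ over $\bar{\mathbb{F}}$ and $D=\operatorname{End}J$. The functor $V\mapsto T(V)$ transforms formal Drinfeld motives of height $r$ over $K$ into $(-\tfrac1r)$-admissible $(W_K,D)$-representations of rank $1$ over $D$. If $W_K$ is dense in $G_K$, this functor is an equivalence between these two categories.
   Context: $F$ is a local field over $\mathbb{F}_q$ with ring of integers $\mathcal{O}$, uniformizer $z$, $d$ the degree of its residue field over $\mathbb{F}_q$. For a perfect field $L\supset\mathbb{F}_q$, $L((\tau^{-1}))$ is the skew field of Laurent series in $\tau^{-1}$ with finite principal parts and $\alpha\tau^{-1}=\tau^{-1}\alpha^q$, with the $\tau^{-1}$-adic topology. A formal Drinfeld motive over $L$ is a left $L((\tau^{-1}))\otimes_{\mathbb{F}_q}F$-module $V$ of dimension 1 over $L((\tau^{-1}))$ with $\tau^{-1}$-adically continuous $F$-action. Choosing $0\ne v\in V$, define $\phi\colon F\to L((\tau^{-1}))$ by $(\phi(x)\otimes1)v=(1\otimes x)v$; the height of $V$ is $\frac1d v_{\tau^{-1}}(\phi(z))$ ($v_{\tau^{-1}}$ the normalized $\tau^{-1}$-adic valuation). For an automorphism $\gamma$ of $\bar K$, $\gamma_\tau$ is the induced coefficientwise automorphism of $\bar K((\tau^{-1}))$. $G_K=\operatorname{Gal}(\bar K/K)$; $\operatorname{ord}\colon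 G_K\to\hat{\mathbb{Z}}$ is restriction to $\bar{\mathbb{F}}$ with $\operatorname{Gal}(\bar{\mathbb{F}}/\mathbb{F}_q)\cong\hat{\mathbb{Z}}$ via the geometric Frobenius; $W_K=\operatorname{ord}^{-1}(\mathbb{Z})$, topologized with $\operatorname{ord}^{-1}(0)$ an open subgroup carrying its profinite topology. For $V$ over $K$, $\bar V=\bar K((\tau^{-1}))\otimes_{K((\tau^{-1}))}V$ and $T(V)=\operatorname{Hom}_{\bar{\mathbb{F}}((\tau^{-1}))\otimes_{\mathbb{F}_q}F}(J,\bar V)$, a right $D$-module, with $\gamma\in W_K$ acting by $\gamma(f)(y)=(\gamma_\tau\otimes\mathrm{id}_V)(f(\tau^{\operatorname{ord}\gamma}y))$. A $(W_K,D)$-representation is a right $D$-module of finite rank with a left $D$-linear $W_K$-action continuous for the $F$-vector space topology. A lattice in a finite-dimensional $F$-space is a finitely generated spanning $\mathcal{O}$-submodule. $V$ is $\lambda$-admissible if there are integers $s,r'$, $r'>0$, $\lambda=s/r'$, and a lattice $\Lambda$ with $\gamma^{r'd}\Lambda=\Lambda z^{s\operatorname{ord}\gamma}$ for all $\gamma\in W_K$. *)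

theory Defs
  imports
    "HOL-Analysis.Analysis"
    "HOL-Algebra.Algebra"
    "HOL-Algebra.Algebraic_Closure_Type"
    "HOL-Computational_Algebra.Formal_Laurent_Series"
begin

unbundle fps_syntax

section \<open>Modules over not necessarily commutative rings\<close>

text \<open>
  HOL-Algebra's locale \<open>module\<close> is restricted to commutative base rings.  As there, a module is
  an additive group presented as (the additive part of) a \<^typ>\<open>'v ring\<close>; the
  multiplicative part of that record is irrelevant throughout.
\<close>

definition left_module ::
  "('r, 'x) ring_scheme \<Rightarrow> ('v, 'y) ring_scheme \<Rightarrow> ('r \<Rightarrow> 'v \<Rightarrow> 'v) \<Rightarrow> bool"
where
  "left_module R M sc \<longleftrightarrow> ring R \<and> abelian_group M \<and>
    (\<forall>a\<in>carrier R. \<forall>v\<in>carrier M. sc a v \<in> carrier M) \<and>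
    (\<forall>a\<in>carrier R. \<forall>v\<in>carrier M. \<forall>w\<in>carrier M. sc a (v \<oplus>\<^bsub>M\<^esub> w) = sc a v \<oplus>\<^bsub>M\<^esub> sc a w) \<and>
    (\<forall>a\<in>carrier R. \<forall>b\<in>carrier R. \<forall>v\<in>carrier M. sc (a \<oplus>\<^bsub>R\<^esub> b) v = sc a v \<oplus>\<^bsub>M\<^esub> sc b v) \<and>
    (\<forall>a\<in>carrier R. \<forall>b\<in>carrier R. \<forall>v\<in>carrier M. sc (a \<otimes>\<^bsub>R\<^esub> b) v = sc a (sc b v)) \<and>
    (\<forall>v\<in>carrier M. sc \<one>\<^bsub>R\<^esub> v = v)"

definition right_module ::
  "('r, 'x) ring_scheme \<Rightarrow> ('v, 'y) ring_scheme \<Rightarrow> ('v \<Rightarrow> 'r \<Rightarrow> 'v) \<Rightarrow> bool"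
where
  "right_module R M sc \<longleftrightarrow> ring R \<and> abelian_group M \<and>
    (\<forall>a\<in>carrier R. \<forall>v\<in>carrier M. sc v a \<in> carrier M) \<and>
    (\<forall>a\<in>carrier R. \<forall>v\<in>carrier M. \<forall>w\<in>carrier M. sc (v \<oplus>\<^bsub>M\<^esub> w) a = sc v a \<oplus>\<^bsub>M\<^esub> sc w a) \<and>
    (\<forall>a\<in>carrier R. \<forall>b\<in>carrier R. \<forall>v\<in>carrier M. sc v (a \<oplus>\<^bsub>R\<^esub> b) = sc v a \<oplus>\<^bsub>M\<^esub> sc v b) \<and>
    (\<forall>a\<in>carrier R. \<forall>b\<in>carrier R. \<forall>v\<in>carrier M. sc v (a \<otimes>\<^bsub>R\<^esub> b) = sc (sc v a) b) \<and>
    (\<forall>v\<in>carrier M. sc v \<one>\<^bsub>R\<^esub> = v)"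

text \<open>
  In the next three definitions \<open>sc a v\<close> is the result of letting the scalar \<open>a\<close> act on \<open>v\<close>,
  from whichever side.
\<close>

definition lin_span ::
  "('v, 'y) ring_scheme \<Rightarrow> ('r \<Rightarrow> 'v \<Rightarrow> 'v) \<Rightarrow> 'r set \<Rightarrow> 'v set \<Rightarrow> 'v set"
where
  "lin_span M sc S A =
    {finsum M (\<lambda>b. sc (c b) b) B | B c. finite B \<and> B \<subseteq> A \<and> c \<in> B \<rightarrow> S}"

definition is_basis ::
  "('r, 'x) ring_scheme \<Rightarrow> ('v, 'y) ring_scheme \<Rightarrow> ('r \<Rightarrow> 'v \<Rightarrow> 'v) \<Rightarrow> 'v set \<Rightarrow> bool"
where
  "is_basis R M sc B \<longleftrightarrow> finite B \<and> B \<subseteq> carrier M \<and>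
    (\<forall>v\<in>carrier M. \<exists>!c. c \<in> B \<rightarrow>\<^sub>E carrier R \<and> v = finsum M (\<lambda>b. sc (c b) b) B)"

definition has_rank ::
  "('r, 'x) ring_scheme \<Rightarrow> ('v, 'y) ring_scheme \<Rightarrow> ('r \<Rightarrow> 'v \<Rightarrow> 'v) \<Rightarrow> nat \<Rightarrow> bool"
where
  "has_rank R M sc n \<longleftrightarrow> (\<exists>B. is_basis R M sc B \<and> card B = n)"


section \<open>Categories\<close>

text \<open>
  Hom-sets are indexed by pairs of objects and need not be disjoint; correspondingly composition,
  \<open>Comp C P Q R g f\<close> for \<open>f : P \<rightarrow> Q\<close> and \<open>g : Q \<rightarrow> R\<close>, and the arrow part of a functor take
  the objects as arguments.
\<close>

record ('o, 'm) category =
  Ob :: "'o set"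
  Arr :: "'o \<Rightarrow> 'o \<Rightarrow> 'm set"
  Comp :: "'o \<Rightarrow> 'o \<Rightarrow> 'o \<Rightarrow> 'm \<Rightarrow> 'm \<Rightarrow> 'm"
  Idn :: "'o \<Rightarrow> 'm"

definition is_category :: "('o, 'm) category \<Rightarrow> bool" where
  "is_category C \<longleftrightarrow>
    (\<forall>P\<in>Ob C. Idn C P \<in> Arr C P P) \<and>
    (\<forall>P\<in>Ob C. \<forall>Q\<in>Ob C. \<forall>R\<in>Ob C. \<forall>f\<in>Arr C P Q. \<forall>g\<in>Arr C Q R. Comp C P Q R g f \<in> Arr C P R) \<and>
    (\<forall>P\<in>Ob C. \<forall>Q\<in>Ob C. \<forall>f\<in>Arr C P Q.
      Comp C P P Q f (Idn C P) = f \<and> Comp C P Q Q (Idn C Q) f = f) \<and>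
    (\<forall>P\<in>Ob C. \<forall>Q\<in>Ob C. \<forall>R\<in>Ob C. \<forall>S\<in>Ob C. \<forall>f\<in>Arr C P Q. \<forall>g\<in>Arr C Q R. \<forall>h\<in>Arr C R S.
      Comp C P R S h (Comp C P Q R g f) = Comp C P Q S (Comp C Q R S h g) f)"

definition is_functor ::
  "('o, 'm) category \<Rightarrow> ('p, 'n) category \<Rightarrow> ('o \<Rightarrow> 'p) \<Rightarrow> ('o \<Rightarrow> 'o \<Rightarrow> 'm \<Rightarrow> 'n) \<Rightarrow> bool"
where
  "is_functor C D Fo Fm \<longleftrightarrow> is_category C \<and> is_category D \<and>
    (\<forall>P\<in>Ob C. Fo P \<in> Ob D) \<and>
    (\<forall>P\<in>Ob C. \<forall>Q\<in>Ob C. \<forall>f\<in>Arr C P Q. Fm P Q f \<in> Arr D (Fo P) (Fo Q)) \<and>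
    (\<forall>P\<in>Ob C. Fm P P (Idn C P) = Idn D (Fo P)) \<and>
    (\<forall>P\<in>Ob C. \<forall>Q\<in>Ob C. \<forall>R\<in>Ob C. \<forall>f\<in>Arr C P Q. \<forall>g\<in>Arr C Q R.
      Fm P R (Comp C P Q R g f) = Comp D (Fo P) (Fo Q) (Fo R) (Fm Q R g) (Fm P Q f))"

definition is_iso :: "('o, 'm) category \<Rightarrow> 'o \<Rightarrow> 'o \<Rightarrow> 'm \<Rightarrow> bool" where
  "is_iso C P Q f \<longleftrightarrow> f \<in> Arr C P Q \<and>
    (\<exists>g\<in>Arr C Q P. Comp C P Q P g f = Idn C P \<and> Comp C Q P Q f g = Idn C Q)"

definition is_nat_iso ::
  "('o, 'm) category \<Rightarrow> ('p, 'n) category \<Rightarrow> ('o \<Rightarrow> 'p) \<Rightarrow> ('o \<Rightarrow> 'o \<Rightarrow> 'm \<Rightarrow> 'n) \<Rightarrow>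
    ('o \<Rightarrow> 'p) \<Rightarrow> ('o \<Rightarrow> 'o \<Rightarrow> 'm \<Rightarrow> 'n) \<Rightarrow> ('o \<Rightarrow> 'n) \<Rightarrow> bool"
where
  "is_nat_iso C D Fo Fm Go Gm \<eta> \<longleftrightarrow>
    (\<forall>P\<in>Ob C. is_iso D (Fo P) (Go P) (\<eta> P)) \<and>
    (\<forall>P\<in>Ob C. \<forall>Q\<in>Ob C. \<forall>f\<in>Arr C P Q.
      Comp D (Fo P) (Fo Q) (Go Q) (\<eta> Q) (Fm P Q f) =
      Comp D (Fo P) (Go P) (Go Q) (Gm P Q f) (\<eta> P))"

definition is_equivalence ::
  "('o, 'm) category \<Rightarrow> ('p, 'n) category \<Rightarrow> ('o \<Rightarrow> 'p) \<Rightarrow> ('o \<Rightarrow> 'o \<Rightarrow> 'm \<Rightarrow> 'n) \<Rightarrow> bool"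
where
  "is_equivalence C D Fo Fm \<longleftrightarrow> is_functor C D Fo Fm \<and>
    (\<exists>Go Gm. is_functor D C Go Gm \<and>
      (\<exists>\<eta>. is_nat_iso C C (\<lambda>P. P) (\<lambda>P Q f. f)
             (\<lambda>P. Go (Fo P)) (\<lambda>P Q f. Gm (Fo P) (Fo Q) (Fm P Q f)) \<eta>) \<and>
      (\<exists>\<epsilon>. is_nat_iso D D (\<lambda>W. Fo (Go W)) (\<lambda>W S g. Fm (Go W) (Go S) (Gm W S g))
             (\<lambda>W. W) (\<lambda>W S g. g) \<epsilon>))"


section \<open>Local fields\<close>

text \<open>A local field is given together with its normalized valuation (with no convention at \<open>0\<close>).\<close>

definition val_ideal :: "('f::field \<Rightarrow> int) \<Rightarrow> int \<Rightarrow> 'f set" where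
  "val_ideal val n = {x. x = 0 \<or> n \<le> val x}"

definition val_ring :: "('f::field \<Rightarrow> int) \<Rightarrow> 'f ring" where
  "val_ring val = ring_of_type_algebra\<lparr>carrier := val_ideal val 0\<rparr>"

definition residue_field :: "('f::field \<Rightarrow> int) \<Rightarrow> 'f set ring" where
  "residue_field val = val_ring val Quot val_ideal val 1"

definition local_field :: "('f::field \<Rightarrow> int) \<Rightarrow> bool" where
  "local_field val \<longleftrightarrow>
    (\<forall>x y. x \<noteq> 0 \<longrightarrow> y \<noteq> 0 \<longrightarrow> val (x * y) = val x + val y) \<and>
    (\<forall>x y. x \<noteq> 0 \<longrightarrow> y \<noteq> 0 \<longrightarrow> x + y \<noteq> 0 \<longrightarrow> min (val x) (val y) \<le> val (x + y)) \<and>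
    (\<exists>x. x \<noteq> 0 \<and> val x = 1) \<and>
    (\<forall>a::nat \<Rightarrow> 'f. (\<forall>n. \<exists>N. \<forall>i\<ge>N. \<forall>j\<ge>N. a i - a j \<in> val_ideal val n) \<longrightarrow>
      (\<exists>x. \<forall>n. \<exists>N. \<forall>i\<ge>N. a i - x \<in> val_ideal val n)) \<and>
    finite (carrier (residue_field val))"

definition val_topology :: "('f::field \<Rightarrow> int) \<Rightarrow> 'f topology" where
  "val_topology val = topology_generated_by {(\<lambda>y. x + y) ` val_ideal val n | x n. True}"


section \<open>Skew Laurent series\<close>

text \<open>
  An element \<open>\<Sum>\<^sub>n a\<^sub>n \<tau>\<^sup>-\<^sup>n\<close> of \<open>L((\<tau>\<^sup>-\<^sup>1))\<close>, with coefficients written on the left, is represented by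
  the formal Laurent series with coefficients \<open>a\<^sub>n\<close>, i.e. \<open>\<tau>\<^sup>-\<^sup>1\<close> is \<^term>\<open>fls_X\<close>.  Addition,
  order of vanishing (\<^const>\<open>fls_subdegree\<close>) and the \<open>\<tau>\<^sup>-\<^sup>1\<close>-adic topology are those of
  \<^typ>\<open>'c fls\<close>, but not the multiplication, where \<open>\<tau>\<^sup>n b = frob q n b \<tau>\<^sup>n\<close>
  for all integers \<open>n\<close>.
\<close>

text \<open>\<open>frob q n\<close> raises to the power \<open>q ^ n\<close>, also for negative \<open>n\<close>; it is only used on fields where this is bijective.\<close>

definition frob :: "nat \<Rightarrow> int \<Rightarrow> 'c::field \<Rightarrow> 'c" where
  "frob q n x = (if 0 \<le> n then x ^ (q ^ nat n) else inv_into UNIV (\<lambda>y. y ^ (q ^ nat (- n))) x)"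

definition skew_mult :: "nat \<Rightarrow> 'c::field fls \<Rightarrow> 'c fls \<Rightarrow> 'c fls" where
  "skew_mult q f g =
    Abs_fls (\<lambda>n. \<Sum>i = fls_subdegree f..n - fls_subdegree g. f $$ i * frob q (- i) (g $$ (n - i)))"

definition laurent_over :: "'c::field set \<Rightarrow> 'c fls set" where
  "laurent_over L = {f. \<forall>n. f $$ n \<in> L}"

definition skew_laurent :: "nat \<Rightarrow> 'c::field set \<Rightarrow> 'c fls ring" where
  "skew_laurent q L =
    \<lparr>carrier = laurent_over L, monoid.mult = skew_mult q, one = 1, ring.zero = 0, add = (+)\<rparr>"

definition tau_pow :: "int \<Rightarrow> 'c::field fls" where
  "tau_pow n = fls_X_intpow (- n)"

definition coeffwise :: "('c::field \<Rightarrow> 'c) \<Rightarrow> 'c fls \<Rightarrow> 'c fls" where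
  "coeffwise \<gamma> f = Abs_fls (\<lambda>n. \<gamma> (f $$ n))"

lemma skew_mult_nth:
  "skew_mult q f g $$ n =
    (\<Sum>i = fls_subdegree f..n - fls_subdegree g. f $$ i * frob q (- i) (g $$ (n - i)))"
proof -
  have "\<forall>\<^sub>\<infinity>n::nat. (\<Sum>i = fls_subdegree f..- int n - fls_subdegree g.
      f $$ i * frob q (- i) (g $$ (- int n - i))) = 0"
    unfolding MOST_nat
    by (rule exI[of _ "nat (- (fls_subdegree f + fls_subdegree g))"]) auto
  then show ?thesis
    unfolding skew_mult_def by simp
qed

lemma tau_inverse_commutation:
  assumes "0 < q" and inj: "inj (\<lambda>x::'c::field. x ^ q)"
  shows "skew_mult q (fls_const \<alpha>) fls_X = skew_mult q fls_X (fls_const (\<alpha> ^ q :: 'c))"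
proof -
  have 1: "frob q (- 1) (\<alpha> ^ q) = \<alpha>"
    using inv_f_f[OF inj] by (simp add: frob_def)
  have 2: "frob q (- 1) (0::'c) = 0"
    using inv_f_f[OF inj, of 0] \<open>0 < q\<close> by (simp add: frob_def zero_power)
  have 3: "frob q 0 x = x" for x :: 'c
    by (simp add: frob_def)
  show ?thesis
  proof (rule fls_eqI)
    fix n :: int
    have l: "skew_mult q (fls_const \<alpha>) fls_X $$ n = (if n = 1 then \<alpha> else 0)"
    proof (cases "1 \<le> n")
      case True
      then have "{0..n - 1} = insert 0 {1..n - 1}" by auto
      then show ?thesis by (auto simp: skew_mult_nth 3)
    qed (auto simp: skew_mult_nth)
    have r: "skew_mult q fls_X (fls_const (\<alpha> ^ q)) $$ n = (if n = 1 then \<alpha> else 0)"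
    proof (cases "1 \<le> n")
      case True
      then have "{1..n} = insert 1 {2..n}" by auto
      then show ?thesis by (auto simp: skew_mult_nth 1 2)
    qed (auto simp: skew_mult_nth)
    show "skew_mult q (fls_const \<alpha>) fls_X $$ n = skew_mult q fls_X (fls_const (\<alpha> ^ q)) $$ n"
      unfolding l r ..
  qed
qed


section \<open>Formal Drinfeld motives and their representations\<close>

text \<open>
  A left module over \<open>L((\<tau>\<^sup>-\<^sup>1)) \<otimes> F\<close> (tensor product over the finite field) is an additive group with
  an action \<open>lmul\<close> of \<open>L((\<tau>\<^sup>-\<^sup>1))\<close> (the action of \<open>s \<otimes> 1\<close>) and an action \<open>fmul\<close> of \<open>F\<close> (the
  action of \<open>1 \<otimes> x\<close>) which commute and which agree on the finite field.
\<close>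

record ('s, 'f, 'v) bimod = "'v ring" +
  lmul :: "'s \<Rightarrow> 'v \<Rightarrow> 'v"
  fmul :: "'f \<Rightarrow> 'v \<Rightarrow> 'v"

text \<open>\<open>bimod_hom L V W\<close> consists of the \<open>L((\<tau>\<^sup>-\<^sup>1)) \<otimes> F\<close>-linear maps from \<open>V\<close> to \<open>W\<close>.\<close>

definition bimod_hom ::
  "'c::field set \<Rightarrow> ('c fls, 'f, 'v) bimod \<Rightarrow> ('c fls, 'f, 'w) bimod \<Rightarrow> ('v \<Rightarrow> 'w) set"
where
  "bimod_hom L V W = {h \<in> carrier V \<rightarrow>\<^sub>E carrier W.
    (\<forall>v\<in>carrier V. \<forall>w\<in>carrier V. h (v \<oplus>\<^bsub>V\<^esub> w) = h v \<oplus>\<^bsub>W\<^esub> h w) \<and>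
    (\<forall>s\<in>laurent_over L. \<forall>v\<in>carrier V. h (lmul V s v) = lmul W s (h v)) \<and>
    (\<forall>x. \<forall>v\<in>carrier V. h (fmul V x v) = fmul W x (h v))}"

text \<open>
  A right module over a ring of type \<^typ>\<open>'d ring\<close>, with an action of (some of) the self-maps
  of \<^typ>\<open>'c\<close>.
\<close>

record ('d, 'c, 'w) wrep = "'w ring" +
  rmul :: "'w \<Rightarrow> 'd \<Rightarrow> 'w"
  wact :: "('c \<Rightarrow> 'c) \<Rightarrow> 'w \<Rightarrow> 'w"

text \<open>
  The type \<^typ>\<open>'q\<close> is the finite field, with \<open>q = CARD('q)\<close> elements, the type \<^typ>\<open>'c\<close> is
  the algebraic closure of its subfield \<open>K\<close>, and the type \<^typ>\<open>'f\<close> is the local field \<open>F\<close>, with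
  normalized valuation \<open>val\<close> and uniformizer \<open>z\<close>.
\<close>

locale drinfeld_setting =
  fixes embK :: "'q::{finite, field} \<Rightarrow> 'c::field"
    and embF :: "'q \<Rightarrow> 'f::field"
    and K :: "'c set"
    and val :: "'f \<Rightarrow> int"
    and z :: 'f
  assumes Kbar: "algebraic_closure ring_of_type_algebra K"
    and embK: "embK \<in> ring_hom ring_of_type_algebra ring_of_type_algebra" "range embK \<subseteq> K"
    and perfect: "\<forall>x\<in>K. \<exists>y\<in>K. y ^ CHAR('c) = x"
    and F: "local_field val"
    and embF: "embF \<in> ring_hom ring_of_type_algebra ring_of_type_algebra"
    and uniformizer: "z \<noteq> 0" "val z = 1"
begin

definition Fbar :: "'c set" where
  "Fbar = {x. ring.algebraic ring_of_type_algebra (range embK) x}"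

definition residue_degree :: nat where
  "residue_degree = ring.dim (residue_field val)
    ((\<lambda>a. val_ideal val 1 +>\<^bsub>val_ring val\<^esub> embF a) ` UNIV) (carrier (residue_field val))"

subsection \<open>Formal Drinfeld motives\<close>

text \<open>
  If \<open>V\<close> has dimension \<open>1\<close>, this is the topology for which \<open>s \<mapsto> s v\<close> is a homeomorphism
  \<open>L((\<tau>\<^sup>-\<^sup>1)) \<rightarrow> V\<close> for every nonzero \<open>v\<close>.
\<close>

definition tau_topology :: "'c set \<Rightarrow> ('c fls, 'f, 'v) bimod \<Rightarrow> 'v topology" where
  "tau_topology L V = topology_generated_by
    {(\<lambda>s. lmul V s v) ` U | U v. openin (top_of_set (laurent_over L)) U \<and>
      v \<in> carrier V - {\<zero>\<^bsub>V\<^esub>}}"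

definition formal_motive :: "'c set \<Rightarrow> ('c fls, 'f, 'v) bimod \<Rightarrow> bool" where
  "formal_motive L V \<longleftrightarrow>
    left_module (skew_laurent CARD('q) L) V (lmul V) \<and>
    left_module (ring_of_type_algebra :: 'f ring) V (fmul V) \<and>
    (\<forall>s\<in>laurent_over L. \<forall>x. \<forall>v\<in>carrier V. lmul V s (fmul V x v) = fmul V x (lmul V s v)) \<and>
    (\<forall>a. \<forall>v\<in>carrier V. lmul V (fls_const (embK a)) v = fmul V (embF a) v) \<and>
    has_rank (skew_laurent CARD('q) L) V (lmul V) 1 \<and>
    continuous_map (prod_topology (val_topology val) (tau_topology L V)) (tau_topology L V)
      (\<lambda>(x, v). fmul V x v)"

definition phi :: "'c set \<Rightarrow> ('c fls, 'f, 'v) bimod \<Rightarrow> 'v \<Rightarrow> 'f \<Rightarrow> 'c fls" where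
  "phi L V v x = (THE s. s \<in> laurent_over L \<and> lmul V s v = fmul V x v)"

definition height :: "'c set \<Rightarrow> ('c fls, 'f, 'v) bimod \<Rightarrow> rat" where
  "height L V = (let v = (SOME v. v \<in> carrier V \<and> v \<noteq> \<zero>\<^bsub>V\<^esub>)
    in of_int (fls_subdegree (phi L V v z)) / of_nat residue_degree)"

definition motives :: "nat \<Rightarrow> (('c fls, 'f, 'v) bimod, 'v \<Rightarrow> 'v) category" where
  "motives r =
    \<lparr>Ob = {V. formal_motive K V \<and> height K V = of_nat r},
     Arr = bimod_hom K,
     Comp = (\<lambda>P Q R g f. compose (carrier P) g f),
     Idn = (\<lambda>P. \<lambda>v\<in>carrier P. v)\<rparr>"

subsection \<open>Galois group and Weil group\<close>

definition gal :: "('c \<Rightarrow> 'c) set" where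
  "gal = {\<gamma> \<in> ring_iso ring_of_type_algebra ring_of_type_algebra. \<forall>x\<in>K. \<gamma> x = x}"

definition krull_topology :: "('c \<Rightarrow> 'c) topology" where
  "krull_topology =
    subtopology (product_topology (\<lambda>_. discrete_topology UNIV) UNIV) gal"

text \<open>
  \<open>ord \<gamma>\<close> is the integer \<open>n\<close> for which the restriction of \<open>\<gamma>\<close> to \<open>Fbar\<close> is the \<open>n\<close>-th power of the
  geometric Frobenius \<open>x \<mapsto> x\<^sup>1\<^sup>/\<^sup>q\<close>; the elements for which it exists are those whose order in
  the profinite completion of the integers is an integer.
\<close>

definition has_ord :: "('c \<Rightarrow> 'c) \<Rightarrow> int \<Rightarrow> bool" where
  "has_ord \<gamma> n \<longleftrightarrow> (\<forall>x\<in>Fbar. \<gamma> x = frob CARD('q) (- n) x)"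

definition weil :: "('c \<Rightarrow> 'c) set" where
  "weil = {\<gamma> \<in> gal. \<exists>n. has_ord \<gamma> n}"

definition ord :: "('c \<Rightarrow> 'c) \<Rightarrow> int" where
  "ord \<gamma> = (THE n. has_ord \<gamma> n)"

definition weil_topology :: "('c \<Rightarrow> 'c) topology" where
  "weil_topology = topology_generated_by
    {(\<lambda>\<iota>. \<gamma> \<circ> \<iota>) ` U | \<gamma> U. \<gamma> \<in> weil \<and>
      openin (subtopology krull_topology {\<iota> \<in> weil. ord \<iota> = 0}) U}"

subsection \<open>Base change to the algebraic closure\<close>

text \<open>
  The tensor product of \<open>Kbar((\<tau>\<^sup>-\<^sup>1))\<close> and \<open>V\<close> over \<open>K((\<tau>\<^sup>-\<^sup>1))\<close> is the quotient of the free abelian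
  group on pairs by the subgroup of bilinear and balancing relations.
\<close>

definition tensor_free :: "('c fls, 'f, 'v) bimod \<Rightarrow> ('c fls \<times> 'v \<Rightarrow>\<^sub>0 int) monoid" where
  "tensor_free V = free_Abelian_group (UNIV \<times> carrier V)"

definition tensor_rel :: "('c fls, 'f, 'v) bimod \<Rightarrow> ('c fls \<times> 'v \<Rightarrow>\<^sub>0 int) set" where
  "tensor_rel V = generate (tensor_free V)
    ({frag_of (a + b, v) - frag_of (a, v) - frag_of (b, v) | a b v. v \<in> carrier V} \<union>
     {frag_of (a, v \<oplus>\<^bsub>V\<^esub> w) - frag_of (a, v) - frag_of (a, w) | a v w.
        v \<in> carrier V \<and> w \<in> carrier V} \<union>
     {frag_of (skew_mult CARD('q) a s, v) - frag_of (a, lmul V s v) | a s v.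
        s \<in> laurent_over K \<and> v \<in> carrier V})"

text \<open>
  \<open>tensor_map V W h\<close> is the homomorphism \<open>[a \<otimes> v] \<mapsto> [a' \<otimes> v']\<close> with \<open>(a', v') = h (a, v)\<close>, for
  any \<open>h\<close> whose additive extension maps relations to relations (so that the union is over equal sets).
\<close>

definition tensor_map ::
  "('c fls, 'f, 'v) bimod \<Rightarrow> ('c fls, 'f, 'w) bimod \<Rightarrow> ('c fls \<times> 'v \<Rightarrow> 'c fls \<times> 'w) \<Rightarrow>
    ('c fls \<times> 'v \<Rightarrow>\<^sub>0 int) set \<Rightarrow> ('c fls \<times> 'w \<Rightarrow>\<^sub>0 int) set"
where
  "tensor_map V W h C =
    (\<Union>c\<in>C. tensor_rel W #>\<^bsub>tensor_free W\<^esub> frag_extend (\<lambda>p. frag_of (h p)) c)"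

definition base_change ::
  "('c fls, 'f, 'v) bimod \<Rightarrow> ('c fls, 'f, ('c fls \<times> 'v \<Rightarrow>\<^sub>0 int) set) bimod"
where
  "base_change V =
    \<lparr>carrier = carrier (tensor_free V Mod tensor_rel V),
     monoid.mult = undefined, one = undefined,
     ring.zero = \<one>\<^bsub>tensor_free V Mod tensor_rel V\<^esub>,
     add = monoid.mult (tensor_free V Mod tensor_rel V),
     lmul = (\<lambda>a. tensor_map V V (\<lambda>(b, v). (skew_mult CARD('q) a b, v))),
     fmul = (\<lambda>x. tensor_map V V (\<lambda>(b, v). (b, fmul V x v)))\<rparr>"

subsection \<open>Representations\<close>

definition EndJ :: "('c fls, 'f, 'j) bimod \<Rightarrow> ('j \<Rightarrow> 'j) ring" where
  "EndJ J =
    \<lparr>carrier = bimod_hom Fbar J J,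
     monoid.mult = (\<lambda>f g. compose (carrier J) f g),
     one = (\<lambda>y\<in>carrier J. y),
     ring.zero = (\<lambda>y\<in>carrier J. \<zero>\<^bsub>J\<^esub>),
     add = (\<lambda>f g. \<lambda>y\<in>carrier J. f y \<oplus>\<^bsub>J\<^esub> g y)\<rparr>"

text \<open>The image of \<open>x \<in> F\<close> in \<open>End J\<close>, through which \<open>F\<close> acts on right \<open>End J\<close>-modules.\<close>

definition scalar :: "('c fls, 'f, 'j) bimod \<Rightarrow> 'f \<Rightarrow> ('j \<Rightarrow> 'j)" where
  "scalar J x = (\<lambda>y\<in>carrier J. fmul J x y)"

definition is_lattice ::
  "('c fls, 'f, 'j) bimod \<Rightarrow> ('j \<Rightarrow> 'j, 'c, 'w) wrep \<Rightarrow> 'w set \<Rightarrow> bool"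
where
  "is_lattice J W \<Lambda> \<longleftrightarrow>
    (\<exists>B. finite B \<and> B \<subseteq> carrier W \<and>
      \<Lambda> = lin_span W (\<lambda>x w. rmul W w (scalar J x)) (val_ideal val 0) B) \<and>
    lin_span W (\<lambda>x w. rmul W w (scalar J x)) UNIV \<Lambda> = carrier W"

text \<open>The lattices are a fundamental system of neighbourhoods of \<open>0\<close> in the \<open>F\<close>-vector space topology.\<close>

definition vs_topology ::
  "('c fls, 'f, 'j) bimod \<Rightarrow> ('j \<Rightarrow> 'j, 'c, 'w) wrep \<Rightarrow> 'w topology"
where
  "vs_topology J W = topology_generated_by
    {(\<lambda>y. w \<oplus>\<^bsub>W\<^esub> y) ` \<Lambda> | w \<Lambda>. w \<in> carrier W \<and> is_lattice J W \<Lambda>}"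

definition representation ::
  "('c fls, 'f, 'j) bimod \<Rightarrow> ('j \<Rightarrow> 'j, 'c, 'w) wrep \<Rightarrow> bool"
where
  "representation J W \<longleftrightarrow>
    right_module (EndJ J) W (rmul W) \<and>
    (\<exists>n. has_rank (EndJ J) W (\<lambda>a w. rmul W w a) n) \<and>
    (\<forall>\<gamma>\<in>weil. \<forall>w\<in>carrier W. wact W \<gamma> w \<in> carrier W) \<and>
    (\<forall>\<gamma>\<in>weil. \<forall>v\<in>carrier W. \<forall>w\<in>carrier W.
      wact W \<gamma> (v \<oplus>\<^bsub>W\<^esub> w) = wact W \<gamma> v \<oplus>\<^bsub>W\<^esub> wact W \<gamma> w) \<and>
    (\<forall>\<gamma>\<in>weil. \<forall>w\<in>carrier W. \<forall>a\<in>carrier (EndJ J).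
      wact W \<gamma> (rmul W w a) = rmul W (wact W \<gamma> w) a) \<and>
    (\<forall>w\<in>carrier W. wact W id w = w) \<and>
    (\<forall>\<gamma>\<in>weil. \<forall>\<delta>\<in>weil. \<forall>w\<in>carrier W. wact W (\<gamma> \<circ> \<delta>) w = wact W \<gamma> (wact W \<delta> w)) \<and>
    continuous_map (prod_topology weil_topology (vs_topology J W)) (vs_topology J W)
      (\<lambda>(\<gamma>, w). wact W \<gamma> w)"

definition admissible ::
  "('c fls, 'f, 'j) bimod \<Rightarrow> rat \<Rightarrow> ('j \<Rightarrow> 'j, 'c, 'w) wrep \<Rightarrow> bool"
where
  "admissible J l W \<longleftrightarrow>
    (\<exists>(s::int) (r'::int) \<Lambda>. 0 < r' \<and> l = of_int s / of_int r' \<and> is_lattice J W \<Lambda> \<and>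
      (\<forall>\<gamma>\<in>weil. wact W (\<gamma> ^^ (nat r' * residue_degree)) ` \<Lambda> =
        (\<lambda>w. rmul W w (scalar J (z powi (s * ord \<gamma>)))) ` \<Lambda>))"

definition rep_hom ::
  "('c fls, 'f, 'j) bimod \<Rightarrow> ('j \<Rightarrow> 'j, 'c, 'w) wrep \<Rightarrow> ('j \<Rightarrow> 'j, 'c, 'u) wrep \<Rightarrow> ('w \<Rightarrow> 'u) set"
where
  "rep_hom J W U = {h \<in> carrier W \<rightarrow>\<^sub>E carrier U.
    (\<forall>v\<in>carrier W. \<forall>w\<in>carrier W. h (v \<oplus>\<^bsub>W\<^esub> w) = h v \<oplus>\<^bsub>U\<^esub> h w) \<and>
    (\<forall>w\<in>carrier W. \<forall>a\<in>carrier (EndJ J). h (rmul W w a) = rmul U (h w) a) \<and>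
    (\<forall>\<gamma>\<in>weil. \<forall>w\<in>carrier W. h (wact W \<gamma> w) = wact U \<gamma> (h w))}"

definition admissible_reps ::
  "('c fls, 'f, 'j) bimod \<Rightarrow> rat \<Rightarrow> (('j \<Rightarrow> 'j, 'c, 'w) wrep, 'w \<Rightarrow> 'w) category"
where
  "admissible_reps J l =
    \<lparr>Ob = {W. representation J W \<and> has_rank (EndJ J) W (\<lambda>a w. rmul W w a) 1 \<and> admissible J l W},
     Arr = rep_hom J,
     Comp = (\<lambda>P Q R g f. compose (carrier P) g f),
     Idn = (\<lambda>P. \<lambda>w\<in>carrier P. w)\<rparr>"

subsection \<open>The functor T\<close>

definition T ::
  "('c fls, 'f, 'j) bimod \<Rightarrow> ('c fls, 'f, 'v) bimod \<Rightarrow>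
    ('j \<Rightarrow> 'j, 'c, 'j \<Rightarrow> ('c fls \<times> 'v \<Rightarrow>\<^sub>0 int) set) wrep"
where
  "T J V =
    \<lparr>carrier = bimod_hom Fbar J (base_change V),
     monoid.mult = undefined, one = undefined,
     ring.zero = (\<lambda>y\<in>carrier J. \<zero>\<^bsub>base_change V\<^esub>),
     add = (\<lambda>f g. \<lambda>y\<in>carrier J. f y \<oplus>\<^bsub>base_change V\<^esub> g y),
     rmul = (\<lambda>f a. compose (carrier J) f a),
     wact = (\<lambda>\<gamma> f. \<lambda>y\<in>carrier J.
       tensor_map V V (\<lambda>(b, v). (coeffwise \<gamma> b, v)) (f (lmul J (tau_pow (ord \<gamma>)) y)))\<rparr>"

definition T_map ::
  "('c fls, 'f, 'j) bimod \<Rightarrow> ('c fls, 'f, 'v) bimod \<Rightarrow> ('c fls, 'f, 'v) bimod \<Rightarrow> ('v \<Rightarrow> 'v) \<Rightarrow>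
    ('j \<Rightarrow> ('c fls \<times> 'v \<Rightarrow>\<^sub>0 int) set) \<Rightarrow> ('j \<Rightarrow> ('c fls \<times> 'v \<Rightarrow>\<^sub>0 int) set)"
where
  "T_map J V W h =
    (\<lambda>f\<in>carrier (T J V). compose (carrier J) (tensor_map V W (\<lambda>(b, v). (b, h v))) f)"

text \<open>
  The objects of \<open>motives r\<close> are the motives whose underlying set lies in the type
  \<^typ>\<open>'v\<close>, which acts as a universe.  Every motive has an isomorphic copy there iff
  \<^typ>\<open>'v\<close> is at least as large as \<open>K((\<tau>\<^sup>-\<^sup>1))\<close>; this is automatic, for example, if \<^typ>\<open>'v\<close> is \<^typ>\<open>'c fls\<close>.
\<close>

definition large_universe :: "'v itself \<Rightarrow> bool" where
  "large_universe _ \<longleftrightarrow> (\<exists>e :: 'c fls \<Rightarrow> 'v. inj_on e (laurent_over K))"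

end

end

theory Submission
  imports Defs
begin

text \<open>
  A motive of dimension 1 is, after the choice of a generator, a homomorphism \<open>\<phi>\<close> from \<open>F\<close> to \<open>K((\<tau>\<^sup>-\<^sup>1))\<close>; morphisms
  become intertwiners. By Lang's theorem in the skew field, any two such homomorphisms of the same height
  are conjugate over the algebraic closure, and the intertwiners of two homomorphisms over the algebraic
  closure of the finite field have coefficients there. Hence \<open>T(V)\<close>, the space of intertwiners between \<open>J\<close> and \<open>V\<close>,
  is \<open>D u\<close> for any nonzero intertwiner \<open>u\<close>; its lattices are the valuation balls, and admissibility says
  that \<open>\<gamma>\<close> shifts the valuation by \<open>ord \<gamma>\<close>.

  If the Weil group is dense, an element of \<open>K((\<tau>\<^sup>-\<^sup>1))\<close> is a series with coefficients fixed by the Weil group,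
  which gives full faithfulness. An admissible representation of rank 1 is a cocycle with values in
  \<open>D\<close>; a form of Hilbert 90 over the skew field writes it as the coboundary of some \<open>u\<close>, and conjugating the action
  of \<open>F\<close> on \<open>J\<close> by \<open>u\<close> gives a motive over \<open>K\<close> with the given representation.
\<close>

section \<open>Categories\<close>

text \<open>In coordinates the skew Laurent series act on the left, and everything that commutes
  with them, the action of \<open>F\<close> as well as every morphism, is multiplication on the
  right. So composition reverses, and \<open>End J\<close> is the opposite of the ring
  \<open>DD\<close> of self-intertwiners. Two facts about Frobenius carry the argument. Since the
  height is positive, \<phi>(z) has positive order e = r d, with d the residue degree; in each
  degree the equation P u = u Q then reads A y^(1/q^e) + B y = C with B nonzero. This is solvable in
  an algebraically closed field, and over the closure of the finite field all its solutions stay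
  there. An element \<gamma> of the Weil group acts on that closure as the power -ord \<gamma> of
  Frobenius, which is conjugation by a power of \<tau>. Hence u -> \<tau>^(ord \<gamma>) \<gamma>(u)
  commutes with left multiplication by elements of D, and it lowers orders by ord \<gamma>. So
  \<gamma>^(r d) lowers orders by r d ord \<gamma>, exactly as z^(-ord \<gamma>) does: this is the
  slope -1/r.\<close>

lemma is_iso_compose_cancel:
  assumes C: "is_category C" and obs: "P \<in> Ob C" "Q \<in> Ob C" "R \<in> Ob C"
    and f: "f \<in> Arr C P Q" and g: "g \<in> Arr C Q P" and gf: "Comp C P Q P g f = Idn C P"
    and h: "h \<in> Arr C R P"
  shows "Comp C R Q P g (Comp C R P Q f h) = h"
  using assms unfolding is_category_def by metis

text \<open>Choosing for each object of \<open>D\<close> an isomorphic object in the image gives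
  \<open>Go\<close>; an arrow is conjugated by the chosen isomorphisms and pulled back through the
  bijections on arrows. Every identity to be checked in \<open>C\<close> becomes one in
  \<open>D\<close> after applying \<open>Fm\<close>, which is injective on arrows.\<close>

lemma is_equivalenceI_fully_faithful:
  fixes C :: "('o, 'm) category" and D :: "('p, 'n) category"
  assumes F: "is_functor C D Fo Fm"
    and ff: "\<And>P Q. P \<in> Ob C \<Longrightarrow> Q \<in> Ob C \<Longrightarrow>
      bij_betw (Fm P Q) (Arr C P Q) (Arr D (Fo P) (Fo Q))"
    and es: "\<And>W. W \<in> Ob D \<Longrightarrow> \<exists>P\<in>Ob C. \<exists>f. is_iso D (Fo P) W f"
  shows "is_equivalence C D Fo Fm"
proof -
  have catC: "is_category C" and catD: "is_category D"
    using F by (auto simp: is_functor_def)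
  have FoOb: "Fo P \<in> Ob D" if "P \<in> Ob C" for P
    using F that by (auto simp: is_functor_def)
  have FmArr: "Fm P Q f \<in> Arr D (Fo P) (Fo Q)" if "P \<in> Ob C" "Q \<in> Ob C" "f \<in> Arr C P Q" for P Q f
    using F that by (auto simp: is_functor_def)
  have Fid: "Fm P P (Idn C P) = Idn D (Fo P)" if "P \<in> Ob C" for P
    using F that by (auto simp: is_functor_def)
  have Fcomp: "Fm P R (Comp C P Q R g f) = Comp D (Fo P) (Fo Q) (Fo R) (Fm Q R g) (Fm P Q f)"
    if "P \<in> Ob C" "Q \<in> Ob C" "R \<in> Ob C" "f \<in> Arr C P Q" "g \<in> Arr C Q R" for P Q R f g
    using F that by (auto simp: is_functor_def)
  have Dcomp: "Comp D P Q R g f \<in> Arr D P R"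
    if "P \<in> Ob D" "Q \<in> Ob D" "R \<in> Ob D" "f \<in> Arr D P Q" "g \<in> Arr D Q R" for P Q R f g
    using catD that by (auto simp: is_category_def)
  have Ccomp: "Comp C P Q R g f \<in> Arr C P R"
    if "P \<in> Ob C" "Q \<in> Ob C" "R \<in> Ob C" "f \<in> Arr C P Q" "g \<in> Arr C Q R" for P Q R f g
    using catC that by (auto simp: is_category_def)
  have Cid: "Idn C P \<in> Arr C P P" if "P \<in> Ob C" for P
    using catC that by (auto simp: is_category_def)
  have Did: "Comp D P P Q f (Idn D P) = f" "Comp D P Q Q (Idn D Q) f = f"
    if "P \<in> Ob D" "Q \<in> Ob D" "f \<in> Arr D P Q" for P Q f
    using catD that by (auto simp: is_category_def)
  have Dassoc: "Comp D P R S h (Comp D P Q R g f) = Comp D P Q S (Comp D Q R S h g) f"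
    if "P \<in> Ob D" "Q \<in> Ob D" "R \<in> Ob D" "S \<in> Ob D"
      "f \<in> Arr D P Q" "g \<in> Arr D Q R" "h \<in> Arr D R S" for P Q R S f g h
    using catD that unfolding is_category_def by blast
  have Finj: "f = g" if "P \<in> Ob C" "Q \<in> Ob C" "f \<in> Arr C P Q" "g \<in> Arr C P Q" "Fm P Q f = Fm P Q g"
    for P Q f g
    using ff[OF that(1,2)] that by (auto simp: bij_betw_def inj_on_def)
  obtain Go where Go: "Go W \<in> Ob C \<and> (\<exists>f. is_iso D (Fo (Go W)) W f)" if "W \<in> Ob D" for W
    using es by metis
  obtain e e' where e0: "e W \<in> Arr D (Fo (Go W)) W \<and> e' W \<in> Arr D W (Fo (Go W)) \<and>
      Comp D (Fo (Go W)) W (Fo (Go W)) (e' W) (e W) = Idn D (Fo (Go W)) \<and>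
      Comp D W (Fo (Go W)) W (e W) (e' W) = Idn D W" if "W \<in> Ob D" for W
    using Go unfolding is_iso_def by metis
  have GoOb: "Go W \<in> Ob C" "Fo (Go W) \<in> Ob D" if "W \<in> Ob D" for W
    using Go[OF that] FoOb by auto
  have e: "e W \<in> Arr D (Fo (Go W)) W" "e' W \<in> Arr D W (Fo (Go W))"
      "Comp D (Fo (Go W)) W (Fo (Go W)) (e' W) (e W) = Idn D (Fo (Go W))"
      "Comp D W (Fo (Go W)) W (e W) (e' W) = Idn D W" if "W \<in> Ob D" for W
    using e0[OF that] by auto
  define lift where "lift P Q = inv_into (Arr C P Q) (Fm P Q)" for P Q
  have lift: "lift P Q g \<in> Arr C P Q" "Fm P Q (lift P Q g) = g"
    if "P \<in> Ob C" "Q \<in> Ob C" "g \<in> Arr D (Fo P) (Fo Q)" for P Q g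
    using bij_betw_imp_surj_on[OF ff[OF that(1,2)]] that unfolding lift_def
    by (auto intro: inv_into_into f_inv_into_f)
  \<comment> \<open>\<open>tr\<close> is conjugation by the chosen isomorphisms; once it is known to
    preserve identities and composites, functoriality of \<open>Gm\<close> follows by
    faithfulness.\<close>
  define tr where "tr W S g = Comp D (Fo (Go W)) W (Fo (Go S))
      (Comp D W S (Fo (Go S)) (e' S) g) (e W)" for W S g
  have tr_arr: "tr W S g \<in> Arr D (Fo (Go W)) (Fo (Go S))"
    if "W \<in> Ob D" "S \<in> Ob D" "g \<in> Arr D W S" for W S g
    unfolding tr_def using that e GoOb by (intro Dcomp) auto
  define Gm where "Gm W S g = lift (Go W) (Go S) (tr W S g)" for W S g
  have Gm: "Gm W S g \<in> Arr C (Go W) (Go S)" "Fm (Go W) (Go S) (Gm W S g) = tr W S g"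
    if "W \<in> Ob D" "S \<in> Ob D" "g \<in> Arr D W S" for W S g
    unfolding Gm_def using lift[OF GoOb(1) GoOb(1) tr_arr] that by auto
  have e_tr: "Comp D (Fo (Go W)) (Fo (Go S)) S (e S) (tr W S g) = Comp D (Fo (Go W)) W S g (e W)"
    if "W \<in> Ob D" "S \<in> Ob D" "g \<in> Arr D W S" for W S g
  proof -
    have "tr W S g = Comp D (Fo (Go W)) S (Fo (Go S)) (e' S) (Comp D (Fo (Go W)) W S g (e W))"
      unfolding tr_def using that e GoOb by (intro Dassoc[symmetric]) auto
    then show ?thesis
      using is_iso_compose_cancel[OF catD that(2) GoOb(2)[OF that(2)] GoOb(2)[OF that(1)]
          e(2)[OF that(2)] e(1)[OF that(2)] e(4)[OF that(2)]] Dcomp that e GoOb by simp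
  qed
  have tr_e': "Comp D W (Fo (Go W)) (Fo (Go S)) (tr W S g) (e' W) = Comp D W S (Fo (Go S)) (e' S) g"
    if "W \<in> Ob D" "S \<in> Ob D" "g \<in> Arr D W S" for W S g
  proof -
    have a: "Comp D W S (Fo (Go S)) (e' S) g \<in> Arr D W (Fo (Go S))"
      using that e GoOb by (intro Dcomp) auto
    have "Comp D W (Fo (Go W)) (Fo (Go S)) (tr W S g) (e' W)
      = Comp D W W (Fo (Go S)) (Comp D W S (Fo (Go S)) (e' S) g) (Comp D W (Fo (Go W)) W (e W) (e' W))"
      unfolding tr_def using that e GoOb a by (intro Dassoc[symmetric]) auto
    then show ?thesis using e(4)[OF that(1)] Did that GoOb a by simp
  qed
  have tr_id: "tr W W (Idn D W) = Idn D (Fo (Go W))" if "W \<in> Ob D" for W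
    unfolding tr_def using Did that GoOb e by simp
  have tr_comp: "tr W R (Comp D W S R h g) = Comp D (Fo (Go W)) (Fo (Go S)) (Fo (Go R)) (tr S R h) (tr W S g)"
    if obs: "W \<in> Ob D" "S \<in> Ob D" "R \<in> Ob D" and g: "g \<in> Arr D W S" and h: "h \<in> Arr D S R" for W S R g h
  proof -
    note ob = obs GoOb(2)[OF obs(1)] GoOb(2)[OF obs(2)] GoOb(2)[OF obs(3)]
    have gW: "Comp D (Fo (Go W)) W S g (e W) \<in> Arr D (Fo (Go W)) S"
      using ob g e(1)[OF obs(1)] by (intro Dcomp) auto
    have eh: "Comp D S R (Fo (Go R)) (e' R) h \<in> Arr D S (Fo (Go R))"
      using ob h e(2)[OF obs(3)] by (intro Dcomp) auto
    have "Comp D (Fo (Go W)) (Fo (Go S)) (Fo (Go R)) (tr S R h) (tr W S g) =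
       Comp D (Fo (Go W)) S (Fo (Go R)) (Comp D S R (Fo (Go R)) (e' R) h)
         (Comp D (Fo (Go W)) (Fo (Go S)) S (e S) (tr W S g))"
      unfolding tr_def[of S R] using ob e(1)[OF obs(2)] eh tr_arr[OF obs(1,2) g]
      by (intro Dassoc[symmetric]) auto
    also have "\<dots> = Comp D (Fo (Go W)) S (Fo (Go R)) (Comp D S R (Fo (Go R)) (e' R) h)
         (Comp D (Fo (Go W)) W S g (e W))"
      using e_tr[OF obs(1,2) g] by simp
    also have "\<dots> = Comp D (Fo (Go W)) W (Fo (Go R))
        (Comp D W S (Fo (Go R)) (Comp D S R (Fo (Go R)) (e' R) h) g) (e W)"
      using ob eh g e(1)[OF obs(1)] by (intro Dassoc) auto
    also have "Comp D W S (Fo (Go R)) (Comp D S R (Fo (Go R)) (e' R) h) g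
       = Comp D W R (Fo (Go R)) (e' R) (Comp D W S R h g)"
      using ob h g e(2)[OF obs(3)] by (intro Dassoc[symmetric]) auto
    finally show ?thesis unfolding tr_def[of W R] by simp
  qed
  have G: "is_functor D C Go Gm"
    unfolding is_functor_def
  proof (intro conjI ballI catC catD)
    fix W assume W: "W \<in> Ob D"
    then show "Go W \<in> Ob C" using GoOb by auto
    show "Gm W W (Idn D W) = Idn C (Go W)"
      using W GoOb[OF W] Gm[OF W W] Cid Fid tr_id[OF W] catD
      by (intro Finj[of "Go W" "Go W"]) (auto simp: is_category_def)
  next
    fix W S g assume "W \<in> Ob D" "S \<in> Ob D" "g \<in> Arr D W S"
    then show "Gm W S g \<in> Arr C (Go W) (Go S)" by (rule Gm)
  next
    fix W S R g h assume obs: "W \<in> Ob D" "S \<in> Ob D" "R \<in> Ob D" and g: "g \<in> Arr D W S" and h: "h \<in> Arr D S R"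
    show "Gm W R (Comp D W S R h g) = Comp C (Go W) (Go S) (Go R) (Gm S R h) (Gm W S g)"
    proof (rule Finj[of "Go W" "Go R"])
      show "Fm (Go W) (Go R) (Gm W R (Comp D W S R h g)) =
        Fm (Go W) (Go R) (Comp C (Go W) (Go S) (Go R) (Gm S R h) (Gm W S g))"
        using obs g h GoOb Gm tr_comp Dcomp Fcomp by simp
    qed (use obs g h GoOb Gm Dcomp Ccomp in auto)
  qed
  \<comment> \<open>The unit at \<open>P\<close> is the preimage of the inverse of the chosen
    isomorphism \<open>e (Fo P)\<close>, and \<open>theta\<close> is the preimage of
    \<open>e (Fo P)\<close> itself.\<close>
  define eta where "eta P = lift P (Go (Fo P)) (e' (Fo P))" for P
  define theta where "theta P = lift (Go (Fo P)) P (e (Fo P))" for P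
  have eta: "eta P \<in> Arr C P (Go (Fo P))" "Fm P (Go (Fo P)) (eta P) = e' (Fo P)"
    and theta: "theta P \<in> Arr C (Go (Fo P)) P" "Fm (Go (Fo P)) P (theta P) = e (Fo P)"
    if "P \<in> Ob C" for P
    unfolding eta_def theta_def using lift that FoOb GoOb e by auto
  have "is_nat_iso C C (\<lambda>P. P) (\<lambda>P Q f. f)
             (\<lambda>P. Go (Fo P)) (\<lambda>P Q f. Gm (Fo P) (Fo Q) (Fm P Q f)) eta"
    unfolding is_nat_iso_def
  proof (intro conjI ballI)
    fix P assume P: "P \<in> Ob C"
    note obs = P FoOb[OF P] GoOb[OF FoOb[OF P]]
    show "is_iso C P (Go (Fo P)) (eta P)"
      unfolding is_iso_def
    proof (intro conjI bexI)
      show "eta P \<in> Arr C P (Go (Fo P))" "theta P \<in> Arr C (Go (Fo P)) P"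
        using eta theta P by auto
      show "Comp C P (Go (Fo P)) P (theta P) (eta P) = Idn C P"
        using obs eta[OF P] theta[OF P] Ccomp Cid Fcomp Fid e[OF obs(2)]
        by (intro Finj[of P P]) auto
      show "Comp C (Go (Fo P)) P (Go (Fo P)) (eta P) (theta P) = Idn C (Go (Fo P))"
        using obs eta[OF P] theta[OF P] Ccomp Cid Fcomp Fid e[OF obs(2)]
        by (intro Finj[of "Go (Fo P)" "Go (Fo P)"]) auto
    qed
  next
    fix P Q f assume P: "P \<in> Ob C" and Q: "Q \<in> Ob C" and f: "f \<in> Arr C P Q"
    note obs = P FoOb[OF P] GoOb[OF FoOb[OF P]] Q FoOb[OF Q] GoOb[OF FoOb[OF Q]]
    show "Comp C P Q (Go (Fo Q)) (eta Q) f =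
       Comp C P (Go (Fo P)) (Go (Fo Q)) (Gm (Fo P) (Fo Q) (Fm P Q f)) (eta P)"
      using obs f eta[OF P] eta[OF Q] Gm[OF obs(2) obs(6) FmArr[OF P Q f]] Ccomp Fcomp
        tr_e'[OF obs(2) obs(6) FmArr[OF P Q f]]
      by (intro Finj[of P "Go (Fo Q)"]) auto
  qed
  moreover have "is_nat_iso D D (\<lambda>W. Fo (Go W)) (\<lambda>W S g. Fm (Go W) (Go S) (Gm W S g))
             (\<lambda>W. W) (\<lambda>W S g. g) e"
    unfolding is_nat_iso_def is_iso_def using e Gm e_tr by (auto intro!: bexI[OF _ e(2)])
  ultimately show ?thesis
    unfolding is_equivalence_def using F G by blast
qed

section \<open>Finite fields and algebraic closures\<close>

text \<open>A Sylow subgroup for \<open>l\<close> of the additive group contains a nonzero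
  \<open>x\<close>, which is annihilated by a power of \<open>l\<close>. In a field the
  characteristic then divides that power.\<close>

lemma prime_dvd_CARD_imp_CHAR:
  assumes "Factorial_Ring.prime l" "l dvd CARD('q)"
  shows "l = CHAR('q::{finite, field})"
proof -
  define G :: "'q monoid" where "G = \<lparr>carrier = UNIV, monoid.mult = (+), one = 0\<rparr>"
  interpret G: group G
    by (rule groupI) (auto simp: G_def add.assoc intro: exI[of _ "- _"])
  have fin: "finite (carrier G)" by simp
  have pos: "CARD('q) > 0" by simp
  obtain a m where am: "CARD('q) = l ^ a * m" "\<not> l dvd m"
    using multiplicity_decompose'[of "CARD('q)" l] pos not_prime_unit[of l] assms(1) by blast
  have "a > 0" using am assms by (cases a) auto
  have "order G = l ^ a * m" using am by (simp add: order_def G_def)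
  then obtain H where H: "subgroup H G" "card H = l ^ a"
    using sylow_thm[of l G a m] assms G.group_axioms fin by auto
  have "card H > 1" using one_less_power[OF prime_gt_1_nat[OF assms(1)] \<open>a > 0\<close>] H by simp
  then obtain x where x: "x \<in> H" "x \<noteq> 0"
    using card_mono[of "{0::'q}" H] by fastforce
  have powG: "x [^]\<^bsub>G\<^esub> n = of_nat n * x" for n :: nat
    by (induction n) (auto simp: G_def nat_pow_def algebra_simps)
  interpret HG: group "G\<lparr>carrier := H\<rparr>" by (rule G.subgroup_imp_group[OF H(1)])
  have "x [^]\<^bsub>G\<^esub> (card H) = \<one>\<^bsub>G\<^esub>"
    using HG.pow_order_eq_1[of x] x(1) by (simp add: order_def nat_pow_def)
  then have "of_nat (l ^ a) * x = 0" using powG H by (simp add: G_def)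
  then have "CHAR('q) dvd l ^ a" using x(2) mult_eq_0_iff of_nat_eq_0_iff_char_dvd by blast
  moreover have "Factorial_Ring.prime CHAR('q)"
    by (rule prime_CHAR_semidom) (simp add: finite_imp_CHAR_pos)
  ultimately have "CHAR('q) dvd l" by (rule prime_dvd_power[rotated])
  then show ?thesis using primes_dvd_imp_eq[OF \<open>Factorial_Ring.prime CHAR('q)\<close> assms(1)] by simp
qed

lemma prime_CHAR_finite_field: "Factorial_Ring.prime CHAR('q::{finite, field})"
  by (rule prime_CHAR_semidom) (simp add: finite_imp_CHAR_pos)

text \<open>Split off the full power of the characteristic; a prime factor of the cofactor would
  again be the characteristic.\<close>

lemma CARD_finite_field_power:
  obtains n where "n > 0" "CARD('q::{finite, field}) = CHAR('q) ^ n"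
proof -
  let ?p = "CHAR('q)"
  have p: "Factorial_Ring.prime ?p" by (rule prime_CHAR_finite_field)
  have pos: "CARD('q) > 0" by simp
  obtain a m where am: "CARD('q) = ?p ^ a * m" "\<not> ?p dvd m"
    using multiplicity_decompose'[of "CARD('q)" ?p] pos not_prime_unit[of ?p] p by blast
  have "m = 1"
  proof (rule ccontr)
    assume "m \<noteq> 1"
    then obtain l where "Factorial_Ring.prime l" "l dvd m" using prime_factor_nat by blast
    then show False using prime_dvd_CARD_imp_CHAR[where 'q='q, of l] am dvd_mult[of l m "?p ^ a"] by metis
  qed
  moreover have "a > 0"
  proof (rule ccontr)
    assume "\<not> a > 0"
    then have "CARD('q) = 1" using am \<open>m = 1\<close> by simp
    then show False using card_mono[of UNIV "{0, 1::'q}"] by simp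
  qed
  ultimately show ?thesis using that[of a] am(1) by (metis mult.right_neutral)
qed

lemma power_CARD_finite_field: "(a :: 'q::{finite, field}) ^ CARD('q) = a"
proof (cases "a = 0")
  case True then show ?thesis by (simp add: power_0_left)
next
  case False
  have "bij_betw ((*) a) (UNIV - {0}) (UNIV - {0})"
    by (rule bij_betwI[where g = "\<lambda>x. x / a"]) (use False in auto)
  then have "prod (\<lambda>x. x) (UNIV - {0}) = prod (\<lambda>x. a * x) (UNIV - {0})"
    using prod.reindex_bij_betw[of "(*) a" "UNIV - {0}" "UNIV - {0}" "\<lambda>x. x"] by simp
  also have "\<dots> = a ^ card (UNIV - {0::'q}) * prod (\<lambda>x. x) (UNIV - {0})"
    by (simp add: prod.distrib)
  finally have "a ^ card (UNIV - {0::'q}) = 1" by simp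
  moreover have "CARD('q) = Suc (card (UNIV - {0::'q}))" by (metis UNIV_I card_Suc_Diff1 finite)
  ultimately show ?thesis by (metis power_Suc mult.right_neutral)
qed

text \<open>By pigeonhole two iterates agree on \<open>R\<close>, and injectivity cancels the
  smaller one. The exponent serves all points of \<open>R\<close> at once; it is applied to
  Frobenius on roots and on residue classes, and to a Weil element on a Galois-stable set.\<close>

lemma finite_injective_periodic:
  assumes "finite R" "inj_on f R" "f ` R \<subseteq> R"
  obtains n where "n > 0" "\<And>x. x \<in> R \<Longrightarrow> (f ^^ n) x = x"
proof -
  have "finite (R \<rightarrow>\<^sub>E R)" using assms(1) by (simp add: finite_PiE)
  moreover have mem: "(f ^^ k) x \<in> R" if "x \<in> R" for k x
    using that assms(3) by (induction k) auto
  ultimately have "finite (range (\<lambda>k. restrict (f ^^ k) R))"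
    by (rule_tac finite_subset[of _ "R \<rightarrow>\<^sub>E R"]) auto
  then have "\<not> inj (\<lambda>k::nat. restrict (f ^^ k) R)"
    using finite_imageD infinite_UNIV_nat by blast
  then obtain i j where "i \<noteq> j" "restrict (f ^^ i) R = restrict (f ^^ j) R"
    by (auto simp: inj_def)
  then obtain i j where ij: "i < j" "restrict (f ^^ i) R = restrict (f ^^ j) R"
    by (metis linorder_neqE_nat)
  have inj: "inj_on (f ^^ k) R" for k
  proof (induction k)
    case (Suc k)
    have "inj_on f ((f ^^ k) ` R)" using assms(2) mem by (auto intro: inj_on_subset)
    then show ?case using comp_inj_on[OF Suc] by (simp add: comp_def)
  qed auto
  have "(f ^^ (j - i)) x = x" if x: "x \<in> R" for x
  proof -
    have "(f ^^ i) ((f ^^ (j - i)) x) = (f ^^ j) x"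
      using ij(1) funpow_add[of i "j - i" f] by (simp add: comp_def)
    also have "\<dots> = (f ^^ i) x" using ij(2) x by (metis restrict_apply')
    finally show ?thesis using inj[of i] mem x by (auto dest: inj_onD)
  qed
  then show ?thesis using that[of "j - i"] ij(1) by auto
qed

section \<open>Polynomials: from HOL-Algebra lists to the type \<open>poly\<close>\<close>

definition polys_over :: "'c::field set \<Rightarrow> 'c poly set" where
  "polys_over S = {P. \<forall>i. Polynomial.coeff P i \<in> S}"

lemma ring_of_type_algebra_sel [simp]:
  "carrier (ring_of_type_algebra :: 'a::comm_ring_1 ring) = UNIV"
  "\<one>\<^bsub>(ring_of_type_algebra :: 'a ring)\<^esub> = 1"
  "\<zero>\<^bsub>(ring_of_type_algebra :: 'a ring)\<^esub> = 0"
  "x \<otimes>\<^bsub>(ring_of_type_algebra :: 'a ring)\<^esub> y = x * y"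
  "x \<oplus>\<^bsub>(ring_of_type_algebra :: 'a ring)\<^esub> y = x + y"
  by (simp_all add: ring_of_type_algebra_def)

lemma ring_of_type_algebra_pow [simp]:
  "x [^]\<^bsub>(ring_of_type_algebra :: 'a::comm_ring_1 ring)\<^esub> (n::nat) = x ^ n"
  by (induction n) (auto simp: nat_pow_def mult.commute)

lemma ring_of_type_algebra_a_inv [simp]:
  "\<ominus>\<^bsub>(ring_of_type_algebra :: 'a::comm_ring_1 ring)\<^esub> x = - x"
proof -
  interpret ring "ring_of_type_algebra :: 'a ring" by (rule ring_from_type_algebra)
  show ?thesis by (rule minus_equality) auto
qed

text \<open>HOL-Algebra lists coefficients from the leading one downwards, \<open>Poly\<close> from
  the constant one upwards; hence the reversal.\<close>

lemma eval_ring_of_type_algebra: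
  "ring.eval (ring_of_type_algebra :: 'a::comm_ring_1 ring) p x = poly (Poly (rev p)) x"
proof -
  interpret ring "ring_of_type_algebra :: 'a ring" by (rule ring_from_type_algebra)
  show ?thesis
    by (induction p) (auto simp: Poly_append poly_monom mult.commute add.commute)
qed

lemma algebraic_ring_of_type_algebra_iff:
  fixes S :: "'c::field set"
  assumes S: "subring S ring_of_type_algebra"
  shows "ring.algebraic ring_of_type_algebra S x \<longleftrightarrow> (\<exists>P. P \<noteq> 0 \<and> P \<in> polys_over S \<and> poly P x = 0)"
proof -
  interpret L: field "ring_of_type_algebra :: 'c ring" by (rule field_from_type_algebra)
  have S0: "0 \<in> S" using subringE(2)[OF S] by simp
  show ?thesis
  proof
    assume "ring.algebraic ring_of_type_algebra S x"
    then obtain p where p: "p \<in> carrier (S[X]\<^bsub>ring_of_type_algebra\<^esub>)" "p \<noteq> []"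
        "L.eval p x = \<zero>\<^bsub>(ring_of_type_algebra :: 'c ring)\<^esub>"
      using L.algebraicE[OF S, of x] by (auto simp: over_def)
    have pol: "set p \<subseteq> S" "hd p \<noteq> 0"
      using p by (auto simp: univ_poly_def polynomial_def)
    have "Poly (rev p) \<noteq> 0"
    proof
      assume "Poly (rev p) = 0"
      then obtain n where "rev p = replicate n 0" by (auto simp: Poly_eq_0)
      then have "p = replicate n 0" by (metis rev_replicate rev_rev_ident)
      then show False using p(2) pol(2) by (cases n) auto
    qed
    moreover have "Poly (rev p) \<in> polys_over S"
      using pol S0 nth_mem[of _ "rev p"] by (auto simp: polys_over_def coeff_Poly_eq nth_default_def)
    ultimately show "\<exists>P. P \<noteq> 0 \<and> P \<in> polys_over S \<and> poly P x = 0"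
      using p(3) by (auto simp: eval_ring_of_type_algebra)
  next
    assume "\<exists>P. P \<noteq> 0 \<and> P \<in> polys_over S \<and> poly P x = 0"
    then obtain P where P: "P \<noteq> 0" "P \<in> polys_over S" "poly P x = 0" by auto
    show "ring.algebraic ring_of_type_algebra S x"
    proof (rule L.algebraicI[unfolded over_def, of "rev (coeffs P)"])
      have "last (coeffs P) \<noteq> 0" using P by (simp add: last_coeffs_eq_coeff_degree)
      moreover have "set (coeffs P) \<subseteq> S"
        using P by (auto simp: polys_over_def coeffs_def)
      ultimately show "rev (coeffs P) \<in> carrier (S[X]\<^bsub>ring_of_type_algebra\<^esub>)"
        using P by (auto simp: univ_poly_def polynomial_def hd_rev)
      show "rev (coeffs P) \<noteq> []" using P by simp
      show "L.eval (rev (coeffs P)) x = \<zero>\<^bsub>(ring_of_type_algebra :: 'c ring)\<^esub>"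
        using P by (simp add: eval_ring_of_type_algebra)
    qed
  qed
qed

lemma algebraic_closure_has_root:
  fixes P :: "'c::field poly"
  assumes "algebraic_closure ring_of_type_algebra (S :: 'c set)" "Polynomial.degree P > 0"
  shows "\<exists>x. poly P x = 0"
proof -
  interpret algebraic_closure "ring_of_type_algebra :: 'c ring" S by (rule assms(1))
  define p where "p = rev (coeffs P)"
  have deg: "Polynomials.degree p = Polynomial.degree P"
    by (auto simp: p_def degree_eq_length_coeffs)
  have p: "p \<in> carrier (poly_ring (ring_of_type_algebra :: 'c ring))"
    by (auto simp: univ_poly_def polynomial_def p_def hd_rev last_coeffs_eq_coeff_degree)
  then have "splitted p" by (rule roots_over_carrier)
  then have "roots p \<noteq> {#}" unfolding splitted_def using deg assms(2) by auto
  then obtain x where "x \<in># roots p" by blast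
  then have "is_root p x" using roots_mem_iff_is_root[OF p] by auto
  then show ?thesis
    by (auto simp: is_root_def eval_ring_of_type_algebra p_def)
qed

text \<open>Raising to the power \<open>n\<close> is additive, so it passes through the sum and
  affects only the variable. Consequently it maps roots of \<open>P\<close> to roots.\<close>

lemma poly_power_additive:
  fixes P :: "'c::field poly"
  assumes add: "\<And>x y::'c. (x + y) ^ n = x ^ n + y ^ n" and "n > 0"
    and P: "\<And>i. Polynomial.coeff P i ^ n = Polynomial.coeff P i"
  shows "poly P x ^ n = poly P (x ^ n)"
proof -
  have s: "(\<Sum>i\<in>A. f i) ^ n = (\<Sum>i\<in>A. f i ^ n)" for A and f :: "nat \<Rightarrow> 'c"
    by (induction A rule: infinite_finite_induct) (use \<open>n > 0\<close> in \<open>auto simp: add zero_power\<close>)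
  have "(x ^ i) ^ n = (x ^ n) ^ i" for i by (metis mult.commute power_mult)
  then show ?thesis
    by (simp add: poly_altdef s power_mult_distrib P)
qed

context drinfeld_setting
begin


section \<open>Frobenius on both fields and the algebraic closure of the finite field\<close>

lemma embK_simps [simp]: "embK 0 = 0" "embK 1 = 1" "embK (a + b) = embK a + embK b"
    "embK (a * b) = embK a * embK b"
proof -
  show add: "embK (a + b) = embK a + embK b" for a b
    using ring_hom_add[OF embK(1), of a b] by simp
  show "embK (a * b) = embK a * embK b" using ring_hom_mult[OF embK(1), of a b] by simp
  show "embK 1 = 1" using ring_hom_one[OF embK(1)] by simp
  show "embK 0 = 0" using add[of 0 0] by (simp only: add_cancel_right_left add_0_left)
qed

lemma embF_simps [simp]: "embF 0 = 0" "embF 1 = 1" "embF (a + b) = embF a + embF b"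
    "embF (a * b) = embF a * embF b"
proof -
  show add: "embF (a + b) = embF a + embF b" for a b
    using ring_hom_add[OF embF, of a b] by simp
  show "embF (a * b) = embF a * embF b" using ring_hom_mult[OF embF, of a b] by simp
  show "embF 1 = 1" using ring_hom_one[OF embF] by simp
  show "embF 0 = 0" using add[of 0 0] by (simp only: add_cancel_right_left add_0_left)
qed

lemma embK_eq_0: "embK a = 0 \<longleftrightarrow> a = 0"
proof
  assume "embK a = 0"
  then show "a = 0"
    by (metis embK_simps(1,2,4) mult_zero_left nonzero_mult_div_cancel_left times_divide_eq_right zero_neq_one)
qed simp

lemma embF_eq_0: "embF a = 0 \<longleftrightarrow> a = 0"
proof
  assume "embF a = 0"
  then show "a = 0"
    by (metis embF_simps(1,2,4) mult_zero_left nonzero_mult_div_cancel_left times_divide_eq_right zero_neq_one)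
qed simp

lemma embK_of_nat: "embK (of_nat n) = of_nat n"
  by (induction n) auto

lemma embF_of_nat: "embF (of_nat n) = of_nat n"
  by (induction n) auto

lemma embK_uminus: "embK (- a) = - embK a"
  by (metis add.right_inverse embK_simps(1,3) minus_unique)

lemma embK_inj: "inj embK"
proof (rule injI)
  fix a b assume "embK a = embK b"
  then have "embK (a + - b) = 0" by (simp only: embK_simps embK_uminus add.right_inverse)
  then show "a = b" using embK_eq_0[of "a + - b"] by simp
qed

lemma CHAR_c: "CHAR('c) = CHAR('q)"
proof (rule CHAR_eqI)
  show "of_nat CHAR('q) = (0::'c)" by (metis embK_of_nat embK_simps(1) of_nat_CHAR)
next
  fix n assume "of_nat n = (0::'c)"
  then show "CHAR('q) dvd n" by (metis embK_of_nat embK_eq_0 of_nat_eq_0_iff_char_dvd)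
qed

lemma CHAR_f: "CHAR('f) = CHAR('q)"
proof (rule CHAR_eqI)
  show "of_nat CHAR('q) = (0::'f)" by (metis embF_of_nat embF_simps(1) of_nat_CHAR)
next
  fix n assume "of_nat n = (0::'f)"
  then show "CHAR('q) dvd n" by (metis embF_of_nat embF_eq_0 of_nat_eq_0_iff_char_dvd)
qed

lemma prime_CHAR_c: "Factorial_Ring.prime CHAR('c)"
  using prime_CHAR_finite_field[where 'q='q] CHAR_c by simp

lemma q_power_CHAR: obtains n where "n > 0" "CARD('q) = CHAR('q) ^ n"
  by (rule CARD_finite_field_power)

lemma q_gt_1: "CARD('q) > 1"
  by (metis q_power_CHAR one_less_power prime_CHAR_finite_field prime_gt_1_nat)

lemma frob_add_q: "(x + y :: 'c) ^ (CARD('q) ^ n) = x ^ (CARD('q) ^ n) + y ^ (CARD('q) ^ n)"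
proof -
  obtain m where "CARD('q) = CHAR('c) ^ m" using q_power_CHAR CHAR_c by metis
  then have "CARD('q) ^ n = CHAR('c) ^ (m * n)" by (simp add: power_mult)
  then show ?thesis by (rule freshmans_dream'[OF prime_CHAR_c])
qed

lemma frob_add_q_f: "(x + y :: 'f) ^ (CARD('q) ^ n) = x ^ (CARD('q) ^ n) + y ^ (CARD('q) ^ n)"
proof -
  obtain m where "CARD('q) = CHAR('f) ^ m" using q_power_CHAR CHAR_f by metis
  then have "CARD('q) ^ n = CHAR('f) ^ (m * n)" by (simp add: power_mult)
  then show ?thesis
    by (rule freshmans_dream'[rotated]) (simp add: CHAR_f prime_CHAR_finite_field)
qed

lemma minus_power_q: "(- x :: 'c) ^ (CARD('q) ^ n) = - (x ^ (CARD('q) ^ n))"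
proof -
  have "(x + - x) ^ (CARD('q) ^ n) = x ^ (CARD('q) ^ n) + (- x) ^ (CARD('q) ^ n)" by (rule frob_add_q)
  then have "x ^ (CARD('q) ^ n) + (- x) ^ (CARD('q) ^ n) = 0" by (simp add: zero_power)
  then show ?thesis by (simp add: eq_neg_iff_add_eq_0 add.commute)
qed

lemma minus_power_q_f: "(- x :: 'f) ^ (CARD('q) ^ n) = - (x ^ (CARD('q) ^ n))"
proof -
  have "(x + - x) ^ (CARD('q) ^ n) = x ^ (CARD('q) ^ n) + (- x) ^ (CARD('q) ^ n)" by (rule frob_add_q_f)
  then have "x ^ (CARD('q) ^ n) + (- x) ^ (CARD('q) ^ n) = 0" by (simp add: zero_power)
  then show ?thesis by (simp add: eq_neg_iff_add_eq_0 add.commute)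
qed

lemma diff_power_q_f: "(x - y :: 'f) ^ (CARD('q) ^ n) = x ^ (CARD('q) ^ n) - y ^ (CARD('q) ^ n)"
  using frob_add_q_f[of x "- y" n] by (simp add: minus_power_q_f)

lemma diff_power_q: "(x - y :: 'c) ^ (CARD('q) ^ n) = x ^ (CARD('q) ^ n) - y ^ (CARD('q) ^ n)"
  using frob_add_q[of x "- y" n] by (simp add: minus_power_q)

lemma has_root: "Polynomial.degree P > 0 \<Longrightarrow> \<exists>x::'c. poly P x = 0"
  using algebraic_closure_has_root[OF Kbar] .

lemma nth_root_ex: 
  assumes "n > 0"
  shows "\<exists>y::'c. y ^ n = x"
proof -
  have "Polynomial.degree (Polynomial.monom 1 n + [:- x:]) = n"
    using assms by (subst degree_add_eq_left) (auto simp: degree_monom_eq)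
  then obtain y where "poly (Polynomial.monom 1 n + [:- x:]) y = 0"
    using has_root assms by metis
  then show ?thesis by (auto simp: poly_monom)
qed

lemma power_q_inj: "x ^ (CARD('q) ^ n) = y ^ (CARD('q) ^ n) \<Longrightarrow> x = (y::'c)"
  using diff_power_q[of x y n] by simp

lemma power_q_bij: "bij (\<lambda>x::'c. x ^ (CARD('q) ^ n))"
proof (rule bijI)
  show "inj (\<lambda>x::'c. x ^ (CARD('q) ^ n))" by (rule injI) (rule power_q_inj)
  show "surj (\<lambda>x::'c. x ^ (CARD('q) ^ n))"
    unfolding surj_def
  proof
    fix y :: 'c
    obtain x where "x ^ (CARD('q) ^ n) = y" using nth_root_ex[of "CARD('q) ^ n" y] by auto
    then show "\<exists>x. y = x ^ (CARD('q) ^ n)" by (intro exI[of _ x]) (rule sym)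
  qed
qed


lemma subring_range_embK: "subring (range embK) ring_of_type_algebra"
proof -
  interpret cring "ring_of_type_algebra :: 'c ring" by (rule cring_from_type_algebra)
  show ?thesis
  proof (rule subringI)
    show "h \<in> range embK \<Longrightarrow> \<ominus>\<^bsub>ring_of_type_algebra\<^esub> h \<in> range embK" for h
      by (auto simp flip: embK_uminus)
  qed (auto simp flip: embK_simps)
qed

lemma power_q_Fq: "x \<in> range embK \<Longrightarrow> x ^ CARD('q) = x"
proof -
  have "embK (a ^ n) = embK a ^ n" for a n by (induction n) auto
  then show "x \<in> range embK \<Longrightarrow> x ^ CARD('q) = x" by (metis power_CARD_finite_field rangeE)
qed

text \<open>The finite set of roots is mapped injectively to itself by the power map, so some
  iterate is the identity on it.\<close>

lemma roots_power_permute: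
  fixes P :: "'c poly"
  assumes "P \<noteq> 0" "\<And>i. Polynomial.coeff P i ^ (CARD('q) ^ n) = Polynomial.coeff P i" "poly P x = 0"
  obtains m where "m > 0" "x ^ (CARD('q) ^ (n * m)) = x"
proof -
  let ?R = "{x. poly P x = 0}" and ?f = "\<lambda>x::'c. x ^ (CARD('q) ^ n)"
  have "finite ?R" using assms(1) by (rule poly_roots_finite)
  moreover have "inj_on ?f ?R" using power_q_inj by (auto intro: inj_onI)
  moreover have "?f ` ?R \<subseteq> ?R"
  proof -
    have "poly P (?f x) = poly P x ^ (CARD('q) ^ n)" for x
      by (rule poly_power_additive[symmetric]) (auto simp: frob_add_q assms)
    then show ?thesis by (auto simp: zero_power)
  qed
  ultimately obtain m where m: "m > 0" "\<And>x. x \<in> ?R \<Longrightarrow> (?f ^^ m) x = x"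
    by (rule finite_injective_periodic) blast
  have "(?f ^^ k) x = x ^ (CARD('q) ^ (n * k))" for k
    by (induction k) (auto simp: power_mult power_add mult.commute simp flip: power_mult)
  then show ?thesis using that[OF m(1)] m(2)[of x] assms(3) by simp
qed

text \<open>Turns algebraicity into an equation that field operations preserve. In one direction
  Frobenius permutes the roots of an annihilating polynomial over the finite field; in the other
  X^(q^n) - X annihilates.\<close>

lemma Fbar_iff: "x \<in> Fbar \<longleftrightarrow> (\<exists>n>0. x ^ (CARD('q) ^ n) = x)"
proof
  assume "x \<in> Fbar"
  then obtain P where P: "P \<noteq> 0" "P \<in> polys_over (range embK)" "poly P x = 0"
    using algebraic_ring_of_type_algebra_iff[OF subring_range_embK] by (auto simp: Fbar_def)
  then have "Polynomial.coeff P i ^ (CARD('q) ^ 1) = Polynomial.coeff P i" for i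
    using power_q_Fq by (simp add: polys_over_def)
  then show "\<exists>n>0. x ^ (CARD('q) ^ n) = x"
    using roots_power_permute[OF P(1) _ P(3), of 1] by auto
next
  assume "\<exists>n>0. x ^ (CARD('q) ^ n) = x"
  then obtain n where n: "n > 0" "x ^ (CARD('q) ^ n) = x" by auto
  have qn: "CARD('q) ^ n > 1" using one_less_power[OF q_gt_1 n(1)] by simp
  let ?P = "Polynomial.monom 1 (CARD('q) ^ n) - Polynomial.monom 1 1 :: 'c poly"
  have "Polynomial.coeff ?P (CARD('q) ^ n) = 1" using qn by simp
  then have "?P \<noteq> 0" by (metis coeff_0 zero_neq_one)
  moreover have mem: "0 \<in> range embK" "1 \<in> range embK" "- 1 \<in> range embK"
    using embK_simps(1,2) embK_uminus[of 1] by (metis rangeI)+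
  have "?P \<in> polys_over (range embK)"
    using mem qn by (simp add: polys_over_def)
  moreover have "poly ?P x = 0" using n by (simp add: poly_monom)
  ultimately have "\<exists>P. P \<noteq> 0 \<and> P \<in> polys_over (range embK) \<and> poly P x = 0" by blast
  then show "x \<in> Fbar"
    using algebraic_ring_of_type_algebra_iff[OF subring_range_embK, of x] by (simp add: Fbar_def)
qed

text \<open>Exponents are combined by multiplication, so finitely many elements lie in one finite
  field.\<close>

lemma Fbar_powers:
  assumes "finite S" "S \<subseteq> Fbar"
  obtains n where "n > 0" "\<And>x. x \<in> S \<Longrightarrow> x ^ (CARD('q) ^ n) = x"
proof -
  have "\<exists>n>0. \<forall>x\<in>S. x ^ (CARD('q) ^ n) = x"
    using assms
proof (induction S rule: finite_induct)
  case empty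
  show ?case by auto
next
  case (insert x S)
  obtain n where n: "n > 0" "\<And>x. x \<in> S \<Longrightarrow> x ^ (CARD('q) ^ n) = x" using insert.IH insert.prems by auto
  obtain m where m: "m > 0" "x ^ (CARD('q) ^ m) = x" using insert.prems Fbar_iff by auto
  have iter: "y ^ (CARD('q) ^ (k * l)) = y" if "y ^ (CARD('q) ^ k) = y" for y :: 'c and k l
  proof (induction l)
    case (Suc l)
    have "y ^ (CARD('q) ^ (k * Suc l)) = (y ^ (CARD('q) ^ k)) ^ (CARD('q) ^ (k * l))"
      by (simp only: mult_Suc_right power_add power_mult)
    then show ?case by (simp only: that Suc)
  qed simp
  have "y ^ (CARD('q) ^ (n * m)) = y" if "y \<in> insert x S" for y
    using that iter[of x m n] iter[of y n m] n(2) m(2) by (auto simp only: insert_iff mult.commute)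
  then show ?case using mult_pos_pos[OF n(1) m(1)] by blast
qed
  then show ?thesis using that by blast
qed

text \<open>The coefficients lie in a common finite field, and the corresponding power of Frobenius
  permutes the roots.\<close>

lemma Fbar_root:
  assumes "P \<noteq> 0" "P \<in> polys_over Fbar" "poly P x = 0"
  shows "x \<in> Fbar"
proof -
  have "finite (Polynomial.coeff P ` {..Polynomial.degree P})" "Polynomial.coeff P ` {..Polynomial.degree P} \<subseteq> Fbar"
    using assms(2) by (auto simp: polys_over_def)
  then obtain n where n: "n > 0" "\<And>x. x \<in> Polynomial.coeff P ` {..Polynomial.degree P} \<Longrightarrow> x ^ (CARD('q) ^ n) = x"
    by (rule Fbar_powers) blast
  then have "Polynomial.coeff P i ^ (CARD('q) ^ n) = Polynomial.coeff P i" for i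
    by (cases "i \<le> Polynomial.degree P") (auto simp: coeff_eq_0 zero_power)
  then show ?thesis
    using roots_power_permute[OF assms(1) _ assms(3), of n] n(1) Fbar_iff by (metis nat_0_less_mult_iff)
qed

text \<open>The cardinality is written as that of \<open>range embK\<close> so that the type
  \<open>'q\<close> enters through the parameter \<open>embK\<close>; \<open>frob_eq_fr\<close>
  restores the form with \<open>CARD('q)\<close>.\<close>

definition fr :: "int \<Rightarrow> 'c \<Rightarrow> 'c" where
  "fr = frob (card (range embK))"

lemma frob_eq_fr: "frob CARD('q) = fr"
  using card_image[OF embK_inj] by (simp add: fr_def)

lemmas fr_frob = frob_eq_fr[symmetric]

lemma fr_0 [simp]: "fr 0 x = x"
  by (simp add: fr_frob frob_def)

lemma fr_nonneg: "n \<ge> 0 \<Longrightarrow> fr n x = x ^ (CARD('q) ^ nat n)"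
  by (simp add: fr_frob frob_def)

lemma fr_nat: "fr (int n) x = x ^ (CARD('q) ^ n)"
  by (simp add: fr_frob frob_def)

lemma fr_neg_power: "(fr (- int n) x) ^ (CARD('q) ^ n) = x"
proof (cases "n = 0")
  case False
  then show ?thesis
    using surj_f_inv_f[OF bij_is_surj[OF power_q_bij], of n x] by (simp add: fr_frob frob_def)
qed simp

lemma fr_Suc: "fr (n + 1) x = (fr n x) ^ CARD('q)"
proof (cases "n \<ge> 0")
  case True
  then show ?thesis by (simp add: fr_nonneg nat_add_distrib mult.commute flip: power_mult)
next
  case False
  then obtain k where k: "n = - int (Suc k)" by (intro that[of "nat (- n) - 1"]) simp
  have "((fr n x) ^ CARD('q)) ^ (CARD('q) ^ k) = x"
    using fr_neg_power[of "Suc k" x] k by (simp add: power_mult)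
  moreover have "(fr (n + 1) x) ^ (CARD('q) ^ k) = x"
    using fr_neg_power[of k x] k by simp
  ultimately show ?thesis using power_q_inj by metis
qed

text \<open>Two-sided induction on the integer exponent: the upward step is \<open>fr_Suc\<close>,
  the downward step cancels a \<open>q\<close>-th power by injectivity. Additivity and
  multiplicativity of \<open>fr\<close> are obtained in the same way.\<close>

lemma fr_fr: "fr m (fr n x) = fr (m + n) x"
proof (induction m rule: int_induct[where k=0])
  case (step1 i)
  then show ?case by (metis fr_Suc add.assoc add.commute)
next
  case (step2 i)
  have "(fr (i - 1) (fr n x)) ^ CARD('q) = (fr (i - 1 + n) x) ^ CARD('q)"
    using step2 fr_Suc[of "i - 1" "fr n x"] fr_Suc[of "i - 1 + n" x] by (simp add: algebra_simps)
  then show ?case using power_q_inj[of _ 1] by (metis power_one_right)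
qed simp

lemma fr_add: "fr n (x + y) = fr n x + fr n y"
proof (induction n rule: int_induct[where k=0])
  case (step1 i)
  then show ?case using frob_add_q[of "fr i x" "fr i y" 1] by (simp add: fr_Suc)
next
  case (step2 i)
  have "(fr (i - 1) (x + y)) ^ CARD('q) = (fr (i - 1) x + fr (i - 1) y) ^ CARD('q)"
    using step2 fr_Suc[of "i - 1"] frob_add_q[of "fr (i - 1) x" "fr (i - 1) y" 1] by simp
  then show ?case using power_q_inj[of _ 1] by (metis power_one_right)
qed simp

lemma fr_mult: "fr n (x * y) = fr n x * fr n y"
proof (induction n rule: int_induct[where k=0])
  case (step1 i)
  then show ?case by (simp add: fr_Suc power_mult_distrib)
next
  case (step2 i)
  have "(fr (i - 1) (x * y)) ^ CARD('q) = (fr (i - 1) x * fr (i - 1) y) ^ CARD('q)"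
    using step2 fr_Suc[of "i - 1" "x * y"] fr_Suc[of "i - 1" x] fr_Suc[of "i - 1" y] by (simp add: power_mult_distrib)
  then show ?case using power_q_inj[of _ 1] by (metis power_one_right)
qed simp

lemma fr_zero [simp]: "fr n 0 = 0"
  using fr_add[of n 0 0] by (simp only: add_cancel_right_left add_0_left)

lemma fr_cancel [simp]: "fr n (fr (- n) x) = x" "fr (- n) (fr n x) = x"
  by (simp_all add: fr_fr)

lemma fr_inject [simp]: "fr n x = fr n y \<longleftrightarrow> x = y"
  by (metis fr_cancel(2))

lemma fr_eq_0 [simp]: "fr n x = 0 \<longleftrightarrow> x = 0"
  using fr_inject[of n x 0] by simp

lemma fr_one [simp]: "fr n 1 = 1"
  using fr_mult[of n 1 1] by (metis fr_eq_0 mult.right_neutral mult_cancel_left zero_neq_one)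

lemma fr_sum: "fr n (sum f A) = (\<Sum>i\<in>A. fr n (f i))"
  by (induction A rule: infinite_finite_induct) (auto simp: fr_add)

lemma fr_power: "fr n (x ^ k) = fr n x ^ k"
  by (induction k) (auto simp: fr_mult)

text \<open>The closure properties under which the series with coefficients in \<open>L\<close> form
  a division subring; negative powers of Frobenius occur because coefficients have to move past
  powers of \<tau>. The instances are \<open>K\<close>, \<open>Fbar\<close> and the whole
  field.\<close>

definition perfect_subfield :: "'c set \<Rightarrow> bool" where
  "perfect_subfield L \<longleftrightarrow> range embK \<subseteq> L \<and> (\<forall>x\<in>L. \<forall>y\<in>L. x + y \<in> L \<and> x * y \<in> L) \<and>
    (\<forall>x\<in>L. - x \<in> L \<and> inverse x \<in> L) \<and> (\<forall>x\<in>L. \<forall>n. fr n x \<in> L)"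

lemma perfect_subfield_UNIV: "perfect_subfield UNIV"
  by (auto simp: perfect_subfield_def)

lemma perfect_subfield_Fbar: "perfect_subfield Fbar"
proof -
  \<comment> \<open>One argument for all field operations: an operation commuting with the powers
    q^n preserves the fixed field of such a power.\<close>
  have closed: "f x y \<in> Fbar" if xy: "x \<in> Fbar" "y \<in> Fbar"
    and pw: "\<And>n. f x y ^ (CARD('q) ^ n) = f (x ^ (CARD('q) ^ n)) (y ^ (CARD('q) ^ n))" for f :: "'c \<Rightarrow> 'c \<Rightarrow> 'c" and x y
  proof -
    obtain n where n: "n > 0" "\<And>w. w \<in> {x, y} \<Longrightarrow> w ^ (CARD('q) ^ n) = w"
      by (rule Fbar_powers[of "{x, y}"]) (use xy in auto)
    have "f x y ^ (CARD('q) ^ n) = f x y" using pw[of n] n(2)[of x] n(2)[of y] by simp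
    then show ?thesis using n(1) Fbar_iff by blast
  qed
  have "fr n x \<in> Fbar" if x: "x \<in> Fbar" for n x
  proof -
    obtain m where m: "m > 0" "x ^ (CARD('q) ^ m) = x" using x Fbar_iff by auto
    have "fr n x ^ (CARD('q) ^ m) = fr n x" using fr_power[of n x "CARD('q) ^ m"] m(2) by simp
    then show ?thesis using m(1) Fbar_iff by blast
  qed
  moreover have "range embK \<subseteq> Fbar"
    using power_q_Fq Fbar_iff by (metis power_one_right subsetI zero_less_one)
  ultimately show ?thesis
    unfolding perfect_subfield_def
    using closed[of _ _ "(+)"] closed[of _ _ "(*)"] closed[of _ _ "\<lambda>x y. - x"] closed[of _ _ "\<lambda>x y. inverse x"]
    by (auto simp: frob_add_q power_mult_distrib minus_power_q power_inverse)
qed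

lemma perfect_subfield_K: "perfect_subfield K"
proof -
  interpret algebraic_closure "ring_of_type_algebra :: 'c ring" K by (rule Kbar)
  have K: "subfield K (ring_of_type_algebra :: 'c ring)" by (rule subfield_axioms)
  note sr = subfieldE(1)[OF K]
  have inv: "inverse x \<in> K" if "x \<in> K" for x
  proof (cases "x = 0")
    case False
    have "inv\<^bsub>(ring_of_type_algebra :: 'c ring)\<^esub> x \<in> K" using subfield_m_inv(1)[OF K, of x] that False by auto
    moreover have "inv\<^bsub>(ring_of_type_algebra :: 'c ring)\<^esub> x = inverse x"
      by (rule comm_inv_char) (use False in auto)
    ultimately show ?thesis by simp
  qed (use that in auto)
  have mult: "x * y \<in> K" and add: "x + y \<in> K" and neg: "- x \<in> K" if "x \<in> K" "y \<in> K" for x y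
    using subringE(5,6,7)[OF sr] that by auto
  have pow: "x ^ n \<in> K" if "x \<in> K" for x n
    using subringE(3)[OF sr] mult that by (induction n) auto
  obtain k where k: "CARD('q) = CHAR('c) ^ k" using q_power_CHAR CHAR_c by metis
  \<comment> \<open>As \<open>q\<close> is a power of the characteristic p, iterated p-th roots in
    the perfect field \<open>K\<close> provide all negative powers of Frobenius.\<close>
  have root: "\<exists>y\<in>K. y ^ (CHAR('c) ^ j) = x" if "x \<in> K" for x j
    using that
  proof (induction j arbitrary: x)
    case 0 then show ?case by auto
  next
    case (Suc j)
    obtain y where "y \<in> K" "y ^ CHAR('c) = x" using perfect Suc by blast
    moreover obtain w where "w \<in> K" "w ^ (CHAR('c) ^ j) = y" using Suc.IH[OF \<open>y \<in> K\<close>] by blast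
    moreover have "w ^ (CHAR('c) ^ Suc j) = (w ^ (CHAR('c) ^ j)) ^ CHAR('c)"
      by (simp only: power_Suc2 power_mult)
    ultimately show ?case by auto
  qed
  have frK: "fr n x \<in> K" if x: "x \<in> K" for n x
  proof (cases "n \<ge> 0")
    case True
    then show ?thesis using pow[OF x] by (simp add: fr_nonneg)
  next
    case False
    then obtain j where j: "n = - int j" by (intro that[of "nat (- n)"]) simp
    obtain y where y: "y \<in> K" "y ^ (CHAR('c) ^ (k * j)) = x" using root[OF x] by blast
    have "y ^ (CARD('q) ^ j) = x" using y k by (simp add: power_mult)
    then have "y = fr n x" using fr_neg_power[of j x] j power_q_inj by metis
    then show ?thesis using y by simp
  qed
  then show ?thesis
    unfolding perfect_subfield_def by (intro conjI ballI allI embK(2) mult add neg inv frK)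
qed

end

section \<open>Skew Laurent series\<close>

text \<open>The filtration by order. Unlike \<open>fls_subdegree\<close>, whose value at the zero
  series is 0, it treats zero like any other series, so that estimates need no case
  distinction.\<close>

definition vanish :: "int \<Rightarrow> 'c::zero fls \<Rightarrow> bool" where
  "vanish n f \<longleftrightarrow> (\<forall>i<n. f $$ i = 0)"

text \<open>The element y \<tau>^(-n), with its coefficient on the left.\<close>

definition mon :: "'c::zero \<Rightarrow> int \<Rightarrow> 'c fls" where
  "mon y n = fls_shift (- n) (fls_const y)"

lemma mon_nth [simp]: "mon y n $$ k = (if k = n then y else 0)"
  by (simp add: mon_def)

lemma vanish_zero [simp]: "vanish n 0"
  by (simp add: vanish_def)

lemma vanish_mono: "vanish n f \<Longrightarrow> m \<le> n \<Longrightarrow> vanish m f"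
  by (simp add: vanish_def)

lemma vanish_add: "vanish n f \<Longrightarrow> vanish n g \<Longrightarrow> vanish n (f + g)"
  for f g :: "'c::monoid_add fls"
  by (simp add: vanish_def)

lemma vanish_diff: "vanish n f \<Longrightarrow> vanish n g \<Longrightarrow> vanish n (f - g)"
  for f g :: "'c::group_add fls"
  by (simp add: vanish_def)

lemma vanish_minus_commute: "vanish n (f - g) = vanish n (g - f)"
  for f g :: "'c::ab_group_add fls"
  by (auto simp: vanish_def)

lemma vanish_mon: "n \<le> k \<Longrightarrow> vanish n (mon y k)"
  by (simp add: vanish_def)

lemma vanish_subdegree: "n \<le> fls_subdegree f \<Longrightarrow> vanish n f"
  by (simp add: vanish_def)

lemma subdegree_vanish: "vanish n f \<Longrightarrow> f \<noteq> 0 \<Longrightarrow> n \<le> fls_subdegree f"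
  by (simp add: vanish_def fls_subdegree_geI)

lemma vanish_ex: "\<exists>a\<le>m. vanish a f"
  by (intro exI[of _ "min m (fls_subdegree f)"]) (auto intro: vanish_subdegree)

lemma vanish_all_imp_0: "(\<And>k::nat. vanish (n0 + int k) f) \<Longrightarrow> f = 0"
proof (rule fls_eqI)
  fix n assume *: "\<And>k::nat. vanish (n0 + int k) f"
  show "f $$ n = 0 $$ n"
    using *[of "nat (n - n0 + 1)"] by (simp add: vanish_def)
qed

lemma fls_of_bounded:
  fixes h :: "int \<Rightarrow> 'c::zero"
  assumes "\<And>n. n < a \<Longrightarrow> h n = 0"
  obtains f where "\<And>n. f $$ n = h n"
  using assms nth_Abs_fls_ex_lower_bound[of h] by blast

text \<open>Completeness with an explicit rate. Each coefficient of the limit is a coefficient of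
  some \<open>U k\<close>, which is why a condition on coefficients passes to the limit.\<close>

lemma fls_limit:
  fixes U :: "nat \<Rightarrow> 'c::field fls"
  assumes U: "\<And>k. vanish (n0 + int k) (U (Suc k) - U k)"
  obtains u where "\<And>k. vanish (n0 + int k) (u - U k)"
    and "\<And>S. (\<And>k. U k \<in> laurent_over S) \<Longrightarrow> u \<in> laurent_over S"
proof -
  have step: "vanish (n0 + int k) (U (k + j) - U k)" for k j
  proof (induction j)
    case (Suc j)
    have "U (k + Suc j) - U k = (U (Suc (k + j)) - U (k + j)) + (U (k + j) - U k)" by simp
    then show ?case
      using Suc vanish_mono[OF U[of "k + j"], of "n0 + int k"] vanish_add by fastforce
  qed simp
  obtain a where a: "a \<le> n0" "vanish a (U 0)" using vanish_ex by blast
  \<comment> \<open>The index exceeds n - n0, and from such an index on the coefficient at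
    \<open>n\<close> no longer changes.\<close>
  define h where "h n = U (nat (n - n0 + 1)) $$ n" for n
  have "h n = 0" if "n < a" for n
    using that a by (simp add: h_def vanish_def)
  then obtain u where u: "\<And>n. u $$ n = h n" using fls_of_bounded[of a h] by metis
  show ?thesis
  proof (rule that[of u])
    fix k
    show "vanish (n0 + int k) (u - U k)"
      unfolding vanish_def
    proof (intro allI impI)
      fix n assume n: "n < n0 + int k"
      define m where "m = nat (n - n0 + 1)"
      have "n < n0 + int m" and mk: "m \<le> k" unfolding m_def using n by (auto split: if_splits)
      then show "(u - U k) $$ n = 0"
        using step[of m "k - m"] u[of n] by (simp add: vanish_def h_def m_def[symmetric])
    qed
  next
    fix S assume "\<And>k. U k \<in> laurent_over S"
    then show "u \<in> laurent_over S" by (simp add: laurent_over_def u h_def)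
  qed
qed

context drinfeld_setting
begin

section \<open>The skew field of Laurent series and its valuation\<close>

definition smult :: "'c fls \<Rightarrow> 'c fls \<Rightarrow> 'c fls" (infixl "\<star>" 70) where
  "smult = skew_mult (card (range embK))"

lemma skew_mult_eq: "skew_mult CARD('q) = smult"
  using card_image[OF embK_inj] by (simp add: smult_def)

text \<open>The definition sums between the subdegrees; further terms vanish, so any lower bounds
  may be used. This allows several series to be handled over a common range of summation.\<close>

lemma smult_nth:
  assumes "vanish a f" "vanish b g"
  shows "(f \<star> g) $$ n = (\<Sum>i = a..n - b. f $$ i * fr (- i) (g $$ (n - i)))"
proof (cases "f = 0 \<or> g = 0")
  case True
  then show ?thesis
    by (auto simp: skew_mult_eq[symmetric] skew_mult_nth frob_eq_fr)
next
  case False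
  have "(f \<star> g) $$ n = (\<Sum>i = fls_subdegree f..n - fls_subdegree g. f $$ i * fr (- i) (g $$ (n - i)))"
    by (simp add: skew_mult_eq[symmetric] skew_mult_nth frob_eq_fr)
  also have "\<dots> = (\<Sum>i = a..n - b. f $$ i * fr (- i) (g $$ (n - i)))"
    using subdegree_vanish[OF assms(1)] subdegree_vanish[OF assms(2)] False
    by (intro sum.mono_neutral_left) (auto simp: not_le)
  finally show ?thesis .
qed

lemma vanish_smult: "vanish a f \<Longrightarrow> vanish b g \<Longrightarrow> vanish (a + b) (f \<star> g)"
  by (subst vanish_def) (simp add: smult_nth)

lemma smult_lead: "vanish a f \<Longrightarrow> vanish b g \<Longrightarrow> (f \<star> g) $$ (a + b) = f $$ a * fr (- a) (g $$ b)"
  by (simp add: smult_nth)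

lemma smult_add_right: "f \<star> (g + h) = f \<star> g + f \<star> h"
proof (rule fls_eqI)
  fix n
  obtain a where a: "vanish a f" using vanish_ex by blast
  obtain b where b: "vanish b g" using vanish_ex by blast
  obtain c where c: "c \<le> b" "vanish c h" using vanish_ex by blast
  have b': "vanish c g" using vanish_mono[OF b c(1)] .
  show "(f \<star> (g + h)) $$ n = (f \<star> g + f \<star> h) $$ n"
    using smult_nth[OF a b'] smult_nth[OF a c(2)] smult_nth[OF a vanish_add[OF b' c(2)]]
    by (simp add: fr_add distrib_left sum.distrib)
qed

lemma smult_add_left: "(f + g) \<star> h = f \<star> h + g \<star> h"
proof (rule fls_eqI)
  fix n
  obtain a where a: "vanish a h" using vanish_ex by blast
  obtain b where b: "vanish b g" using vanish_ex by blast
  obtain c where c: "c \<le> b" "vanish c f" using vanish_ex by blast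
  have b': "vanish c g" using vanish_mono[OF b c(1)] .
  show "((f + g) \<star> h) $$ n = (f \<star> h + g \<star> h) $$ n"
    using smult_nth[OF b' a] smult_nth[OF c(2) a] smult_nth[OF vanish_add[OF c(2) b'] a]
    by (simp add: distrib_right sum.distrib)
qed

lemma smult_0 [simp]: "f \<star> 0 = 0" "0 \<star> f = 0"
  using smult_add_right[of f 0 0] smult_add_left[of 0 0 f] by (simp_all only: add_cancel_right_left add_0_left)

lemma smult_uminus: "f \<star> (- g) = - (f \<star> g)" "(- f) \<star> g = - (f \<star> g)"
  using smult_add_right[of f g "- g"] smult_add_left[of f "- f" g]
  by (simp_all add: eq_neg_iff_add_eq_0 add.commute)

lemma smult_diff_right: "f \<star> (g - h) = f \<star> g - f \<star> h"
  using smult_add_right[of f g "- h"] by (simp add: smult_uminus)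

lemma smult_diff_left: "(f - g) \<star> h = f \<star> h - g \<star> h"
  using smult_add_left[of f "- g" h] by (simp add: smult_uminus)

lemma smult_assoc: "(f \<star> g) \<star> h = f \<star> (g \<star> h)"
proof (rule fls_eqI)
  fix n
  obtain a b c where v: "vanish a f" "vanish b g" "vanish c h" using vanish_ex by metis
  have "((f \<star> g) \<star> h) $$ n =
      (\<Sum>k = a + b..n - c. \<Sum>i = a..k - b. f $$ i * fr (- i) (g $$ (k - i)) * fr (- k) (h $$ (n - k)))"
    by (simp add: smult_nth[OF vanish_smult[OF v(1,2)] v(3)] smult_nth[OF v(1,2)] sum_distrib_right)
  also have "\<dots> = (\<Sum>(k, i)\<in>(SIGMA k:{a + b..n - c}. {a..k - b}).
      f $$ i * fr (- i) (g $$ (k - i)) * fr (- k) (h $$ (n - k)))"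
    by (rule sum.Sigma) auto
  \<comment> \<open>Substitute k = i + j; the twist by -k of the last factor is the composite of the
    twists by -i and -j.\<close>
  also have "\<dots> = (\<Sum>(i, j)\<in>(SIGMA i:{a..n - (b + c)}. {b..n - i - c}).
      f $$ i * (fr (- i) (g $$ j) * fr (- i - j) (h $$ (n - i - j))))"
    by (rule sum.reindex_bij_witness[where i = "\<lambda>(i, j). (i + j, i)" and j = "\<lambda>(k, i). (i, k - i)"])
      (auto simp: algebra_simps)
  also have "\<dots> = (\<Sum>i = a..n - (b + c). \<Sum>j = b..n - i - c.
      f $$ i * (fr (- i) (g $$ j) * fr (- i - j) (h $$ (n - i - j))))"
    by (rule sum.Sigma[symmetric]) auto
  also have "\<dots> = (f \<star> (g \<star> h)) $$ n"
    by (simp add: smult_nth[OF v(1) vanish_smult[OF v(2,3)]] smult_nth[OF v(2,3)] fr_sum fr_mult fr_fr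
        sum_distrib_left)
  finally show "((f \<star> g) \<star> h) $$ n = (f \<star> (g \<star> h)) $$ n" .
qed

lemma smult_const_left [simp]: "(fls_const c \<star> g) $$ n = c * g $$ n"
proof -
  obtain b where b: "b \<le> n" "vanish b g" using vanish_ex by blast
  have "vanish 0 (fls_const c)" by (simp add: vanish_def)
  then have "(fls_const c \<star> g) $$ n = (\<Sum>i = 0..n - b. fls_const c $$ i * fr (- i) (g $$ (n - i)))"
    using smult_nth b by blast
  also have "\<dots> = (\<Sum>i\<in>{0}. fls_const c $$ i * fr (- i) (g $$ (n - i)))"
    using b by (intro sum.mono_neutral_right) auto
  finally show ?thesis by simp
qed

lemma smult_mon_right: "(f \<star> mon y m) $$ n = f $$ (n - m) * fr (m - n) y"
proof -
  obtain a where a: "a \<le> n - m" "vanish a f" using vanish_ex by blast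
  have "vanish m (mon y m)" by (simp add: vanish_mon)
  then have "(f \<star> mon y m) $$ n = (\<Sum>i = a..n - m. f $$ i * fr (- i) (mon y m $$ (n - i)))"
    using smult_nth a by blast
  also have "\<dots> = (\<Sum>i\<in>{n - m}. f $$ i * fr (- i) (mon y m $$ (n - i)))"
    using a by (intro sum.mono_neutral_right) auto
  finally show ?thesis by simp
qed

lemma smult_mon_left: "(mon y m \<star> f) $$ n = y * fr (- m) (f $$ (n - m))"
proof -
  obtain a where a: "a \<le> n - m" "vanish a f" using vanish_ex by blast
  have "vanish m (mon y m)" by (simp add: vanish_mon)
  then have "(mon y m \<star> f) $$ n = (\<Sum>i = m..n - a. mon y m $$ i * fr (- i) (f $$ (n - i)))"
    using smult_nth a by blast
  also have "\<dots> = (\<Sum>i\<in>{m}. mon y m $$ i * fr (- i) (f $$ (n - i)))"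
    using a by (intro sum.mono_neutral_right) auto
  finally show ?thesis by simp
qed

lemma mon_1_0: "mon 1 0 = 1"
  by (rule fls_eqI) simp

lemma smult_1 [simp]: "1 \<star> f = f" "f \<star> 1 = f"
  by (rule fls_eqI, simp add: smult_mon_left smult_mon_right flip: mon_1_0)+

lemma tau_pow_mon: "tau_pow n = mon 1 (- n)"
  by (rule fls_eqI) (simp add: tau_pow_def)

lemma tau_pow_left: "(tau_pow m \<star> f) $$ n = fr m (f $$ (n + m))"
  by (simp add: tau_pow_mon smult_mon_left)

lemma tau_pow_right: "(f \<star> tau_pow m) $$ n = f $$ (n + m)"
  by (simp add: tau_pow_mon smult_mon_right)

lemma tau_pow_add: "tau_pow m \<star> tau_pow n = tau_pow (m + n)"
  by (rule fls_eqI) (auto simp: tau_pow_left, auto simp: tau_pow_mon)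

lemma tau_pow_0 [simp]: "tau_pow 0 = (1 :: 'c fls)"
  by (simp add: tau_pow_mon mon_1_0)

lemma vanish_tau_pow: "vanish (- n) (tau_pow n)"
  by (simp add: tau_pow_mon vanish_mon)

text \<open>Leading coefficients multiply up to a Frobenius twist, which is injective.\<close>

lemma smult_eq_0_iff: "f \<star> g = 0 \<longleftrightarrow> f = 0 \<or> g = 0"
proof
  assume *: "f \<star> g = 0"
  have "(f \<star> g) $$ (fls_subdegree f + fls_subdegree g) =
    f $$ fls_subdegree f * fr (- fls_subdegree f) (g $$ fls_subdegree g)"
    by (rule smult_lead) (auto intro: vanish_subdegree)
  then show "f = 0 \<or> g = 0" using * by (auto simp: nth_fls_subdegree_zero_iff)
qed auto

lemma subdegree_smult: "f \<noteq> 0 \<Longrightarrow> g \<noteq> 0 \<Longrightarrow> fls_subdegree (f \<star> g) = fls_subdegree f + fls_subdegree g"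
  using vanish_smult[of "fls_subdegree f" f "fls_subdegree g" g]
  by (intro fls_subdegree_eqI) (auto simp: smult_lead vanish_subdegree vanish_def)

lemma perfect_subfield_closed:
  fixes h :: "'z \<Rightarrow> 'c"
  assumes "perfect_subfield L"
  shows "0 \<in> L" "1 \<in> L" "embK a \<in> L" "x \<in> L \<Longrightarrow> y \<in> L \<Longrightarrow> x + y \<in> L"
    "x \<in> L \<Longrightarrow> y \<in> L \<Longrightarrow> x - y \<in> L" "x \<in> L \<Longrightarrow> y \<in> L \<Longrightarrow> x * y \<in> L"
    "x \<in> L \<Longrightarrow> - x \<in> L" "x \<in> L \<Longrightarrow> inverse x \<in> L" "x \<in> L \<Longrightarrow> fr n x \<in> L"
    "(\<And>i. i \<in> A \<Longrightarrow> h i \<in> L) \<Longrightarrow> sum h A \<in> L"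
proof -
  note L = assms[unfolded perfect_subfield_def]
  show 01: "0 \<in> L" "1 \<in> L" using L by (metis embK_simps(1,2) rangeI subsetD)+
  show "x \<in> L \<Longrightarrow> y \<in> L \<Longrightarrow> x - y \<in> L" using L by (metis add_uminus_conv_diff)
  show "(\<And>i. i \<in> A \<Longrightarrow> h i \<in> L) \<Longrightarrow> sum h A \<in> L"
    by (induction A rule: infinite_finite_induct) (use L 01 in auto)
qed (use assms in \<open>auto simp: perfect_subfield_def\<close>)

lemma laurent_over_simps:
  assumes "perfect_subfield L"
  shows "0 \<in> laurent_over L" "1 \<in> laurent_over L"
    "f \<in> laurent_over L \<Longrightarrow> g \<in> laurent_over L \<Longrightarrow> f + g \<in> laurent_over L"
    "f \<in> laurent_over L \<Longrightarrow> g \<in> laurent_over L \<Longrightarrow> f - g \<in> laurent_over L"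
    "f \<in> laurent_over L \<Longrightarrow> - f \<in> laurent_over L"
    "f \<in> laurent_over L \<Longrightarrow> g \<in> laurent_over L \<Longrightarrow> f \<star> g \<in> laurent_over L"
    "tau_pow n \<in> laurent_over L" "fls_const (embK a) \<in> laurent_over L"
    "c \<in> L \<Longrightarrow> mon c n \<in> laurent_over L"
proof -
  note L = assms[unfolded perfect_subfield_def]
  note L01 = perfect_subfield_closed(1,2)[OF assms]
  show "0 \<in> laurent_over L" "1 \<in> laurent_over L" "tau_pow n \<in> laurent_over L"
    "fls_const (embK a) \<in> laurent_over L" "c \<in> L \<Longrightarrow> mon c n \<in> laurent_over L"
    using L L01 by (auto simp: laurent_over_def tau_pow_mon)
  show "f \<in> laurent_over L \<Longrightarrow> g \<in> laurent_over L \<Longrightarrow> f + g \<in> laurent_over L"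
    using L by (auto simp: laurent_over_def)
  show "f \<in> laurent_over L \<Longrightarrow> - f \<in> laurent_over L"
    using L by (auto simp: laurent_over_def)
  show "f \<in> laurent_over L \<Longrightarrow> g \<in> laurent_over L \<Longrightarrow> f - g \<in> laurent_over L"
    using L by (simp add: laurent_over_def) (metis add_uminus_conv_diff)
  note sum = perfect_subfield_closed(10)[OF assms]
  obtain a b where v: "vanish a f" "vanish b g" using vanish_ex by metis
  show "f \<in> laurent_over L \<Longrightarrow> g \<in> laurent_over L \<Longrightarrow> f \<star> g \<in> laurent_over L"
    unfolding laurent_over_def using L by (simp add: smult_nth[OF v]) (intro allI sum, simp)
qed

text \<open>Successive approximation: an additive map that shifts the filtration by \<open>e\<close>
  is onto as soon as it is onto in the leading degree of monomials. It serves for inverses, with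
  left multiplication, and for Lang's equation, with u -> P u - u Q.\<close>

lemma solve_degreewise:
  assumes L: "perfect_subfield L"
    and add: "\<And>u v. \<Phi> (u + v) = \<Phi> u + \<Phi> v"
    and van: "\<And>n u. vanish n u \<Longrightarrow> vanish (n + e) (\<Phi> u)"
    and cl: "\<And>u. u \<in> laurent_over L \<Longrightarrow> \<Phi> u \<in> laurent_over L"
    and sol: "\<And>n c. c \<in> L \<Longrightarrow> \<exists>y\<in>L. \<Phi> (mon y n) $$ (n + e) = c"
    and t: "vanish (n0 + e) t" "t \<in> laurent_over L"
  obtains u where "vanish n0 u" "u \<in> laurent_over L" "\<Phi> u = t"
proof -
  note LL = laurent_over_simps[OF L]
  have "\<exists>U. \<forall>k. (vanish n0 (U k) \<and> U k \<in> laurent_over L \<and> vanish (n0 + e + int k) (t - \<Phi> (U k))) \<and>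
      vanish (n0 + int k) (U (Suc k) - U k)"
  proof (rule dependent_nat_choice, goal_cases)
    case 1
    have "\<Phi> 0 = 0" using add[of 0 0] by (simp only: add_cancel_right_left add_0_left)
    then show ?case using t LL by (intro exI[of _ 0]) auto
  next
    case (2 u k)
    let ?n = "n0 + int k"
    have "t - \<Phi> u \<in> laurent_over L" using 2 t LL cl by auto
    \<comment> \<open>The lowest surviving coefficient of the defect is removed by one monomial of
      degree \<open>n0 + k\<close>, which raises the order of the defect by one.\<close>
    then obtain y where y: "y \<in> L" "\<Phi> (mon y ?n) $$ (?n + e) = (t - \<Phi> u) $$ (?n + e)"
      using sol[of "(t - \<Phi> u) $$ (?n + e)" ?n] by (auto simp: laurent_over_def)
    have v: "vanish (?n + e) (\<Phi> (mon y ?n))" by (intro van vanish_mon) auto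
    have "vanish (n0 + e + int (Suc k)) (t - \<Phi> (u + mon y ?n))"
      unfolding vanish_def
    proof (intro allI impI)
      fix i assume i: "i < n0 + e + int (Suc k)"
      show "(t - \<Phi> (u + mon y ?n)) $$ i = 0"
      proof (cases "i = ?n + e")
        case True then show ?thesis using y by (simp add: add)
      next
        case False
        then have "i < ?n + e" using i by auto
        then show ?thesis using 2 v by (simp add: add vanish_def algebra_simps)
      qed
    qed
    moreover have "vanish n0 (mon y ?n)" by (simp add: vanish_mon)
    ultimately show ?case
      using 2 LL(3,9) y(1) by (intro exI[of _ "u + mon y ?n"]) (auto simp: vanish_add vanish_mon)
  qed
  then obtain U where U: "\<And>k. vanish n0 (U k)" "\<And>k. U k \<in> laurent_over L"
    "\<And>k. vanish (n0 + e + int k) (t - \<Phi> (U k))" "\<And>k. vanish (n0 + int k) (U (Suc k) - U k)"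
    by blast
  obtain u where u: "\<And>k. vanish (n0 + int k) (u - U k)" "\<And>S. (\<And>k. U k \<in> laurent_over S) \<Longrightarrow> u \<in> laurent_over S"
    using fls_limit[OF U(4)] by metis
  have "vanish (n0 + e + int k) (t - \<Phi> u)" for k
  proof -
    have "\<Phi> u = \<Phi> (U k) + \<Phi> (u - U k)" using add[of "U k" "u - U k"] by simp
    then have "t - \<Phi> u = (t - \<Phi> (U k)) - \<Phi> (u - U k)" by simp
    then show ?thesis using vanish_diff[OF U(3)[of k], of "\<Phi> (u - U k)"] van[OF u(1)[of k]] by (simp add: algebra_simps)
  qed
  then have "t - \<Phi> u = 0" by (rule vanish_all_imp_0)
  moreover have "vanish n0 u" using vanish_add[OF U(1)[of 0], of "u - U 0"] u(1)[of 0] by simp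
  ultimately show ?thesis using that u(2) U(2) by simp
qed

lemma smult_right_inverse_ex:
  assumes L: "perfect_subfield L" and f: "f \<in> laurent_over L" "f \<noteq> 0"
  shows "\<exists>g\<in>laurent_over L. f \<star> g = 1"
proof -
  define e where "e = fls_subdegree f"
  have e: "vanish e f" "f $$ e \<noteq> 0" using f by (auto simp: e_def vanish_subdegree)
  obtain g where "vanish (- e) g" "g \<in> laurent_over L" "f \<star> g = 1"
  proof (rule solve_degreewise[OF L, of "\<lambda>g. f \<star> g" e "- e" 1])
    show "\<exists>y\<in>L. (f \<star> mon y n) $$ (n + e) = c" if "c \<in> L" for n c
    \<comment> \<open>The leading coefficient of the product is f_e times the twist of y by -e; the
      witness inverts this.\<close>
    proof (rule bexI[of _ "fr e (c * inverse (f $$ e))"])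
      show "(f \<star> mon (fr e (c * inverse (f $$ e))) n) $$ (n + e) = c"
        using e by (simp add: smult_mon_right)
      show "fr e (c * inverse (f $$ e)) \<in> L"
        using L that f by (simp add: perfect_subfield_def laurent_over_def)
    qed
    show "vanish (n + e) (f \<star> u)" if "vanish n u" for n u
      using vanish_smult[OF e(1) that] by (simp add: add.commute)
  qed (auto simp: smult_add_right laurent_over_simps[OF L] f vanish_def)
  then show ?thesis by auto
qed

text \<open>Chosen in the whole skew field; by uniqueness of inverses it has coefficients in every
  perfect subfield that contains those of \<open>f\<close> (see \<open>sinv_in\<close>).\<close>

definition sinv :: "'c fls \<Rightarrow> 'c fls" where
  "sinv f = (SOME g. f \<star> g = 1)"

lemma sinv_right: "f \<noteq> 0 \<Longrightarrow> f \<star> sinv f = 1"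
  using smult_right_inverse_ex[OF perfect_subfield_UNIV, of f]
  unfolding sinv_def by (auto simp: laurent_over_def intro: someI_ex)

text \<open>A right inverse has itself a right inverse, which must be the original element.\<close>

lemma sinv_left: "f \<noteq> 0 \<Longrightarrow> sinv f \<star> f = 1"
proof -
  assume f: "f \<noteq> 0"
  then have "sinv f \<noteq> 0" using sinv_right[OF f] by auto
  then have "f = f \<star> (sinv f \<star> sinv (sinv f))" using sinv_right by simp
  also have "\<dots> = sinv (sinv f)" using sinv_right[OF f] by (simp flip: smult_assoc)
  finally show ?thesis using sinv_right[OF \<open>sinv f \<noteq> 0\<close>] by simp
qed

lemma sinv_nonzero: "f \<noteq> 0 \<Longrightarrow> sinv f \<noteq> 0"
  using sinv_right by force

lemma smult_left_cancel: "h \<noteq> 0 \<Longrightarrow> h \<star> f = h \<star> g \<longleftrightarrow> f = g"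
  using smult_eq_0_iff[of h "f - g"] by (simp add: smult_diff_right)

lemma smult_right_cancel: "h \<noteq> 0 \<Longrightarrow> f \<star> h = g \<star> h \<longleftrightarrow> f = g"
  using smult_eq_0_iff[of "f - g" h] by (simp add: smult_diff_left)

lemma sinv_left_assoc: "f \<noteq> 0 \<Longrightarrow> sinv f \<star> (f \<star> g) = g"
  by (simp add: sinv_left flip: smult_assoc)

lemma sinv_right_assoc: "f \<noteq> 0 \<Longrightarrow> f \<star> (sinv f \<star> g) = g"
  by (simp add: sinv_right flip: smult_assoc)

lemma sinv_in:
  assumes "perfect_subfield L" "f \<in> laurent_over L" "f \<noteq> 0"
  shows "sinv f \<in> laurent_over L"
proof -
  obtain g where g: "g \<in> laurent_over L" "f \<star> g = 1" using smult_right_inverse_ex assms by blast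
  then have "g = sinv f" using smult_left_cancel[OF assms(3), of g "sinv f"] sinv_right[OF assms(3)] by simp
  then show ?thesis using g by simp
qed

lemma subdegree_sinv: "f \<noteq> 0 \<Longrightarrow> fls_subdegree (sinv f) = - fls_subdegree f"
  using subdegree_smult[of f "sinv f"] sinv_right sinv_nonzero by fastforce

lemma fr_power_poly:
  assumes "e > 0"
  shows "fr e x = x ^ (CARD('q) ^ nat e)" "CARD('q) ^ nat e > 1"
  using assms one_less_power[OF q_gt_1, of "nat e"] by (simp_all add: fr_nonneg)

text \<open>In degree n Lang's equation contains \<open>fr (- e) y\<close> next to \<open>y\<close>.
  The substitution y = fr e x turns it into a root equation for the polynomial B X^(q^e) + A X +
  C.\<close>

lemma degree_affine_frob:
  fixes A B C :: 'c
  assumes "e > 0" "B \<noteq> 0"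
  defines "P \<equiv> Polynomial.monom B (CARD('q) ^ nat e) + [:C, A:]"
  shows "Polynomial.degree P = CARD('q) ^ nat e" "P \<noteq> 0" "poly P y = B * fr e y + A * y + C"
proof -
  note N = fr_power_poly[OF assms(1)]
  have "Polynomial.degree [:C, A:] \<le> 1" by simp
  then show *: "Polynomial.degree P = CARD('q) ^ nat e"
    unfolding P_def using N(2) assms(2)
    by (subst degree_add_eq_left) (auto simp: degree_monom_eq)
  then show "P \<noteq> 0" using N(2) by (intro notI) simp
  show "poly P y = B * fr e y + A * y + C"
    by (simp add: P_def poly_monom N(1) algebra_simps)
qed

lemma affine_frob_solvable:
  assumes "e > 0" "B \<noteq> 0"
  shows "\<exists>y. A * fr (- e) y + B * y = (C::'c)"
proof -
  note P = degree_affine_frob[OF assms, of "- C" A]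
  have "Polynomial.degree (Polynomial.monom B (CARD('q) ^ nat e) + [:- C, A:]) > 0"
    using P(1) fr_power_poly(2)[OF assms(1)] by linarith
  then obtain x where "poly (Polynomial.monom B (CARD('q) ^ nat e) + [:- C, A:]) x = 0"
    using has_root by blast
  then have "B * fr e x + A * x + - C = 0" using P(3)[of x] by simp
  then show ?thesis by (intro exI[of _ "fr e x"]) (simp add: algebra_simps)
qed

text \<open>After the substitution y = fr e x the unknown is a root of a nonzero polynomial over
  \<open>Fbar\<close>.\<close>

lemma affine_frob_Fbar:
  assumes "e > 0" "B \<noteq> 0" "A \<in> Fbar" "B \<in> Fbar" "A * fr (- e) y + B * y \<in> Fbar"
  shows "y \<in> Fbar"
proof -
  define C where "C = - (A * fr (- e) y + B * y)"
  define x where "x = fr (- e) y"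
  have y: "y = fr e x" by (simp add: x_def)
  let ?P = "Polynomial.monom B (CARD('q) ^ nat e) + [:C, A:]"
  note L = perfect_subfield_closed[OF perfect_subfield_Fbar]
  have C: "C \<in> Fbar" "0 \<in> Fbar" unfolding C_def by (intro L assms(5))+
  have "poly ?P x = 0" using degree_affine_frob(3)[OF assms(1,2)] by (simp add: C_def y algebra_simps)
  moreover have "?P \<in> polys_over Fbar"
  proof -
    have "Polynomial.coeff [:C, A:] i \<in> Fbar" for i
      using C assms by (auto simp: coeff_pCons split: nat.splits)
    then show ?thesis using assms C by (auto simp: polys_over_def intro!: L)
  qed
  ultimately have "x \<in> Fbar" using Fbar_root degree_affine_frob(2)[OF assms(1,2)] by blast
  then show ?thesis using L(9) y by simp
qed

text \<open>Later it bounds the possible leading coefficients of self-intertwiners, which is the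
  source of all finiteness in the division algebra.\<close>

lemma finite_frob_eigen:
  assumes "e > 0" "B \<noteq> 0"
  shows "finite {y. A * fr (- e) y = B * y}"
proof -
  let ?P = "Polynomial.monom B (CARD('q) ^ nat e) + [:0, - A:]"
  have "{y. A * fr (- e) y = B * y} \<subseteq> fr e ` {x. poly ?P x = 0}"
  proof
    fix y assume "y \<in> {y. A * fr (- e) y = B * y}"
    then have "poly ?P (fr (- e) y) = 0" using degree_affine_frob(3)[OF assms, of 0 "- A" "fr (- e) y"] by simp
    then show "y \<in> fr e ` {x. poly ?P x = 0}" by (intro image_eqI[of _ _ "fr (- e) y"]) auto
  qed
  moreover have "finite {x. poly ?P x = 0}" using degree_affine_frob(2)[OF assms] poly_roots_finite by blast
  ultimately show ?thesis using finite_subset by blast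
qed

text \<open>The leading coefficient in a prescribed degree \<open>i\<close> solves a Kummer equation
  and can be taken nonzero; all later coefficients solve inhomogeneous affine Frobenius equations.
  The freedom in \<open>i\<close> is used when two embeddings of the residue field have to be
  matched.\<close>

lemma lang_conjugate:
  assumes e: "e > 0" and P: "vanish e P" "P $$ e \<noteq> 0" and Q: "vanish e Q" "Q $$ e \<noteq> 0"
  obtains u where "vanish i u" "u $$ i \<noteq> 0" "P \<star> u = u \<star> Q"
proof -
  let ?\<Phi> = "\<lambda>u. P \<star> u - u \<star> Q"
  have van: "vanish (n + e) (?\<Phi> u)" if "vanish n u" for n u
    using vanish_diff[OF vanish_smult[OF P(1) that], of "u \<star> Q"] vanish_smult[OF that Q(1)] by (simp add: add.commute)
  have lead: "?\<Phi> (mon y n) $$ (n + e) = P $$ e * fr (- e) y - fr (- n) (Q $$ e) * y" for y n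
    by (simp add: smult_mon_right smult_mon_left)
  obtain b where b: "b \<noteq> 0" "P $$ e * fr (- e) b = fr (- i) (Q $$ e) * b"
  proof -
    \<comment> \<open>Put b = x^(q^e). The condition on the leading coefficient b becomes an
      equation for x^(q^e - 1) with nonzero right-hand side.\<close>
    define M where "M = CARD('q) ^ nat e - 1"
    have M: "M > 0" "CARD('q) ^ nat e = Suc M" using fr_power_poly(2)[OF e] by (auto simp: M_def)
    obtain x where x: "x ^ M = P $$ e * inverse (fr (- i) (Q $$ e))" using nth_root_ex[OF M(1)] by blast
    have "x \<noteq> 0" using x P Q M by (auto simp: zero_power)
    moreover have "fr e x = x * x ^ M" using fr_power_poly(1)[OF e] M by simp
    ultimately show ?thesis using that[of "fr e x"] x Q by (simp add: field_simps)
  qed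
  have t: "vanish (i + 1 + e) (- ?\<Phi> (mon b i))"
    unfolding vanish_def
  proof (intro allI impI)
    fix k assume k: "k < i + 1 + e"
    show "(- ?\<Phi> (mon b i)) $$ k = 0"
    proof (cases "k = i + e")
      case True then show ?thesis using lead[of b i] b by simp
    next
      case False
      then show ?thesis using van[of i "mon b i"] k by (auto simp: vanish_mon vanish_def)
    qed
  qed
  \<comment> \<open>The correction starts in degree i + 1, so it cannot destroy the nonzero
    coefficient in degree i.\<close>
  obtain u where u: "vanish (i + 1) u" "?\<Phi> u = - ?\<Phi> (mon b i)"
  proof (rule solve_degreewise[OF perfect_subfield_UNIV, of ?\<Phi> e "i + 1" "- ?\<Phi> (mon b i)"])
    show "\<exists>y\<in>UNIV. ?\<Phi> (mon y n) $$ (n + e) = c" for n c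
    proof -
      obtain y where "P $$ e * fr (- e) y + (- fr (- n) (Q $$ e)) * y = c"
        using affine_frob_solvable[OF e, of "- fr (- n) (Q $$ e)" "P $$ e" c] Q by auto
      then show ?thesis by (intro bexI[of _ y]) (simp_all only: lead UNIV_I minus_mult_left[symmetric] add_uminus_conv_diff)
    qed
    show "vanish (i + 1 + e) (- ?\<Phi> (mon b i))" by (rule t)
    show "vanish (n + e) (?\<Phi> u)" if "vanish n u" for n u using that by (rule van)
  qed (auto simp: smult_add_right smult_add_left laurent_over_def)
  show ?thesis
  proof (rule that[of "mon b i + u"])
    show "vanish i (mon b i + u)" using vanish_mono[OF u(1)] by (intro vanish_add vanish_mon) auto
    show "(mon b i + u) $$ i \<noteq> 0" using u(1) b(1) by (simp add: vanish_def)
    show "P \<star> (mon b i + u) = (mon b i + u) \<star> Q"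
      using u(2) by (simp add: smult_add_left smult_add_right algebra_simps)
  qed
qed

text \<open>In degree n + e the relation is an affine Frobenius equation for the coefficient u_n
  whose other terms involve only lower coefficients of \<open>u\<close>. By induction these lie in
  \<open>Fbar\<close>, and then so does every solution.\<close>

lemma conjugate_over_Fbar:
  assumes e: "e > 0" and P: "vanish e P" "P \<in> laurent_over Fbar"
    and Q: "vanish e Q" "Q $$ e \<noteq> 0" "Q \<in> laurent_over Fbar" and u: "P \<star> u = u \<star> Q"
  shows "u \<in> laurent_over Fbar"
proof -
  note L = perfect_subfield_closed[OF perfect_subfield_Fbar]
  note F0 = L(1) and sum = L(10)
  obtain a where a: "vanish a u" using vanish_ex by blast
  have "\<forall>m. m < a + int k \<longrightarrow> u $$ m \<in> Fbar" for k
  proof (induction k)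
    case 0 then show ?case using a F0 by (simp add: vanish_def)
  next
    case (Suc k)
    let ?n = "a + int k"
    have "(P \<star> u) $$ (?n + e) = (\<Sum>i = e..?n + e - a. P $$ i * fr (- i) (u $$ (?n + e - i)))"
      by (rule smult_nth[OF P(1) a])
    also have "{e..?n + e - a} = insert e {e + 1..?n + e - a}" by auto
    finally have Pu: "(P \<star> u) $$ (?n + e) = P $$ e * fr (- e) (u $$ ?n) +
        (\<Sum>i = e + 1..?n + e - a. P $$ i * fr (- i) (u $$ (?n + e - i)))" by simp
    have "(u \<star> Q) $$ (?n + e) = (\<Sum>i = a..?n + e - e. u $$ i * fr (- i) (Q $$ (?n + e - i)))"
      by (rule smult_nth[OF a Q(1)])
    also have "{a..?n + e - e} = insert ?n {a..?n - 1}" by auto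
    finally have uQ: "(u \<star> Q) $$ (?n + e) = u $$ ?n * fr (- ?n) (Q $$ e) +
        (\<Sum>i = a..?n - 1. u $$ i * fr (- i) (Q $$ (?n + e - i)))" by simp
    have A: "(\<Sum>i = e + 1..?n + e - a. P $$ i * fr (- i) (u $$ (?n + e - i))) \<in> Fbar"
      using Suc L P(2) by (intro sum) (auto simp: laurent_over_def)
    have B: "(\<Sum>i = a..?n - 1. u $$ i * fr (- i) (Q $$ (?n + e - i))) \<in> Fbar"
      using Suc L Q(3) by (intro sum) (auto simp: laurent_over_def)
    have "P $$ e * fr (- e) (u $$ ?n) + (- fr (- ?n) (Q $$ e)) * u $$ ?n =
      (\<Sum>i = a..?n - 1. u $$ i * fr (- i) (Q $$ (?n + e - i))) +
      - (\<Sum>i = e + 1..?n + e - a. P $$ i * fr (- i) (u $$ (?n + e - i)))"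
      using Pu uQ u by (simp add: algebra_simps)
    also have "\<dots> \<in> Fbar" by (intro L A B)
    finally have "P $$ e * fr (- e) (u $$ ?n) + (- fr (- ?n) (Q $$ e)) * u $$ ?n \<in> Fbar" .
    moreover have "P $$ e \<in> Fbar" "- fr (- ?n) (Q $$ e) \<in> Fbar"
      using P(2) Q(3) by (auto simp: laurent_over_def intro!: L)
    ultimately have un: "u $$ ?n \<in> Fbar"
      using affine_frob_Fbar[OF e, of "- fr (- ?n) (Q $$ e)" "P $$ e" "u $$ ?n"] Q(2) by simp
    show ?case
    proof (intro allI impI)
      fix m assume "m < a + int (Suc k)"
      then consider "m < a + int k" | "m = ?n" by linarith
      then show "u $$ m \<in> Fbar" using Suc un by cases auto
    qed
  qed
  then have "u $$ m \<in> Fbar" for m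
  proof -
    have "m < a + int (nat (m - a + 1))" by linarith
    then show ?thesis using \<open>\<And>k. \<forall>m. m < a + int k \<longrightarrow> u $$ m \<in> Fbar\<close> by blast
  qed
  then show ?thesis by (simp add: laurent_over_def)
qed

subsection \<open>Coefficientwise automorphisms\<close>

lemma coeffwise_nth: "\<gamma> 0 = 0 \<Longrightarrow> coeffwise \<gamma> f $$ n = \<gamma> (f $$ n)" for \<gamma> :: "'c \<Rightarrow> 'c"
proof -
  assume "\<gamma> 0 = 0"
  then have "\<exists>N. \<forall>n<N. \<gamma> (f $$ n) = 0"
    by (intro exI[of _ "fls_subdegree f"]) auto
  then show ?thesis unfolding coeffwise_def by (rule nth_Abs_fls_ex_lower_bound)
qed

text \<open>For a nonnegative power of Frobenius this is multiplicativity; for a negative one apply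
  the inverse power to both sides.\<close>

lemma ring_iso_fr:
  fixes \<gamma> :: "'c \<Rightarrow> 'c"
  assumes "\<And>x y. \<gamma> (x * y) = \<gamma> x * \<gamma> y" "\<gamma> 1 = 1"
  shows "\<gamma> (fr n x) = fr n (\<gamma> x)"
proof -
  have pow: "\<gamma> (x ^ k) = \<gamma> x ^ k" for x k by (induction k) (auto simp: assms)
  show ?thesis
  proof (cases "n \<ge> 0")
    case True then show ?thesis by (simp add: fr_nonneg pow)
  next
    case False
    then have "fr (- n) (\<gamma> y) = \<gamma> (fr (- n) y)" for y by (simp add: fr_nonneg pow)
    then have "fr (- n) (\<gamma> (fr n x)) = fr (- n) (fr n (\<gamma> x))" by simp
    then show ?thesis by (simp only: fr_inject)
  qed
qed

lemma coeffwise_smult: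
  fixes \<gamma> :: "'c \<Rightarrow> 'c"
  assumes "\<And>x y. \<gamma> (x * y) = \<gamma> x * \<gamma> y" "\<gamma> 1 = 1" "\<And>x y. \<gamma> (x + y) = \<gamma> x + \<gamma> y"
  shows "coeffwise \<gamma> (f \<star> g) = coeffwise \<gamma> f \<star> coeffwise \<gamma> g"
proof (rule fls_eqI)
  fix n
  have 0: "\<gamma> 0 = 0" using assms(3)[of 0 0] by (simp only: add_cancel_right_left add_0_left)
  have sum: "\<gamma> (sum h A) = (\<Sum>i\<in>A. \<gamma> (h i))" for h :: "int \<Rightarrow> 'c" and A
    by (induction A rule: infinite_finite_induct) (auto simp: 0 assms(3))
  obtain a b where v: "vanish a f" "vanish b g" using vanish_ex by metis
  have v': "vanish a (coeffwise \<gamma> f)" "vanish b (coeffwise \<gamma> g)"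
    using v by (auto simp: vanish_def coeffwise_nth 0)
  show "coeffwise \<gamma> (f \<star> g) $$ n = (coeffwise \<gamma> f \<star> coeffwise \<gamma> g) $$ n"
    by (simp add: coeffwise_nth 0 smult_nth[OF v] smult_nth[OF v'] sum assms ring_iso_fr[OF assms(1,2)])
qed

end

section \<open>Local fields\<close>

context drinfeld_setting
begin

abbreviation vball :: "int \<Rightarrow> 'f set" where "vball \<equiv> val_ideal val"

lemma val_mult: "x \<noteq> 0 \<Longrightarrow> y \<noteq> 0 \<Longrightarrow> val (x * y) = val x + val y"
  using F by (simp add: local_field_def)

lemma val_add: "x \<noteq> 0 \<Longrightarrow> y \<noteq> 0 \<Longrightarrow> x + y \<noteq> 0 \<Longrightarrow> min (val x) (val y) \<le> val (x + y)"
  using F by (simp add: local_field_def)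

lemma val_1 [simp]: "val 1 = 0"
  using val_mult[of 1 1] by simp

lemma val_minus_1: "val (- 1) = 0"
  using val_mult[of "- 1" "- 1"] by simp

lemma val_uminus [simp]: "val (- x) = val x"
  using val_mult[of "- 1" x] val_minus_1 by (cases "x = 0") auto

lemma val_power: "x \<noteq> 0 \<Longrightarrow> val (x ^ n) = int n * val x"
  by (induction n) (auto simp: val_mult algebra_simps)

lemma val_inverse: "x \<noteq> 0 \<Longrightarrow> val (inverse x) = - val x"
  using val_mult[of x "inverse x"] by simp

lemma vball_iff: "x \<in> vball n \<longleftrightarrow> x = 0 \<or> n \<le> val x"
  by (simp add: val_ideal_def)

lemma vball_0 [simp]: "0 \<in> vball n"
  by (simp add: vball_iff)

lemma vball_1 [simp]: "1 \<in> vball 0"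
  by (simp add: vball_iff)

lemma vball_add: "x \<in> vball n \<Longrightarrow> y \<in> vball n \<Longrightarrow> x + y \<in> vball n"
proof (cases "x = 0 \<or> y = 0 \<or> x + y = 0")
  case False
  assume "x \<in> vball n" "y \<in> vball n"
  then have "n \<le> val x" "n \<le> val y" using False by (auto simp: vball_iff)
  then show ?thesis using val_add[of x y] False by (simp add: vball_iff)
qed (auto simp: vball_iff)

lemma vball_uminus [simp]: "- x \<in> vball n \<longleftrightarrow> x \<in> vball n"
  by (simp add: vball_iff)

lemma vball_minus_commute: "x - y \<in> vball n \<longleftrightarrow> y - x \<in> vball n"
  using vball_uminus[of "x - y" n] by simp

lemma vball_diff_trans: "x - y \<in> vball n \<Longrightarrow> y - w \<in> vball n \<Longrightarrow> x - w \<in> vball n"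
  using vball_add[of "x - y" n "y - w"] by simp

lemma vball_mult: "x \<in> vball m \<Longrightarrow> y \<in> vball n \<Longrightarrow> x * y \<in> vball (m + n)"
  using val_mult[of x y] by (auto simp: vball_iff)

lemma vball_mono: "x \<in> vball n \<Longrightarrow> m \<le> n \<Longrightarrow> x \<in> vball m"
  by (auto simp: vball_iff)

lemma vball_power: "x \<in> vball n \<Longrightarrow> k > 0 \<Longrightarrow> x ^ k \<in> vball (int k * n)"
  using val_power[of x k] by (auto simp: vball_iff zero_power mult_left_mono)

lemma vball_power_0: "x \<in> vball 0 \<Longrightarrow> x ^ k \<in> vball 0"
  using vball_power[of x 0 k] by (cases "k = 0") auto

lemma vball_all: "(\<And>k::nat. x \<in> vball (n + int k)) \<Longrightarrow> x = 0"
proof (rule ccontr)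
  assume *: "\<And>k::nat. x \<in> vball (n + int k)" "x \<noteq> 0"
  then show False using *(1)[of "nat (val x - n + 1)"] by (auto simp: vball_iff split: if_splits)
qed

lemma vball_ex: "\<exists>n. x \<in> vball n"
  by (auto simp: vball_iff)

lemma val_z_powi: "z powi n \<noteq> 0 \<and> val (z powi n) = n"
  using uniformizer val_power[of z "nat n"] val_power[of "inverse z" "nat (- n)"] val_inverse[of z]
  by (auto simp: power_int_def)

lemma vball_z_powi: "z powi n \<in> vball n"
  using val_z_powi[of n] by (simp add: vball_iff)

lemma vball_factor:
  assumes "x \<in> vball (m + n)"
  obtains y where "y \<in> vball n" "x = z powi m * y"
proof (rule that[of "z powi (- m) * x"])
  show "z powi (- m) * x \<in> vball n" using vball_mult[OF vball_z_powi[of "- m"] assms] by simp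
  show "x = z powi m * (z powi (- m) * x)" using uniformizer by (simp add: power_int_minus val_z_powi field_simps)
qed

lemma complete_limit:
  assumes "\<And>i. a (Suc i) - a i \<in> vball (n0 + int i)"
  obtains x where "\<And>i. x - a i \<in> vball (n0 + int i)"
proof -
  have step: "a (i + j) - a i \<in> vball (n0 + int i)" for i j
  proof (induction j)
    case (Suc j)
    show ?case
      using vball_diff_trans[of "a (i + Suc j)" "a (i + j)" _ "a i"] Suc vball_mono[OF assms[of "i + j"]] by simp
  qed simp
  have "\<exists>N. \<forall>i\<ge>N. \<forall>j\<ge>N. a i - a j \<in> vball n" for n
  proof (intro exI allI impI)
    fix i j assume "nat (n - n0) \<le> i" "nat (n - n0) \<le> j"
    then have "a i - a (nat (n - n0)) \<in> vball n" "a j - a (nat (n - n0)) \<in> vball n"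
      using step[of "nat (n - n0)" "i - nat (n - n0)"] step[of "nat (n - n0)" "j - nat (n - n0)"]
      by (auto intro: vball_mono)
    then show "a i - a j \<in> vball n" using vball_diff_trans vball_minus_commute by blast
  qed
  moreover have "\<forall>a::nat \<Rightarrow> 'f. (\<forall>n. \<exists>N. \<forall>i\<ge>N. \<forall>j\<ge>N. a i - a j \<in> vball n) \<longrightarrow>
      (\<exists>x. \<forall>n. \<exists>N. \<forall>i\<ge>N. a i - x \<in> vball n)"
    using F by (simp add: local_field_def)
  ultimately obtain x where x: "\<And>n. \<exists>N. \<forall>i\<ge>N. a i - x \<in> vball n" by blast
  have "x - a i \<in> vball (n0 + int i)" for i
  proof -
    obtain N where N: "\<And>j. j \<ge> N \<Longrightarrow> a j - x \<in> vball (n0 + int i)" using x by blast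
    have "a (i + N) - x \<in> vball (n0 + int i)" using N by simp
    then show ?thesis using step[of i N] vball_diff_trans vball_minus_commute by blast
  qed
  then show ?thesis by (rule that)
qed

section \<open>Residue classes and Teichmueller representatives\<close>

definition residue_class :: "'f \<Rightarrow> 'f set" where
  "residue_class x = {y. y - x \<in> vball 1}"

lemma residue_class_eq: "residue_class x = residue_class y \<longleftrightarrow> x - y \<in> vball 1"
proof
  assume "residue_class x = residue_class y"
  moreover have "x \<in> residue_class x" by (simp add: residue_class_def)
  ultimately show "x - y \<in> vball 1" by (simp add: residue_class_def)
next
  assume "x - y \<in> vball 1"
  then show "residue_class x = residue_class y"
    using vball_diff_trans vball_minus_commute unfolding residue_class_def by blast
qed

lemma finite_residue_classes: "finite (residue_class ` vball 0)"
proof -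
  have "residue_class x = val_ideal val 1 +>\<^bsub>val_ring val\<^esub> x" for x
    by (auto simp: residue_class_def a_r_coset_def' val_ring_def ring_of_type_algebra_def intro: bexI[of _ "_ - x"])
  then have "residue_class ` vball 0 = carrier (residue_field val)"
    by (auto simp: residue_field_def FactRing_def A_RCOSETS_def' val_ring_def)
  then show ?thesis using F by (simp add: local_field_def)
qed

text \<open>The q-th power map on the finite set of residue classes is injective, so an iterate of
  it is the identity.\<close>

lemma residue_power_q_trivial:
  obtains m where "m > 0" "\<And>x. x \<in> vball 0 \<Longrightarrow> x ^ (CARD('q) ^ m) - x \<in> vball 1"
proof -
  let ?C = "residue_class ` vball 0"
  define f where "f C = residue_class ((SOME y. y \<in> C) ^ CARD('q))" for C
  \<comment> \<open>The forward direction makes the power map on classes well defined, the backward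
    direction makes it injective.\<close>
  have pw: "x - y \<in> vball 1 \<longleftrightarrow> x ^ CARD('q) - y ^ CARD('q) \<in> vball 1" for x y
  proof (cases "x = y")
    case False
    have e: "x ^ CARD('q) - y ^ CARD('q) = (x - y) ^ CARD('q)" using diff_power_q_f[of x y 1] by simp
    have "1 \<le> val (x - y) \<longleftrightarrow> 1 \<le> int CARD('q) * val (x - y)"
      by (simp add: int_one_le_iff_zero_less zero_less_mult_iff)
    then show ?thesis unfolding e using False val_power[of "x - y" "CARD('q)"] by (simp add: vball_iff)
  qed simp
  have f: "f (residue_class x) = residue_class (x ^ CARD('q))" for x
  proof -
    have "x \<in> residue_class x" by (simp add: residue_class_def)
    then have "(SOME y. y \<in> residue_class x) \<in> residue_class x" by (rule someI)
    then show ?thesis unfolding f_def residue_class_eq using pw by (simp add: residue_class_def)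
  qed
  have "inj_on f ?C" by (rule inj_onI, elim imageE, simp only: f residue_class_eq pw[symmetric])
  moreover have "f ` ?C \<subseteq> ?C" by (auto simp: f vball_power_0)
  ultimately obtain m where m: "m > 0" "\<And>C. C \<in> ?C \<Longrightarrow> (f ^^ m) C = C"
    using finite_injective_periodic[OF finite_residue_classes] by metis
  have "(f ^^ n) (residue_class x) = residue_class (x ^ (CARD('q) ^ n))" for n x
    by (induction n) (simp_all add: f mult.commute flip: power_mult)
  then have "residue_class (x ^ (CARD('q) ^ m)) = residue_class x" if "x \<in> vball 0" for x
    using m(2)[of "residue_class x"] that by simp
  then show ?thesis using that[OF m(1)] residue_class_eq by blast
qed

lemma card_range_embK: "card (range embK) = CARD('q)"
  by (rule card_image[OF embK_inj])

text \<open>Some m for which x^(q^m) and x agree modulo the maximal ideal; it may be a proper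
  multiple of the residue degree.\<close>

definition teich_exp :: nat where
  "teich_exp = (SOME m. m > 0 \<and> (\<forall>x\<in>vball 0. x ^ (card (range embK) ^ m) - x \<in> vball 1))"

lemma teich_exp: "teich_exp > 0" "x \<in> vball 0 \<Longrightarrow> x ^ (CARD('q) ^ teich_exp) - x \<in> vball 1"
proof -
  have "\<exists>m. m > 0 \<and> (\<forall>x\<in>vball 0. x ^ (CARD('q) ^ m) - x \<in> vball 1)"
    using residue_power_q_trivial by metis
  then have "teich_exp > 0 \<and> (\<forall>x\<in>vball 0. x ^ (CARD('q) ^ teich_exp) - x \<in> vball 1)"
    unfolding teich_exp_def card_range_embK by (rule someI_ex)
  then show "teich_exp > 0" "x \<in> vball 0 \<Longrightarrow> x ^ (CARD('q) ^ teich_exp) - x \<in> vball 1" by auto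
qed

text \<open>The Teichmueller representatives. In equal characteristic they form a finite subfield of
  \<open>F\<close> that lifts the residue field.\<close>

definition teich :: "'f set" where
  "teich = {x. x ^ (card (range embK) ^ teich_exp) = x}"

lemma teich_iff: "x \<in> teich \<longleftrightarrow> x ^ (CARD('q) ^ teich_exp) = x"
  by (simp add: teich_def card_range_embK)

lemma teich_N: "CARD('q) ^ teich_exp > 1"
  using one_less_power[OF q_gt_1 teich_exp(1)] .

lemma teich_closed:
  "0 \<in> teich" "1 \<in> teich" "x \<in> teich \<Longrightarrow> y \<in> teich \<Longrightarrow> x + y \<in> teich" "x \<in> teich \<Longrightarrow> - x \<in> teich"
  "x \<in> teich \<Longrightarrow> y \<in> teich \<Longrightarrow> x * y \<in> teich" "x \<in> teich \<Longrightarrow> inverse x \<in> teich"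
  "x \<in> teich \<Longrightarrow> x ^ i \<in> teich" "embF a \<in> teich"
proof -
  show "x \<in> teich \<Longrightarrow> x ^ i \<in> teich"
  proof -
    have "(x ^ i) ^ (CARD('q) ^ teich_exp) = (x ^ (CARD('q) ^ teich_exp)) ^ i"
      by (simp only: mult.commute flip: power_mult)
    then show "x \<in> teich \<Longrightarrow> x ^ i \<in> teich" by (simp add: teich_iff)
  qed
  have 1: "embF a ^ CARD('q) = embF a" for a
  proof -
    have "embF (a ^ n) = embF a ^ n" for n by (induction n) auto
    then show ?thesis by (metis power_CARD_finite_field)
  qed
  have "embF a ^ (CARD('q) ^ n) = embF a" for n a
    by (induction n) (simp_all add: 1 power_mult)
  then show "embF a \<in> teich" by (simp add: teich_iff)
qed (auto simp: teich_iff frob_add_q_f minus_power_q_f power_mult_distrib power_inverse zero_power)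

lemma finite_teich: "finite teich"
proof -
  let ?N = "CARD('q) ^ teich_exp"
  let ?P = "Polynomial.monom 1 ?N - Polynomial.monom 1 1 :: 'f poly"
  have "Polynomial.coeff ?P ?N = 1" using teich_N by simp
  then have "?P \<noteq> 0" by (metis coeff_0 zero_neq_one)
  then have "finite {x. poly ?P x = 0}" by (rule poly_roots_finite)
  moreover have "teich = {x. poly ?P x = 0}" by (auto simp: teich_iff poly_monom)
  ultimately show ?thesis by simp
qed

lemma teich_vball: "x \<in> teich \<Longrightarrow> x \<in> vball 0"
proof (cases "x = 0")
  case False
  assume "x \<in> teich"
  then have "int (CARD('q) ^ teich_exp) * val x = 1 * val x"
    using val_power[OF False, of "CARD('q) ^ teich_exp"] by (simp add: teich_iff)
  then have "val x = 0" using teich_N by (metis less_irrefl mult_cancel_right of_nat_1 of_nat_eq_iff)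
  then show ?thesis by (simp add: vball_iff)
qed simp

text \<open>The representative is the limit of x^(N^i) with N = q^m. Successive differences are (x^N
  - x)^(N^i), whose valuations are at least N^i.\<close>

lemma teich_lift:
  assumes "x \<in> vball 0"
  obtains t where "t \<in> teich" "x - t \<in> vball 1"
proof -
  define N where "N = CARD('q) ^ teich_exp"
  have N: "N > 1" using teich_N by (simp add: N_def)
  define a where "a i = x ^ (N ^ i)" for i
  have Npow: "N ^ i = CARD('q) ^ (teich_exp * i)" for i by (simp add: N_def power_mult)
  have diff: "(u - v) ^ (N ^ i) = u ^ (N ^ i) - v ^ (N ^ i)" for u v :: 'f and i
    unfolding Npow by (rule diff_power_q_f)
  have "a (Suc i) - a i = (x ^ N - x) ^ (N ^ i)" for i
    unfolding diff by (simp add: a_def power_mult)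
  moreover have "x ^ N - x \<in> vball 1" using teich_exp(2)[OF assms] by (simp add: N_def)
  then have pw: "(x ^ N - x) ^ (N ^ i) \<in> vball (int (N ^ i))" for i
    using vball_power[of "x ^ N - x" 1 "N ^ i"] N by simp
  have gt: "N ^ i \<ge> i + 1" for i
    using power_gt_expt[of N i] N by simp
  ultimately have "a (Suc i) - a i \<in> vball (1 + int i)" for i
  proof -
    have "1 + int i \<le> int (N ^ i)" using gt[of i] by linarith
    then show ?thesis using vball_mono[OF pw[of i]] \<open>\<And>i. a (Suc i) - a i = (x ^ N - x) ^ (N ^ i)\<close> by simp
  qed
  then obtain t where t: "\<And>i. t - a i \<in> vball (1 + int i)" by (rule complete_limit) blast
  have "t ^ N - t \<in> vball (1 + int i)" for i
  proof -
    have "t ^ N - a (Suc i) = (t - a i) ^ N" using diff[of t "a i" 1] by (simp add: a_def mult.commute flip: power_mult)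
    moreover have "(t - a i) ^ N \<in> vball (int N * (1 + int i))" using vball_power[OF t[of i]] N by simp
    moreover have "1 + int i \<le> int N * (1 + int i)" using N by simp
    ultimately have "t ^ N - a (Suc i) \<in> vball (1 + int i)" using vball_mono by metis
    moreover have "t - a (Suc i) \<in> vball (1 + int i)" using vball_mono[OF t[of "Suc i"]] by simp
    ultimately show ?thesis using vball_diff_trans vball_minus_commute by blast
  qed
  then have "t ^ N - t = 0" by (rule vball_all)
  then have "t \<in> teich" by (simp add: teich_iff N_def)
  moreover have "x - t \<in> vball 1" using t[of 0] vball_minus_commute by (simp add: a_def)
  ultimately show ?thesis by (rule that)
qed

text \<open>Expansion in powers of \<open>z\<close> with Teichmueller digits. It reduces an identity
  that is additive and continuous in \<open>x\<close> to representatives and powers of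
  \<open>z\<close>.\<close>

lemma teich_dense:
  assumes G: "\<And>t n. t \<in> teich \<Longrightarrow> t * z powi n \<in> G" "\<And>x y. x \<in> G \<Longrightarrow> y \<in> G \<Longrightarrow> x + y \<in> G"
  obtains g where "g \<in> G" "x - g \<in> vball n"
proof -
  obtain n0 where n0: "x \<in> vball n0" using vball_ex by blast
  have "\<exists>g\<in>G. x - g \<in> vball (n0 + int j)" for j
  proof (induction j)
    case 0
    show ?case using n0 G(1)[OF teich_closed(1)] by (intro bexI[of _ 0]) auto
  next
    case (Suc j)
    then obtain g where g: "g \<in> G" "x - g \<in> vball (n0 + int j)" by blast
    obtain w where w: "w \<in> vball 0" "x - g = z powi (n0 + int j) * w"
      using vball_factor[of "x - g" "n0 + int j" 0] g by auto
    obtain t where t: "t \<in> teich" "w - t \<in> vball 1" using teich_lift[OF w(1)] .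
    have "x - (g + t * z powi (n0 + int j)) = z powi (n0 + int j) * (w - t)"
      using w(2) by (simp add: algebra_simps)
    also have "\<dots> \<in> vball (n0 + int j + 1)" by (intro vball_mult vball_z_powi t)
    finally show ?case using G g t by (intro bexI[of _ "g + t * z powi (n0 + int j)"]) (auto simp: algebra_simps)
  qed
  from this[of "nat (n - n0)"] obtain g where "g \<in> G" "x - g \<in> vball (n0 + int (nat (n - n0)))" by blast
  then show ?thesis using that vball_mono by (metis add.commute diff_le_eq int_nat_eq int_ops(1) nat_int order_refl linorder_le_cases nat_le_iff diff_add_cancel le_add_diff_inverse add_increasing2 zero_le_imp_eq_int)
qed

text \<open>The sum over all representatives is unchanged by translating them by 1, so their number
  is 0 in \<open>F\<close>, and both fields have the same characteristic. The number occurs as the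
  factor of an average that must not vanish.\<close>

lemma card_teich: "of_nat (card (teich - {0})) = (- 1 :: 'c)"
proof -
  have "bij_betw (\<lambda>x. x + 1) teich teich"
    by (rule bij_betwI[where g = "\<lambda>x. x + - 1"]) (auto intro!: teich_closed(2-4) simp del: add_uminus_conv_diff)
  then have "(\<Sum>x\<in>teich. x) = (\<Sum>x\<in>teich. x + 1)"
    using sum.reindex_bij_betw[of "\<lambda>x. x + 1" teich teich "\<lambda>x. x"] by simp
  then have "of_nat (card teich) = (0 :: 'f)" by (simp add: sum.distrib)
  then have "CHAR('c) dvd card teich" using CHAR_f CHAR_c by (simp add: of_nat_eq_0_iff_char_dvd)
  then have "of_nat (card teich) = (0 :: 'c)" by (simp add: of_nat_eq_0_iff_char_dvd)
  moreover have "card teich = Suc (card (teich - {0}))"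
    using card_Suc_Diff1[OF finite_teich teich_closed(1)] by simp
  ultimately show ?thesis by (simp add: eq_neg_iff_add_eq_0 add.commute)
qed

lemma teich_generator:
  obtains g where "g \<in> teich" "\<And>x. x \<in> teich \<Longrightarrow> x \<noteq> 0 \<Longrightarrow> \<exists>i. x = g ^ i"
proof -
  interpret L: field "ring_of_type_algebra :: 'f ring" by (rule field_from_type_algebra)
  have sr: "subring teich (ring_of_type_algebra :: 'f ring)"
    by (rule L.subringI) (auto intro: teich_closed)
  have "subfield teich (ring_of_type_algebra :: 'f ring)"
  proof (rule L.subfieldI'[OF sr])
    fix x assume "x \<in> teich - {\<zero>\<^bsub>(ring_of_type_algebra :: 'f ring)\<^esub>}"
    then have "x \<in> teich" "x \<noteq> 0" by auto
    moreover have "inv\<^bsub>(ring_of_type_algebra :: 'f ring)\<^esub> x = inverse x"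
      by (rule L.comm_inv_char) (use \<open>x \<noteq> 0\<close> in auto)
    ultimately show "inv\<^bsub>(ring_of_type_algebra :: 'f ring)\<^esub> x \<in> teich" using teich_closed(6) by simp
  qed
  then have f: "field ((ring_of_type_algebra :: 'f ring)\<lparr>carrier := teich\<rparr>)" by (rule L.subfield_iff(2))
  have pow: "x [^]\<^bsub>(ring_of_type_algebra :: 'f ring)\<lparr>carrier := teich\<rparr>\<^esub> (i::nat) = x ^ i" for x i
    by (induction i) (auto simp: nat_pow_def mult.commute)
  have fin: "finite (carrier ((ring_of_type_algebra :: 'f ring)\<lparr>carrier := teich\<rparr>))"
    using finite_teich by simp
  obtain a where a: "a \<in> carrier (Multiplicative_Group.mult_of ((ring_of_type_algebra :: 'f ring)\<lparr>carrier := teich\<rparr>))"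
     "carrier (Multiplicative_Group.mult_of ((ring_of_type_algebra :: 'f ring)\<lparr>carrier := teich\<rparr>)) =
       {a [^]\<^bsub>(ring_of_type_algebra :: 'f ring)\<lparr>carrier := teich\<rparr>\<^esub> i | i::nat. i \<in> UNIV}"
    using field.finite_field_mult_group_has_gen[OF f] fin by blast
  have "carrier (Multiplicative_Group.mult_of ((ring_of_type_algebra :: 'f ring)\<lparr>carrier := teich\<rparr>)) = teich - {0}"
    by (simp add: Multiplicative_Group.carrier_mult_of)
  then show ?thesis using that[of a] a unfolding pow by auto
qed


lemma range_embK_iff: "x \<in> range embK \<longleftrightarrow> x ^ CARD('q) = x"
proof -
  let ?P = "Polynomial.monom 1 CARD('q) + [:0, - 1:] :: 'c poly"
  have deg: "Polynomial.degree ?P = CARD('q)"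
    using q_gt_1 by (subst degree_add_eq_left) (auto simp: degree_monom_eq)
  have nz: "?P \<noteq> 0" using deg q_gt_1 by (metis degree_0 not_less_zero)
  have eq: "{x. poly ?P x = 0} = {x. x ^ CARD('q) = x}" by (auto simp: poly_monom)
  have fin: "finite {x::'c. x ^ CARD('q) = x}" using poly_roots_finite[OF nz] eq by simp
  have "card {x::'c. x ^ CARD('q) = x} \<le> card (range embK)"
    using card_poly_roots_bound[OF nz] eq deg card_range_embK by simp
  moreover have "range embK \<subseteq> {x. x ^ CARD('q) = x}" using power_q_Fq by auto
  ultimately have "range embK = {x. x ^ CARD('q) = x}" using card_seteq[OF fin] by blast
  then show ?thesis by auto
qed

text \<open>Used to see that a product of conjugate linear factors has coefficients in the finite
  field.\<close>

lemma map_poly_frob_mult: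
  fixes P Q :: "'c poly"
  shows "map_poly (\<lambda>x. x ^ CARD('q)) (P * Q) = map_poly (\<lambda>x. x ^ CARD('q)) P * map_poly (\<lambda>x. x ^ CARD('q)) Q"
proof (rule poly_eqI)
  have 0: "(0::'c) ^ CARD('q) = 0" by (simp add: zero_power)
  have sum: "(sum h A) ^ CARD('q) = (\<Sum>i\<in>A. h i ^ CARD('q))" for h :: "nat \<Rightarrow> 'c" and A
    by (induction A rule: infinite_finite_induct) (use frob_add_q[of _ _ 1] 0 in auto)
  fix n
  show "Polynomial.coeff (map_poly (\<lambda>x. x ^ CARD('q)) (P * Q)) n =
    Polynomial.coeff (map_poly (\<lambda>x. x ^ CARD('q)) P * map_poly (\<lambda>x. x ^ CARD('q)) Q) n"
    by (simp add: coeff_map_poly[where f = "\<lambda>x. x ^ CARD('q)", OF 0] coeff_mult sum power_mult_distrib)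
qed

text \<open>The conjugates of the second embedding are the roots of a polynomial over the finite field,
  which also annihilates the image of a generator under the first embedding.\<close>

lemma teich_embeddings_conjugate:
  fixes \<chi>\<^sub>1 \<chi>\<^sub>2 :: "'f \<Rightarrow> 'c"
  assumes add: "\<And>x y. x \<in> teich \<Longrightarrow> y \<in> teich \<Longrightarrow> \<chi>\<^sub>1 (x + y) = \<chi>\<^sub>1 x + \<chi>\<^sub>1 y"
      "\<And>x y. x \<in> teich \<Longrightarrow> y \<in> teich \<Longrightarrow> \<chi>\<^sub>2 (x + y) = \<chi>\<^sub>2 x + \<chi>\<^sub>2 y"
    and mult: "\<And>x y. x \<in> teich \<Longrightarrow> y \<in> teich \<Longrightarrow> \<chi>\<^sub>1 (x * y) = \<chi>\<^sub>1 x * \<chi>\<^sub>1 y"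
      "\<And>x y. x \<in> teich \<Longrightarrow> y \<in> teich \<Longrightarrow> \<chi>\<^sub>2 (x * y) = \<chi>\<^sub>2 x * \<chi>\<^sub>2 y"
    and emb: "\<And>a. \<chi>\<^sub>1 (embF a) = embK a" "\<And>a. \<chi>\<^sub>2 (embF a) = embK a"
  obtains i :: nat where "\<And>x. x \<in> teich \<Longrightarrow> \<chi>\<^sub>1 x = \<chi>\<^sub>2 x ^ (CARD('q) ^ i)"
proof -
  have chi0: "\<chi>\<^sub>1 0 = 0" "\<chi>\<^sub>2 0 = 0" "\<chi>\<^sub>1 1 = 1" "\<chi>\<^sub>2 1 = 1"
    using emb[of 0] emb[of 1] by simp_all
  have pow1: "\<chi>\<^sub>1 (x ^ n) = \<chi>\<^sub>1 x ^ n" if "x \<in> teich" for x n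
    by (induction n) (use that teich_closed(7) in \<open>auto simp: chi0 mult\<close>)
  have pow2: "\<chi>\<^sub>2 (x ^ n) = \<chi>\<^sub>2 x ^ n" if "x \<in> teich" for x n
    by (induction n) (use that teich_closed(7) in \<open>auto simp: chi0 mult\<close>)
  obtain g where g: "g \<in> teich" "\<And>x. x \<in> teich \<Longrightarrow> x \<noteq> 0 \<Longrightarrow> \<exists>i. x = g ^ i"
    by (rule teich_generator) blast
  define s where "s = \<chi>\<^sub>2 g"
  let ?m = "teich_exp"
  have s: "s ^ (CARD('q) ^ ?m) = s" using pow2[OF g(1)] g(1) by (metis s_def teich_iff)
  let ?f = "\<lambda>x::'c. x ^ CARD('q)"
  have f0: "?f 0 = 0" by (simp add: zero_power)
  define lin where "lin i = [:- (s ^ (CARD('q) ^ i)), 1:]" for i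
  define P where "P = (\<Prod>i<?m. lin i)"
  have lin: "map_poly ?f (lin i) = lin (Suc i)" for i
  proof (rule poly_eqI)
    fix n
    have "(- (s ^ (CARD('q) ^ i))) ^ CARD('q) = - (s ^ (CARD('q) ^ Suc i))"
      using minus_power_q[of "s ^ (CARD('q) ^ i)" 1] by (simp add: mult.commute flip: power_mult)
    then show "Polynomial.coeff (map_poly ?f (lin i)) n = Polynomial.coeff (lin (Suc i)) n"
      by (auto simp: lin_def coeff_map_poly[where f = ?f, OF f0] coeff_pCons f0 split: nat.splits)
  qed
  have "map_poly ?f (\<Prod>i\<in>A. lin i) = (\<Prod>i\<in>A. lin (Suc i))" for A
  proof (induction A rule: infinite_finite_induct)
    case (insert x A)
    then have "prod lin (insert x A) = lin x * prod lin A"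
      "(\<Prod>i\<in>insert x A. lin (Suc i)) = lin (Suc x) * (\<Prod>i\<in>A. lin (Suc i))" by simp_all
    then show ?case using insert.IH map_poly_frob_mult[of "lin x" "prod lin A"] lin[of x] by simp
  next
    case empty
    show ?case by (rule poly_eqI) (auto simp: coeff_map_poly[where f = ?f, OF f0] f0)
  next
    case (infinite A)
    then show ?case by (intro poly_eqI) (auto simp: coeff_map_poly[where f = ?f, OF f0] f0)
  qed
  then have mP: "map_poly ?f P = (\<Prod>i<?m. lin (Suc i))" by (simp add: P_def)
  \<comment> \<open>Frobenius on coefficients shifts the linear factors cyclically because s^(q^m) =
    s. Comparing after multiplication by \<open>lin 0\<close> avoids reindexing a cyclic
    product.\<close>
  have "lin 0 * (\<Prod>i<?m. lin (Suc i)) = (\<Prod>i<Suc ?m. lin i)"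
    by (rule prod.lessThan_Suc_shift[symmetric])
  also have "\<dots> = lin 0 * P" using s by (simp add: P_def lin_def mult.commute)
  finally have "lin 0 * map_poly ?f P = lin 0 * P" using mP by simp
  moreover have "lin 0 \<noteq> 0" by (simp add: lin_def)
  ultimately have "map_poly ?f P = P" using mult_left_cancel by blast
  then have "Polynomial.coeff P i ^ CARD('q) = Polynomial.coeff P i" for i
    using coeff_map_poly[where f = ?f and p = P and n = i, OF f0] by simp
  then have "Polynomial.coeff P i \<in> range embK" for i by (simp add: range_embK_iff)
  then have "\<forall>i. \<exists>a. Polynomial.coeff P i = embK a" by blast
  then obtain c where c: "\<And>i. Polynomial.coeff P i = embK (c i)" using choice[of "\<lambda>i a. Polynomial.coeff P i = embK a"] by blast
  \<comment> \<open>\<open>y\<close> is \<open>P\<close> evaluated at \<open>g\<close> inside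
    \<open>F\<close>. Since the second embedding sends it to P(s) = 0 and a nonzero representative
    is invertible, \<open>y\<close> is 0; the first embedding then gives the root.\<close>
  define y where "y = (\<Sum>i\<le>Polynomial.degree P. embF (c i) * g ^ i)"
  have sum_teich: "sum h A \<in> teich" if "\<And>i. i \<in> A \<Longrightarrow> h i \<in> teich" for h :: "nat \<Rightarrow> 'f" and A
    using that by (induction A rule: infinite_finite_induct) (auto intro: teich_closed)
  have t: "embF (c i) * g ^ i \<in> teich" for i by (intro teich_closed g)
  have sum1: "\<chi>\<^sub>1 (sum h A) = (\<Sum>i\<in>A. \<chi>\<^sub>1 (h i))" if "\<And>i. h i \<in> teich" for h :: "nat \<Rightarrow> 'f" and A
    using that by (induction A rule: infinite_finite_induct) (auto simp: chi0 add sum_teich)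
  have sum2: "\<chi>\<^sub>2 (sum h A) = (\<Sum>i\<in>A. \<chi>\<^sub>2 (h i))" if "\<And>i. h i \<in> teich" for h :: "nat \<Rightarrow> 'f" and A
    using that by (induction A rule: infinite_finite_induct) (auto simp: chi0 add sum_teich)
  have "\<chi>\<^sub>2 y = poly P s"
    unfolding y_def by (simp add: sum2[OF t] mult teich_closed g emb pow2 poly_altdef c s_def)
  also have "poly P s = 0"
    using teich_exp(1) by (auto simp: P_def poly_prod lin_def intro!: bexI[of _ 0])
  finally have "\<chi>\<^sub>2 y = 0" .
  moreover have y: "y \<in> teich" unfolding y_def using t by (intro sum_teich)
  ultimately have "y = 0" using mult(2)[OF y teich_closed(6)[OF y]] chi0 by (cases "y = 0") auto
  moreover have "\<chi>\<^sub>1 y = poly P (\<chi>\<^sub>1 g)"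
    unfolding y_def by (simp add: sum1[OF t] mult teich_closed g emb pow1 poly_altdef c)
  ultimately have "poly P (\<chi>\<^sub>1 g) = 0" using chi0 by simp
  then obtain i where i: "\<chi>\<^sub>1 g = s ^ (CARD('q) ^ i)"
    by (auto simp: P_def poly_prod lin_def)
  show ?thesis
  proof (rule that[of i])
    fix x assume x: "x \<in> teich"
    show "\<chi>\<^sub>1 x = \<chi>\<^sub>2 x ^ (CARD('q) ^ i)"
    proof (cases "x = 0")
      case True then show ?thesis by (simp add: chi0 zero_power)
    next
      case False
      then obtain j where "x = g ^ j" using g x by blast
      then show ?thesis
        by (simp add: pow1 pow2 g i s_def[symmetric] mult.commute flip: power_mult)
    qed
  qed
qed

section \<open>Embeddings of the local field into skew Laurent series\<close>

text \<open>The homomorphisms attached to motives, with e = r d. The last clause is continuity in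
  quantitative form; \<open>phomD\<close> sharpens it to the statement that valuations are
  multiplied by \<open>e\<close>.\<close>

definition phom :: "int \<Rightarrow> 'c set \<Rightarrow> ('f \<Rightarrow> 'c fls) \<Rightarrow> bool" where
  "phom e L \<phi> \<longleftrightarrow> e > 0 \<and> (\<forall>x. \<phi> x \<in> laurent_over L) \<and> (\<forall>x y. \<phi> (x + y) = \<phi> x + \<phi> y) \<and>
    (\<forall>x y. \<phi> (x * y) = \<phi> x \<star> \<phi> y) \<and> \<phi> 1 = 1 \<and> (\<forall>a. \<phi> (embF a) = fls_const (embK a)) \<and>
    (\<forall>n. \<forall>x\<in>vball n. vanish (e * n) (\<phi> x))"

lemma phomD:
  assumes "phom e L \<phi>"
  shows "e > 0" "\<phi> x \<in> laurent_over L" "\<phi> (x + y) = \<phi> x + \<phi> y" "\<phi> (x * y) = \<phi> x \<star> \<phi> y"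
    "\<phi> 1 = 1" "\<phi> (embF a) = fls_const (embK a)" "x \<in> vball n \<Longrightarrow> vanish (e * n) (\<phi> x)"
    "\<phi> 0 = 0" "\<phi> (- x) = - \<phi> x" "\<phi> (x - y) = \<phi> x - \<phi> y" "\<phi> x \<star> \<phi> y = \<phi> y \<star> \<phi> x"
    "x \<noteq> 0 \<Longrightarrow> \<phi> x \<star> \<phi> (inverse x) = 1" "x \<noteq> 0 \<Longrightarrow> \<phi> (inverse x) \<star> \<phi> x = 1" "x \<noteq> 0 \<Longrightarrow> \<phi> x \<noteq> 0"
    "x \<noteq> 0 \<Longrightarrow> \<phi> x $$ (e * val x) \<noteq> 0" "x \<noteq> 0 \<Longrightarrow> fls_subdegree (\<phi> x) = e * val x"
proof -
  show "e > 0" "\<phi> x \<in> laurent_over L" "\<phi> (embF a) = fls_const (embK a)"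
    and one: "\<phi> 1 = 1" and add: "\<And>x y. \<phi> (x + y) = \<phi> x + \<phi> y"
    and mult: "\<And>x y. \<phi> (x * y) = \<phi> x \<star> \<phi> y" and van: "\<And>x n. x \<in> vball n \<Longrightarrow> vanish (e * n) (\<phi> x)"
    using assms by (auto simp: phom_def)
  show 0: "\<phi> 0 = 0" using add[of 0 0] by (simp only: add_cancel_right_left add_0_left)
  show neg: "\<And>x. \<phi> (- x) = - \<phi> x" using add[of _ "- _"] 0 by (metis add.right_inverse add_eq_0_iff)
  show "\<phi> (x - y) = \<phi> x - \<phi> y" using add[of x "- y"] neg by simp
  show "\<phi> x \<star> \<phi> y = \<phi> y \<star> \<phi> x" using mult[of x y] mult[of y x] by (simp add: mult.commute)
  show inv: "x \<noteq> 0 \<Longrightarrow> \<phi> x \<star> \<phi> (inverse x) = 1" using mult[of x "inverse x"] one by simp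
  show "x \<noteq> 0 \<Longrightarrow> \<phi> (inverse x) \<star> \<phi> x = 1" using mult[of "inverse x" x] one by simp
  show "x \<noteq> 0 \<Longrightarrow> \<phi> x \<noteq> 0" using inv by auto
  \<comment> \<open>The orders of \<phi>(x) and of its inverse are bounded below by opposite
    numbers, and the product is 1; so the bound is attained.\<close>
  show lead: "\<phi> x $$ (e * val x) \<noteq> 0" if x: "x \<noteq> 0"
  proof
    assume *: "\<phi> x $$ (e * val x) = 0"
    have v: "vanish (e * val x) (\<phi> x)" "vanish (- (e * val x)) (\<phi> (inverse x))"
      using van[of x "val x"] van[of "inverse x" "- val x"] x by (auto simp: vball_iff val_inverse)
    have "(\<phi> x \<star> \<phi> (inverse x)) $$ (e * val x + - (e * val x)) = 0"
      unfolding smult_lead[OF v] using * by simp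
    then show False using inv[OF x] by simp
  qed
  show "fls_subdegree (\<phi> x) = e * val x" if x: "x \<noteq> 0"
    using van[of x "val x"] lead[OF x] x by (intro fls_subdegree_eqI) (auto simp: vball_iff vanish_def)
qed

lemma smult_sum_left: "(\<Sum>i\<in>A. f i) \<star> g = (\<Sum>i\<in>A. f i \<star> g)"
  by (induction A rule: infinite_finite_induct) (auto simp: smult_add_left)

lemma smult_sum_right: "g \<star> (\<Sum>i\<in>A. f i) = (\<Sum>i\<in>A. g \<star> f i)"
  by (induction A rule: infinite_finite_induct) (auto simp: smult_add_right)

lemma fls_sum_nth: "(\<Sum>i\<in>A. f i) $$ n = (\<Sum>i\<in>A. f i $$ n)" for f :: "'z \<Rightarrow> 'c fls"
  by (induction A rule: infinite_finite_induct) auto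

text \<open>The elements satisfying the relation are closed under sums, products and inverses; as
  they contain \<open>z\<close> and the representatives, they are dense, and both sides depend
  continuously on \<open>x\<close>.\<close>

lemma intertwine_everywhere:
  assumes \<phi>: "phom e L\<^sub>1 \<phi>\<^sub>1" "phom e L\<^sub>2 \<phi>\<^sub>2"
    and t: "\<And>t. t \<in> teich \<Longrightarrow> \<phi>\<^sub>1 t \<star> w = w \<star> \<phi>\<^sub>2 t" and zw: "\<phi>\<^sub>1 z \<star> w = w \<star> \<phi>\<^sub>2 z"
  shows "\<phi>\<^sub>1 x \<star> w = w \<star> \<phi>\<^sub>2 x"
proof -
  note \<phi>1 = phomD[OF \<phi>(1)] and \<phi>2 = phomD[OF \<phi>(2)]
  let ?G = "{x. \<phi>\<^sub>1 x \<star> w = w \<star> \<phi>\<^sub>2 x}"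
  have mult: "x * y \<in> ?G" if "x \<in> ?G" "y \<in> ?G" for x y
  proof -
    have "\<phi>\<^sub>1 (x * y) \<star> w = \<phi>\<^sub>1 x \<star> (w \<star> \<phi>\<^sub>2 y)" using that by (simp add: \<phi>1(4) smult_assoc)
    also have "\<dots> = w \<star> \<phi>\<^sub>2 (x * y)" using that by (simp add: \<phi>2(4) flip: smult_assoc)
    finally show ?thesis by simp
  qed
  have inv: "inverse x \<in> ?G" if "x \<in> ?G" "x \<noteq> 0" for x
  proof -
    have "\<phi>\<^sub>1 (inverse x) \<star> w = \<phi>\<^sub>1 (inverse x) \<star> (w \<star> \<phi>\<^sub>2 x) \<star> \<phi>\<^sub>2 (inverse x)"
      using \<phi>2(12)[OF that(2)] by (simp add: smult_assoc)
    also have "\<dots> = (\<phi>\<^sub>1 (inverse x) \<star> \<phi>\<^sub>1 x) \<star> w \<star> \<phi>\<^sub>2 (inverse x)"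
      using that by (simp add: smult_assoc)
    also have "\<dots> = w \<star> \<phi>\<^sub>2 (inverse x)" using \<phi>1(13)[OF that(2)] by simp
    finally show ?thesis by simp
  qed
  have pow: "x ^ n \<in> ?G" if "x \<in> ?G" for x n
    by (induction n) (use mult that \<phi>1(5) \<phi>2(5) in auto)
  have powi: "z powi n \<in> ?G" for n
    using pow[of z "nat n"] pow[of "inverse z" "nat (- n)"] inv[of z] zw uniformizer
    by (auto simp: power_int_def)
  have "\<phi>\<^sub>1 x \<star> w - w \<star> \<phi>\<^sub>2 x = 0"
  proof -
    obtain a where a: "vanish a w" using vanish_ex by blast
    have "vanish (a + int k) (\<phi>\<^sub>1 x \<star> w - w \<star> \<phi>\<^sub>2 x)" for k
    proof -
      obtain g where g: "g \<in> ?G" "x - g \<in> vball (int k)"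
        by (rule teich_dense[of ?G x "int k"])
          (use t powi mult in \<open>auto simp: \<phi>1(3) \<phi>2(3) smult_add_left smult_add_right\<close>)
      have "vanish (e * int k + a) (\<phi>\<^sub>1 (x - g) \<star> w)" "vanish (a + e * int k) (w \<star> \<phi>\<^sub>2 (x - g))"
        using \<phi>1(7)[OF g(2)] \<phi>2(7)[OF g(2)] a by (auto intro: vanish_smult)
      then have "vanish (a + e * int k) (\<phi>\<^sub>1 (x - g) \<star> w - w \<star> \<phi>\<^sub>2 (x - g))"
        by (intro vanish_diff) (auto simp: add.commute)
      moreover have "\<phi>\<^sub>1 (x - g) \<star> w - w \<star> \<phi>\<^sub>2 (x - g) = \<phi>\<^sub>1 x \<star> w - w \<star> \<phi>\<^sub>2 x"
        using g(1) by (simp add: \<phi>1(10) \<phi>2(10) smult_diff_left smult_diff_right)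
      moreover have "a + int k \<le> a + e * int k" using \<phi>1(1) mult_right_mono[of 1 e "int k"] by simp
      ultimately show ?thesis using vanish_mono by metis
    qed
    then show ?thesis by (rule vanish_all_imp_0)
  qed
  then show ?thesis by simp
qed

text \<open>Averaging over the roots of unity makes a solution of Lang's equation for the uniformizer
  commute with the residue field; it does not vanish because the degree of the solution is
  chosen so that the two actions agree on its leading coefficient.\<close>

lemma intertwiner_exists:
  assumes \<phi>: "phom e L\<^sub>1 \<phi>\<^sub>1" "phom e L\<^sub>2 \<phi>\<^sub>2"
  obtains w where "w \<noteq> 0" "\<And>x. \<phi>\<^sub>1 x \<star> w = w \<star> \<phi>\<^sub>2 x"
proof -
  note \<phi>1 = phomD[OF \<phi>(1)] and \<phi>2 = phomD[OF \<phi>(2)]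
  have v1: "vanish 0 (\<phi>\<^sub>1 t)" and v2: "vanish 0 (\<phi>\<^sub>2 t)" if "t \<in> teich" for t
    using \<phi>1(7)[OF teich_vball[OF that]] \<phi>2(7)[OF teich_vball[OF that]] by simp_all
  obtain i :: nat where i: "\<And>x. x \<in> teich \<Longrightarrow> \<phi>\<^sub>1 x $$ 0 = (\<phi>\<^sub>2 x $$ 0) ^ (CARD('q) ^ i)"
  proof (rule teich_embeddings_conjugate[of "\<lambda>x. \<phi>\<^sub>1 x $$ 0" "\<lambda>x. \<phi>\<^sub>2 x $$ 0"])
    show "\<phi>\<^sub>1 (x * y) $$ 0 = \<phi>\<^sub>1 x $$ 0 * \<phi>\<^sub>1 y $$ 0" if "x \<in> teich" "y \<in> teich" for x y
      using smult_lead[OF v1[OF that(1)] v1[OF that(2)]] by (simp add: \<phi>1(4))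
    show "\<phi>\<^sub>2 (x * y) $$ 0 = \<phi>\<^sub>2 x $$ 0 * \<phi>\<^sub>2 y $$ 0" if "x \<in> teich" "y \<in> teich" for x y
      using smult_lead[OF v2[OF that(1)] v2[OF that(2)]] by (simp add: \<phi>2(4))
  qed (auto simp: \<phi>1 \<phi>2)
  have z: "vanish e (\<phi>\<^sub>1 z)" "vanish e (\<phi>\<^sub>2 z)" "\<phi>\<^sub>1 z $$ e \<noteq> 0" "\<phi>\<^sub>2 z $$ e \<noteq> 0"
    using \<phi>1(7)[of z 1] \<phi>2(7)[of z 1] \<phi>1(15)[of z] \<phi>2(15)[of z] uniformizer by (auto simp: vball_iff)
  \<comment> \<open>Moving the second embedding of a representative past a leading term of degree -i
    raises its residue to the power q^i, which is the residue under the first embedding.\<close>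
  obtain u where u: "vanish (- int i) u" "u $$ (- int i) \<noteq> 0" "\<phi>\<^sub>1 z \<star> u = u \<star> \<phi>\<^sub>2 z"
    by (rule lang_conjugate[OF \<phi>1(1) z(1,3,2,4)])
  let ?T = "teich - {0}"
  define w where "w = (\<Sum>t\<in>?T. \<phi>\<^sub>1 t \<star> u \<star> \<phi>\<^sub>2 (inverse t))"
  have "(\<phi>\<^sub>1 t \<star> u \<star> \<phi>\<^sub>2 (inverse t)) $$ (- int i) = u $$ (- int i)" if t: "t \<in> ?T" for t
  proof -
    have t': "t \<in> teich" "inverse t \<in> teich" "t \<noteq> 0" using t teich_closed(6) by auto
    have v: "vanish (0 + - int i) (\<phi>\<^sub>1 t \<star> u)" using vanish_smult[OF v1[OF t'(1)] u(1)] .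
    have one: "\<phi>\<^sub>1 t $$ 0 * \<phi>\<^sub>1 (inverse t) $$ 0 = 1"
      using smult_lead[OF v1[OF t'(1)] v1[OF t'(2)]] \<phi>1(12)[OF t'(3)] by simp
    have "(\<phi>\<^sub>1 t \<star> u \<star> \<phi>\<^sub>2 (inverse t)) $$ (- int i) =
      \<phi>\<^sub>1 t $$ 0 * u $$ (- int i) * fr (int i) (\<phi>\<^sub>2 (inverse t) $$ 0)"
      using smult_lead[OF v v2[OF t'(2)]] smult_lead[OF v1[OF t'(1)] u(1)] by simp
    also have "fr (int i) (\<phi>\<^sub>2 (inverse t) $$ 0) = \<phi>\<^sub>1 (inverse t) $$ 0"
      using i[OF t'(2)] by (simp add: fr_nat)
    finally show ?thesis using one by (simp add: algebra_simps)
  qed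
  \<comment> \<open>All summands share the leading coefficient of \<open>u\<close>, and their number
    is -1 in the coefficient field.\<close>
  then have "w $$ (- int i) = of_nat (card ?T) * u $$ (- int i)"
    by (simp add: w_def fls_sum_nth)
  then have "w \<noteq> 0" using u(2) by (auto simp: card_teich)
  moreover have "\<phi>\<^sub>1 x \<star> w = w \<star> \<phi>\<^sub>2 x" for x
  proof (rule intertwine_everywhere[OF \<phi>])
    have "\<phi>\<^sub>1 z \<star> (\<phi>\<^sub>1 t \<star> u \<star> \<phi>\<^sub>2 (inverse t)) = (\<phi>\<^sub>1 t \<star> u \<star> \<phi>\<^sub>2 (inverse t)) \<star> \<phi>\<^sub>2 z" for t
    proof -
      have "\<phi>\<^sub>1 z \<star> (\<phi>\<^sub>1 t \<star> u \<star> \<phi>\<^sub>2 (inverse t)) = (\<phi>\<^sub>1 t \<star> \<phi>\<^sub>1 z) \<star> u \<star> \<phi>\<^sub>2 (inverse t)"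
        using \<phi>1(11)[of z t] by (simp flip: smult_assoc)
      also have "\<dots> = \<phi>\<^sub>1 t \<star> u \<star> (\<phi>\<^sub>2 z \<star> \<phi>\<^sub>2 (inverse t))" using u(3) by (simp add: smult_assoc)
      also have "\<phi>\<^sub>2 z \<star> \<phi>\<^sub>2 (inverse t) = \<phi>\<^sub>2 (inverse t) \<star> \<phi>\<^sub>2 z" by (rule \<phi>2(11))
      finally show ?thesis by (simp add: smult_assoc)
    qed
    then show "\<phi>\<^sub>1 z \<star> w = w \<star> \<phi>\<^sub>2 z" by (simp add: w_def smult_sum_left smult_sum_right)
  next
    fix s assume s: "s \<in> teich"
    show "\<phi>\<^sub>1 s \<star> w = w \<star> \<phi>\<^sub>2 s"
    proof (cases "s = 0")
      case False
      \<comment> \<open>Multiplication by \<open>s\<close> permutes the nonzero representatives;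
        reindexing the average by it brings the action of \<open>s\<close> to the front.\<close>
      have bij: "bij_betw ((*) s) ?T ?T"
        by (rule bij_betwI[where g = "(*) (inverse s)"]) (use False s in \<open>auto intro: teich_closed\<close>)
      have "w \<star> \<phi>\<^sub>2 s = (\<Sum>t\<in>?T. \<phi>\<^sub>1 t \<star> u \<star> \<phi>\<^sub>2 (inverse t) \<star> \<phi>\<^sub>2 s)"
        by (simp add: w_def smult_sum_left)
      also have "\<dots> = (\<Sum>t\<in>?T. \<phi>\<^sub>1 (s * t) \<star> u \<star> \<phi>\<^sub>2 (inverse (s * t)) \<star> \<phi>\<^sub>2 s)"
        by (rule sum.reindex_bij_betw[OF bij, symmetric])
      also have "\<dots> = (\<Sum>t\<in>?T. \<phi>\<^sub>1 s \<star> (\<phi>\<^sub>1 t \<star> u \<star> \<phi>\<^sub>2 (inverse t)))"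
      proof (rule sum.cong[OF refl])
        fix t
        have "\<phi>\<^sub>2 (inverse (s * t)) \<star> \<phi>\<^sub>2 s = \<phi>\<^sub>2 (inverse t)"
        proof -
          have "inverse (s * t) * s = inverse t" using False by (simp add: field_simps)
          then show ?thesis by (metis \<phi>2(4))
        qed
        then show "\<phi>\<^sub>1 (s * t) \<star> u \<star> \<phi>\<^sub>2 (inverse (s * t)) \<star> \<phi>\<^sub>2 s = \<phi>\<^sub>1 s \<star> (\<phi>\<^sub>1 t \<star> u \<star> \<phi>\<^sub>2 (inverse t))"
          by (simp add: \<phi>1(4) smult_assoc)
      qed
      also have "\<dots> = \<phi>\<^sub>1 s \<star> w" by (simp add: w_def smult_sum_right)
      finally show ?thesis by simp
    qed (simp add: \<phi>1(8) \<phi>2(8))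
  qed
  ultimately show ?thesis by (rule that)
qed

end

section \<open>Topologies defined by valuations\<close>

lemma vanish_dist:
  fixes s t :: "'c::ab_group_add fls"
  shows "0 \<le> n \<Longrightarrow> dist s t < inverse (2 ^ nat n) \<Longrightarrow> vanish n (s - t)"
    and "0 \<le> n \<Longrightarrow> vanish n (s - t) \<Longrightarrow> dist s t \<le> inverse (2 ^ nat n)"
proof -
  assume n: "0 \<le> n"
  show "vanish n (s - t)" if d: "dist s t < inverse (2 ^ nat n)"
  proof (cases "s = t")
    case False
    have "fls_subdegree (s - t) \<ge> 0"
    proof (rule ccontr)
      assume *: "\<not> 0 \<le> fls_subdegree (s - t)"
      then have "dist s t = 2 ^ nat (- fls_subdegree (s - t))" using False by (simp add: dist_fls_def)
      moreover have "(1::real) \<le> 2 ^ nat (- fls_subdegree (s - t))" by (rule one_le_power) simp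
      moreover have "inverse (2 ^ nat n) \<le> (1::real)" by (rule inverse_le_1_iff[THEN iffD2]) simp
      ultimately show False using d by linarith
    qed
    then have "inverse (2 ^ nat (fls_subdegree (s - t))) < (inverse (2 ^ nat n) :: real)"
      using d False by (simp add: dist_fls_def)
    then have "(2::real) ^ nat n < 2 ^ nat (fls_subdegree (s - t))" by (simp add: inverse_less_iff_less)
    then have "nat n < nat (fls_subdegree (s - t))" by simp
    then show ?thesis by (intro vanish_subdegree) linarith
  qed simp
  show "dist s t \<le> inverse (2 ^ nat n)" if v: "vanish n (s - t)"
  proof (cases "s = t")
    case False
    then have "n \<le> fls_subdegree (s - t)" using subdegree_vanish[OF v] by simp
    moreover from this n have "(2::real) ^ nat n \<le> 2 ^ nat (fls_subdegree (s - t))"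
      by (intro power_increasing) auto
    ultimately show ?thesis using False n by (simp add: dist_fls_def le_imp_inverse_le)
  qed simp
qed

text \<open>Replaces the metric by the filtration. The topologies on fields and modules all get a
  description of this kind, after which continuity is an estimate of orders.\<close>

lemma open_fls_iff:
  fixes S :: "'c::ab_group_add fls set"
  shows "open S \<longleftrightarrow> (\<forall>s\<in>S. \<exists>n. \<forall>t. vanish n (t - s) \<longrightarrow> t \<in> S)"
proof
  assume S: "open S"
  show "\<forall>s\<in>S. \<exists>n. \<forall>t. vanish n (t - s) \<longrightarrow> t \<in> S"
  proof
    fix s assume "s \<in> S"
    then obtain d where d: "d > 0" "\<And>t. dist t s < d \<Longrightarrow> t \<in> S" using S by (auto simp: open_dist)
    obtain k :: nat where "inverse 2 ^ k < d" using real_arch_pow_inv[OF d(1), of "inverse 2"] by auto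
    then have "dist t s < d" if "vanish (int k) (t - s)" for t
      using vanish_dist(2)[OF _ that] by (simp add: power_one_over inverse_eq_divide)
    then show "\<exists>n. \<forall>t. vanish n (t - s) \<longrightarrow> t \<in> S" using d(2) by blast
  qed
next
  assume *: "\<forall>s\<in>S. \<exists>n. \<forall>t. vanish n (t - s) \<longrightarrow> t \<in> S"
  show "open S"
    unfolding open_dist
  proof
    fix s assume "s \<in> S"
    then obtain n where n: "\<And>t. vanish n (t - s) \<Longrightarrow> t \<in> S" using * by blast
    have "t \<in> S" if "dist t s < inverse (2 ^ nat (max n 0))" for t
      using vanish_dist(1)[OF _ that] n vanish_mono by (metis max.cobounded1 max.cobounded2)
    then show "\<exists>e>0. \<forall>y. dist y s < e \<longrightarrow> y \<in> S" by (intro exI[of _ "inverse (2 ^ nat (max n 0))"]) auto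
  qed
qed

context drinfeld_setting
begin

text \<open>Every point of a coset of a ball is a centre of it; hence a generating set contains a
  ball around each of its points.\<close>

lemma openin_val_topology:
  "openin (val_topology val) A \<longleftrightarrow> (\<forall>x\<in>A. \<exists>n. \<forall>y. y - x \<in> vball n \<longrightarrow> y \<in> A)"
proof
  assume "openin (val_topology val) A"
  then have "generate_topology_on {(\<lambda>y. x + y) ` vball n | x n. True} A"
    by (simp add: val_topology_def openin_topology_generated_by_iff)
  then show "\<forall>x\<in>A. \<exists>n. \<forall>y. y - x \<in> vball n \<longrightarrow> y \<in> A"
  proof (induction rule: generate_topology_on.induct)
    case (Int a b)
    show ?case
    proof
      fix x assume "x \<in> a \<inter> b"
      then obtain m n where mn: "\<And>y. y - x \<in> vball m \<Longrightarrow> y \<in> a" "\<And>y. y - x \<in> vball n \<Longrightarrow> y \<in> b"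
        using Int by blast
      show "\<exists>n. \<forall>y. y - x \<in> vball n \<longrightarrow> y \<in> a \<inter> b"
        by (intro exI[of _ "max m n"]) (auto intro!: mn elim: vball_mono)
    qed
  next
    case (UN S)
    then show ?case by (meson Union_iff)
  next
    case (Basis s)
    then obtain w n where s: "s = (\<lambda>y. w + y) ` vball n" by auto
    show ?case
    proof
      fix x assume "x \<in> s"
      then have x: "x - w \<in> vball n" using s by auto
      have "y \<in> s" if "y - x \<in> vball n" for y
        using vball_diff_trans[OF that x] s by (auto intro: image_eqI[of _ _ "y - w"])
      then show "\<exists>n. \<forall>y. y - x \<in> vball n \<longrightarrow> y \<in> s" by blast
    qed
  qed auto
next
  assume *: "\<forall>x\<in>A. \<exists>n. \<forall>y. y - x \<in> vball n \<longrightarrow> y \<in> A"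
  show "openin (val_topology val) A"
  proof (subst openin_subopen, intro ballI)
    fix x assume "x \<in> A"
    then obtain n where n: "\<And>y. y - x \<in> vball n \<Longrightarrow> y \<in> A" using * by blast
    have "openin (val_topology val) ((\<lambda>y. x + y) ` vball n)"
      unfolding val_topology_def by (rule topology_generated_by_Basis) auto
    then show "\<exists>T. openin (val_topology val) T \<and> x \<in> T \<and> T \<subseteq> A"
      using n by (intro exI[of _ "(\<lambda>y. x + y) ` vball n"]) (auto intro: image_eqI[of _ _ 0])
  qed
qed

section \<open>Motives in coordinates\<close>

text \<open>Writing v = s v0 identifies \<open>V\<close> with the series over \<open>L\<close>. As
  the action of \<open>F\<close> commutes with the left action, it becomes right multiplication by
  \<phi>(x); the properties of \<phi> as a homomorphism are kept apart in
  \<open>phom\<close>.\<close>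

definition coord :: "'c set \<Rightarrow> ('c fls, 'f, 'v) bimod \<Rightarrow> ('v \<Rightarrow> 'c fls) \<Rightarrow> ('f \<Rightarrow> 'c fls) \<Rightarrow> bool" where
  "coord L V c \<phi> \<longleftrightarrow> abelian_group V \<and> bij_betw c (carrier V) (laurent_over L) \<and>
    (\<forall>v\<in>carrier V. \<forall>w\<in>carrier V. c (v \<oplus>\<^bsub>V\<^esub> w) = c v + c w) \<and>
    (\<forall>s\<in>laurent_over L. \<forall>v\<in>carrier V. lmul V s v \<in> carrier V \<and> c (lmul V s v) = s \<star> c v) \<and>
    (\<forall>x. \<forall>v\<in>carrier V. fmul V x v \<in> carrier V \<and> c (fmul V x v) = c v \<star> \<phi> x)"

lemma coordD:
  assumes "coord L V c \<phi>"
  shows "abelian_group V" "bij_betw c (carrier V) (laurent_over L)"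
    "v \<in> carrier V \<Longrightarrow> w \<in> carrier V \<Longrightarrow> c (v \<oplus>\<^bsub>V\<^esub> w) = c v + c w"
    "s \<in> laurent_over L \<Longrightarrow> v \<in> carrier V \<Longrightarrow> lmul V s v \<in> carrier V"
    "s \<in> laurent_over L \<Longrightarrow> v \<in> carrier V \<Longrightarrow> c (lmul V s v) = s \<star> c v"
    "v \<in> carrier V \<Longrightarrow> fmul V x v \<in> carrier V"
    "v \<in> carrier V \<Longrightarrow> c (fmul V x v) = c v \<star> \<phi> x"
    "v \<in> carrier V \<Longrightarrow> c v \<in> laurent_over L"
    "v \<in> carrier V \<Longrightarrow> w \<in> carrier V \<Longrightarrow> c v = c w \<longleftrightarrow> v = w"
    "c \<zero>\<^bsub>V\<^esub> = 0"
    "u \<in> laurent_over L \<Longrightarrow> inv_into (carrier V) c u \<in> carrier V"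
    "u \<in> laurent_over L \<Longrightarrow> c (inv_into (carrier V) c u) = u"
    "v \<in> carrier V \<Longrightarrow> w \<in> carrier V \<Longrightarrow> v \<oplus>\<^bsub>V\<^esub> w \<in> carrier V" "\<zero>\<^bsub>V\<^esub> \<in> carrier V"
proof -
  show V: "abelian_group V" and bij: "bij_betw c (carrier V) (laurent_over L)"
    and add: "\<And>v w. v \<in> carrier V \<Longrightarrow> w \<in> carrier V \<Longrightarrow> c (v \<oplus>\<^bsub>V\<^esub> w) = c v + c w"
    and "s \<in> laurent_over L \<Longrightarrow> v \<in> carrier V \<Longrightarrow> lmul V s v \<in> carrier V"
    "s \<in> laurent_over L \<Longrightarrow> v \<in> carrier V \<Longrightarrow> c (lmul V s v) = s \<star> c v"
    "v \<in> carrier V \<Longrightarrow> fmul V x v \<in> carrier V"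
    "v \<in> carrier V \<Longrightarrow> c (fmul V x v) = c v \<star> \<phi> x"
    using assms by (auto simp: coord_def)
  interpret V: abelian_group V by (rule V)
  show "v \<in> carrier V \<Longrightarrow> c v \<in> laurent_over L" using bij by (auto simp: bij_betw_def)
  show "v \<in> carrier V \<Longrightarrow> w \<in> carrier V \<Longrightarrow> c v = c w \<longleftrightarrow> v = w"
    using bij by (auto simp: bij_betw_def inj_on_def)
  show "c \<zero>\<^bsub>V\<^esub> = 0" using add[of "\<zero>\<^bsub>V\<^esub>" "\<zero>\<^bsub>V\<^esub>"] by (simp only: V.zero_closed V.r_zero add_cancel_right_left)
  show "u \<in> laurent_over L \<Longrightarrow> inv_into (carrier V) c u \<in> carrier V"
    "u \<in> laurent_over L \<Longrightarrow> c (inv_into (carrier V) c u) = u"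
    using bij by (auto simp: bij_betw_def intro: inv_into_into f_inv_into_f)
  show "v \<in> carrier V \<Longrightarrow> w \<in> carrier V \<Longrightarrow> v \<oplus>\<^bsub>V\<^esub> w \<in> carrier V" "\<zero>\<^bsub>V\<^esub> \<in> carrier V" by simp_all
qed

lemma bimod_homD:
  assumes "h \<in> bimod_hom L V W"
  shows "v \<in> carrier V \<Longrightarrow> h v \<in> carrier W" "h \<in> extensional (carrier V)"
    "v \<in> carrier V \<Longrightarrow> w \<in> carrier V \<Longrightarrow> h (v \<oplus>\<^bsub>V\<^esub> w) = h v \<oplus>\<^bsub>W\<^esub> h w"
    "s \<in> laurent_over L \<Longrightarrow> v \<in> carrier V \<Longrightarrow> h (lmul V s v) = lmul W s (h v)"
    "v \<in> carrier V \<Longrightarrow> h (fmul V x v) = fmul W x (h v)"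
  using assms by (auto simp: bimod_hom_def PiE_def)

section \<open>Morphisms as right multiplications\<close>

definition intertwiners :: "'c set \<Rightarrow> ('f \<Rightarrow> 'c fls) \<Rightarrow> ('f \<Rightarrow> 'c fls) \<Rightarrow> 'c fls set" where
  "intertwiners L \<phi> \<psi> = {u \<in> laurent_over L. \<forall>x. \<phi> x \<star> u = u \<star> \<psi> x}"

definition hcoord :: "('c fls, 'f, 'v) bimod \<Rightarrow> ('v \<Rightarrow> 'c fls) \<Rightarrow> ('w \<Rightarrow> 'c fls) \<Rightarrow> ('v \<Rightarrow> 'w) \<Rightarrow> 'c fls" where
  "hcoord V cV cW h = cW (h (inv_into (carrier V) cV 1))"

definition hom_of :: "('c fls, 'f, 'v) bimod \<Rightarrow> ('v \<Rightarrow> 'c fls) \<Rightarrow> ('c fls, 'f, 'w) bimod \<Rightarrow> ('w \<Rightarrow> 'c fls) \<Rightarrow>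
    'c fls \<Rightarrow> ('v \<Rightarrow> 'w)" where
  "hom_of V cV W cW u = (\<lambda>v\<in>carrier V. inv_into (carrier W) cW (cV v \<star> u))"

text \<open>A linear map is determined by the image \<open>u\<close> of the generator, and commuting
  with \<open>F\<close> says that \<open>u\<close> intertwines. Two coefficient fields occur because
  elements of T(V) map a motive over \<open>Fbar\<close> to one over the big field.\<close>

lemma hcoord:
  assumes L: "perfect_subfield L" and L': "perfect_subfield L'" and sub: "L \<subseteq> L'"
    and V: "coord L V cV \<phi>" and W: "coord L' W cW \<psi>"
    and phi: "\<And>x. \<phi> x \<in> laurent_over L"
    and h: "h \<in> bimod_hom L V W"
  shows "hcoord V cV cW h \<in> intertwiners L' \<phi> \<psi>"
    and "v \<in> carrier V \<Longrightarrow> cW (h v) = cV v \<star> hcoord V cV cW h"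
proof -
  note V' = coordD[OF V] and W' = coordD[OF W] and LL = laurent_over_simps[OF L]
  define v0 where "v0 = inv_into (carrier V) cV 1"
  have v0: "v0 \<in> carrier V" "cV v0 = 1" using V'(11,12)[OF LL(2)] by (auto simp: v0_def)
  have u: "hcoord V cV cW h = cW (h v0)" by (simp add: hcoord_def v0_def)
  have hW: "h v \<in> carrier W" if "v \<in> carrier V" for v using h that by (auto simp: bimod_hom_def)
  have sub': "s \<in> laurent_over L \<Longrightarrow> s \<in> laurent_over L'" for s using sub by (auto simp: laurent_over_def)
  show main: "cW (h v) = cV v \<star> hcoord V cV cW h" if v: "v \<in> carrier V" for v
  proof -
    have cv: "cV v \<in> laurent_over L" using V' v by auto
    have "v = lmul V (cV v) v0" using V' v v0 cv by (metis smult_1(2))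
    then have "h v = lmul W (cV v) (h v0)" using bimod_homD(4)[OF h cv v0(1)] by simp
    then show ?thesis using W'(5)[OF sub'[OF cv] hW[OF v0(1)]] u by simp
  qed
  have "\<phi> x \<star> hcoord V cV cW h = hcoord V cV cW h \<star> \<psi> x" for x
  proof -
    have "cW (h (fmul V x v0)) = \<phi> x \<star> hcoord V cV cW h"
      using main[OF V'(6)[OF v0(1)]] V'(7)[OF v0(1)] v0(2) by simp
    moreover have "h (fmul V x v0) = fmul W x (h v0)" using h v0 by (auto simp: bimod_hom_def)
    ultimately show ?thesis using W'(7)[OF hW[OF v0(1)]] u by simp
  qed
  then show "hcoord V cV cW h \<in> intertwiners L' \<phi> \<psi>"
    using W'(8)[OF hW[OF v0(1)]] u by (simp add: intertwiners_def)
qed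

lemma hcoord_inject:
  assumes "perfect_subfield L" "perfect_subfield L'" "L \<subseteq> L'" "coord L V cV \<phi>" "coord L' W cW \<psi>"
    "\<And>x. \<phi> x \<in> laurent_over L" "h \<in> bimod_hom L V W" "g \<in> bimod_hom L V W"
    "hcoord V cV cW h = hcoord V cV cW g"
  shows "h = g"
proof (rule extensionalityI[of _ "carrier V"])
  show "h \<in> extensional (carrier V)" "g \<in> extensional (carrier V)"
    using assms by (auto simp: bimod_hom_def PiE_def)
  fix v assume v: "v \<in> carrier V"
  then have "h v \<in> carrier W" "g v \<in> carrier W" using assms by (auto simp: bimod_hom_def)
  then show "h v = g v"
    using hcoord(2)[OF assms(1-6) assms(7) v] hcoord(2)[OF assms(1-6) assms(8) v] assms(9) coordD(9)[OF assms(5)] by metis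
qed

lemma hom_of:
  assumes L: "perfect_subfield L" and L': "perfect_subfield L'" and sub: "L \<subseteq> L'"
    and V: "coord L V cV \<phi>" and W: "coord L' W cW \<psi>"
    and phi: "\<And>x. \<phi> x \<in> laurent_over L" and psi: "\<And>x. \<psi> x \<in> laurent_over L'"
    and u: "u \<in> intertwiners L' \<phi> \<psi>"
  shows "hom_of V cV W cW u \<in> bimod_hom L V W" "hcoord V cV cW (hom_of V cV W cW u) = u"
    "v \<in> carrier V \<Longrightarrow> cW (hom_of V cV W cW u v) = cV v \<star> u"
proof -
  note V' = coordD[OF V] and W' = coordD[OF W] and LL = laurent_over_simps[OF L] and LL' = laurent_over_simps[OF L']
  have sub': "s \<in> laurent_over L \<Longrightarrow> s \<in> laurent_over L'" for s using sub by (auto simp: laurent_over_def)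
  have u': "u \<in> laurent_over L'" "\<And>x. \<phi> x \<star> u = u \<star> \<psi> x" using u by (auto simp: intertwiners_def)
  have mem: "cV v \<star> u \<in> laurent_over L'" if "v \<in> carrier V" for v
    using LL'(6)[OF sub'[OF V'(8)[OF that]] u'(1)] .
  let ?h = "hom_of V cV W cW u"
  show c: "cW (?h v) = cV v \<star> u" if "v \<in> carrier V" for v
    using that W'(12)[OF mem[OF that]] by (simp add: hom_of_def)
  have hW: "?h v \<in> carrier W" if "v \<in> carrier V" for v
    using that W'(11)[OF mem[OF that]] by (simp add: hom_of_def)
  show "?h \<in> bimod_hom L V W"
    unfolding bimod_hom_def
  proof (intro CollectI conjI ballI allI)
    show "?h \<in> carrier V \<rightarrow>\<^sub>E carrier W" using hW by (auto simp: hom_of_def)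
    fix v assume v: "v \<in> carrier V"
    { fix w assume w: "w \<in> carrier V"
      have "cW (?h (v \<oplus>\<^bsub>V\<^esub> w)) = cW (?h v \<oplus>\<^bsub>W\<^esub> ?h w)"
        using v w hW V'(13) by (simp add: c V'(3) W'(3) smult_add_left)
      then show "?h (v \<oplus>\<^bsub>V\<^esub> w) = ?h v \<oplus>\<^bsub>W\<^esub> ?h w"
        using W'(9)[OF hW[OF V'(13)[OF v w]] W'(13)[OF hW[OF v] hW[OF w]]] by simp }
    { fix s assume s: "s \<in> laurent_over L"
      have "cW (?h (lmul V s v)) = cW (lmul W s (?h v))"
        using v s hW V'(4) by (simp add: c V'(5) W'(5) sub' smult_assoc)
      then show "?h (lmul V s v) = lmul W s (?h v)"
        using W'(9)[OF hW[OF V'(4)[OF s v]] W'(4)[OF sub'[OF s] hW[OF v]]] by simp }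
    { fix x
      have "cW (?h (fmul V x v)) = cW (fmul W x (?h v))"
        using v hW V'(6) by (simp add: c V'(7) W'(7) smult_assoc u'(2))
      then show "?h (fmul V x v) = fmul W x (?h v)"
        using W'(9)[OF hW[OF V'(6)[OF v]] W'(6)[OF hW[OF v]]] by simp }
  qed
  show "hcoord V cV cW ?h = u"
    unfolding hcoord_def using c[OF V'(11)[OF LL(2)]] V'(12)[OF LL(2)] by simp
qed

text \<open>Composites of right multiplications multiply in the opposite order.\<close>

lemma hcoord_compose:
  assumes "perfect_subfield L" "perfect_subfield L'" "L \<subseteq> L'" "coord L V cV \<phi>" "coord L' W cW \<psi>"
    "\<And>x. \<phi> x \<in> laurent_over L"
    and f: "f \<in> bimod_hom L V V" and g: "g \<in> bimod_hom L V W"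
  shows "hcoord V cV cW (compose (carrier V) g f) = hcoord V cV cV f \<star> hcoord V cV cW g"
proof -
  note V' = coordD[OF assms(4)] and LL = laurent_over_simps[OF assms(1)]
  let ?v0 = "inv_into (carrier V) cV 1"
  have v0: "?v0 \<in> carrier V" using V'(11)[OF LL(2)] .
  then have "f ?v0 \<in> carrier V" using f by (auto simp: bimod_hom_def)
  then have "cW (g (f ?v0)) = cV (f ?v0) \<star> hcoord V cV cW g" by (rule hcoord(2)[OF assms(1-6) g])
  then show ?thesis using v0 by (simp add: hcoord_def compose_def)
qed

lemma bimod_hom_compose:
  assumes V: "coord L V cV \<phi>" and f: "f \<in> bimod_hom L V W" and g: "g \<in> bimod_hom L' W Y" and "L \<subseteq> L'"
  shows "compose (carrier V) g f \<in> bimod_hom L V Y"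
proof -
  note V' = coordD[OF V] and f' = bimod_homD[OF f] and g' = bimod_homD[OF g]
  have sub: "s \<in> laurent_over L \<Longrightarrow> s \<in> laurent_over L'" for s using \<open>L \<subseteq> L'\<close> by (auto simp: laurent_over_def)
  show ?thesis
    unfolding bimod_hom_def
    by (auto simp: compose_def V' f' g' sub)
qed

lemma bimod_hom_id:
  assumes "coord L V cV \<phi>"
  shows "(\<lambda>v\<in>carrier V. v) \<in> bimod_hom L V V"
  using coordD[OF assms] by (auto simp: bimod_hom_def)

lemma hcoord_id:
  assumes "perfect_subfield L" "coord L V cV \<phi>"
  shows "hcoord V cV cV (\<lambda>v\<in>carrier V. v) = 1"
  using coordD(11,12)[OF assms(2) laurent_over_simps(2)[OF assms(1)]] by (simp add: hcoord_def)

lemma intertwiners_smult: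
  assumes "perfect_subfield L" "u \<in> intertwiners L \<phi> \<psi>" "w \<in> intertwiners L \<psi> \<xi>"
  shows "u \<star> w \<in> intertwiners L \<phi> \<xi>"
proof -
  have "\<phi> x \<star> (u \<star> w) = (u \<star> w) \<star> \<xi> x" for x
  proof -
    have u: "\<phi> x \<star> u = u \<star> \<psi> x" and w: "\<psi> x \<star> w = w \<star> \<xi> x"
      using assms(2,3) by (auto simp: intertwiners_def)
    have "\<phi> x \<star> (u \<star> w) = u \<star> (\<psi> x \<star> w)" using u by (metis smult_assoc)
    then show ?thesis using w by (simp add: smult_assoc)
  qed
  then show ?thesis using assms laurent_over_simps(6)[OF assms(1)] by (simp add: intertwiners_def)
qed

lemma intertwiners_sinv:
  assumes "perfect_subfield L" "u \<in> intertwiners L \<phi> \<psi>" "u \<noteq> 0"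
  shows "sinv u \<in> intertwiners L \<psi> \<phi>"
proof -
  have "\<psi> x \<star> sinv u = sinv u \<star> (u \<star> \<psi> x) \<star> sinv u" for x
    using assms(3) by (simp add: sinv_left flip: smult_assoc)
  also have "sinv u \<star> (u \<star> \<psi> x) \<star> sinv u = sinv u \<star> \<phi> x" for x
    using assms by (simp add: intertwiners_def sinv_right smult_assoc flip: ) (metis (no_types, lifting) smult_assoc sinv_right smult_1(2))
  finally show ?thesis using assms sinv_in by (simp add: intertwiners_def)
qed

subsection \<open>Existence of coordinates\<close>

lemma openin_tau_topology_ball:
  assumes "v \<in> carrier V" "v \<noteq> \<zero>\<^bsub>V\<^esub>"
  shows "openin (tau_topology L V) ((\<lambda>s. lmul V s v) ` {s \<in> laurent_over L. vanish n s})"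
  unfolding tau_topology_def
proof (rule topology_generated_by_Basis, intro CollectI exI conjI)
  have "open {s :: 'c fls. vanish n s}"
    unfolding open_fls_iff
  proof
    fix s :: "'c fls" assume s: "s \<in> {s. vanish n s}"
    have "vanish n t" if "vanish n (t - s)" for t
      using vanish_add[OF that, of s] s by simp
    then show "\<exists>m. \<forall>t. vanish m (t - s) \<longrightarrow> t \<in> {s. vanish n s}" by auto
  qed
  then show "openin (top_of_set (laurent_over L)) {s \<in> laurent_over L. vanish n s}"
    by (auto simp: openin_open)
qed (use assms in auto)

text \<open>The same choice as in \<open>height\<close>, so that the height speaks about the \<phi>
  of these coordinates.\<close>

definition motive_base :: "('c fls, 'f, 'v) bimod \<Rightarrow> 'v" where
  "motive_base V = (SOME v. v \<in> carrier V \<and> v \<noteq> \<zero>\<^bsub>V\<^esub>)"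

definition motive_coord :: "'c set \<Rightarrow> ('c fls, 'f, 'v) bimod \<Rightarrow> 'v \<Rightarrow> 'c fls" where
  "motive_coord L V v = (THE s. s \<in> laurent_over L \<and> lmul V s (motive_base V) = v)"

text \<open>The algebra is a change of generator; the content is the passage from topological
  continuity to the estimate in \<open>phom\<close>. Continuity only gives integrality of \<phi> on
  some ball, and multiplicativity extends this to the ring of integers.\<close>

lemma formal_motive_coord:
  assumes L: "perfect_subfield L" and M: "formal_motive L V" and ht: "height L V = of_nat r" and r: "r > 0"
  defines "\<phi> \<equiv> phi L V (motive_base V)"
  shows "coord L V (motive_coord L V) \<phi>" "phom (int (r * residue_degree)) L \<phi>"
proof -
  note LL = laurent_over_simps[OF L]
  let ?R = "skew_laurent CARD('q) L"
  have lm: "left_module ?R V (lmul V)" and fm: "left_module (ring_of_type_algebra :: 'f ring) V (fmul V)"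
    and comm: "\<And>s x v. s \<in> laurent_over L \<Longrightarrow> v \<in> carrier V \<Longrightarrow> lmul V s (fmul V x v) = fmul V x (lmul V s v)"
    and Fq: "\<And>a v. v \<in> carrier V \<Longrightarrow> lmul V (fls_const (embK a)) v = fmul V (embF a) v"
    and rk: "has_rank ?R V (lmul V) 1"
    and cont: "continuous_map (prod_topology (val_topology val) (tau_topology L V)) (tau_topology L V)
      (\<lambda>(x, v). fmul V x v)"
    using M by (auto simp: formal_motive_def)
  have V: "abelian_group V" using lm by (simp add: left_module_def)
  interpret V: abelian_group V by (rule V)
  have l: "\<And>s v. s \<in> laurent_over L \<Longrightarrow> v \<in> carrier V \<Longrightarrow> lmul V s v \<in> carrier V"
    "\<And>s v w. s \<in> laurent_over L \<Longrightarrow> v \<in> carrier V \<Longrightarrow> w \<in> carrier V \<Longrightarrow> lmul V s (v \<oplus>\<^bsub>V\<^esub> w) = lmul V s v \<oplus>\<^bsub>V\<^esub> lmul V s w"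
    "\<And>s t v. s \<in> laurent_over L \<Longrightarrow> t \<in> laurent_over L \<Longrightarrow> v \<in> carrier V \<Longrightarrow> lmul V (s + t) v = lmul V s v \<oplus>\<^bsub>V\<^esub> lmul V t v"
    "\<And>s t v. s \<in> laurent_over L \<Longrightarrow> t \<in> laurent_over L \<Longrightarrow> v \<in> carrier V \<Longrightarrow> lmul V (s \<star> t) v = lmul V s (lmul V t v)"
    "\<And>v. v \<in> carrier V \<Longrightarrow> lmul V 1 v = v"
    using lm by (auto simp: left_module_def skew_laurent_def skew_mult_eq)
  have f: "\<And>x v. v \<in> carrier V \<Longrightarrow> fmul V x v \<in> carrier V"
    "\<And>x v w. v \<in> carrier V \<Longrightarrow> w \<in> carrier V \<Longrightarrow> fmul V x (v \<oplus>\<^bsub>V\<^esub> w) = fmul V x v \<oplus>\<^bsub>V\<^esub> fmul V x w"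
    "\<And>x y v. v \<in> carrier V \<Longrightarrow> fmul V (x + y) v = fmul V x v \<oplus>\<^bsub>V\<^esub> fmul V y v"
    "\<And>x y v. v \<in> carrier V \<Longrightarrow> fmul V (x * y) v = fmul V x (fmul V y v)"
    "\<And>v. v \<in> carrier V \<Longrightarrow> fmul V 1 v = v"
    using fm by (auto simp: left_module_def)
  obtain b where b: "b \<in> carrier V" "\<And>v. v \<in> carrier V \<Longrightarrow> \<exists>!s. s \<in> laurent_over L \<and> lmul V s b = v"
  proof -
    obtain B where B: "is_basis ?R V (lmul V) B" "card B = 1" using rk by (auto simp: has_rank_def)
    then obtain b where Bb: "B = {b}" by (auto simp: card_1_singleton_iff)
    have bV: "b \<in> carrier V" using B Bb by (auto simp: is_basis_def)
    have ex: "\<exists>!c. c \<in> {b} \<rightarrow>\<^sub>E laurent_over L \<and> v = finsum V (\<lambda>b. lmul V (c b) b) {b}" if "v \<in> carrier V" for v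
      using B(1) that unfolding is_basis_def Bb by (simp add: skew_laurent_def)
    have fs: "finsum V (\<lambda>b. lmul V (c b) b) {b} = lmul V (c b) b" if "c b \<in> laurent_over L" for c
      using V.finsum_insert[of "{}" b "\<lambda>b. lmul V (c b) b"] l(1)[OF that bV] by simp
    have "\<exists>!s. s \<in> laurent_over L \<and> lmul V s b = v" if v: "v \<in> carrier V" for v
    proof -
      obtain c where c: "c \<in> {b} \<rightarrow>\<^sub>E laurent_over L" "v = finsum V (\<lambda>b. lmul V (c b) b) {b}"
        and un: "\<And>c'. c' \<in> {b} \<rightarrow>\<^sub>E laurent_over L \<Longrightarrow> v = finsum V (\<lambda>b. lmul V (c' b) b) {b} \<Longrightarrow> c' = c"
        using ex[OF v] by blast
      show ?thesis
      proof (rule ex1I[of _ "c b"])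
        have cb: "c b \<in> laurent_over L" using c(1) by auto
        then show "c b \<in> laurent_over L \<and> lmul V (c b) b = v" using c(2) fs[of c] by simp
        fix s assume s: "s \<in> laurent_over L \<and> lmul V s b = v"
        have "(\<lambda>x\<in>{b}. s) = c" using s fs[of "\<lambda>x\<in>{b}. s"] by (intro un) auto
        then show "s = c b" by auto
      qed
    qed
    then show ?thesis using that bV by blast
  qed
  have l0: "lmul V 0 v = \<zero>\<^bsub>V\<^esub>" if "v \<in> carrier V" for v
  proof -
    have "lmul V 0 v = lmul V 0 v \<oplus>\<^bsub>V\<^esub> lmul V 0 v" using l(3)[OF LL(1) LL(1) that] by simp
    then show ?thesis using l(1)[OF LL(1) that] V.add.l_cancel_one' by metis
  qed
  define v0 where "v0 = motive_base V"
  have "lmul V 1 b \<noteq> lmul V 0 b" using b(2)[OF b(1)] l(5)[OF b(1)] LL(1,2) by (metis zero_neq_one)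
  then have "b \<noteq> \<zero>\<^bsub>V\<^esub>" using l(5)[OF b(1)] l0[OF b(1)] by auto
  then have v0: "v0 \<in> carrier V" "v0 \<noteq> \<zero>\<^bsub>V\<^esub>"
    using someI_ex[of "\<lambda>v. v \<in> carrier V \<and> v \<noteq> \<zero>\<^bsub>V\<^esub>"] b(1) by (auto simp: v0_def motive_base_def)
  \<comment> \<open>The basis of the rank condition need not be the vector chosen by
    \<open>height\<close>; over a skew field any nonzero vector of a one-dimensional space is a
    basis.\<close>
  have v0': "\<exists>!s. s \<in> laurent_over L \<and> lmul V s v0 = v" if v: "v \<in> carrier V" for v
  proof -
    obtain s0 where s0: "s0 \<in> laurent_over L" "lmul V s0 b = v0" using b(2)[OF v0(1)] by blast
    have "s0 \<noteq> 0" using s0 v0 l0[OF b(1)] by auto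
    note inv = sinv_in[OF L s0(1) \<open>s0 \<noteq> 0\<close>]
    obtain t where t: "t \<in> laurent_over L" "lmul V t b = v" using b(2)[OF v] by blast
    show ?thesis
    proof (rule ex1I[of _ "t \<star> sinv s0"])
      have "lmul V (t \<star> sinv s0) v0 = lmul V ((t \<star> sinv s0) \<star> s0) b"
        using l(4)[OF LL(6)[OF t(1) inv] s0(1) b(1)] s0 by simp
      also have "\<dots> = v" using t \<open>s0 \<noteq> 0\<close> by (simp add: smult_assoc sinv_left)
      finally show "t \<star> sinv s0 \<in> laurent_over L \<and> lmul V (t \<star> sinv s0) v0 = v" using LL(6)[OF t(1) inv] by simp
      fix s assume s: "s \<in> laurent_over L \<and> lmul V s v0 = v"
      then have "lmul V (s \<star> s0) b = v" using l(4)[of s s0 b] s0 b by simp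
      then have "s \<star> s0 = t" using b(2)[OF v] t LL(6) s s0 by blast
      then show "s = t \<star> sinv s0" using \<open>s0 \<noteq> 0\<close> by (simp add: smult_assoc sinv_right flip: \<open>s \<star> s0 = t\<close>)
    qed
  qed
  define c where "c = motive_coord L V"
  have cI: "c v = s" if "s \<in> laurent_over L" "lmul V s v0 = v" for s v
    unfolding c_def motive_coord_def using v0'[OF l(1)[OF that(1) v0(1)]] that by (auto simp: v0_def intro!: the1_equality)
  have c: "c v \<in> laurent_over L" "lmul V (c v) v0 = v" if "v \<in> carrier V" for v
    using v0'[OF that] cI by metis+
  have phi: "\<phi> x = c (fmul V x v0)" for x
    by (simp add: \<phi>_def phi_def c_def motive_coord_def v0_def)
  note fv = f(1)[OF v0(1)]
  have phi': "\<phi> x \<in> laurent_over L" "lmul V (\<phi> x) v0 = fmul V x v0" for x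
    using c[OF fv] by (auto simp: phi)
  show co: "coord L V (motive_coord L V) \<phi>"
    unfolding coord_def c_def[symmetric]
  proof (intro conjI ballI allI V)
    show "bij_betw c (carrier V) (laurent_over L)"
      by (rule bij_betwI[where g = "\<lambda>s. lmul V s v0"]) (use c cI l(1)[OF _ v0(1)] in auto)
    fix v assume v: "v \<in> carrier V"
    show "c (v \<oplus>\<^bsub>V\<^esub> w) = c v + c w" if w: "w \<in> carrier V" for w
      using c[OF v] c[OF w] l(3)[OF c(1)[OF v] c(1)[OF w] v0(1)] by (intro cI LL) auto
    show "lmul V s v \<in> carrier V" if "s \<in> laurent_over L" for s using l(1)[OF that v] .
    show "c (lmul V s v) = s \<star> c v" if "s \<in> laurent_over L" for s
      using l(4)[OF that c(1)[OF v] v0(1)] c[OF v] that by (intro cI LL) auto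
    show "fmul V x v \<in> carrier V" for x using f(1)[OF v] .
    show "c (fmul V x v) = c v \<star> \<phi> x" for x
      using l(4)[OF c(1)[OF v] phi'(1) v0(1)] c[OF v] phi' comm[OF c(1)[OF v] v0(1)] by (intro cI LL) auto
  qed
  have padd: "\<phi> (x + y) = \<phi> x + \<phi> y" for x y
    unfolding phi[of "x + y"] using f(3)[OF v0(1)] l(3)[OF phi'(1) phi'(1) v0(1)] phi' by (intro cI LL) auto
  \<comment> \<open>In right multiplications the factors appear in reverse order; commutativity of
    \<open>F\<close> then turns this into multiplicativity.\<close>
  have pmult': "\<phi> (x * y) = \<phi> y \<star> \<phi> x" for x y
    unfolding phi[of "x * y"]
  proof (intro cI LL phi')
    have "lmul V (\<phi> y \<star> \<phi> x) v0 = lmul V (\<phi> y) (fmul V x v0)" using l(4)[OF phi'(1) phi'(1) v0(1)] phi' by simp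
    also have "\<dots> = fmul V x (fmul V y v0)" using comm[OF phi'(1) v0(1)] phi' by simp
    finally show "lmul V (\<phi> y \<star> \<phi> x) v0 = fmul V (x * y) v0" using f(4)[OF v0(1)] by simp
  qed
  have pmult: "\<phi> (x * y) = \<phi> x \<star> \<phi> y" for x y using pmult'[of y x] by (simp add: mult.commute)
  have pone: "\<phi> 1 = 1" unfolding phi using f(5)[OF v0(1)] l(5)[OF v0(1)] LL by (intro cI) auto
  have pF: "\<phi> (embF a) = fls_const (embK a)" for a
    unfolding phi using Fq[OF v0(1)] LL by (intro cI) auto
  have p0: "\<phi> 0 = 0" using padd[of 0 0] by (simp only: add_cancel_right_left add_0_left)
  have pinv: "\<phi> x \<star> \<phi> (inverse x) = 1" if "x \<noteq> 0" for x using that pmult[of x "inverse x"] pone by simp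
  have pnz: "\<phi> x \<noteq> 0" if "x \<noteq> 0" for x using pinv[OF that] by auto
  have ppow: "\<phi> (x ^ n) \<noteq> 0 \<and> fls_subdegree (\<phi> (x ^ n)) = int n * fls_subdegree (\<phi> x)" if "x \<noteq> 0" for x n
    by (induction n) (auto simp: pone pmult subdegree_smult pnz[OF that] smult_eq_0_iff algebra_simps)
  define e where "e = int (r * residue_degree)"
  have sz: "fls_subdegree (\<phi> z) = e" and e: "e > 0"
  proof -
    have h: "of_int (fls_subdegree (\<phi> z)) / of_nat residue_degree = (of_nat r :: rat)"
      using ht by (simp add: height_def \<phi>_def motive_base_def Let_def)
    \<comment> \<open>Division by zero gives 0, so a positive height forces a positive residue
      degree.\<close>
    then have d: "residue_degree > 0" using r by (intro Nat.gr0I) simp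
    then have "of_int (fls_subdegree (\<phi> z)) = (of_int e :: rat)"
      using h by (simp add: e_def field_simps)
    then show "fls_subdegree (\<phi> z) = e" by (simp only: of_int_eq_iff)
    show "e > 0" using r d by (simp add: e_def)
  qed
  \<comment> \<open>Continuity at (0, v0): a neighbourhood of 0 in \<open>F\<close> carries v0 into
    the multiples of v0 by series of nonnegative order.\<close>
  obtain n :: nat where n: "\<And>x. x \<in> vball (int n) \<Longrightarrow> vanish 0 (\<phi> x)"
  proof -
    let ?B = "(\<lambda>s. lmul V s v0) ` {s \<in> laurent_over L. vanish 0 s}"
    let ?P = "prod_topology (val_topology val) (tau_topology L V)"
    have B: "openin (tau_topology L V) ?B" by (rule openin_tau_topology_ball[OF v0])
    have top: "topspace (val_topology val) = UNIV"
      using openin_subset[of "val_topology val" UNIV] by (auto simp: openin_val_topology)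
    have "vanish (- 1) (1 :: 'c fls)" by (simp add: vanish_def)
    have "v0 \<in> (\<lambda>s. lmul V s v0) ` {s \<in> laurent_over L. vanish (- 1) s}"
      using l(5)[OF v0(1)] LL(2) \<open>vanish (- 1) 1\<close> by (intro image_eqI[of _ _ 1]) auto
    then have tv: "v0 \<in> topspace (tau_topology L V)"
      using openin_subset[OF openin_tau_topology_ball[OF v0, of L "- 1"]] by blast
    define S where "S = {p \<in> topspace ?P. (case p of (x, v) \<Rightarrow> fmul V x v) \<in> ?B}"
    have oS: "openin ?P S" unfolding S_def
      by (rule openin_continuous_map_preimage[OF cont B])
    have "fmul V 0 v0 = lmul V 0 v0" using phi'(2)[of 0] p0 by simp
    then have "(0, v0) \<in> S"
      using tv top LL(1) by (auto simp: topspace_prod_topology S_def)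
    then obtain U W where UW: "openin (val_topology val) U" "0 \<in> U" "v0 \<in> W" "U \<times> W \<subseteq> S"
      using oS[unfolded openin_prod_topology_alt, rule_format, of 0 v0] by auto
    obtain n where n: "\<And>y. y - 0 \<in> vball n \<Longrightarrow> y \<in> U" using UW(1,2) unfolding openin_val_topology by blast
    have "vanish 0 (\<phi> x)" if x: "x \<in> vball (int (nat n))" for x
    proof -
      have "x \<in> U" using n[of x] vball_mono[OF x, of n] by simp
      then have "(x, v0) \<in> S" using UW by blast
      then obtain s where "s \<in> laurent_over L" "vanish 0 s" "lmul V s v0 = fmul V x v0" by (auto simp: S_def)
      then show ?thesis using cI[of s "fmul V x v0"] phi by simp
    qed
    then show ?thesis by (rule that)
  qed
  have int0: "vanish 0 (\<phi> x)" if x: "x \<in> vball 0" for x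
  proof (cases "x = 0")
    case False
    have "fls_subdegree (\<phi> x) \<ge> 0"
    proof (rule ccontr)
      assume neg: "\<not> 0 \<le> fls_subdegree (\<phi> x)"
      \<comment> \<open>If \<phi>(x) had order at most -1, then \<phi>(x^j z^n) would have order at
        most -j + n e < 0, although x^j z^n lies in the ball on which \<phi> is integral.\<close>
      define j where "j = nat (int n * e) + 1"
      have "z ^ n \<in> vball (int n)" using vball_z_powi[of "int n"] by simp
      then have "x ^ j * z ^ n \<in> vball (0 + int n)" by (intro vball_mult vball_power_0 x)
      then have "vanish 0 (\<phi> (x ^ j * z ^ n))" using n by simp
      moreover have nz: "\<phi> (x ^ j * z ^ n) \<noteq> 0" using False uniformizer by (intro pnz) simp
      ultimately have "0 \<le> fls_subdegree (\<phi> (x ^ j * z ^ n))" by (rule subdegree_vanish)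
      also have "\<dots> = int j * fls_subdegree (\<phi> x) + int n * e"
        using ppow[OF False, of j] ppow[OF uniformizer(1), of n] sz by (simp add: pmult subdegree_smult)
      also have "\<dots> \<le> int j * (- 1) + int n * e" using neg by (intro add_right_mono mult_left_mono) auto
      also have "\<dots> < 0" using e by (simp add: j_def)
      finally show False by simp
    qed
    then show ?thesis by (rule vanish_subdegree)
  qed (simp add: p0)
  have zp: "vanish (e * m) (\<phi> (z powi m))" for m
  proof (cases "m \<ge> 0")
    case True
    then show ?thesis using ppow[OF uniformizer(1), of "nat m"] sz
      by (intro vanish_subdegree) (simp add: power_int_def algebra_simps)
  next
    case False
    have nz: "inverse z \<noteq> 0" using uniformizer by simp
    have "fls_subdegree (\<phi> z) + fls_subdegree (\<phi> (inverse z)) = 0"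
      using subdegree_smult[OF pnz[OF uniformizer(1)] pnz[OF nz]] pinv[OF uniformizer(1)] by simp
    then have "fls_subdegree (\<phi> (inverse z)) = - e" using sz by simp
    then show ?thesis using False ppow[OF nz, of "nat (- m)"]
      by (intro vanish_subdegree) (simp add: power_int_def algebra_simps)
  qed
  show "phom (int (r * residue_degree)) L \<phi>"
    unfolding phom_def e_def[symmetric]
  proof (intro conjI allI ballI e phi'(1) padd pmult pone pF)
    fix m x assume "x \<in> vball m"
    then obtain y where y: "y \<in> vball 0" "x = z powi m * y" using vball_factor[of x m 0] by auto
    then show "vanish (e * m) (\<phi> x)" using vanish_smult[OF zp[of m] int0[OF y(1)]] by (simp add: pmult)
  qed
qed

end

section \<open>Base change in coordinates\<close>

context drinfeld_setting
begin

text \<open>The additive extension of (a, v) -> a c(v): the coordinate of a tensor, computed on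
  formal sums.\<close>

definition tcoord :: "('v \<Rightarrow> 'c fls) \<Rightarrow> ('c fls \<times> 'v \<Rightarrow>\<^sub>0 int) \<Rightarrow> 'c fls" where
  "tcoord c x = (\<Sum>p\<in>Poly_Mapping.keys x. of_int (Poly_Mapping.lookup x p) * (fst p \<star> c (snd p)))"

lemma tcoord_superset:
  assumes "finite S" "Poly_Mapping.keys x \<subseteq> S"
  shows "tcoord c x = (\<Sum>p\<in>S. of_int (Poly_Mapping.lookup x p) * (fst p \<star> c (snd p)))"
  unfolding tcoord_def using assms
  by (intro sum.mono_neutral_left) (auto simp: in_keys_iff)

lemma tcoord_diff: "tcoord c (x - y) = tcoord c x - tcoord c y"
proof -
  let ?S = "Poly_Mapping.keys x \<union> Poly_Mapping.keys y"
  have S: "finite ?S" "Poly_Mapping.keys x \<subseteq> ?S" "Poly_Mapping.keys y \<subseteq> ?S" by auto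
  have "Poly_Mapping.keys (x - y) \<subseteq> ?S" by (rule keys_diff)
  then show ?thesis
    by (simp add: tcoord_superset[OF S(1)] lookup_minus left_diff_distrib sum_subtractf)
qed

lemma tcoord_0 [simp]: "tcoord c 0 = 0"
  by (simp add: tcoord_def)

lemma tcoord_uminus: "tcoord c (- x) = - tcoord c x"
  using tcoord_diff[of c 0 x] by simp

lemma tcoord_add: "tcoord c (x + y) = tcoord c x + tcoord c y"
  using tcoord_diff[of c x "- y"] by (simp add: tcoord_uminus)

lemma tcoord_frag_of [simp]: "tcoord c (frag_of p) = fst p \<star> c (snd p)"
  by (simp add: tcoord_def)

lemma tensor_free_simps [simp]:
  "x \<in> carrier (tensor_free V) \<longleftrightarrow> Poly_Mapping.keys x \<subseteq> UNIV \<times> carrier V"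
  "\<one>\<^bsub>tensor_free V\<^esub> = 0" "x \<otimes>\<^bsub>tensor_free V\<^esub> y = x + y"
  "Poly_Mapping.keys x \<subseteq> UNIV \<times> carrier V \<Longrightarrow> inv\<^bsub>tensor_free V\<^esub> x = - x"
  by (auto simp: tensor_free_def)

lemma comm_group_tensor_free: "comm_group (tensor_free V)"
  unfolding tensor_free_def by (rule abelian_free_Abelian_group)

definition tensor_relators :: "('c fls, 'f, 'v) bimod \<Rightarrow> ('c fls \<times> 'v \<Rightarrow>\<^sub>0 int) set" where
  "tensor_relators V =
    {frag_of (a + b, v) - frag_of (a, v) - frag_of (b, v) | a b v. v \<in> carrier V} \<union>
     {frag_of (a, v \<oplus>\<^bsub>V\<^esub> w) - frag_of (a, v) - frag_of (a, w) | a v w.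
        v \<in> carrier V \<and> w \<in> carrier V} \<union>
     {frag_of (a \<star> s, v) - frag_of (a, lmul V s v) | a s v.
        s \<in> laurent_over K \<and> v \<in> carrier V}"

lemma tensor_rel_eq: "tensor_rel V = generate (tensor_free V) (tensor_relators V)"
  unfolding tensor_rel_def tensor_relators_def skew_mult_eq ..

lemma keys_diff_subset: "Poly_Mapping.keys x \<subseteq> S \<Longrightarrow> Poly_Mapping.keys y \<subseteq> S \<Longrightarrow> Poly_Mapping.keys (x - y) \<subseteq> S"
  using keys_diff[of x y] by blast

lemma tensor_relators_carrier:
  assumes V: "coord K V c \<phi>"
  shows "tensor_relators V \<subseteq> carrier (tensor_free V)"
  unfolding tensor_relators_def
  by (auto simp: coordD(4,13)[OF V] intro!: keys_diff_subset)
    (auto simp: coordD(4,13)[OF V] keys_diff_subset dest!: subsetD[OF keys_diff])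

lemma subgroup_tensor_rel:
  assumes V: "coord K V c \<phi>"
  shows "subgroup (tensor_rel V) (tensor_free V)"
proof -
  interpret G: comm_group "tensor_free V" by (rule comm_group_tensor_free)
  show ?thesis unfolding tensor_rel_eq by (rule G.generate_is_subgroup[OF tensor_relators_carrier[OF V]])
qed

lemma tensor_rel_keys:
  assumes "coord K V c \<phi>" "x \<in> tensor_rel V"
  shows "Poly_Mapping.keys x \<subseteq> UNIV \<times> carrier V"
  using subgroup.subset[OF subgroup_tensor_rel[OF assms(1)]] assms(2) tensor_free_simps(1)[of x V] by blast

lemma tensor_rel_diff:
  assumes V: "coord K V c \<phi>" and "x \<in> tensor_rel V" "y \<in> tensor_rel V"
  shows "x - y \<in> tensor_rel V"
proof -
  note R = subgroup_tensor_rel[OF V]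
  show ?thesis
    using subgroup.m_closed[OF R assms(2) subgroup.m_inv_closed[OF R assms(3)]] tensor_rel_keys[OF V assms(3)] by simp
qed

text \<open>The relators have coordinate 0. Conversely every formal sum is congruent to the single
  symbol with its coordinate and the generator v0, so coordinate 0 leaves the symbol (0, v0), itself
  a relation.\<close>

lemma tensor_rel_iff:
  assumes V: "coord K V c \<phi>"
  shows "x \<in> tensor_rel V \<longleftrightarrow> x \<in> carrier (tensor_free V) \<and> tcoord c x = 0"
proof
  note V' = coordD[OF V]
  assume "x \<in> tensor_rel V"
  moreover have rel: "tcoord c h = 0" if "h \<in> tensor_relators V" for h
    using that
    by (auto simp: tensor_relators_def tcoord_diff V' smult_add_left smult_add_right smult_assoc)
  moreover have "tcoord c h = 0" if "h \<in> generate (tensor_free V) (tensor_relators V)" for h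
    using that
  proof (induction rule: generate.induct)
    case (inv h)
    then have "Poly_Mapping.keys h \<subseteq> UNIV \<times> carrier V" using tensor_relators_carrier[OF V] tensor_free_simps(1)[of h V] by blast
    then show ?case using rel[OF inv] by (simp add: tcoord_uminus)
  qed (auto simp: rel tcoord_add)
  ultimately show "x \<in> carrier (tensor_free V) \<and> tcoord c x = 0"
    using tensor_rel_keys[OF V] by (simp add: tensor_rel_eq)
next
  note V' = coordD[OF V] and LL = laurent_over_simps[OF perfect_subfield_K]
  assume x: "x \<in> carrier (tensor_free V) \<and> tcoord c x = 0"
  let ?R = "tensor_rel V"
  note rdiff = tensor_rel_diff[OF V]
  define v0 where "v0 = inv_into (carrier V) c 1"
  have v0: "v0 \<in> carrier V" "c v0 = 1" using V'(11,12)[OF LL(2)] by (auto simp: v0_def)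
  have zero: "0 \<in> ?R" using generate.one[of "tensor_free V"] by (simp add: tensor_rel_eq)
  have inc: "h \<in> ?R" if "h \<in> tensor_relators V" for h
    using that by (auto simp: tensor_rel_eq intro: generate.incl)
  have g1: "frag_of (a + b, v0) - frag_of (a, v0) - frag_of (b, v0) \<in> ?R" for a b
    by (rule inc) (use v0 in \<open>auto simp: tensor_relators_def\<close>)
  \<comment> \<open>The additivity relator with both coefficients 0 is minus the symbol (0,
    v0).\<close>
  have f0: "- frag_of (0, v0) \<in> ?R" using g1[of 0 0] by simp
  have "x - frag_of (tcoord c x, v0) \<in> ?R"
    using x[THEN conjunct1, unfolded tensor_free_simps]
  proof (induction x rule: frag_induction)
    case zero
    then show ?case using f0 by simp
  next
    case (one p)
    obtain a v where p: "p = (a, v)" by (cases p)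
    then have v: "v \<in> carrier V" using one by auto
    have "lmul V (c v) v0 = v" using V' v v0 by (metis smult_1(2))
    then have "frag_of (a \<star> c v, v0) - frag_of (a, v) \<in> ?R"
      using V'(8)[OF v] v0(1) by (intro inc) (force simp: tensor_relators_def)
    then have "0 - (frag_of (a \<star> c v, v0) - frag_of (a, v)) \<in> ?R" by (rule rdiff[OF zero])
    then show ?case by (simp add: p)
  next
    case (diff a b)
    let ?f = "\<lambda>u. frag_of (u, v0)"
    let ?a = "tcoord c a" and ?b = "tcoord c b"
    have "?f (?a - ?b + ?b) - ?f (?a - ?b) - ?f ?b \<in> ?R" by (rule g1)
    then have "0 - (0 - (?f ?a - ?f (?a - ?b) - ?f ?b)) \<in> ?R"
      using tensor_rel_diff[OF V zero] by (simp only: diff_add_cancel)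
    then have "?f ?a - ?f (?a - ?b) - ?f ?b \<in> ?R" by simp
    then have "(a - ?f ?a) - (b - ?f ?b) - (0 - (?f ?a - ?f (?a - ?b) - ?f ?b)) \<in> ?R"
      by (rule rdiff[OF rdiff[OF diff(1,2)] rdiff[OF zero]])
    then show ?case by (simp add: tcoord_diff algebra_simps)
  qed
  then have "x - frag_of (0, v0) \<in> ?R" using x by simp
  then have "x - frag_of (0, v0) - (- frag_of (0, v0)) \<in> ?R" by (rule rdiff[OF _ f0])
  then show "x \<in> ?R" by simp
qed

text \<open>\<open>tcoord\<close> is constant on cosets, so the choice of the representative is
  harmless.\<close>

definition bcoord :: "('v \<Rightarrow> 'c fls) \<Rightarrow> ('c fls \<times> 'v \<Rightarrow>\<^sub>0 int) set \<Rightarrow> 'c fls" where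
  "bcoord c C = tcoord c (SOME x. x \<in> C)"

lemma base_change_carrier:
  "carrier (base_change V) = {tensor_rel V #>\<^bsub>tensor_free V\<^esub> x | x. x \<in> carrier (tensor_free V)}"
  by (auto simp: base_change_def FactGroup_def RCOSETS_def)

lemma coset_tensor_rel:
  assumes V: "coord K V c \<phi>" and x: "x \<in> carrier (tensor_free V)"
  shows "y \<in> tensor_rel V #>\<^bsub>tensor_free V\<^esub> x \<longleftrightarrow> y \<in> carrier (tensor_free V) \<and> tcoord c y = tcoord c x"
proof
  assume "y \<in> tensor_rel V #>\<^bsub>tensor_free V\<^esub> x"
  then obtain h where "h \<in> tensor_rel V" "y = h + x" by (auto simp: r_coset_def)
  then show "y \<in> carrier (tensor_free V) \<and> tcoord c y = tcoord c x"
    using x tensor_rel_iff[OF V, of h] keys_add[of h x] by (auto simp: tcoord_add)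
next
  assume "y \<in> carrier (tensor_free V) \<and> tcoord c y = tcoord c x"
  then have "y - x \<in> tensor_rel V"
    using x by (auto simp: tensor_rel_iff[OF V] tcoord_diff dest!: subsetD[OF keys_diff])
  then show "y \<in> tensor_rel V #>\<^bsub>tensor_free V\<^esub> x"
    by (auto simp: r_coset_def intro!: bexI[of _ "y - x"])
qed

lemma bcoord_coset:
  assumes V: "coord K V c \<phi>" and x: "x \<in> carrier (tensor_free V)"
  shows "bcoord c (tensor_rel V #>\<^bsub>tensor_free V\<^esub> x) = tcoord c x"
proof -
  have "x \<in> tensor_rel V #>\<^bsub>tensor_free V\<^esub> x" using coset_tensor_rel[OF V x] x by simp
  then have "(SOME y. y \<in> tensor_rel V #>\<^bsub>tensor_free V\<^esub> x) \<in> tensor_rel V #>\<^bsub>tensor_free V\<^esub> x"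
    by (rule someI)
  then show ?thesis using coset_tensor_rel[OF V x] by (simp add: bcoord_def)
qed

text \<open>Every \<open>tensor_map\<close> in use induces an additive map \<open>H\<close> on
  coordinates: multiplication by a series on the left, by \<phi>(x) or the coordinate of a morphism
  on the right, or a coefficientwise automorphism. Formal sums with equal coordinates then have
  images with equal coordinates, so cosets go to cosets.\<close>

lemma tensor_map_coord:
  fixes H :: "'c fls \<Rightarrow> 'c fls"
  assumes V: "coord K V c \<phi>" and W: "coord K W c' \<psi>"
    and H: "\<And>u v. H (u + v) = H u + H v"
    and h: "\<And>a v. v \<in> carrier V \<Longrightarrow> snd (h (a, v)) \<in> carrier W"
      "\<And>a v. v \<in> carrier V \<Longrightarrow> fst (h (a, v)) \<star> c' (snd (h (a, v))) = H (a \<star> c v)"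
    and C: "C \<in> carrier (base_change V)"
  shows "tensor_map V W h C \<in> carrier (base_change W)" "bcoord c' (tensor_map V W h C) = H (bcoord c C)"
proof -
  let ?ext = "frag_extend (\<lambda>p. frag_of (h p))"
  have H0: "H 0 = 0" using H[of 0 0] by (simp only: add_cancel_right_left add_0_left)
  have Hd: "H (u - v) = H u - H v" for u v
    using H[of "u - v" v] by simp
  have ext: "?ext x \<in> carrier (tensor_free W) \<and> tcoord c' (?ext x) = H (tcoord c x)"
    if "x \<in> carrier (tensor_free V)" for x
    using that[unfolded tensor_free_simps]
  proof (induction x rule: frag_induction)
    case (one p)
    then show ?case using h[of "snd p" "fst p"] by (cases "h p") auto
  next
    case (diff a b)
    then show ?case by (auto simp: frag_extend_diff tcoord_diff Hd dest!: subsetD[OF keys_diff])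
  qed (simp add: H0)
  obtain x where x: "x \<in> carrier (tensor_free V)" "C = tensor_rel V #>\<^bsub>tensor_free V\<^esub> x"
    using C by (auto simp: base_change_carrier)
  have "tensor_rel W #>\<^bsub>tensor_free W\<^esub> ?ext y = tensor_rel W #>\<^bsub>tensor_free W\<^esub> ?ext x" if "y \<in> C" for y
  proof -
    have y: "y \<in> carrier (tensor_free V)" "tcoord c y = tcoord c x"
      using that coset_tensor_rel[OF V x(1)] x(2) by auto
    show ?thesis
      using coset_tensor_rel[OF W ext[OF y(1), THEN conjunct1]] coset_tensor_rel[OF W ext[OF x(1), THEN conjunct1]]
        ext[OF y(1)] ext[OF x(1)] y(2) by auto
  qed
  moreover have "x \<in> C" using coset_tensor_rel[OF V x(1)] x by simp
  ultimately have eq: "tensor_map V W h C = tensor_rel W #>\<^bsub>tensor_free W\<^esub> ?ext x"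
    unfolding tensor_map_def by blast
  show "tensor_map V W h C \<in> carrier (base_change W)"
    unfolding eq base_change_carrier using ext[OF x(1)] by blast
  show "bcoord c' (tensor_map V W h C) = H (bcoord c C)"
    using bcoord_coset[OF W ext[OF x(1), THEN conjunct1]] bcoord_coset[OF V x(1)] ext[OF x(1)] eq x(2) by metis
qed

text \<open>Base change keeps \<phi> and only enlarges the field of coefficients.\<close>

lemma coord_base_change:
  assumes V: "coord K V c \<phi>"
  shows "coord UNIV (base_change V) (bcoord c) \<phi>"
proof -
  note V' = coordD[OF V] and LL = laurent_over_simps[OF perfect_subfield_K]
  let ?R = "tensor_rel V" and ?G = "tensor_free V"
  interpret G: comm_group ?G by (rule comm_group_tensor_free)
  have R: "subgroup ?R ?G" by (rule subgroup_tensor_rel[OF V])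
  have norm: "?R \<lhd> ?G" using R by (rule G.subgroup_imp_normal)
  interpret Q: comm_group "?G Mod ?R" by (rule G.abelian_FactGroup[OF R])
  have ab: "abelian_group (base_change V)"
  proof (rule abelian_groupI)
    fix C assume "C \<in> carrier (base_change V)"
    then show "\<exists>C'\<in>carrier (base_change V). C' \<oplus>\<^bsub>base_change V\<^esub> C = \<zero>\<^bsub>base_change V\<^esub>"
      using Q.l_inv_ex[of C] by (simp add: base_change_def del: mult_FactGroup one_FactGroup)
  qed (simp_all add: base_change_def Q.m_ac Q.m_closed del: mult_FactGroup one_FactGroup)
  have lo: "laurent_over (UNIV :: 'c set) = UNIV" by (auto simp: laurent_over_def)
  have cos: "?R #>\<^bsub>?G\<^esub> x \<in> carrier (base_change V)" if "x \<in> carrier ?G" for x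
    using that by (auto simp: base_change_carrier)
  define v0 where "v0 = inv_into (carrier V) c 1"
  have v0: "v0 \<in> carrier V" "c v0 = 1" using V'(11,12)[OF LL(2)] by (auto simp: v0_def)
  have bij: "bij_betw (bcoord c) (carrier (base_change V)) UNIV"
    unfolding bij_betw_def
  proof
    show "inj_on (bcoord c) (carrier (base_change V))"
    proof (rule inj_onI)
      fix C C' assume C: "C \<in> carrier (base_change V)" "C' \<in> carrier (base_change V)" "bcoord c C = bcoord c C'"
      obtain x x' where x: "x \<in> carrier ?G" "C = ?R #>\<^bsub>?G\<^esub> x" "x' \<in> carrier ?G" "C' = ?R #>\<^bsub>?G\<^esub> x'"
        using C(1,2) by (auto simp: base_change_carrier)
      then have "tcoord c x = tcoord c x'" using C(3) bcoord_coset[OF V] by metis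
      then show "C = C'" using coset_tensor_rel[OF V x(1)] coset_tensor_rel[OF V x(3)] x by auto
    qed
    have "u \<in> bcoord c ` carrier (base_change V)" for u
    proof (rule image_eqI)
      have f: "frag_of (u, v0) \<in> carrier ?G" using v0 by simp
      show "?R #>\<^bsub>?G\<^esub> frag_of (u, v0) \<in> carrier (base_change V)" by (rule cos[OF f])
      show "u = bcoord c (?R #>\<^bsub>?G\<^esub> frag_of (u, v0))" using bcoord_coset[OF V f] v0 by simp
    qed
    then show "bcoord c ` carrier (base_change V) = UNIV" by auto
  qed
  have add: "bcoord c (C \<oplus>\<^bsub>base_change V\<^esub> C') = bcoord c C + bcoord c C'"
    if C: "C \<in> carrier (base_change V)" "C' \<in> carrier (base_change V)" for C C'
  proof -
    obtain x x' where x: "x \<in> carrier ?G" "C = ?R #>\<^bsub>?G\<^esub> x" "x' \<in> carrier ?G" "C' = ?R #>\<^bsub>?G\<^esub> x'"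
      using C(1,2) by (auto simp: base_change_carrier)
    have "C \<oplus>\<^bsub>base_change V\<^esub> C' = C <#>\<^bsub>?G\<^esub> C'" by (simp add: base_change_def)
    also have "\<dots> = ?R #>\<^bsub>?G\<^esub> (x \<otimes>\<^bsub>?G\<^esub> x')" using normal.rcos_sum[OF norm x(1,3)] x by simp
    finally show ?thesis
      using x bcoord_coset[OF V G.m_closed[OF x(1,3)]] bcoord_coset[OF V x(1)] bcoord_coset[OF V x(3)]
      by (simp add: tcoord_add)
  qed
  show ?thesis
    unfolding coord_def lo
  proof (intro conjI ballI allI ab bij add; assumption?)
    fix C assume C: "C \<in> carrier (base_change V)"
    have l: "lmul (base_change V) a = tensor_map V V (\<lambda>(b, v). (a \<star> b, v))" for a
      by (simp add: base_change_def skew_mult_eq)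
    have f: "fmul (base_change V) x = tensor_map V V (\<lambda>(b, v). (b, fmul V x v))" for x
      by (simp add: base_change_def)
    show "lmul (base_change V) s C \<in> carrier (base_change V)" "bcoord c (lmul (base_change V) s C) = s \<star> bcoord c C" for s
      unfolding l using C
      by (intro tensor_map_coord[OF V V, where H = "\<lambda>u. s \<star> u"]; simp add: smult_add_right smult_assoc)+
    show "fmul (base_change V) x C \<in> carrier (base_change V)" "bcoord c (fmul (base_change V) x C) = bcoord c C \<star> \<phi> x" for x
      unfolding f using C
      by (intro tensor_map_coord[OF V V, where H = "\<lambda>u. u \<star> \<phi> x"]; simp add: smult_add_left smult_assoc V')+
  qed
qed

lemma galD:
  assumes "\<gamma> \<in> gal"
  shows "\<gamma> (x + y) = \<gamma> x + \<gamma> y" "\<gamma> (x * y) = \<gamma> x * \<gamma> y" "\<gamma> 1 = 1" "\<gamma> 0 = 0" "bij \<gamma>" "x \<in> K \<Longrightarrow> \<gamma> x = x"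
proof -
  have g: "\<gamma> \<in> ring_iso (ring_of_type_algebra :: 'c ring) ring_of_type_algebra" using assms by (simp add: gal_def)
  then have h: "\<gamma> \<in> ring_hom (ring_of_type_algebra :: 'c ring) ring_of_type_algebra"
    and "bij \<gamma>" by (auto simp: ring_iso_def)
  then show "bij \<gamma>" by simp
  show add: "\<gamma> (x + y) = \<gamma> x + \<gamma> y" for x y using ring_hom_add[OF h, of x y] by simp
  show "\<gamma> (x * y) = \<gamma> x * \<gamma> y" using ring_hom_mult[OF h, of x y] by simp
  show "\<gamma> 1 = 1" using ring_hom_one[OF h] by simp
  show "\<gamma> 0 = 0" using add[of 0 0] by (simp only: add_cancel_right_left add_0_left)
  show "x \<in> K \<Longrightarrow> \<gamma> x = x" using assms by (simp add: gal_def)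
qed

lemma coeffwise_gal:
  assumes "\<gamma> \<in> gal"
  shows "coeffwise \<gamma> f $$ n = \<gamma> (f $$ n)" "coeffwise \<gamma> (f + g) = coeffwise \<gamma> f + coeffwise \<gamma> g"
    "coeffwise \<gamma> (f \<star> g) = coeffwise \<gamma> f \<star> coeffwise \<gamma> g" "s \<in> laurent_over K \<Longrightarrow> coeffwise \<gamma> s = s"
proof -
  note g = galD[OF assms]
  show 1: "coeffwise \<gamma> f $$ n = \<gamma> (f $$ n)" for f n by (rule coeffwise_nth[of \<gamma>, OF g(4)])
  show "coeffwise \<gamma> (f + g) = coeffwise \<gamma> f + coeffwise \<gamma> g" by (rule fls_eqI) (simp add: 1 g)
  show "coeffwise \<gamma> (f \<star> g) = coeffwise \<gamma> f \<star> coeffwise \<gamma> g" by (rule coeffwise_smult) (simp_all add: g)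
  show "s \<in> laurent_over K \<Longrightarrow> coeffwise \<gamma> s = s" by (rule fls_eqI) (simp add: 1 g laurent_over_def)
qed

lemma tensor_map_coeffwise:
  assumes V: "coord K V c \<phi>" and \<gamma>: "\<gamma> \<in> gal" and C: "C \<in> carrier (base_change V)"
  shows "tensor_map V V (\<lambda>(b, v). (coeffwise \<gamma> b, v)) C \<in> carrier (base_change V)"
    "bcoord c (tensor_map V V (\<lambda>(b, v). (coeffwise \<gamma> b, v)) C) = coeffwise \<gamma> (bcoord c C)"
  using C
  by (intro tensor_map_coord[OF V V, where H = "coeffwise \<gamma>"];
      simp add: coeffwise_gal[OF \<gamma>] coordD(8)[OF V])+

lemma tensor_map_hom:
  assumes V: "coord K V c \<phi>" and W: "coord K W c' \<psi>" and phi: "\<And>x. \<phi> x \<in> laurent_over K"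
    and h: "h \<in> bimod_hom K V W" and C: "C \<in> carrier (base_change V)"
  shows "tensor_map V W (\<lambda>(b, v). (b, h v)) C \<in> carrier (base_change W)"
    "bcoord c' (tensor_map V W (\<lambda>(b, v). (b, h v)) C) = bcoord c C \<star> hcoord V c c' h"
  using C hcoord(2)[OF perfect_subfield_K perfect_subfield_K subset_refl V W phi h] bimod_homD(1)[OF h]
  by (intro tensor_map_coord[OF V W, where H = "\<lambda>u. u \<star> hcoord V c c' h"]; simp add: smult_add_left smult_assoc)+

end

section \<open>The division algebra and modules of rank one over it\<close>

context drinfeld_setting
begin

lemma laurent_over_UNIV [simp]: "laurent_over (UNIV :: 'c set) = UNIV"
  by (auto simp: laurent_over_def)

lemma hom_characterization:
  assumes L: "perfect_subfield L" and L': "perfect_subfield L'" and sub: "L \<subseteq> L'"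
    and V: "coord L V cV \<phi>" and W: "coord L' W cW \<psi>"
    and phi: "\<And>x. \<phi> x \<in> laurent_over L" and psi: "\<And>x. \<psi> x \<in> laurent_over L'"
    and u: "u \<in> intertwiners L' \<phi> \<psi>" and h: "h \<in> extensional (carrier V)"
    and hv: "\<And>v. v \<in> carrier V \<Longrightarrow> h v \<in> carrier W" "\<And>v. v \<in> carrier V \<Longrightarrow> cW (h v) = cV v \<star> u"
  shows "h \<in> bimod_hom L V W" "hcoord V cV cW h = u"
proof -
  note ho = hom_of[OF L L' sub V W phi psi u]
  have "h = hom_of V cV W cW u"
  proof (rule extensionalityI[OF h])
    show "hom_of V cV W cW u \<in> extensional (carrier V)" by (simp add: hom_of_def)
    fix v assume v: "v \<in> carrier V"
    show "h v = hom_of V cV W cW u v"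
      using coordD(9)[OF W hv(1)[OF v] bimod_homD(1)[OF ho(1) v]] hv(2)[OF v] ho(3)[OF v] by simp
  qed
  then show "h \<in> bimod_hom L V W" "hcoord V cV cW h = u" using ho by auto
qed

lemma intertwiners_closed:
  assumes L: "perfect_subfield L"
  shows "0 \<in> intertwiners L \<phi> \<psi>"
    "u \<in> intertwiners L \<phi> \<psi> \<Longrightarrow> w \<in> intertwiners L \<phi> \<psi> \<Longrightarrow> u + w \<in> intertwiners L \<phi> \<psi>"
    "u \<in> intertwiners L \<phi> \<psi> \<Longrightarrow> w \<in> intertwiners L \<phi> \<psi> \<Longrightarrow> u - w \<in> intertwiners L \<phi> \<psi>"
    "u \<in> intertwiners L \<phi> \<psi> \<Longrightarrow> - u \<in> intertwiners L \<phi> \<psi>"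
    "1 \<in> intertwiners L \<phi> \<phi>"
  using laurent_over_simps[OF L]
  by (auto simp: intertwiners_def smult_add_left smult_add_right smult_diff_left smult_diff_right smult_uminus)

end

lemma finsum_singleton:
  assumes "abelian_group W" "f b \<in> carrier W"
  shows "finsum W f {b} = f b"
proof -
  interpret W: abelian_group W by (rule assms(1))
  show ?thesis using W.finsum_insert[of "{}" b f] assms(2) by simp
qed

locale drinfeld_module = drinfeld_setting embK embF K val z
  for embK :: "'q::{finite, field} \<Rightarrow> 'c::field" and embF :: "'q \<Rightarrow> 'f::field"
    and K :: "'c set" and val :: "'f \<Rightarrow> int" and z :: 'f +
  fixes J :: "('c fls, 'f, 'j) bimod" and cJ :: "'j \<Rightarrow> 'c fls" and \<phi>J :: "'f \<Rightarrow> 'c fls" and e :: int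
  assumes J: "coord Fbar J cJ \<phi>J" and phiJ: "phom e Fbar \<phi>J"
begin

lemmas J' = coordD[OF J] and phiJ' = phomD[OF phiJ]
lemmas F' = laurent_over_simps[OF perfect_subfield_Fbar]

definition DD :: "'c fls set" where "DD = intertwiners Fbar \<phi>J \<phi>J"

text \<open>A self-intertwiner over the big field commutes with \<phi>(z), a series of positive
  order over \<open>Fbar\<close>; this already forces its coefficients into
  \<open>Fbar\<close>.\<close>

lemma DD_eq: "DD = intertwiners UNIV \<phi>J \<phi>J"
proof -
  have "u \<in> laurent_over Fbar" if "\<And>x. \<phi>J x \<star> u = u \<star> \<phi>J x" for u
  proof (rule conjugate_over_Fbar[OF phiJ'(1) _ phiJ'(2) _ _ phiJ'(2) that])
    show "vanish e (\<phi>J z)" using phiJ'(7)[of z 1] uniformizer by (simp add: vball_iff)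
    then show "vanish e (\<phi>J z)" .
    show "\<phi>J z $$ e \<noteq> 0" using phiJ'(15)[of z] uniformizer by simp
  qed
  then show ?thesis by (auto simp: DD_def intertwiners_def)
qed

lemma DD_Fbar: "d \<in> DD \<Longrightarrow> d \<in> laurent_over Fbar"
  by (simp add: DD_def intertwiners_def)

lemma DD_comm: "d \<in> DD \<Longrightarrow> \<phi>J x \<star> d = d \<star> \<phi>J x"
  by (simp add: DD_def intertwiners_def)

lemma DD_closed:
  "0 \<in> DD" "1 \<in> DD" "d \<in> DD \<Longrightarrow> d' \<in> DD \<Longrightarrow> d + d' \<in> DD" "d \<in> DD \<Longrightarrow> d' \<in> DD \<Longrightarrow> d - d' \<in> DD"
  "d \<in> DD \<Longrightarrow> - d \<in> DD" "d \<in> DD \<Longrightarrow> d' \<in> DD \<Longrightarrow> d \<star> d' \<in> DD" "d \<in> DD \<Longrightarrow> d \<noteq> 0 \<Longrightarrow> sinv d \<in> DD"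
  "\<phi>J x \<in> DD"
  using intertwiners_closed[OF perfect_subfield_Fbar] intertwiners_smult[OF perfect_subfield_Fbar]
    intertwiners_sinv[OF perfect_subfield_Fbar] phiJ'(2,11)
  by (auto simp: DD_def) (auto simp: intertwiners_def)

definition dcoord :: "('j \<Rightarrow> 'j) \<Rightarrow> 'c fls" where "dcoord = hcoord J cJ cJ"

lemma dcoord_DD: "a \<in> carrier (EndJ J) \<Longrightarrow> dcoord a \<in> DD"
  and dcoord_app: "a \<in> carrier (EndJ J) \<Longrightarrow> v \<in> carrier J \<Longrightarrow> cJ (a v) = cJ v \<star> dcoord a"
  using hcoord[OF perfect_subfield_Fbar perfect_subfield_Fbar subset_refl J J phiJ'(2)]
  by (auto simp: dcoord_def DD_def EndJ_def)

lemma dcoord_inject: "a \<in> carrier (EndJ J) \<Longrightarrow> b \<in> carrier (EndJ J) \<Longrightarrow> dcoord a = dcoord b \<Longrightarrow> a = b"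
  using hcoord_inject[OF perfect_subfield_Fbar perfect_subfield_Fbar subset_refl J J phiJ'(2)]
  by (auto simp: dcoord_def EndJ_def)

lemma dcoord_surj:
  assumes "d \<in> DD"
  obtains a where "a \<in> carrier (EndJ J)" "dcoord a = d"
  using hom_of(1,2)[OF perfect_subfield_Fbar perfect_subfield_Fbar subset_refl J J phiJ'(2) phiJ'(2)] assms that
  by (auto simp: dcoord_def DD_def EndJ_def)

lemma EndJ_app: "a \<in> carrier (EndJ J) \<Longrightarrow> v \<in> carrier J \<Longrightarrow> a v \<in> carrier J"
  by (auto simp: EndJ_def dest: bimod_homD(1))

lemma EndJ_characterization:
  assumes "d \<in> DD" "h \<in> extensional (carrier J)" "\<And>v. v \<in> carrier J \<Longrightarrow> h v \<in> carrier J"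
    "\<And>v. v \<in> carrier J \<Longrightarrow> cJ (h v) = cJ v \<star> d"
  shows "h \<in> carrier (EndJ J)" "dcoord h = d"
  using hom_characterization[OF perfect_subfield_Fbar perfect_subfield_Fbar subset_refl J J phiJ'(2) phiJ'(2), of d h] assms
  by (auto simp: dcoord_def DD_def EndJ_def)

lemma EndJ_add:
  assumes "a \<in> carrier (EndJ J)" "b \<in> carrier (EndJ J)"
  shows "a \<oplus>\<^bsub>EndJ J\<^esub> b \<in> carrier (EndJ J)" "dcoord (a \<oplus>\<^bsub>EndJ J\<^esub> b) = dcoord a + dcoord b"
  using EndJ_characterization[of "dcoord a + dcoord b" "a \<oplus>\<^bsub>EndJ J\<^esub> b"] assms
    EndJ_app dcoord_app dcoord_DD DD_closed(3) J'(3,13)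
  by (auto simp: EndJ_def smult_add_right)

lemma EndJ_mult:
  assumes "a \<in> carrier (EndJ J)" "b \<in> carrier (EndJ J)"
  shows "a \<otimes>\<^bsub>EndJ J\<^esub> b \<in> carrier (EndJ J)" "dcoord (a \<otimes>\<^bsub>EndJ J\<^esub> b) = dcoord b \<star> dcoord a"
proof -
  have "cJ (a (b v)) = cJ v \<star> (dcoord b \<star> dcoord a)" if "v \<in> carrier J" for v
    using dcoord_app[OF assms(1) EndJ_app[OF assms(2) that]] dcoord_app[OF assms(2) that] by (simp add: smult_assoc)
  then show "a \<otimes>\<^bsub>EndJ J\<^esub> b \<in> carrier (EndJ J)" "dcoord (a \<otimes>\<^bsub>EndJ J\<^esub> b) = dcoord b \<star> dcoord a"
    using EndJ_characterization[of "dcoord b \<star> dcoord a" "a \<otimes>\<^bsub>EndJ J\<^esub> b"] assms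
      EndJ_app dcoord_DD DD_closed(6)
    by (auto simp: EndJ_def compose_def)
qed

lemma EndJ_one: "\<one>\<^bsub>EndJ J\<^esub> \<in> carrier (EndJ J)" "dcoord \<one>\<^bsub>EndJ J\<^esub> = 1"
  using EndJ_characterization[of 1 "\<one>\<^bsub>EndJ J\<^esub>"] DD_closed(2) by (auto simp: EndJ_def)

lemma EndJ_zero: "\<zero>\<^bsub>EndJ J\<^esub> \<in> carrier (EndJ J)" "dcoord \<zero>\<^bsub>EndJ J\<^esub> = 0"
  using EndJ_characterization[of 0 "\<zero>\<^bsub>EndJ J\<^esub>"] DD_closed(1) J'(10,14) by (auto simp: EndJ_def)

lemma scalar_EndJ: "scalar J x \<in> carrier (EndJ J)" "dcoord (scalar J x) = \<phi>J x"
  using EndJ_characterization[of "\<phi>J x" "scalar J x"] DD_closed(8) J'(6,7) by (auto simp: scalar_def)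

lemma ring_EndJ: "ring (EndJ J)"
proof (rule ringI)
  show "abelian_group (EndJ J)"
  proof (rule abelian_groupI)
    fix a assume a: "a \<in> carrier (EndJ J)"
    obtain b where "b \<in> carrier (EndJ J)" "dcoord b = - dcoord a"
      using dcoord_surj[OF DD_closed(5)[OF dcoord_DD[OF a]]] .
    then show "\<exists>b\<in>carrier (EndJ J). b \<oplus>\<^bsub>EndJ J\<^esub> a = \<zero>\<^bsub>EndJ J\<^esub>"
      using a by (intro bexI[of _ b] dcoord_inject) (auto simp: EndJ_add EndJ_zero)
  qed (auto intro!: dcoord_inject simp: EndJ_add EndJ_zero add.assoc add.commute)
  show "Group.monoid (EndJ J)"
    by (rule monoidI) (auto intro!: dcoord_inject simp: EndJ_mult EndJ_one smult_assoc)
qed (auto intro!: dcoord_inject simp: EndJ_add EndJ_mult smult_add_left smult_add_right)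

text \<open>Coordinates on a right module that is free of rank one. Right multiplication by an
  endomorphism becomes left multiplication by its coordinate, because \<open>dcoord\<close> reverses
  products.\<close>

definition rcoord :: "('j \<Rightarrow> 'j, 'c, 'w) wrep \<Rightarrow> ('w \<Rightarrow> 'c fls) \<Rightarrow> bool" where
  "rcoord W c \<longleftrightarrow> abelian_group W \<and> bij_betw c (carrier W) DD \<and>
    (\<forall>v\<in>carrier W. \<forall>w\<in>carrier W. c (v \<oplus>\<^bsub>W\<^esub> w) = c v + c w) \<and>
    (\<forall>w\<in>carrier W. \<forall>a\<in>carrier (EndJ J). rmul W w a \<in> carrier W \<and> c (rmul W w a) = dcoord a \<star> c w)"

lemma rcoordD:
  assumes "rcoord W c"
  shows "abelian_group W" "bij_betw c (carrier W) DD"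
    "v \<in> carrier W \<Longrightarrow> w \<in> carrier W \<Longrightarrow> c (v \<oplus>\<^bsub>W\<^esub> w) = c v + c w"
    "w \<in> carrier W \<Longrightarrow> a \<in> carrier (EndJ J) \<Longrightarrow> rmul W w a \<in> carrier W"
    "w \<in> carrier W \<Longrightarrow> a \<in> carrier (EndJ J) \<Longrightarrow> c (rmul W w a) = dcoord a \<star> c w"
    "w \<in> carrier W \<Longrightarrow> c w \<in> DD"
    "v \<in> carrier W \<Longrightarrow> w \<in> carrier W \<Longrightarrow> c v = c w \<longleftrightarrow> v = w"
    "c \<zero>\<^bsub>W\<^esub> = 0" "v \<in> carrier W \<Longrightarrow> w \<in> carrier W \<Longrightarrow> v \<oplus>\<^bsub>W\<^esub> w \<in> carrier W" "\<zero>\<^bsub>W\<^esub> \<in> carrier W"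
    "w \<in> carrier W \<Longrightarrow> rmul W w (scalar J x) \<in> carrier W"
    "w \<in> carrier W \<Longrightarrow> c (rmul W w (scalar J x)) = \<phi>J x \<star> c w"
proof -
  show W: "abelian_group W" and bij: "bij_betw c (carrier W) DD"
    and add: "\<And>v w. v \<in> carrier W \<Longrightarrow> w \<in> carrier W \<Longrightarrow> c (v \<oplus>\<^bsub>W\<^esub> w) = c v + c w"
    and r1: "\<And>w a. w \<in> carrier W \<Longrightarrow> a \<in> carrier (EndJ J) \<Longrightarrow> rmul W w a \<in> carrier W"
    and r2: "\<And>w a. w \<in> carrier W \<Longrightarrow> a \<in> carrier (EndJ J) \<Longrightarrow> c (rmul W w a) = dcoord a \<star> c w"
    using assms by (auto simp: rcoord_def)
  interpret W: abelian_group W by (rule W)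
  show "w \<in> carrier W \<Longrightarrow> c w \<in> DD" using bij by (auto simp: bij_betw_def)
  show "v \<in> carrier W \<Longrightarrow> w \<in> carrier W \<Longrightarrow> c v = c w \<longleftrightarrow> v = w"
    using bij by (auto simp: bij_betw_def inj_on_def)
  show "c \<zero>\<^bsub>W\<^esub> = 0" using add[of "\<zero>\<^bsub>W\<^esub>" "\<zero>\<^bsub>W\<^esub>"] by (simp only: W.zero_closed W.r_zero add_cancel_right_left)
  show "v \<in> carrier W \<Longrightarrow> w \<in> carrier W \<Longrightarrow> v \<oplus>\<^bsub>W\<^esub> w \<in> carrier W" "\<zero>\<^bsub>W\<^esub> \<in> carrier W" by simp_all
  show "w \<in> carrier W \<Longrightarrow> rmul W w (scalar J x) \<in> carrier W"
    "w \<in> carrier W \<Longrightarrow> c (rmul W w (scalar J x)) = \<phi>J x \<star> c w"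
    using r1 r2 scalar_EndJ by simp_all
qed

lemma rcoord_surj:
  assumes "rcoord W c" "d \<in> DD"
  obtains w where "w \<in> carrier W" "c w = d"
  using rcoordD(2)[OF assms(1)] assms(2) that by (metis bij_betw_iff_bijections)

lemma rcoord_right_module:
  assumes "rcoord W c"
  shows "right_module (EndJ J) W (rmul W)" "has_rank (EndJ J) W (\<lambda>a w. rmul W w a) 1"
proof -
  note W = rcoordD[OF assms]
  interpret R: ring "EndJ J" by (rule ring_EndJ)
  show "right_module (EndJ J) W (rmul W)"
    unfolding right_module_def
  proof (intro conjI ballI ring_EndJ W(1) W(4); assumption?)
    fix a v assume a: "a \<in> carrier (EndJ J)" and v: "v \<in> carrier W"
    { fix w assume w: "w \<in> carrier W"
      show "rmul W (v \<oplus>\<^bsub>W\<^esub> w) a = rmul W v a \<oplus>\<^bsub>W\<^esub> rmul W w a"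
        using a v w by (subst W(7)[symmetric]) (simp_all add: W smult_add_right) }
    { fix b assume b: "b \<in> carrier (EndJ J)"
      show "rmul W v (a \<oplus>\<^bsub>EndJ J\<^esub> b) = rmul W v a \<oplus>\<^bsub>W\<^esub> rmul W v b"
        using a b v by (subst W(7)[symmetric]) (simp_all add: W EndJ_add smult_add_left)
      show "rmul W v (a \<otimes>\<^bsub>EndJ J\<^esub> b) = rmul W (rmul W v a) b"
        using a b v by (subst W(7)[symmetric]) (simp_all add: W EndJ_mult smult_assoc) }
  next
    fix v assume v: "v \<in> carrier W"
    show "rmul W v \<one>\<^bsub>EndJ J\<^esub> = v"
      using v by (subst W(7)[symmetric]) (simp_all add: W EndJ_one)
  qed
  obtain b where b: "b \<in> carrier W" "c b = 1" using rcoord_surj[OF assms DD_closed(2)] .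
  have fs: "finsum W (\<lambda>x. rmul W x (k x)) {b} = rmul W b (k b)" if "k b \<in> carrier (EndJ J)" for k
    using finsum_singleton[OF W(1), of "\<lambda>x. rmul W x (k x)" b] W(4)[OF b(1) that] by simp
  have "is_basis (EndJ J) W (\<lambda>a w. rmul W w a) {b}"
    unfolding is_basis_def
  proof (intro conjI ballI)
    fix v assume v: "v \<in> carrier W"
    obtain a where a: "a \<in> carrier (EndJ J)" "dcoord a = c v" using dcoord_surj[OF W(6)[OF v]] .
    have eq: "rmul W b a = v" using a b v by (subst W(7)[symmetric]) (simp_all add: W)
    show "\<exists>!k. k \<in> {b} \<rightarrow>\<^sub>E carrier (EndJ J) \<and> v = finsum W (\<lambda>x. rmul W x (k x)) {b}"
    proof (rule ex1I[of _ "\<lambda>x\<in>{b}. a"])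
      show "(\<lambda>x\<in>{b}. a) \<in> {b} \<rightarrow>\<^sub>E carrier (EndJ J) \<and> v = finsum W (\<lambda>x. rmul W x ((\<lambda>x\<in>{b}. a) x)) {b}"
        using fs[of "\<lambda>x\<in>{b}. a"] a eq by auto
      fix k assume k: "k \<in> {b} \<rightarrow>\<^sub>E carrier (EndJ J) \<and> v = finsum W (\<lambda>x. rmul W x (k x)) {b}"
      then have kb: "k b \<in> carrier (EndJ J)" by auto
      then have "v = rmul W b (k b)" using fs[of k] k by simp
      then have "dcoord (k b) = dcoord a" using W(5)[OF b(1) kb] a b by simp
      then have "k b = a" using dcoord_inject kb a by blast
      then show "k = (\<lambda>x\<in>{b}. a)" using k by (auto simp: PiE_def extensional_def fun_eq_iff)
    qed
  qed (use b in auto)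
  then show "has_rank (EndJ J) W (\<lambda>a w. rmul W w a) 1" unfolding has_rank_def by (intro exI[of _ "{b}"]) simp
qed

text \<open>Each vector is b a for a unique endomorphism a, where b is the basis vector; its
  coordinate is \<open>dcoord a\<close>.\<close>

lemma rank_one_rcoord:
  assumes rm: "right_module (EndJ J) W (rmul W)" and rk: "has_rank (EndJ J) W (\<lambda>a w. rmul W w a) 1"
  obtains c where "rcoord W c"
proof -
  have W: "abelian_group W" using rm by (simp add: right_module_def)
  have r: "\<And>a v. a \<in> carrier (EndJ J) \<Longrightarrow> v \<in> carrier W \<Longrightarrow> rmul W v a \<in> carrier W"
    "\<And>a b v. a \<in> carrier (EndJ J) \<Longrightarrow> b \<in> carrier (EndJ J) \<Longrightarrow> v \<in> carrier W \<Longrightarrow> rmul W v (a \<oplus>\<^bsub>EndJ J\<^esub> b) = rmul W v a \<oplus>\<^bsub>W\<^esub> rmul W v b"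
    "\<And>a b v. a \<in> carrier (EndJ J) \<Longrightarrow> b \<in> carrier (EndJ J) \<Longrightarrow> v \<in> carrier W \<Longrightarrow> rmul W v (a \<otimes>\<^bsub>EndJ J\<^esub> b) = rmul W (rmul W v a) b"
    using rm by (auto simp: right_module_def)
  obtain B where B: "is_basis (EndJ J) W (\<lambda>a w. rmul W w a) B" "card B = 1" using rk by (auto simp: has_rank_def)
  then obtain b where Bb: "B = {b}" by (auto simp: card_1_singleton_iff)
  have bW: "b \<in> carrier W" using B Bb by (auto simp: is_basis_def)
  have ex: "\<exists>!k. k \<in> {b} \<rightarrow>\<^sub>E carrier (EndJ J) \<and> v = finsum W (\<lambda>b. rmul W b (k b)) {b}" if "v \<in> carrier W" for v
    using B(1) that unfolding is_basis_def Bb by simp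
  have fs: "finsum W (\<lambda>x. rmul W x (k x)) {b} = rmul W b (k b)" if "k b \<in> carrier (EndJ J)" for k
    using finsum_singleton[OF W, of "\<lambda>x. rmul W x (k x)" b] r(1)[OF that bW] by simp
  have "\<exists>!a. a \<in> carrier (EndJ J) \<and> rmul W b a = v" if v: "v \<in> carrier W" for v
  proof -
    obtain k where k: "k \<in> {b} \<rightarrow>\<^sub>E carrier (EndJ J)" "v = finsum W (\<lambda>b. rmul W b (k b)) {b}"
      and un: "\<And>k'. k' \<in> {b} \<rightarrow>\<^sub>E carrier (EndJ J) \<Longrightarrow> v = finsum W (\<lambda>b. rmul W b (k' b)) {b} \<Longrightarrow> k' = k"
      using ex[OF v] by blast
    show ?thesis
    proof (rule ex1I[of _ "k b"])
      have kb: "k b \<in> carrier (EndJ J)" using k(1) by auto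
      then show "k b \<in> carrier (EndJ J) \<and> rmul W b (k b) = v" using k(2) fs[of k] by simp
      fix a assume a: "a \<in> carrier (EndJ J) \<and> rmul W b a = v"
      have "(\<lambda>x\<in>{b}. a) = k" using a fs[of "\<lambda>x\<in>{b}. a"] by (intro un) auto
      then show "a = k b" by auto
    qed
  qed
  then obtain g where g: "\<And>v. v \<in> carrier W \<Longrightarrow> g v \<in> carrier (EndJ J) \<and> rmul W b (g v) = v"
    and gu: "\<And>v a. v \<in> carrier W \<Longrightarrow> a \<in> carrier (EndJ J) \<Longrightarrow> rmul W b a = v \<Longrightarrow> a = g v"
    by metis
  interpret R: ring "EndJ J" by (rule ring_EndJ)
  have "rcoord W (\<lambda>v. dcoord (g v))"
    unfolding rcoord_def
  proof (intro conjI ballI W r(1); assumption?)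
    show "bij_betw (\<lambda>v. dcoord (g v)) (carrier W) DD"
      unfolding bij_betw_def
    proof
      show "inj_on (\<lambda>v. dcoord (g v)) (carrier W)"
        by (rule inj_onI) (metis g dcoord_inject)
      show "(\<lambda>v. dcoord (g v)) ` carrier W = DD"
      proof
        show "(\<lambda>v. dcoord (g v)) ` carrier W \<subseteq> DD" using g dcoord_DD by auto
        show "DD \<subseteq> (\<lambda>v. dcoord (g v)) ` carrier W"
        proof
          fix d assume "d \<in> DD"
          then obtain a where a: "a \<in> carrier (EndJ J)" "dcoord a = d" by (rule dcoord_surj)
          then have "a = g (rmul W b a)" using gu r(1)[OF a(1) bW] by blast
          then show "d \<in> (\<lambda>v. dcoord (g v)) ` carrier W" using a r(1)[OF a(1) bW] by (intro image_eqI[of _ _ "rmul W b a"]) auto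
        qed
      qed
    qed
    fix v assume v: "v \<in> carrier W"
    { fix w assume w: "w \<in> carrier W"
      have "g v \<oplus>\<^bsub>EndJ J\<^esub> g w = g (v \<oplus>\<^bsub>W\<^esub> w)"
        using g[OF v] g[OF w] r(2)[of "g v" "g w" b] bW v w abelian_group.axioms(1)[OF W, THEN abelian_monoid.a_closed]
        by (intro gu) auto
      then show "dcoord (g (v \<oplus>\<^bsub>W\<^esub> w)) = dcoord (g v) + dcoord (g w)"
        using EndJ_add(2)[of "g v" "g w"] g[OF v] g[OF w] by simp }
    { fix a assume a: "a \<in> carrier (EndJ J)"
      have "g v \<otimes>\<^bsub>EndJ J\<^esub> a = g (rmul W v a)"
        using g[OF v] a r(3)[of "g v" a b] bW v r(1)[OF a v] by (intro gu) auto
      then show "dcoord (g (rmul W v a)) = dcoord a \<star> dcoord (g v)"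
        using EndJ_mult(2)[of "g v" a] g[OF v] a by simp }
  qed
  then show ?thesis by (rule that)
qed

end

section \<open>Lattices\<close>

context drinfeld_module
begin

text \<open>Comparing leading terms in \<phi>(z) d = d \<phi>(z) gives a homogeneous Frobenius
  equation with finitely many solutions.\<close>

lemma finite_leading_coefficients: "finite {d $$ n | d. d \<in> DD \<and> vanish n d}"
proof -
  let ?a = "\<phi>J z $$ e"
  have z: "vanish e (\<phi>J z)" "?a \<noteq> 0"
    using phiJ'(7)[of z 1] phiJ'(15)[of z] uniformizer by (auto simp: vball_iff)
  have "{d $$ n | d. d \<in> DD \<and> vanish n d} \<subseteq> {y. ?a * fr (- e) y = fr (- n) ?a * y}"
  proof clarify
    fix d assume d: "d \<in> DD" "vanish n d"
    have "(\<phi>J z \<star> d) $$ (e + n) = (d \<star> \<phi>J z) $$ (n + e)" using DD_comm[OF d(1), of z] by (simp add: add.commute)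
    then show "?a * fr (- e) (d $$ n) = fr (- n) ?a * d $$ n"
      using smult_lead[OF z(1) d(2)] smult_lead[OF d(2) z(1)] by (simp add: mult.commute)
  qed
  moreover have "finite {y. ?a * fr (- e) y = fr (- n) ?a * y}"
    using z(2) by (intro finite_frob_eigen phiJ'(1)) simp
  ultimately show ?thesis using finite_subset by blast
qed

text \<open>Successive quotients of the filtration on \<open>DD\<close> are finite, so a ball modulo
  a smaller one has finitely many representatives; one coefficient is adjusted at a time.\<close>

lemma finite_representatives:
  "\<exists>R. finite R \<and> R \<subseteq> {d \<in> DD. vanish n d} \<and> (\<forall>d\<in>DD. vanish n d \<longrightarrow> (\<exists>x\<in>R. vanish (n + int k) (d - x)))"
proof (induction k)
  case 0
  show ?case by (rule exI[of _ "{0}"]) (auto simp: DD_closed)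
next
  case (Suc k)
  then obtain R where R: "finite R" "R \<subseteq> {d \<in> DD. vanish n d}"
    "\<And>d. d \<in> DD \<Longrightarrow> vanish n d \<Longrightarrow> \<exists>x\<in>R. vanish (n + int k) (d - x)" by blast
  let ?m = "n + int k"
  let ?S = "{d $$ ?m | d. d \<in> DD \<and> vanish ?m d}"
  define g where "g s = (SOME d. d \<in> DD \<and> vanish ?m d \<and> d $$ ?m = s)" for s
  have g: "g s \<in> DD \<and> vanish ?m (g s) \<and> g s $$ ?m = s" if s: "s \<in> ?S" for s
  proof -
    have "\<exists>d. d \<in> DD \<and> vanish ?m d \<and> d $$ ?m = s" using s by auto
    then show ?thesis unfolding g_def by (rule someI_ex)
  qed
  show ?case
  proof (intro exI conjI ballI impI)
    show "finite ((\<lambda>(x, s). x + g s) ` (R \<times> ?S))"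
      by (intro finite_imageI finite_cartesian_product R finite_leading_coefficients)
    show "(\<lambda>(x, s). x + g s) ` (R \<times> ?S) \<subseteq> {d \<in> DD. vanish n d}"
    proof clarsimp
      fix x d assume x: "x \<in> R" and d: "d \<in> DD" "vanish ?m d"
      then have "d $$ ?m \<in> ?S" by auto
      from g[OF this] have "g (d $$ ?m) \<in> DD" "vanish n (g (d $$ ?m))" by (auto elim: vanish_mono)
      then show "x + g (d $$ ?m) \<in> DD \<and> vanish n (x + g (d $$ ?m))"
        using R(2) x by (auto intro: DD_closed vanish_add)
    qed
    fix d assume d: "d \<in> DD" "vanish n d"
    then obtain x where x: "x \<in> R" "vanish ?m (d - x)" using R(3) by blast
    have dx: "d - x \<in> DD" using d x R(2) by (auto intro: DD_closed)
    define s where "s = (d - x) $$ ?m"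
    have s: "s \<in> ?S" unfolding s_def using dx x(2) by blast
    have "vanish (n + int (Suc k)) (d - (x + g s))"
      unfolding vanish_def
    proof (intro allI impI)
      fix i assume i: "i < n + int (Suc k)"
      show "(d - (x + g s)) $$ i = 0"
      proof (cases "i = ?m")
        case True then show ?thesis using g[OF s] by (simp add: s_def)
      next
        case False
        then have "i < ?m" using i by simp
        then show ?thesis using g[OF s] x(2) by (simp add: vanish_def)
      qed
    qed
    then show "\<exists>y\<in>(\<lambda>(x, s). x + g s) ` (R \<times> ?S). vanish (n + int (Suc k)) (d - y)"
      using x(1) s by (intro bexI[of _ "x + g s"]) auto
  qed
qed

text \<open>Successive approximation with representatives modulo the uniformizer expresses an element
  as a combination of finitely many generators with power series in the uniformizer as coefficients.\<close>

lemma finite_generators: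
  obtains R where "finite R" "R \<subseteq> {d \<in> DD. vanish n d}"
    "\<And>d. d \<in> DD \<Longrightarrow> vanish n d \<Longrightarrow> \<exists>k. (\<forall>x\<in>R. k x \<in> vball 0) \<and> d = (\<Sum>x\<in>R. \<phi>J (k x) \<star> x)"
proof -
  obtain R where R: "finite R" "R \<subseteq> {d \<in> DD. vanish n d}"
    "\<And>d. d \<in> DD \<Longrightarrow> vanish n d \<Longrightarrow> \<exists>x\<in>R. vanish (n + int (nat e)) (d - x)"
    using finite_representatives[of n "nat e"] by blast
  have e: "int (nat e) = e" using phiJ'(1) by simp
  let ?E = "{d \<in> DD. vanish n d}"
  obtain g where g: "\<And>d. d \<in> ?E \<Longrightarrow> g d \<in> R \<and> vanish (n + e) (d - g d)"
    using R(3) unfolding e by (metis (no_types, lifting) mem_Collect_eq)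
  \<comment> \<open>Modulo order n + e an element is its representative \<open>g d\<close>; dividing
    the rest by \<phi>(z), which has order \<open>e\<close>, returns it to the original
    ball.\<close>
  define nx where "nx d = \<phi>J (inverse z) \<star> (d - g d)" for d
  have zinv: "vanish (- e) (\<phi>J (inverse z))"
    using phiJ'(7)[of "inverse z" "- 1"] uniformizer val_inverse by (simp add: vball_iff)
  have nx: "nx d \<in> ?E" if "d \<in> ?E" for d
  proof -
    have "vanish (- e + (n + e)) (nx d)" unfolding nx_def using g[OF that] by (intro vanish_smult zinv) auto
    moreover have "nx d \<in> DD" unfolding nx_def using g[OF that] that R(2) by (intro DD_closed) auto
    ultimately show ?thesis by simp
  qed
  have dec: "d = g d + \<phi>J z \<star> nx d" for d
    using phiJ'(12)[OF uniformizer(1)] by (simp add: nx_def flip: smult_assoc)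
  have "\<exists>k. (\<forall>x\<in>R. k x \<in> vball 0) \<and> d = (\<Sum>x\<in>R. \<phi>J (k x) \<star> x)" if d: "d \<in> DD" "vanish n d" for d
  proof -
    define D where "D i = (nx ^^ i) d" for i
    have D: "D i \<in> ?E" for i by (induction i) (use d nx in \<open>auto simp: D_def\<close>)
    \<comment> \<open>The coefficient of a generator \<open>x\<close> collects the powers z^j for
      the steps j at which \<open>x\<close> was the representative.\<close>
    define a where "a x i = (\<Sum>j<i. if g (D j) = x then z ^ j else 0)" for x i
    have part: "d = (\<Sum>x\<in>R. \<phi>J (a x i) \<star> x) + \<phi>J (z ^ i) \<star> D i" for i
    proof (induction i)
      case 0
      then show ?case by (simp add: a_def D_def phiJ'(5,8))
    next
      case (Suc i)
      have DS: "D (Suc i) = nx (D i)" by (simp add: D_def)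
      have "\<phi>J (a x (Suc i)) \<star> x = \<phi>J (a x i) \<star> x + (if g (D i) = x then \<phi>J (z ^ i) \<star> x else 0)" for x
        by (simp add: a_def phiJ'(3,8) smult_add_left)
      then have "(\<Sum>x\<in>R. \<phi>J (a x (Suc i)) \<star> x) = (\<Sum>x\<in>R. \<phi>J (a x i) \<star> x) + \<phi>J (z ^ i) \<star> g (D i)"
        using g[OF D[of i]] R(1) by (simp add: sum.distrib sum.delta')
      moreover have "\<phi>J (z ^ i) \<star> D i = \<phi>J (z ^ i) \<star> g (D i) + \<phi>J (z ^ Suc i) \<star> D (Suc i)"
      proof -
        have hS: "\<phi>J (z ^ Suc i) = \<phi>J (z ^ i) \<star> \<phi>J z" using phiJ'(4)[of "z ^ i" z] by (simp add: mult.commute)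
        show ?thesis unfolding DS hS by (subst dec[of "D i"]) (simp add: smult_add_right smult_assoc)
      qed
      ultimately show ?case using Suc by (simp add: add.assoc)
    qed
    have "\<exists>k. \<forall>i. k - a x i \<in> vball (0 + int i)" for x
    proof (rule complete_limit[of "a x" 0])
      show "a x (Suc i) - a x i \<in> vball (0 + int i)" for i
        using vball_z_powi[of "int i"] by (simp add: a_def)
    qed blast
    then obtain k where k: "\<And>x i. k x - a x i \<in> vball (int i)" by (metis add_0)
    have "k x \<in> vball 0" for x using k[of x 0] by (simp add: a_def)
    moreover have "d - (\<Sum>x\<in>R. \<phi>J (k x) \<star> x) = 0"
    proof (rule vanish_all_imp_0[of n])
      fix i :: nat
      have sumv: "vanish m (sum h A)" if "\<And>x. x \<in> A \<Longrightarrow> vanish m (h x)" for m and h :: "'c fls \<Rightarrow> 'c fls" and A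
        using that by (induction A rule: infinite_finite_induct) (auto intro: vanish_add)
      have le: "n + int i \<le> e * int i + n" using phiJ'(1) mult_right_mono[of 1 e "int i"] by simp
      have "d - (\<Sum>x\<in>R. \<phi>J (k x) \<star> x) = \<phi>J (z ^ i) \<star> D i - (\<Sum>x\<in>R. \<phi>J (k x - a x i) \<star> x)"
        by (subst part[of i]) (simp add: phiJ'(10) smult_diff_left sum_subtractf)
      also have "vanish (e * int i + n) \<dots>"
      proof (intro vanish_diff vanish_smult sumv)
        show "vanish (e * int i) (\<phi>J (z ^ i))" using vball_z_powi[of "int i"] by (intro phiJ'(7)) simp
        show "vanish (e * int i) (\<phi>J (k x - a x i))" for x using k by (intro phiJ'(7))
      qed (use D R(2) in auto)
      finally show "vanish (n + int i) (d - (\<Sum>x\<in>R. \<phi>J (k x) \<star> x))" using vanish_mono[OF _ le] by blast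
    qed
    ultimately show ?thesis by (intro exI[of _ k]) simp
  qed
  then show ?thesis by (rule that[OF R(1,2)])
qed

section \<open>Lattices against valuation balls\<close>

abbreviation scmul :: "('j \<Rightarrow> 'j, 'c, 'w) wrep \<Rightarrow> 'f \<Rightarrow> 'w \<Rightarrow> 'w" where
  "scmul W x w \<equiv> rmul W w (scalar J x)"

lemma rcoord_finsum:
  assumes W: "rcoord W c" and "finite B" "\<And>b. b \<in> B \<Longrightarrow> f b \<in> carrier W"
  shows "finsum W f B \<in> carrier W \<and> c (finsum W f B) = (\<Sum>b\<in>B. c (f b))"
proof -
  note W' = rcoordD[OF W]
  interpret W: abelian_group W by (rule W')
  show ?thesis using assms(2,3)
  proof (induction B rule: finite_induct)
    case (insert b B)
    then have "finsum W f (insert b B) = f b \<oplus>\<^bsub>W\<^esub> finsum W f B" by (intro W.finsum_insert) auto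
    then show ?case using insert W' by simp
  qed (simp add: W')
qed

lemma lin_span_iff:
  assumes W: "rcoord W c" and B: "finite B" "B \<subseteq> carrier W" and S: "0 \<in> S"
  shows "w \<in> lin_span W (scmul W) S B \<longleftrightarrow>
    w \<in> carrier W \<and> (\<exists>k. (\<forall>b\<in>B. k b \<in> S) \<and> c w = (\<Sum>b\<in>B. \<phi>J (k b) \<star> c b))"
proof
  note W' = rcoordD[OF W]
  assume "w \<in> lin_span W (scmul W) S B"
  then obtain B' k where B': "finite B'" "B' \<subseteq> B" "k \<in> B' \<rightarrow> S" and w: "w = finsum W (\<lambda>b. scmul W (k b) b) B'"
    by (auto simp: lin_span_def)
  have fin: "w \<in> carrier W \<and> c w = (\<Sum>b\<in>B'. \<phi>J (k b) \<star> c b)"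
    unfolding w using rcoord_finsum[OF W B'(1), of "\<lambda>b. scmul W (k b) b"] B' B W' by (auto simp: subset_iff)
  have "(\<Sum>b\<in>B'. \<phi>J (k b) \<star> c b) = (\<Sum>b\<in>B. \<phi>J (if b \<in> B' then k b else 0) \<star> c b)"
    using B(1) B'(2) by (intro sum.mono_neutral_cong_left) (auto simp: phiJ'(8))
  then show "w \<in> carrier W \<and> (\<exists>k. (\<forall>b\<in>B. k b \<in> S) \<and> c w = (\<Sum>b\<in>B. \<phi>J (k b) \<star> c b))"
    using fin B'(3) S by (intro conjI exI[of _ "\<lambda>b. if b \<in> B' then k b else 0"]) auto
next
  note W' = rcoordD[OF W]
  assume "w \<in> carrier W \<and> (\<exists>k. (\<forall>b\<in>B. k b \<in> S) \<and> c w = (\<Sum>b\<in>B. \<phi>J (k b) \<star> c b))"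
  then obtain k where w: "w \<in> carrier W" and k: "\<And>b. b \<in> B \<Longrightarrow> k b \<in> S" "c w = (\<Sum>b\<in>B. \<phi>J (k b) \<star> c b)" by blast
  have "finsum W (\<lambda>b. scmul W (k b) b) B \<in> carrier W \<and> c (finsum W (\<lambda>b. scmul W (k b) b) B) = (\<Sum>b\<in>B. \<phi>J (k b) \<star> c b)"
    using rcoord_finsum[OF W B(1), of "\<lambda>b. scmul W (k b) b"] B W' by (auto simp: subset_iff)
  then have "w = finsum W (\<lambda>b. scmul W (k b) b) B" using W'(7)[OF w] k(2) by metis
  then show "w \<in> lin_span W (scmul W) S B"
    using B k(1) by (auto simp: lin_span_def intro!: exI[of _ B] exI[of _ k])
qed

lemma lin_span_member:
  assumes W: "rcoord W c" and b: "b \<in> carrier W" "b \<in> A" and "x \<in> S"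
  shows "scmul W x b \<in> lin_span W (scmul W) S A"
  unfolding lin_span_def mem_Collect_eq
proof (intro exI[of _ "{b}"] exI[of _ "\<lambda>_. x"] conjI)
  show "scmul W x b = finsum W (\<lambda>b. scmul W x b) {b}"
    using finsum_singleton[OF rcoordD(1)[OF W], of "\<lambda>b. scmul W x b" b] rcoordD(11)[OF W b(1)] by simp
qed (use assms in auto)

definition rball :: "('j \<Rightarrow> 'j, 'c, 'w) wrep \<Rightarrow> ('w \<Rightarrow> 'c fls) \<Rightarrow> int \<Rightarrow> 'w set" where
  "rball W c n = {w \<in> carrier W. vanish n (c w)}"

lemma vanish_z_powi: "vanish (e * m) (\<phi>J (z powi m))"
  by (intro phiJ'(7) vball_z_powi)

lemma z_powi_cancel: "\<phi>J (z powi (- m)) \<star> (\<phi>J (z powi m) \<star> d) = d" "\<phi>J (z powi m) \<star> (\<phi>J (z powi (- m)) \<star> d) = d"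
  using phiJ'(12,13)[of "z powi m"] val_z_powi[of m] by (simp_all add: power_int_minus flip: smult_assoc)

lemma rball_generators:
  assumes W: "rcoord W c"
  obtains B where "finite B" "B \<subseteq> carrier W" "rball W c n = lin_span W (scmul W) (vball 0) B"
proof -
  note W' = rcoordD[OF W]
  obtain R where R: "finite R" "R \<subseteq> {d \<in> DD. vanish n d}"
    "\<And>d. d \<in> DD \<Longrightarrow> vanish n d \<Longrightarrow> \<exists>k. (\<forall>x\<in>R. k x \<in> vball 0) \<and> d = (\<Sum>x\<in>R. \<phi>J (k x) \<star> x)"
    by (rule finite_generators[of n]) blast
  define s where "s = inv_into (carrier W) c"
  have s: "s d \<in> carrier W" "c (s d) = d" if "d \<in> DD" for d
    using W'(2) that by (auto simp: s_def bij_betw_def inv_into_into f_inv_into_f)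
  have inj: "inj_on s R" using s R(2) by (intro inj_onI) (metis (no_types, lifting) mem_Collect_eq subset_iff)
  have sB: "finite (s ` R)" "s ` R \<subseteq> carrier W" using R s by auto
  have re: "(\<Sum>b\<in>s ` R. \<phi>J (k b) \<star> c b) = (\<Sum>x\<in>R. \<phi>J (k (s x)) \<star> x)" for k
    using s R(2) by (subst sum.reindex[OF inj]) (auto intro!: sum.cong)
  have "rball W c n = lin_span W (scmul W) (vball 0) (s ` R)"
  proof (rule Set.set_eqI)
    fix w
    show "w \<in> rball W c n \<longleftrightarrow> w \<in> lin_span W (scmul W) (vball 0) (s ` R)"
      unfolding lin_span_iff[OF W sB vball_0] re rball_def
    proof safe
      assume w: "w \<in> carrier W" "vanish n (c w)"
      then obtain k where k: "\<And>x. x \<in> R \<Longrightarrow> k x \<in> vball 0" "c w = (\<Sum>x\<in>R. \<phi>J (k x) \<star> x)"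
        using R(3)[OF W'(6)] by blast
      have "inv_into R s (s x) = x" if "x \<in> R" for x using inj that by simp
      then show "\<exists>k. (\<forall>b\<in>s ` R. k b \<in> vball 0) \<and> c w = (\<Sum>x\<in>R. \<phi>J (k (s x)) \<star> x)"
        using k by (intro exI[of _ "\<lambda>b. k (inv_into R s b)"]) auto
    next
      fix k assume k: "\<forall>b\<in>s ` R. k b \<in> vball 0" "c w = (\<Sum>x\<in>R. \<phi>J (k (s x)) \<star> x)"
      have sumv: "vanish m (sum h A)" if "\<And>x. x \<in> A \<Longrightarrow> vanish m (h x)" for m and h :: "'c fls \<Rightarrow> 'c fls" and A
        using that by (induction A rule: infinite_finite_induct) (auto intro: vanish_add)
      show "vanish n (c w)"
        unfolding k(2)
      proof (rule sumv)
        fix x assume "x \<in> R"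
        then have "vanish 0 (\<phi>J (k (s x)))" "vanish n x" using k(1) R(2) phiJ'(7)[of "k (s x)" 0] by auto
        then show "vanish n (\<phi>J (k (s x)) \<star> x)" using vanish_smult[of 0 "\<phi>J (k (s x))" n x] by simp
      qed
    qed
  qed
  then show ?thesis using that sB by blast
qed

text \<open>Finite generation comes from \<open>finite_generators\<close>; the ball spans because a
  power of \<open>z\<close> moves any vector into it.\<close>

lemma rball_lattice:
  assumes W: "rcoord W c"
  shows "is_lattice J W (rball W c n)"
  unfolding is_lattice_def
proof
  note W' = rcoordD[OF W]
  show "\<exists>B. finite B \<and> B \<subseteq> carrier W \<and> rball W c n = lin_span W (scmul W) (vball 0) B"
    using rball_generators[OF W, of n] by metis
  show "lin_span W (scmul W) UNIV (rball W c n) = carrier W"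
  proof
    show "lin_span W (scmul W) UNIV (rball W c n) \<subseteq> carrier W"
    proof
      fix w assume "w \<in> lin_span W (scmul W) UNIV (rball W c n)"
      then obtain B k where "finite B" "B \<subseteq> rball W c n" "w = finsum W (\<lambda>b. scmul W (k b) b) B"
        by (auto simp: lin_span_def)
      then show "w \<in> carrier W"
        using rcoord_finsum[OF W, of B "\<lambda>b. scmul W (k b) b"] W' by (auto simp: rball_def subset_iff)
    qed
    show "carrier W \<subseteq> lin_span W (scmul W) UNIV (rball W c n)"
    proof
      fix w assume w: "w \<in> carrier W"
      obtain a where a: "vanish a (c w)" using vanish_ex by blast
      \<comment> \<open>As e is at least 1, multiplication by z^m raises the order by at least m,
        enough to pass from a to n.\<close>
      define m where "m = \<bar>n - a\<bar>"
      have "n - a \<le> m" "1 * m \<le> e * m" using phiJ'(1) mult_right_mono[of 1 e m] by (simp_all add: m_def)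
      then have "n \<le> e * m + a" by linarith
      then have v: "vanish n (\<phi>J (z powi m) \<star> c w)" using vanish_mono[OF vanish_smult[OF vanish_z_powi a]] by blast
      let ?b = "scmul W (z powi m) w"
      have b: "?b \<in> carrier W" "?b \<in> rball W c n" using W' w v by (auto simp: rball_def)
      have "scmul W (z powi (- m)) ?b = w"
        using W'(11)[OF b(1)] w b by (subst W'(7)[symmetric]) (simp_all add: W' z_powi_cancel)
      then show "w \<in> lin_span W (scmul W) UNIV (rball W c n)"
        using lin_span_member[OF W b, of "z powi (- m)" UNIV] by simp
    qed
  qed
qed

lemma latticeE:
  assumes W: "rcoord W c" and \<Lambda>: "is_lattice J W \<Lambda>"
  obtains B where "finite B" "B \<subseteq> carrier W"
    "\<And>w. w \<in> \<Lambda> \<longleftrightarrow> w \<in> carrier W \<and> (\<exists>k. (\<forall>b\<in>B. k b \<in> vball 0) \<and> c w = (\<Sum>b\<in>B. \<phi>J (k b) \<star> c b))"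
proof -
  obtain B where B: "finite B" "B \<subseteq> carrier W" "\<Lambda> = lin_span W (scmul W) (vball 0) B"
    using \<Lambda> by (auto simp: is_lattice_def)
  show ?thesis by (rule that[OF B(1,2)]) (use lin_span_iff[OF W B(1,2) vball_0] B(3) in simp)
qed

lemma lattice_closed:
  assumes W: "rcoord W c" and \<Lambda>: "is_lattice J W \<Lambda>"
  shows "\<Lambda> \<subseteq> carrier W" "\<zero>\<^bsub>W\<^esub> \<in> \<Lambda>" "v \<in> \<Lambda> \<Longrightarrow> w \<in> \<Lambda> \<Longrightarrow> v \<oplus>\<^bsub>W\<^esub> w \<in> \<Lambda>"
    "w \<in> \<Lambda> \<Longrightarrow> x \<in> vball 0 \<Longrightarrow> scmul W x w \<in> \<Lambda>"
proof -
  note W' = rcoordD[OF W]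
  obtain B where B: "finite B" "B \<subseteq> carrier W"
    "\<And>w. w \<in> \<Lambda> \<longleftrightarrow> w \<in> carrier W \<and> (\<exists>k. (\<forall>b\<in>B. k b \<in> vball 0) \<and> c w = (\<Sum>b\<in>B. \<phi>J (k b) \<star> c b))"
    by (rule latticeE[OF W \<Lambda>]) blast
  show "\<Lambda> \<subseteq> carrier W" using B(3) by blast
  show "\<zero>\<^bsub>W\<^esub> \<in> \<Lambda>"
    unfolding B(3) using W' by (intro conjI exI[of _ "\<lambda>_. 0"]) (auto simp: phiJ'(8))
  { assume v: "v \<in> \<Lambda>" and w: "w \<in> \<Lambda>"
    obtain k where k: "\<forall>b\<in>B. k b \<in> vball 0" "c v = (\<Sum>b\<in>B. \<phi>J (k b) \<star> c b)" using v B(3) by blast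
    obtain l where l: "\<forall>b\<in>B. l b \<in> vball 0" "c w = (\<Sum>b\<in>B. \<phi>J (l b) \<star> c b)" using w B(3) by blast
    show "v \<oplus>\<^bsub>W\<^esub> w \<in> \<Lambda>"
      unfolding B(3) using W'(3,9) v w B(3) k l
      by (intro conjI exI[of _ "\<lambda>b. k b + l b"]) (auto simp: phiJ'(3) smult_add_left sum.distrib vball_add) }
  { assume w: "w \<in> \<Lambda>" and x: "x \<in> vball 0"
    obtain l where l: "\<forall>b\<in>B. l b \<in> vball 0" "c w = (\<Sum>b\<in>B. \<phi>J (l b) \<star> c b)" using w B(3) by blast
    have "x * l b \<in> vball 0" if "b \<in> B" for b using vball_mult[OF x, of "l b" 0] l(1) that by simp
    then show "scmul W x w \<in> \<Lambda>"
      unfolding B(3) using W'(11,12) w B(3) l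
      by (intro conjI exI[of _ "\<lambda>b. x * l b"]) (auto simp: phiJ'(4) smult_assoc smult_sum_right) }
qed

text \<open>Integral scalars do not lower orders, so the generators bound the whole lattice.\<close>

lemma lattice_bounded:
  assumes W: "rcoord W c" and \<Lambda>: "is_lattice J W \<Lambda>"
  obtains n where "\<Lambda> \<subseteq> rball W c n"
proof -
  obtain B where B: "finite B" "B \<subseteq> carrier W"
    "\<And>w. w \<in> \<Lambda> \<longleftrightarrow> w \<in> carrier W \<and> (\<exists>k. (\<forall>b\<in>B. k b \<in> vball 0) \<and> c w = (\<Sum>b\<in>B. \<phi>J (k b) \<star> c b))"
    by (rule latticeE[OF W \<Lambda>]) blast
  have "\<exists>n. \<forall>b\<in>B. vanish n (c b)"
    using B(1)
  proof (induction B rule: finite_induct)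
    case (insert b B)
    then obtain n where n: "\<forall>b\<in>B. vanish n (c b)" by blast
    obtain m where "m \<le> n" "vanish m (c b)" using vanish_ex by blast
    then show ?case using n vanish_mono by (intro exI[of _ m]) auto
  qed auto
  then obtain n where n: "\<And>b. b \<in> B \<Longrightarrow> vanish n (c b)" by blast
  have sumv: "vanish m (sum h A)" if "\<And>x. x \<in> A \<Longrightarrow> vanish m (h x)" for m and h :: "'w \<Rightarrow> 'c fls" and A
    using that by (induction A rule: infinite_finite_induct) (auto intro: vanish_add)
  have "vanish n (c w)" if w: "w \<in> \<Lambda>" for w
  proof -
    obtain k where k: "\<forall>b\<in>B. k b \<in> vball 0" "c w = (\<Sum>b\<in>B. \<phi>J (k b) \<star> c b)"
      using w unfolding B(3) by blast
    show ?thesis unfolding k(2)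
    proof (rule sumv)
      fix b assume b: "b \<in> B"
      show "vanish n (\<phi>J (k b) \<star> c b)" using vanish_smult[OF phiJ'(7)[of "k b" 0] n[OF b]] k(1) b by simp
    qed
  qed
  then show ?thesis using that[of n] lattice_closed(1)[OF W \<Lambda>] by (auto simp: rball_def)
qed

text \<open>The unit ball is finitely generated, and since the lattice spans, a power z^m takes each
  generator into it. So z^m times the unit ball, which is the ball of order e m, lies in the
  lattice.\<close>

lemma lattice_open:
  assumes W: "rcoord W c" and \<Lambda>: "is_lattice J W \<Lambda>"
  obtains n where "rball W c n \<subseteq> \<Lambda>"
proof -
  note W' = rcoordD[OF W] and \<Lambda>' = lattice_closed[OF W \<Lambda>]
  obtain B where B: "finite B" "B \<subseteq> carrier W" "rball W c 0 = lin_span W (scmul W) (vball 0) B"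
    by (rule rball_generators[OF W])
  have one: "\<exists>m\<ge>0. scmul W (z powi m) w \<in> \<Lambda>" if w: "w \<in> carrier W" for w
  proof -
    have "w \<in> lin_span W (scmul W) UNIV \<Lambda>" using \<Lambda> w by (simp add: is_lattice_def)
    then obtain L k where L: "finite L" "L \<subseteq> \<Lambda>" and wL: "w = finsum W (\<lambda>b. scmul W (k b) b) L"
      by (auto simp: lin_span_def)
    have L': "L \<subseteq> carrier W" using L \<Lambda>' by blast
    have cw: "c w = (\<Sum>b\<in>L. \<phi>J (k b) \<star> c b)"
      unfolding wL using rcoord_finsum[OF W L(1), of "\<lambda>b. scmul W (k b) b"] L' W' by (auto simp: subset_iff)
    \<comment> \<open>A common denominator for the finitely many coefficients.\<close>
    have "\<exists>m\<ge>0. \<forall>b\<in>L. z powi m * k b \<in> vball 0"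
      using L(1)
    proof (induction L rule: finite_induct)
      case (insert b L)
      then obtain m where m: "m \<ge> 0" "\<forall>b\<in>L. z powi m * k b \<in> vball 0" by blast
      obtain n where n: "k b \<in> vball n" using vball_ex by blast
      define M where "M = max m (- n)"
      have "z powi M * k b \<in> vball 0" using vball_mono[OF vball_mult[OF vball_z_powi[of M] n], of 0] by (simp add: M_def)
      moreover have "z powi M * k b' \<in> vball 0" if "b' \<in> L" for b'
      proof -
        have "z powi M * k b' = z powi (M - m) * (z powi m * k b')" using uniformizer by (simp add: power_int_diff)
        also have "\<dots> \<in> vball ((M - m) + 0)" using m that by (intro vball_mult vball_z_powi) auto
        finally show ?thesis by (rule vball_mono) (simp add: M_def)
      qed
      ultimately show ?case using m(1) by (intro exI[of _ M]) (auto simp: M_def)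
    qed auto
    then obtain m where m: "m \<ge> 0" "\<And>b. b \<in> L \<Longrightarrow> z powi m * k b \<in> vball 0" by blast
    have "finsum W (\<lambda>b. scmul W (z powi m * k b) b) L' \<in> \<Lambda>" if "L' \<subseteq> L" for L'
    proof -
      interpret W: abelian_group W by (rule W')
      have "finite L'" using that L(1) finite_subset by blast
      then show ?thesis using that
      proof (induction L' rule: finite_induct)
        case (insert b L'')
        then have b: "b \<in> \<Lambda>" "b \<in> carrier W" using L L' by auto
        have "finsum W (\<lambda>b. scmul W (z powi m * k b) b) (insert b L'') =
          scmul W (z powi m * k b) b \<oplus>\<^bsub>W\<^esub> finsum W (\<lambda>b. scmul W (z powi m * k b) b) L''"
          using insert L' W'(11) by (intro W.finsum_insert) (auto simp: subset_iff)
        then show ?case using \<Lambda>'(3,4) b insert m(2)[of b] by auto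
      qed (simp add: \<Lambda>')
    qed
    then have fin: "finsum W (\<lambda>b. scmul W (z powi m * k b) b) L \<in> \<Lambda>" by blast
    have "scmul W (z powi m) w = finsum W (\<lambda>b. scmul W (z powi m * k b) b) L"
    proof (subst W'(7)[symmetric])
      show "scmul W (z powi m) w \<in> carrier W" using W' w by auto
      show "finsum W (\<lambda>b. scmul W (z powi m * k b) b) L \<in> carrier W" using fin \<Lambda>' by auto
      show "c (scmul W (z powi m) w) = c (finsum W (\<lambda>b. scmul W (z powi m * k b) b) L)"
        using rcoord_finsum[OF W L(1), of "\<lambda>b. scmul W (z powi m * k b) b"] L' W' w cw
        by (auto simp: subset_iff smult_sum_right phiJ'(4) smult_assoc intro!: sum.cong)
    qed
    then show ?thesis using fin m(1) by auto
  qed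
  have shift: "scmul W (z powi M) w \<in> \<Lambda>" if "scmul W (z powi m) w \<in> \<Lambda>" "m \<le> M" "w \<in> carrier W" for m M w
  proof -
    have "scmul W (z powi (M - m)) (scmul W (z powi m) w) \<in> \<Lambda>"
      by (rule \<Lambda>'(4)[OF that(1)], rule vball_mono[OF vball_z_powi]) (use that in simp)
    moreover have "scmul W (z powi (M - m)) (scmul W (z powi m) w) = scmul W (z powi M) w"
      using that W'(11) uniformizer
      by (subst W'(7)[symmetric]) (simp_all add: W' power_int_diff flip: phiJ'(4) smult_assoc)
    ultimately show ?thesis by simp
  qed
  have "\<exists>m\<ge>0. \<forall>b\<in>B. scmul W (z powi m) b \<in> \<Lambda>"
    using B(1,2)
  proof (induction B rule: finite_induct)
    case (insert b B)
    then obtain m where m: "m \<ge> 0" "\<forall>b\<in>B. scmul W (z powi m) b \<in> \<Lambda>" by blast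
    obtain n where n: "n \<ge> 0" "scmul W (z powi n) b \<in> \<Lambda>" using one insert by blast
    show ?case using insert.prems m n shift by (intro exI[of _ "max m n"]) (auto simp: subset_iff)
  qed auto
  then obtain m where m: "m \<ge> 0" "\<And>b. b \<in> B \<Longrightarrow> scmul W (z powi m) b \<in> \<Lambda>" by blast
  have "rball W c (e * m) \<subseteq> \<Lambda>"
  proof
    fix w assume w: "w \<in> rball W c (e * m)"
    then have wW: "w \<in> carrier W" "vanish (e * m) (c w)" by (auto simp: rball_def)
    let ?w = "scmul W (z powi (- m)) w"
    have "vanish (e * (- m) + e * m) (\<phi>J (z powi (- m)) \<star> c w)" by (intro vanish_smult vanish_z_powi wW)
    then have "?w \<in> rball W c 0" using W' wW by (auto simp: rball_def)
    then obtain k where k: "\<And>b. b \<in> B \<Longrightarrow> k b \<in> vball 0" "c ?w = (\<Sum>b\<in>B. \<phi>J (k b) \<star> c b)"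
      unfolding B(3) lin_span_iff[OF W B(1,2) vball_0] by blast
    have fin: "finsum W (\<lambda>b. scmul W (k b) (scmul W (z powi m) b)) L \<in> \<Lambda>" if "L \<subseteq> B" for L
    proof -
      interpret W: abelian_group W by (rule W')
      have "finite L" using that B(1) finite_subset by blast
      then show ?thesis using that
      proof (induction L rule: finite_induct)
        case (insert b L)
        have "finsum W (\<lambda>b. scmul W (k b) (scmul W (z powi m) b)) (insert b L) =
          scmul W (k b) (scmul W (z powi m) b) \<oplus>\<^bsub>W\<^esub> finsum W (\<lambda>b. scmul W (k b) (scmul W (z powi m) b)) L"
          using insert B(2) W'(11) by (intro W.finsum_insert) (auto simp: subset_iff)
        then show ?case using \<Lambda>'(3,4) m(2) k(1) insert by auto
      qed (simp add: \<Lambda>')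
    qed
    have "w = finsum W (\<lambda>b. scmul W (k b) (scmul W (z powi m) b)) B"
    proof (subst W'(7)[symmetric])
      show "w \<in> carrier W" by (rule wW)
      show "finsum W (\<lambda>b. scmul W (k b) (scmul W (z powi m) b)) B \<in> carrier W" using fin \<Lambda>' by auto
      have "\<phi>J (k b) \<star> (\<phi>J (z powi m) \<star> c b) = \<phi>J (z powi m) \<star> (\<phi>J (k b) \<star> c b)" for b
        using phiJ'(11)[of "k b" "z powi m"] by (simp flip: smult_assoc)
      then have "c (finsum W (\<lambda>b. scmul W (k b) (scmul W (z powi m) b)) B) = \<phi>J (z powi m) \<star> c ?w"
        using rcoord_finsum[OF W B(1), of "\<lambda>b. scmul W (k b) (scmul W (z powi m) b)"] B(2) W' k(2)
        by (auto simp: subset_iff smult_sum_right intro!: sum.cong)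
      then show "c w = c (finsum W (\<lambda>b. scmul W (k b) (scmul W (z powi m) b)) B)"
        using wW W' by (simp add: z_powi_cancel)
    qed
    then show "w \<in> \<Lambda>" using fin[OF subset_refl] by simp
  qed
  then show ?thesis by (rule that)
qed

text \<open>Every ball is a lattice and every lattice contains a ball, so the vector space topology
  is read off from orders of coordinates.\<close>

lemma openin_vs_topology:
  assumes W: "rcoord W c"
  shows "openin (vs_topology J W) U \<longleftrightarrow>
    U \<subseteq> carrier W \<and> (\<forall>w\<in>U. \<exists>n. \<forall>v\<in>carrier W. vanish n (c v - c w) \<longrightarrow> v \<in> U)"
proof
  note W' = rcoordD[OF W]
  interpret W: abelian_group W by (rule W')
  assume "openin (vs_topology J W) U"
  then have "generate_topology_on {(\<lambda>y. w \<oplus>\<^bsub>W\<^esub> y) ` \<Lambda> | w \<Lambda>. w \<in> carrier W \<and> is_lattice J W \<Lambda>} U"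
    by (simp add: vs_topology_def openin_topology_generated_by_iff)
  then show "U \<subseteq> carrier W \<and> (\<forall>w\<in>U. \<exists>n. \<forall>v\<in>carrier W. vanish n (c v - c w) \<longrightarrow> v \<in> U)"
  proof (induction rule: generate_topology_on.induct)
    case (Int a b)
    have "\<exists>n. \<forall>v\<in>carrier W. vanish n (c v - c w) \<longrightarrow> v \<in> a \<inter> b" if w: "w \<in> a \<inter> b" for w
    proof -
      obtain m n where mn: "\<And>v. v \<in> carrier W \<Longrightarrow> vanish m (c v - c w) \<Longrightarrow> v \<in> a"
        "\<And>v. v \<in> carrier W \<Longrightarrow> vanish n (c v - c w) \<Longrightarrow> v \<in> b" using Int w by blast
      show ?thesis
        by (intro exI[of _ "max m n"]) (auto intro!: mn elim: vanish_mono)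
    qed
    then show ?case using Int by auto
  next
    case (UN S)
    then show ?case by (meson Sup_le_iff Union_iff)
  next
    case (Basis s)
    then obtain w0 \<Lambda> where s: "s = (\<lambda>y. w0 \<oplus>\<^bsub>W\<^esub> y) ` \<Lambda>" "w0 \<in> carrier W" "is_lattice J W \<Lambda>" by auto
    note \<Lambda>' = lattice_closed[OF W s(3)]
    obtain n where n: "rball W c n \<subseteq> \<Lambda>" by (rule lattice_open[OF W s(3)])
    have "v \<in> s" if w: "w \<in> s" and v: "v \<in> carrier W" "vanish n (c v - c w)" for v w
    proof -
      obtain l where l: "l \<in> \<Lambda>" "w = w0 \<oplus>\<^bsub>W\<^esub> l" using w s by auto
      then have lW: "l \<in> carrier W" "w \<in> carrier W" using \<Lambda>' s by auto
      have "c v - c w \<in> DD" using W' v lW by (intro DD_closed) auto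
      then obtain y where y: "y \<in> carrier W" "c y = c v - c w" by (rule rcoord_surj[OF W])
      have "y \<in> \<Lambda>" using n y v by (auto simp: rball_def)
      then have "l \<oplus>\<^bsub>W\<^esub> y \<in> \<Lambda>" using \<Lambda>' l by auto
      moreover have "v = w0 \<oplus>\<^bsub>W\<^esub> (l \<oplus>\<^bsub>W\<^esub> y)"
        using v y lW s(2) l by (subst W'(7)[symmetric]) (simp_all add: W')
      ultimately show ?thesis using s by blast
    qed
    moreover have "s \<subseteq> carrier W" using s \<Lambda>' by auto
    ultimately show ?case by blast
  qed auto
next
  note W' = rcoordD[OF W]
  interpret W: abelian_group W by (rule W')
  assume U: "U \<subseteq> carrier W \<and> (\<forall>w\<in>U. \<exists>n. \<forall>v\<in>carrier W. vanish n (c v - c w) \<longrightarrow> v \<in> U)"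
  show "openin (vs_topology J W) U"
  proof (subst openin_subopen, intro ballI)
    fix w assume w: "w \<in> U"
    then obtain n where n: "\<And>v. v \<in> carrier W \<Longrightarrow> vanish n (c v - c w) \<Longrightarrow> v \<in> U" using U by blast
    have wW: "w \<in> carrier W" using w U by blast
    let ?T = "(\<lambda>y. w \<oplus>\<^bsub>W\<^esub> y) ` rball W c n"
    have "openin (vs_topology J W) ?T"
      unfolding vs_topology_def using wW rball_lattice[OF W] by (intro topology_generated_by_Basis) blast
    moreover have "w \<in> ?T" using wW W' by (intro image_eqI[of _ _ "\<zero>\<^bsub>W\<^esub>"]) (auto simp: rball_def)
    moreover have "?T \<subseteq> U" using n wW W' by (auto simp: rball_def)
    ultimately show "\<exists>T. openin (vs_topology J W) T \<and> w \<in> T \<and> T \<subseteq> U" by blast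
  qed
qed

lemma topspace_vs_topology:
  assumes W: "rcoord W c"
  shows "topspace (vs_topology J W) = carrier W"
proof -
  have "openin (vs_topology J W) (carrier W)" by (auto simp: openin_vs_topology[OF W])
  then have "carrier W \<subseteq> topspace (vs_topology J W)" by (rule openin_subset)
  moreover have "topspace (vs_topology J W) \<subseteq> carrier W"
    using openin_topspace[of "vs_topology J W"] unfolding openin_vs_topology[OF W] by blast
  ultimately show ?thesis by blast
qed

end

section \<open>The Weil group\<close>

context drinfeld_setting
begin

text \<open>If two powers of Frobenius agreed on \<open>Fbar\<close>, their quotient
  \<open>fr (- k)\<close> would be trivial there; but the equation fr (-k) y - y = 1 of
  Artin-Schreier type has a solution in \<open>Fbar\<close>.\<close>

lemma has_ord_unique:
  assumes "has_ord \<gamma> m" "has_ord \<gamma> n"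
  shows "m = n"
proof -
  have "m \<le> n" if "has_ord \<gamma> m" "has_ord \<gamma> n" for m n
  proof (rule ccontr)
    assume "\<not> m \<le> n"
    define k where "k = m - n"
    have k: "k > 0" using \<open>\<not> m \<le> n\<close> by (simp add: k_def)
    obtain y where y: "1 * fr (- k) y + (- 1) * y = 1" using affine_frob_solvable[OF k, of "- 1" 1 1] by auto
    have one: "1 \<in> Fbar" "- 1 \<in> Fbar" using perfect_subfield_closed[OF perfect_subfield_Fbar] by auto
    have yF: "y \<in> Fbar" using affine_frob_Fbar[OF k, of "- 1" 1 y] one y by simp
    have "fr (- m) y = fr (- n) y" using that yF by (simp add: has_ord_def frob_eq_fr)
    then have "fr n (fr (- m) y) = y" by simp
    then have "fr (- k) y = y" by (simp add: fr_fr k_def)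
    then show False using y by simp
  qed
  then show ?thesis using assms by (intro antisym) auto
qed

lemma weilI: "\<gamma> \<in> gal \<Longrightarrow> has_ord \<gamma> n \<Longrightarrow> \<gamma> \<in> weil" "has_ord \<gamma> n \<Longrightarrow> ord \<gamma> = n"
  using has_ord_unique by (auto simp: weil_def ord_def intro!: the_equality)

lemma weilD: "\<gamma> \<in> weil \<Longrightarrow> \<gamma> \<in> gal" "\<gamma> \<in> weil \<Longrightarrow> has_ord \<gamma> (ord \<gamma>)"
  "\<gamma> \<in> weil \<Longrightarrow> x \<in> Fbar \<Longrightarrow> \<gamma> x = fr (- ord \<gamma>) x"
proof -
  show "\<gamma> \<in> weil \<Longrightarrow> \<gamma> \<in> gal" by (simp add: weil_def)
  show o: "\<gamma> \<in> weil \<Longrightarrow> has_ord \<gamma> (ord \<gamma>)" using weilI(2) by (auto simp: weil_def)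
  show "\<gamma> \<in> weil \<Longrightarrow> x \<in> Fbar \<Longrightarrow> \<gamma> x = fr (- ord \<gamma>) x" using o by (simp add: has_ord_def frob_eq_fr)
qed

lemma galI:
  fixes \<gamma> :: "'c \<Rightarrow> 'c"
  assumes "\<And>x y. \<gamma> (x + y) = \<gamma> x + \<gamma> y" "\<And>x y. \<gamma> (x * y) = \<gamma> x * \<gamma> y" "\<gamma> 1 = 1" "bij \<gamma>" "\<And>x. x \<in> K \<Longrightarrow> \<gamma> x = x"
  shows "\<gamma> \<in> gal"
  using assms by (auto simp: gal_def ring_iso_def ring_hom_def)

lemma gal_id: "id \<in> gal"
  by (rule galI) auto

lemma gal_comp: "\<gamma> \<in> gal \<Longrightarrow> \<delta> \<in> gal \<Longrightarrow> \<gamma> \<circ> \<delta> \<in> gal"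
  by (rule galI) (auto simp: galD bij_comp)

lemma gal_inv:
  assumes "\<gamma> \<in> gal"
  shows "inv_into UNIV \<gamma> \<in> gal" "\<gamma> \<circ> inv_into UNIV \<gamma> = id" "inv_into UNIV \<gamma> \<circ> \<gamma> = id" "\<gamma> (inv_into UNIV \<gamma> x) = x" "inv_into UNIV \<gamma> (\<gamma> x) = x"
proof -
  note g = galD[OF assms]
  have s: "\<gamma> (inv_into UNIV \<gamma> x) = x" and i: "inv_into UNIV \<gamma> (\<gamma> x) = x" for x
    using g(5) by (auto simp: bij_def surj_f_inv_f inv_f_f)
  show "\<gamma> (inv_into UNIV \<gamma> x) = x" "inv_into UNIV \<gamma> (\<gamma> x) = x" by (rule s, rule i)
  show "\<gamma> \<circ> inv_into UNIV \<gamma> = id" "inv_into UNIV \<gamma> \<circ> \<gamma> = id" using s i by auto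
  show "inv_into UNIV \<gamma> \<in> gal"
  proof (rule galI)
    show "inv_into UNIV \<gamma> (x + y) = inv_into UNIV \<gamma> x + inv_into UNIV \<gamma> y" for x y by (metis s i g(1))
    show "inv_into UNIV \<gamma> (x * y) = inv_into UNIV \<gamma> x * inv_into UNIV \<gamma> y" for x y by (metis s i g(2))
    show "inv_into UNIV \<gamma> 1 = 1" by (metis i g(3))
    show "bij (inv_into UNIV \<gamma>)" using g(5) by (rule bij_imp_bij_inv)
    show "x \<in> K \<Longrightarrow> inv_into UNIV \<gamma> x = x" for x by (metis i g(6))
  qed
qed

lemma weil_id: "id \<in> weil" "ord id = 0"
  using weilI[of id 0] gal_id by (auto simp: has_ord_def frob_eq_fr)

lemma weil_comp:
  assumes "\<gamma> \<in> weil" "\<delta> \<in> weil"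
  shows "\<gamma> \<circ> \<delta> \<in> weil" "ord (\<gamma> \<circ> \<delta>) = ord \<gamma> + ord \<delta>"
proof -
  have "has_ord (\<gamma> \<circ> \<delta>) (ord \<gamma> + ord \<delta>)"
    unfolding has_ord_def frob_eq_fr
  proof
    fix x assume x: "x \<in> Fbar"
    then have "fr (- ord \<delta>) x \<in> Fbar" using perfect_subfield_closed(9)[OF perfect_subfield_Fbar] by simp
    then show "(\<gamma> \<circ> \<delta>) x = fr (- (ord \<gamma> + ord \<delta>)) x"
      using weilD(3)[OF assms(1)] weilD(3)[OF assms(2) x] by (simp add: fr_fr)
  qed
  then show "\<gamma> \<circ> \<delta> \<in> weil" "ord (\<gamma> \<circ> \<delta>) = ord \<gamma> + ord \<delta>"
    using weilI gal_comp weilD(1) assms by auto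
qed

lemma weil_inv:
  assumes "\<gamma> \<in> weil"
  shows "inv_into UNIV \<gamma> \<in> weil" "ord (inv_into UNIV \<gamma>) = - ord \<gamma>"
proof -
  note g = gal_inv[OF weilD(1)[OF assms]]
  have "has_ord (inv_into UNIV \<gamma>) (- ord \<gamma>)"
    unfolding has_ord_def frob_eq_fr
  proof
    fix x assume x: "x \<in> Fbar"
    then have "fr (ord \<gamma>) x \<in> Fbar" using perfect_subfield_closed(9)[OF perfect_subfield_Fbar] by simp
    then have "\<gamma> (fr (ord \<gamma>) x) = x" using weilD(3)[OF assms] by simp
    then show "inv_into UNIV \<gamma> x = fr (- (- ord \<gamma>)) x" using g(5)[of "fr (ord \<gamma>) x"] by simp
  qed
  then show "inv_into UNIV \<gamma> \<in> weil" "ord (inv_into UNIV \<gamma>) = - ord \<gamma>" using weilI g(1) by auto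
qed

lemma weil_funpow:
  assumes "\<gamma> \<in> weil"
  shows "\<gamma> ^^ k \<in> weil \<and> ord (\<gamma> ^^ k) = int k * ord \<gamma>"
proof (induction k)
  case 0
  then show ?case using weil_id by (simp add: id_def)
next
  case (Suc k)
  then have "\<gamma> \<circ> \<gamma> ^^ k \<in> weil" "ord (\<gamma> \<circ> \<gamma> ^^ k) = ord \<gamma> + int k * ord \<gamma>"
    using weil_comp[OF assms, of "\<gamma> ^^ k"] by (blast, presburger)
  moreover have "ord \<gamma> + int k * ord \<gamma> = int (Suc k) * ord \<gamma>" by (simp add: algebra_simps)
  ultimately show ?case by (simp only: funpow.simps)
qed

text \<open>The basic neighbourhoods of the identity in the Weil group; the condition on
  \<open>ord\<close> reflects that the kernel of \<open>ord\<close> is open.\<close>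

definition wfix :: "'c set \<Rightarrow> ('c \<Rightarrow> 'c) set" where
  "wfix S = {\<iota> \<in> weil. ord \<iota> = 0 \<and> (\<forall>x\<in>S. \<iota> x = x)}"

lemma openin_pointwise:
  "openin (product_topology (\<lambda>_. discrete_topology UNIV) UNIV) V \<longleftrightarrow>
    (\<forall>f\<in>V. \<exists>S. finite S \<and> (\<forall>g. (\<forall>x\<in>S. g x = f x) \<longrightarrow> g \<in> V))"
  for V :: "('a \<Rightarrow> 'b) set"
proof
  assume V: "openin (product_topology (\<lambda>_. discrete_topology UNIV) UNIV) V"
  show "\<forall>f\<in>V. \<exists>S. finite S \<and> (\<forall>g. (\<forall>x\<in>S. g x = f x) \<longrightarrow> g \<in> V)"
  proof
    fix f assume "f \<in> V"
    then obtain U where U: "finite {i. U i \<noteq> (UNIV :: 'b set)}" "f \<in> Pi\<^sub>E UNIV U" "Pi\<^sub>E UNIV U \<subseteq> V"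
      using V unfolding openin_product_topology_alt by auto
    have "g \<in> V" if "\<forall>x\<in>{i. U i \<noteq> UNIV}. g x = f x" for g
    proof -
      have "g x \<in> U x" for x using that U(2) by (cases "U x = UNIV") auto
      then show ?thesis using U(3) by auto
    qed
    then show "\<exists>S. finite S \<and> (\<forall>g. (\<forall>x\<in>S. g x = f x) \<longrightarrow> g \<in> V)"
      using U(1) by (intro exI[of _ "{i. U i \<noteq> UNIV}"] conjI) simp_all
  qed
next
  assume *: "\<forall>f\<in>V. \<exists>S. finite S \<and> (\<forall>g. (\<forall>x\<in>S. g x = f x) \<longrightarrow> g \<in> V)"
  show "openin (product_topology (\<lambda>_. discrete_topology UNIV) UNIV) V"
    unfolding openin_product_topology_alt
  proof (intro ballI)
    fix f assume "f \<in> V"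
    from bspec[OF * this] obtain S where S0: "finite S" "\<forall>g. (\<forall>x\<in>S. g x = f x) \<longrightarrow> g \<in> V"
      by (elim exE conjE)
    then have S: "finite S" "\<And>g. (\<And>x. x \<in> S \<Longrightarrow> g x = f x) \<Longrightarrow> g \<in> V" by blast+
    define U where "U i = (if i \<in> S then {f i} else UNIV)" for i
    have "{i. U i \<noteq> UNIV} \<subseteq> S" by (auto simp: U_def)
    then have "finite {i. U i \<noteq> UNIV}" using S(1) finite_subset by blast
    moreover have "f \<in> Pi\<^sub>E UNIV U" by (auto simp: U_def)
    moreover have "Pi\<^sub>E UNIV U \<subseteq> V"
    proof
      fix g assume g: "g \<in> Pi\<^sub>E UNIV U"
      have "g x = f x" if "x \<in> S" for x
      proof -
        have "g x \<in> U x" using g by auto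
        then show ?thesis using that by (simp add: U_def)
      qed
      then show "g \<in> V" by (rule S(2))
    qed
    ultimately show "\<exists>U. finite {i \<in> UNIV. U i \<noteq> topspace (discrete_topology UNIV)} \<and>
        (\<forall>i\<in>UNIV. openin (discrete_topology UNIV) (U i)) \<and> f \<in> Pi\<^sub>E UNIV U \<and> Pi\<^sub>E UNIV U \<subseteq> V"
      by (intro exI[of _ U]) auto
  qed
qed

text \<open>An open set of the Krull topology prescribes finitely many values near a given point,
  and composing on the right with an element of \<open>wfix\<close> of these arguments keeps the
  values. So the translates of the sets \<open>wfix S\<close> form a basis.\<close>

lemma openin_weil_topology:
  "openin (weil_topology) Q \<longleftrightarrow> Q \<subseteq> weil \<and> (\<forall>\<gamma>\<in>Q. \<exists>S. finite S \<and> (\<forall>\<iota>\<in>wfix S. \<gamma> \<circ> \<iota> \<in> Q))"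
proof
  let ?I = "{\<iota> \<in> weil. ord \<iota> = 0}"
  assume "openin weil_topology Q"
  then have "generate_topology_on {(\<lambda>\<iota>. \<gamma> \<circ> \<iota>) ` U | \<gamma> U. \<gamma> \<in> weil \<and> openin (subtopology krull_topology ?I) U} Q"
    by (simp add: weil_topology_def openin_topology_generated_by_iff)
  then show "Q \<subseteq> weil \<and> (\<forall>\<gamma>\<in>Q. \<exists>S. finite S \<and> (\<forall>\<iota>\<in>wfix S. \<gamma> \<circ> \<iota> \<in> Q))"
  proof (induction rule: generate_topology_on.induct)
    case (Int a b)
    have "\<exists>S. finite S \<and> (\<forall>\<iota>\<in>wfix S. \<gamma> \<circ> \<iota> \<in> a \<inter> b)" if "\<gamma> \<in> a \<inter> b" for \<gamma>
    proof -
      from Int.IH that have "\<exists>S. finite S \<and> (\<forall>\<iota>\<in>wfix S. \<gamma> \<circ> \<iota> \<in> a)" "\<exists>S. finite S \<and> (\<forall>\<iota>\<in>wfix S. \<gamma> \<circ> \<iota> \<in> b)"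
        by blast+
      then obtain S T where ST: "finite S" "\<forall>\<iota>\<in>wfix S. \<gamma> \<circ> \<iota> \<in> a" "finite T" "\<forall>\<iota>\<in>wfix T. \<gamma> \<circ> \<iota> \<in> b"
        by (elim exE conjE)
      have "wfix (S \<union> T) \<subseteq> wfix S \<inter> wfix T" by (auto simp: wfix_def)
      then show ?thesis using ST by (intro exI[of _ "S \<union> T"] conjI finite_UnI) blast+
    qed
    moreover have "a \<inter> b \<subseteq> weil" using Int.IH by blast
    ultimately show ?case by blast
  next
    case (UN S)
    then show ?case by (meson Sup_le_iff Union_iff)
  next
    case (Basis s)
    then obtain \<gamma>0 U where s: "s = (\<lambda>\<iota>. \<gamma>0 \<circ> \<iota>) ` U" "\<gamma>0 \<in> weil" "openin (subtopology krull_topology ?I) U" by auto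
    then obtain V where V: "openin (product_topology (\<lambda>_. discrete_topology UNIV) UNIV) V" "U = V \<inter> gal \<inter> ?I"
      by (auto simp: krull_topology_def openin_subtopology)
    have "\<exists>S. finite S \<and> (\<forall>\<iota>\<in>wfix S. \<gamma> \<circ> \<iota> \<in> s)" if gs: "\<gamma> \<in> s" for \<gamma>
    proof -
      obtain \<iota>0 where i0: "\<gamma> = \<gamma>0 \<circ> \<iota>0" "\<iota>0 \<in> U" using gs unfolding s(1) by (rule imageE)
      then have "\<iota>0 \<in> V" using V(2) by blast
      from bspec[OF V(1)[unfolded openin_pointwise] this]
      obtain S where S0: "finite S" "\<forall>g. (\<forall>x\<in>S. g x = \<iota>0 x) \<longrightarrow> g \<in> V" by (elim exE conjE)
      then have S: "finite S" "\<And>g. (\<And>x. x \<in> S \<Longrightarrow> g x = \<iota>0 x) \<Longrightarrow> g \<in> V" by blast+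
      have "\<gamma> \<circ> \<iota> \<in> s" if i: "\<iota> \<in> wfix S" for \<iota>
      proof -
        have "\<iota>0 \<circ> \<iota> \<in> V" using i by (intro S(2)) (auto simp: wfix_def)
        moreover have "\<iota>0 \<circ> \<iota> \<in> weil" "ord (\<iota>0 \<circ> \<iota>) = 0" using weil_comp[of \<iota>0 \<iota>] i i0 V(2) by (auto simp: wfix_def)
        ultimately have "\<iota>0 \<circ> \<iota> \<in> U" using V(2) weilD(1) by auto
        then show ?thesis using s(1) i0(1) by (auto simp: comp_assoc)
      qed
      then show ?thesis using S(1) by blast
    qed
    moreover have "s \<subseteq> weil" using s V weil_comp by auto
    ultimately show ?case by blast
  qed auto
next
  assume Q: "Q \<subseteq> weil \<and> (\<forall>\<gamma>\<in>Q. \<exists>S. finite S \<and> (\<forall>\<iota>\<in>wfix S. \<gamma> \<circ> \<iota> \<in> Q))"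
  show "openin weil_topology Q"
  proof (subst openin_subopen, intro ballI)
    fix \<gamma> assume g: "\<gamma> \<in> Q"
    then obtain S where S: "finite S" "\<And>\<iota>. \<iota> \<in> wfix S \<Longrightarrow> \<gamma> \<circ> \<iota> \<in> Q" using Q by blast
    have "openin (product_topology (\<lambda>_. discrete_topology UNIV) UNIV) {f :: 'c \<Rightarrow> 'c. \<forall>x\<in>S. f x = x}"
      unfolding openin_pointwise using S(1) by (intro ballI exI[of _ S]) auto
    moreover have "wfix S = {f :: 'c \<Rightarrow> 'c. \<forall>x\<in>S. f x = x} \<inter> gal \<inter> {\<iota> \<in> weil. ord \<iota> = 0}"
      using weilD(1) by (auto simp: wfix_def)
    ultimately have "openin (subtopology krull_topology {\<iota> \<in> weil. ord \<iota> = 0}) (wfix S)"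
      unfolding krull_topology_def openin_subtopology by blast
    then have "openin weil_topology ((\<lambda>\<iota>. \<gamma> \<circ> \<iota>) ` wfix S)"
      unfolding weil_topology_def using g Q by (intro topology_generated_by_Basis) blast
    moreover have "\<gamma> \<in> (\<lambda>\<iota>. \<gamma> \<circ> \<iota>) ` wfix S"
      using weil_id by (intro image_eqI[of _ _ id]) (auto simp: wfix_def)
    ultimately show "\<exists>T. openin weil_topology T \<and> \<gamma> \<in> T \<and> T \<subseteq> Q" using S(2) by blast
  qed
qed

lemma topspace_weil_topology: "topspace weil_topology = weil"
proof -
  have "openin weil_topology weil"
    unfolding openin_weil_topology using weil_comp by (auto simp: wfix_def intro: exI[of _ "{}"])
  then have "weil \<subseteq> topspace weil_topology" by (rule openin_subset)
  moreover have "topspace weil_topology \<subseteq> weil"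
    using openin_topspace[of weil_topology] unfolding openin_weil_topology by blast
  ultimately show ?thesis by blast
qed

text \<open>The action of the Weil group on T(V) in coordinates.\<close>

definition twist :: "('c \<Rightarrow> 'c) \<Rightarrow> 'c fls \<Rightarrow> 'c fls" where
  "twist \<gamma> u = tau_pow (ord \<gamma>) \<star> coeffwise \<gamma> u"

lemma twist_nth: "\<gamma> \<in> weil \<Longrightarrow> twist \<gamma> u $$ n = fr (ord \<gamma>) (\<gamma> (u $$ (n + ord \<gamma>)))"
  by (simp add: twist_def tau_pow_left coeffwise_gal[OF weilD(1)])

text \<open>On \<open>Fbar\<close> the element acts as the power -ord \<gamma> of Frobenius, and
  moving \<tau>^(ord \<gamma>) past a coefficient applies the opposite power.\<close>

lemma tau_pow_Fbar:
  assumes "\<gamma> \<in> weil" "s \<in> laurent_over Fbar"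
  shows "tau_pow (ord \<gamma>) \<star> coeffwise \<gamma> s = s \<star> tau_pow (ord \<gamma>)"
  using assms by (intro fls_eqI)
    (simp add: tau_pow_left tau_pow_right coeffwise_gal[OF weilD(1)] weilD(3) laurent_over_def)

text \<open>Left linearity over \<open>Fbar\<close> makes the action commute with
  \<open>End J\<close>, right linearity over \<open>K\<close> makes it commute with morphisms of
  motives, and the shift of orders is the source of admissibility.\<close>

lemma twist_simps:
  assumes "\<gamma> \<in> weil"
  shows "twist \<gamma> (u + v) = twist \<gamma> u + twist \<gamma> v" "twist \<gamma> (u - v) = twist \<gamma> u - twist \<gamma> v" "twist \<gamma> 0 = 0"
    "s \<in> laurent_over Fbar \<Longrightarrow> twist \<gamma> (s \<star> u) = s \<star> twist \<gamma> u"
    "s \<in> laurent_over K \<Longrightarrow> twist \<gamma> (u \<star> s) = twist \<gamma> u \<star> s"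
    "vanish n u \<Longrightarrow> vanish (n - ord \<gamma>) (twist \<gamma> u)"
    "twist \<gamma> u = 0 \<longleftrightarrow> u = 0" "fls_subdegree (twist \<gamma> u) = (if u = 0 then 0 else fls_subdegree u - ord \<gamma>)"
proof -
  note c = coeffwise_gal[OF weilD(1)[OF assms]] and g = galD[OF weilD(1)[OF assms]]
  show add: "\<And>u v. twist \<gamma> (u + v) = twist \<gamma> u + twist \<gamma> v" by (simp add: twist_def c smult_add_right)
  show "twist \<gamma> (u - v) = twist \<gamma> u - twist \<gamma> v" using add[of "u - v" v] by simp
  show z: "twist \<gamma> 0 = 0" using add[of 0 0] by (simp only: add_cancel_right_left add_0_left)
  show "s \<in> laurent_over Fbar \<Longrightarrow> twist \<gamma> (s \<star> u) = s \<star> twist \<gamma> u"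
    using tau_pow_Fbar[OF assms] by (simp add: twist_def c flip: smult_assoc)
  show "s \<in> laurent_over K \<Longrightarrow> twist \<gamma> (u \<star> s) = twist \<gamma> u \<star> s"
    by (simp add: twist_def c smult_assoc)
  show "vanish n u \<Longrightarrow> vanish (n - ord \<gamma>) (twist \<gamma> u)"
    by (simp add: vanish_def twist_nth[OF assms] g)
  have g0: "\<gamma> x = 0 \<longleftrightarrow> x = 0" for x using g(4,5) by (metis bij_is_inj injD)
  show nz: "twist \<gamma> u = 0 \<longleftrightarrow> u = 0"
  proof
    assume *: "twist \<gamma> u = 0"
    have "u $$ n = 0" for n
      using twist_nth[OF assms, of u "n - ord \<gamma>"] * by (simp add: g0)
    then show "u = 0" by (intro fls_eqI) simp
  qed (simp add: z)
  show "fls_subdegree (twist \<gamma> u) = (if u = 0 then 0 else fls_subdegree u - ord \<gamma>)"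
    by (auto simp: z twist_nth[OF assms] g0 intro!: fls_subdegree_eqI)
qed

lemma twist_id: "twist id u = u"
  by (rule fls_eqI) (simp add: twist_nth[OF weil_id(1)] weil_id)

lemma twist_comp:
  assumes "\<gamma> \<in> weil" "\<delta> \<in> weil"
  shows "twist (\<gamma> \<circ> \<delta>) u = twist \<gamma> (twist \<delta> u)"
proof (rule fls_eqI)
  fix n
  note g = galD[OF weilD(1)[OF assms(1)]]
  show "twist (\<gamma> \<circ> \<delta>) u $$ n = twist \<gamma> (twist \<delta> u) $$ n"
    using twist_nth[OF weil_comp(1)[OF assms]] weil_comp(2)[OF assms] ring_iso_fr[of \<gamma>, OF g(2,3)]
    by (simp add: twist_nth assms fr_fr add.commute add.left_commute)
qed

end

section \<open>The representation attached to a motive\<close>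

context drinfeld_module
begin

lemma scmul_rball:
  assumes W: "rcoord W c"
  shows "scmul W (z powi m) ` rball W c 0 = rball W c (e * m)"
proof
  note W' = rcoordD[OF W]
  show "scmul W (z powi m) ` rball W c 0 \<subseteq> rball W c (e * m)"
    using vanish_smult[OF vanish_z_powi[of m], of 0] W' by (auto simp: rball_def)
  show "rball W c (e * m) \<subseteq> scmul W (z powi m) ` rball W c 0"
  proof
    fix w assume w: "w \<in> rball W c (e * m)"
    then have wW: "w \<in> carrier W" "vanish (e * m) (c w)" by (auto simp: rball_def)
    let ?v = "scmul W (z powi (- m)) w"
    have "?v \<in> rball W c 0"
      using vanish_smult[OF vanish_z_powi[of "- m"] wW(2)] W' wW(1) by (auto simp: rball_def)
    moreover have "w = scmul W (z powi m) ?v"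
      using W'(11)[OF W'(11)[OF wW(1)]] wW by (subst W'(7)[symmetric]) (simp_all add: W' z_powi_cancel)
    ultimately show "w \<in> scmul W (z powi m) ` rball W c 0" by blast
  qed
qed

definition tc :: "('v \<Rightarrow> 'c fls) \<Rightarrow> ('j \<Rightarrow> ('c fls \<times> 'v \<Rightarrow>\<^sub>0 int) set) \<Rightarrow> 'c fls" where
  "tc c f = hcoord J cJ (bcoord c) f"

lemmas T_hom_assms = perfect_subfield_Fbar perfect_subfield_UNIV subset_UNIV J

context
  fixes V :: "('c fls, 'f, 'v) bimod" and c :: "'v \<Rightarrow> 'c fls" and \<phi> :: "'f \<Rightarrow> 'c fls"
  assumes V: "coord K V c \<phi>" and phi: "phom e K \<phi>"
begin

lemmas B = coord_base_change[OF V]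
lemmas B' = coordD[OF B]

lemma T_carrier: "carrier (T J V) = bimod_hom Fbar J (base_change V)"
  by (simp add: T_def)

lemma tc_mem: "f \<in> carrier (T J V) \<Longrightarrow> tc c f \<in> intertwiners UNIV \<phi>J \<phi>"
  and tc_app: "f \<in> carrier (T J V) \<Longrightarrow> y \<in> carrier J \<Longrightarrow> bcoord c (f y) = cJ y \<star> tc c f"
  using hcoord[OF T_hom_assms B phiJ'(2)] by (auto simp: T_carrier tc_def)

lemma tc_inject: "f \<in> carrier (T J V) \<Longrightarrow> g \<in> carrier (T J V) \<Longrightarrow> tc c f = tc c g \<Longrightarrow> f = g"
  using hcoord_inject[OF T_hom_assms B phiJ'(2)] by (auto simp: T_carrier tc_def)

lemma tc_surj:
  assumes "u \<in> intertwiners UNIV \<phi>J \<phi>"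
  obtains f where "f \<in> carrier (T J V)" "tc c f = u"
  using hom_of(1,2)[OF T_hom_assms B phiJ'(2) _ assms] that by (auto simp: T_carrier tc_def)

lemma T_characterization:
  assumes "u \<in> intertwiners UNIV \<phi>J \<phi>" "h \<in> extensional (carrier J)"
    "\<And>v. v \<in> carrier J \<Longrightarrow> h v \<in> carrier (base_change V)"
    "\<And>v. v \<in> carrier J \<Longrightarrow> bcoord c (h v) = cJ v \<star> u"
  shows "h \<in> carrier (T J V)" "tc c h = u"
  using hom_characterization[OF T_hom_assms B phiJ'(2) _ assms] by (auto simp: T_carrier tc_def)

lemma T_app: "f \<in> carrier (T J V) \<Longrightarrow> y \<in> carrier J \<Longrightarrow> f y \<in> carrier (base_change V)"
  by (auto simp: T_carrier dest: bimod_homD(1))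

lemma T_add:
  assumes "f \<in> carrier (T J V)" "g \<in> carrier (T J V)"
  shows "f \<oplus>\<^bsub>T J V\<^esub> g \<in> carrier (T J V)" "tc c (f \<oplus>\<^bsub>T J V\<^esub> g) = tc c f + tc c g"
proof -
  have "tc c f + tc c g \<in> intertwiners UNIV \<phi>J \<phi>"
    using tc_mem assms by (intro intertwiners_closed perfect_subfield_UNIV) auto
  then show "f \<oplus>\<^bsub>T J V\<^esub> g \<in> carrier (T J V)" "tc c (f \<oplus>\<^bsub>T J V\<^esub> g) = tc c f + tc c g"
    using T_characterization[of "tc c f + tc c g" "f \<oplus>\<^bsub>T J V\<^esub> g"] assms T_app B'(3,13) tc_app
    by (auto simp: T_def smult_add_right)
qed

lemma T_zero: "\<zero>\<^bsub>T J V\<^esub> \<in> carrier (T J V)" "tc c \<zero>\<^bsub>T J V\<^esub> = 0"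
  using T_characterization[of 0 "\<zero>\<^bsub>T J V\<^esub>"] intertwiners_closed(1)[OF perfect_subfield_UNIV] B'(10,14)
  by (auto simp: T_def)

lemma T_rmul:
  assumes "f \<in> carrier (T J V)" "a \<in> carrier (EndJ J)"
  shows "rmul (T J V) f a \<in> carrier (T J V)" "tc c (rmul (T J V) f a) = dcoord a \<star> tc c f"
proof -
  have f: "f \<in> bimod_hom Fbar J (base_change V)" and a: "a \<in> bimod_hom Fbar J J"
    using assms by (auto simp: T_carrier EndJ_def)
  show "rmul (T J V) f a \<in> carrier (T J V)"
    using bimod_hom_compose[OF J a f subset_refl] by (simp add: T_def)
  show "tc c (rmul (T J V) f a) = dcoord a \<star> tc c f"
    using hcoord_compose[OF T_hom_assms B phiJ'(2) a f] by (simp add: T_def tc_def dcoord_def)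
qed

lemma twist_intertwiner:
  assumes "\<gamma> \<in> weil" "u \<in> intertwiners UNIV \<phi>J \<phi>"
  shows "twist \<gamma> u \<in> intertwiners UNIV \<phi>J \<phi>"
proof -
  have "\<phi>J x \<star> twist \<gamma> u = twist \<gamma> u \<star> \<phi> x" for x
  proof -
    have "\<phi>J x \<star> twist \<gamma> u = twist \<gamma> (\<phi>J x \<star> u)" using twist_simps(4)[OF assms(1) phiJ'(2)] by simp
    also have "\<dots> = twist \<gamma> (u \<star> \<phi> x)" using assms(2) by (simp add: intertwiners_def)
    finally show ?thesis using twist_simps(5)[OF assms(1) phomD(2)[OF phi]] by simp
  qed
  then show ?thesis by (simp add: intertwiners_def)
qed

text \<open>Applying \<gamma> to the value of f at \<tau>^(ord \<gamma>) y gives the product of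
  \<tau>^(ord \<gamma>), the conjugate of the coordinate of y and that of f. The coordinate of y
  lies over \<open>Fbar\<close>, so \<open>tau_pow_Fbar\<close> brings it back to the left.\<close>

lemma T_wact:
  assumes "\<gamma> \<in> weil" "f \<in> carrier (T J V)"
  shows "wact (T J V) \<gamma> f \<in> carrier (T J V)" "tc c (wact (T J V) \<gamma> f) = twist \<gamma> (tc c f)"
proof -
  let ?h = "wact (T J V) \<gamma> f" and ?t = "tensor_map V V (\<lambda>(b, v). (coeffwise \<gamma> b, v))"
  have h: "?h = (\<lambda>y\<in>carrier J. ?t (f (lmul J (tau_pow (ord \<gamma>)) y)))" by (simp add: T_def)
  have tau: "lmul J (tau_pow (ord \<gamma>)) y \<in> carrier J" "cJ (lmul J (tau_pow (ord \<gamma>)) y) = tau_pow (ord \<gamma>) \<star> cJ y"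
    if "y \<in> carrier J" for y
    using J'(4,5)[OF F'(7) that] by auto
  note tm = tensor_map_coeffwise[OF V weilD(1)[OF assms(1)]]
  note cg = coeffwise_gal[OF weilD(1)[OF assms(1)]]
  have "?h y \<in> carrier (base_change V)" if "y \<in> carrier J" for y
    using that tm(1)[OF T_app[OF assms(2) tau(1)[OF that]]] by (simp add: h)
  moreover have "bcoord c (?h y) = cJ y \<star> twist \<gamma> (tc c f)" if y: "y \<in> carrier J" for y
  proof -
    have "bcoord c (?h y) = coeffwise \<gamma> (bcoord c (f (lmul J (tau_pow (ord \<gamma>)) y)))"
      using y tm(2)[OF T_app[OF assms(2) tau(1)[OF y]]] by (simp add: h)
    also have "\<dots> = coeffwise \<gamma> (tau_pow (ord \<gamma>)) \<star> (coeffwise \<gamma> (cJ y) \<star> coeffwise \<gamma> (tc c f))"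
      using tc_app[OF assms(2) tau(1)[OF y]] tau(2)[OF y] by (simp add: cg smult_assoc)
    also have "coeffwise \<gamma> (tau_pow (ord \<gamma>)) = tau_pow (ord \<gamma>)"
      by (rule cg(4)) (rule laurent_over_simps(7)[OF perfect_subfield_K])
    also have "tau_pow (ord \<gamma>) \<star> (coeffwise \<gamma> (cJ y) \<star> coeffwise \<gamma> (tc c f)) = cJ y \<star> twist \<gamma> (tc c f)"
      using tau_pow_Fbar[OF assms(1) J'(8)[OF y]] by (simp add: twist_def flip: smult_assoc)
    finally show ?thesis .
  qed
  ultimately show "?h \<in> carrier (T J V)" "tc c ?h = twist \<gamma> (tc c f)"
    using T_characterization[OF twist_intertwiner[OF assms(1) tc_mem[OF assms(2)]], of ?h] by (auto simp: h)
qed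

lemma T_base:
  obtains u where "u \<noteq> 0" "u \<in> intertwiners UNIV \<phi>J \<phi>"
  using intertwiner_exists[OF phiJ phi] by (auto simp: intertwiners_def)

lemma T_abelian_group: "abelian_group (T J V)"
proof (rule abelian_groupI)
  fix f assume f: "f \<in> carrier (T J V)"
  obtain g where "g \<in> carrier (T J V)" "tc c g = - tc c f"
    using tc_surj[OF intertwiners_closed(4)[OF perfect_subfield_UNIV tc_mem[OF f]]] .
  then show "\<exists>g\<in>carrier (T J V). g \<oplus>\<^bsub>T J V\<^esub> f = \<zero>\<^bsub>T J V\<^esub>"
    using f by (intro bexI[of _ g] tc_inject) (auto simp: T_add T_zero)
qed (auto intro!: tc_inject simp: T_add T_zero add.assoc add.commute)

text \<open>A nonzero intertwiner u is a basis: right multiplication by its inverse turns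
  intertwiners into self-intertwiners of \<open>\<phi>J\<close> over the big field, and these form
  \<open>DD\<close>.\<close>

lemma rcoord_T:
  assumes u: "u \<noteq> 0" "u \<in> intertwiners UNIV \<phi>J \<phi>"
  shows "rcoord (T J V) (\<lambda>f. tc c f \<star> sinv u)"
  unfolding rcoord_def
proof (intro conjI ballI T_abelian_group T_rmul(1); assumption?)
  have inv: "sinv u \<in> intertwiners UNIV \<phi> \<phi>J" by (rule intertwiners_sinv[OF perfect_subfield_UNIV u(2,1)])
  show "bij_betw (\<lambda>f. tc c f \<star> sinv u) (carrier (T J V)) DD"
    unfolding bij_betw_def
  proof
    show "inj_on (\<lambda>f. tc c f \<star> sinv u) (carrier (T J V))"
      by (rule inj_onI) (simp add: smult_right_cancel[OF sinv_nonzero[OF u(1)]] tc_inject)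
    show "(\<lambda>f. tc c f \<star> sinv u) ` carrier (T J V) = DD"
    proof
      show "(\<lambda>f. tc c f \<star> sinv u) ` carrier (T J V) \<subseteq> DD"
        unfolding DD_eq using intertwiners_smult[OF perfect_subfield_UNIV tc_mem inv] by auto
      show "DD \<subseteq> (\<lambda>f. tc c f \<star> sinv u) ` carrier (T J V)"
      proof
        fix d assume "d \<in> DD"
        then have "d \<star> u \<in> intertwiners UNIV \<phi>J \<phi>"
          unfolding DD_eq using intertwiners_smult[OF perfect_subfield_UNIV _ u(2)] by blast
        then obtain f where "f \<in> carrier (T J V)" "tc c f = d \<star> u" by (rule tc_surj)
        then show "d \<in> (\<lambda>f. tc c f \<star> sinv u) ` carrier (T J V)"
          using u(1) by (intro image_eqI[of _ _ f]) (simp_all add: smult_assoc sinv_right)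
      qed
    qed
  qed
qed (simp_all add: T_add T_rmul smult_add_left smult_assoc)

text \<open>With \<delta> = \<gamma> \<iota> close to \<gamma> and v close to w, the difference
  \<delta> v - \<gamma> w splits as \<delta>(v - w) + \<gamma>(\<iota> w - w). The first term is
  small because \<open>twist\<close> shifts orders by a fixed amount, the second because \<iota>
  fixes the low coefficients of w.\<close>

lemma T_continuous:
  "continuous_map (prod_topology weil_topology (vs_topology J (T J V))) (vs_topology J (T J V))
      (\<lambda>(\<gamma>, w). wact (T J V) \<gamma> w)"
proof -
  obtain u where u: "u \<noteq> 0" "u \<in> intertwiners UNIV \<phi>J \<phi>" by (rule T_base)
  note W = rcoord_T[OF u]
  let ?\<kappa> = "\<lambda>f. tc c f \<star> sinv u"
  let ?P = "prod_topology weil_topology (vs_topology J (T J V))"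
  define s0 where "s0 = fls_subdegree u"
  have vu: "vanish s0 u" "vanish (- s0) (sinv u)"
    using u by (auto simp: s0_def subdegree_sinv intro!: vanish_subdegree)
  have v1: "vanish (n - s0) (?\<kappa> f - ?\<kappa> g)" if "vanish n (tc c f - tc c g)" for n f g
    using vanish_smult[OF that vu(2)] by (simp add: smult_diff_left)
  have v2: "vanish n (tc c f - tc c g)" if "vanish (n - s0) (?\<kappa> f - ?\<kappa> g)" for n f g
  proof -
    have "(?\<kappa> f - ?\<kappa> g) \<star> u = tc c f - tc c g"
      using u(1) by (simp add: smult_diff_left smult_assoc sinv_left)
    then show ?thesis using vanish_smult[OF that vu(1)] by simp
  qed
  note ts = topspace_vs_topology[OF W]
  have "openin ?P {p \<in> topspace ?P. (case p of (\<gamma>, w) \<Rightarrow> wact (T J V) \<gamma> w) \<in> U}"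
    if U: "openin (vs_topology J (T J V)) U" for U
    unfolding openin_prod_topology_alt
  proof (intro allI impI)
    fix \<gamma> w assume "(\<gamma>, w) \<in> {p \<in> topspace ?P. (case p of (\<gamma>, w) \<Rightarrow> wact (T J V) \<gamma> w) \<in> U}"
    then have g: "\<gamma> \<in> weil" and w: "w \<in> carrier (T J V)" and wU: "wact (T J V) \<gamma> w \<in> U"
      by (auto simp: topspace_weil_topology ts)
    obtain n where n: "\<And>v. v \<in> carrier (T J V) \<Longrightarrow> vanish n (?\<kappa> v - ?\<kappa> (wact (T J V) \<gamma> w)) \<Longrightarrow> v \<in> U"
      using U wU unfolding openin_vs_topology[OF W] by blast
    \<comment> \<open>\<open>twist\<close> by \<gamma> costs \<open>ord \<gamma>\<close> and
      division by u costs \<open>s0\<close>; starting with this precision leaves precision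
      n.\<close>
    define M where "M = n + s0 + ord \<gamma>"
    obtain a where a: "vanish a (tc c w)" using vanish_ex by blast
    define S where "S = (\<lambda>i. tc c w $$ i) ` {a..<M}"
    define A where "A = (\<lambda>\<iota>. \<gamma> \<circ> \<iota>) ` wfix S"
    define B where "B = {v \<in> carrier (T J V). vanish (M - s0) (?\<kappa> v - ?\<kappa> w)}"
    have "openin weil_topology A"
      unfolding openin_weil_topology
    proof (intro conjI ballI)
      show "A \<subseteq> weil" using weil_comp[OF g] by (auto simp: A_def wfix_def)
      fix \<delta> assume "\<delta> \<in> A"
      then obtain \<iota> where i: "\<delta> = \<gamma> \<circ> \<iota>" "\<iota> \<in> wfix S" by (auto simp: A_def)
      have "\<delta> \<circ> \<iota>' \<in> A" if "\<iota>' \<in> wfix S" for \<iota>'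
        using weil_comp[of \<iota> \<iota>'] that i by (auto simp: A_def wfix_def comp_assoc)
      moreover have "finite S" by (simp add: S_def)
      ultimately show "\<exists>S. finite S \<and> (\<forall>\<iota>\<in>wfix S. \<delta> \<circ> \<iota> \<in> A)" by blast
    qed
    moreover have "openin (vs_topology J (T J V)) B"
      unfolding openin_vs_topology[OF W]
    proof (intro conjI ballI)
      show "B \<subseteq> carrier (T J V)" by (auto simp: B_def)
      fix v assume v: "v \<in> B"
      have "v' \<in> B" if "v' \<in> carrier (T J V)" "vanish (M - s0) (?\<kappa> v' - ?\<kappa> v)" for v'
        using vanish_add[OF that(2), of "?\<kappa> v - ?\<kappa> w"] v that(1) by (simp add: B_def)
      then show "\<exists>n. \<forall>v'\<in>carrier (T J V). vanish n (?\<kappa> v' - ?\<kappa> v) \<longrightarrow> v' \<in> B" by blast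
    qed
    moreover have "\<gamma> \<in> A" using weil_id unfolding A_def by (intro image_eqI[of _ _ id]) (auto simp: wfix_def)
    moreover have "w \<in> B" using w by (simp add: B_def)
    moreover have "A \<times> B \<subseteq> {p \<in> topspace ?P. (case p of (\<gamma>, w) \<Rightarrow> wact (T J V) \<gamma> w) \<in> U}"
    proof
      fix p assume "p \<in> A \<times> B"
      then obtain \<delta> v where p: "p = (\<delta>, v)" and d: "\<delta> \<in> A" and v: "v \<in> B" by (elim SigmaE) simp
      then obtain \<iota> where i: "\<delta> = \<gamma> \<circ> \<iota>" "\<iota> \<in> wfix S" by (auto simp: A_def)
      then have iw: "\<iota> \<in> weil" "ord \<iota> = 0" "\<And>x. x \<in> S \<Longrightarrow> \<iota> x = x" by (auto simp: wfix_def)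
      have vT: "v \<in> carrier (T J V)" using v by (simp add: B_def)
      have dw: "\<delta> \<in> weil" "ord \<delta> = ord \<gamma>" using weil_comp[OF g iw(1)] i iw(2) by auto
      have "vanish M (tc c v - tc c w)" using v v2 by (simp add: B_def)
      then have 1: "vanish (M - ord \<gamma>) (twist \<delta> (tc c v - tc c w))" using twist_simps(6)[OF dw(1)] dw(2) by metis
      have "vanish M (twist \<iota> (tc c w) - tc c w)"
        unfolding vanish_def
      proof (intro allI impI)
        fix k assume k: "k < M"
        show "(twist \<iota> (tc c w) - tc c w) $$ k = 0"
        proof (cases "k < a")
          case True
          then show ?thesis using a iw galD(4)[OF weilD(1)[OF iw(1)]] by (simp add: twist_nth vanish_def)
        next
          case False
          then show ?thesis using k iw by (simp add: twist_nth S_def)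
        qed
      qed
      then have 2: "vanish (M - ord \<gamma>) (twist \<gamma> (twist \<iota> (tc c w) - tc c w))" by (rule twist_simps(6)[OF g])
      have "tc c (wact (T J V) \<delta> v) - tc c (wact (T J V) \<gamma> w) =
          twist \<delta> (tc c v - tc c w) + twist \<gamma> (twist \<iota> (tc c w) - tc c w)"
        by (simp add: T_wact[OF dw(1) vT] T_wact[OF g w] twist_simps(2)[OF dw(1)] twist_simps(2)[OF g])
          (simp add: i twist_comp[OF g iw(1)])
      then have "vanish (M - ord \<gamma>) (tc c (wact (T J V) \<delta> v) - tc c (wact (T J V) \<gamma> w))"
        using vanish_add[OF 1 2] by simp
      then have "vanish n (?\<kappa> (wact (T J V) \<delta> v) - ?\<kappa> (wact (T J V) \<gamma> w))"
        using v1[of "M - ord \<gamma>"] by (simp add: M_def)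
      then have "wact (T J V) \<delta> v \<in> U" using n T_wact(1)[OF dw(1) vT] by blast
      then show "p \<in> {p \<in> topspace ?P. (case p of (\<gamma>, w) \<Rightarrow> wact (T J V) \<gamma> w) \<in> U}"
        using dw vT p by (simp add: topspace_weil_topology ts)
    qed
    ultimately show "\<exists>A B. openin weil_topology A \<and> openin (vs_topology J (T J V)) B \<and> \<gamma> \<in> A \<and> w \<in> B \<and>
        A \<times> B \<subseteq> {p \<in> topspace ?P. (case p of (\<gamma>, w) \<Rightarrow> wact (T J V) \<gamma> w) \<in> U}" by blast
  qed
  then show ?thesis
    unfolding continuous_map_def by (auto simp: topspace_weil_topology ts T_wact(1))
qed

lemma T_representation: "representation J (T J V)" "has_rank (EndJ J) (T J V) (\<lambda>a w. rmul (T J V) w a) 1"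
proof -
  obtain u where u: "u \<noteq> 0" "u \<in> intertwiners UNIV \<phi>J \<phi>" by (rule T_base)
  note rm = rcoord_right_module[OF rcoord_T[OF u]]
  show "has_rank (EndJ J) (T J V) (\<lambda>a w. rmul (T J V) w a) 1" by (rule rm)
  show "representation J (T J V)"
    unfolding representation_def
  proof (intro conjI ballI rm(1) T_continuous T_wact(1); assumption?)
    show "\<exists>n. has_rank (EndJ J) (T J V) (\<lambda>a w. rmul (T J V) w a) n" using rm(2) by blast
    fix w assume w: "w \<in> carrier (T J V)"
    show "wact (T J V) id w = w"
      by (rule tc_inject) (simp_all add: w T_wact weil_id twist_id)
    { fix \<gamma> \<delta> assume "\<gamma> \<in> weil" "\<delta> \<in> weil"
      then show "wact (T J V) (\<gamma> \<circ> \<delta>) w = wact (T J V) \<gamma> (wact (T J V) \<delta> w)"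
        by (intro tc_inject) (simp_all add: w T_wact weil_comp twist_comp) }
    { fix \<gamma> a assume "\<gamma> \<in> weil" "a \<in> carrier (EndJ J)"
      then show "wact (T J V) \<gamma> (rmul (T J V) w a) = rmul (T J V) (wact (T J V) \<gamma> w) a"
        using DD_Fbar[OF dcoord_DD] by (intro tc_inject) (simp_all add: w T_wact T_rmul twist_simps(4)) }
    { fix \<gamma> v assume "\<gamma> \<in> weil" "v \<in> carrier (T J V)"
      then show "wact (T J V) \<gamma> (v \<oplus>\<^bsub>T J V\<^esub> w) = wact (T J V) \<gamma> v \<oplus>\<^bsub>T J V\<^esub> wact (T J V) \<gamma> w"
        by (intro tc_inject) (simp_all add: w T_wact T_add twist_simps(1)) }
  qed
qed

text \<open>The unit ball serves as the lattice, with s = -1 and r' = r: both \<gamma>^(r d) and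
  z^(-ord \<gamma>) carry it onto the ball of order -e ord \<gamma>.\<close>

lemma T_admissible:
  assumes r: "r > 0" "e = int (r * residue_degree)"
  shows "admissible J (- (1 / of_nat r)) (T J V)"
proof -
  obtain u where u: "u \<noteq> 0" "u \<in> intertwiners UNIV \<phi>J \<phi>" by (rule T_base)
  note W = rcoord_T[OF u]
  let ?\<kappa> = "\<lambda>f. tc c f \<star> sinv u"
  let ?\<Lambda> = "rball (T J V) ?\<kappa> 0"
  \<comment> \<open>In the coordinate given by u the action is right multiplication by
    \<open>twist \<delta> u\<close> times the inverse of u, an element of order -ord
    \<delta>.\<close>
  have act: "wact (T J V) \<delta> w \<in> rball (T J V) ?\<kappa> (n - ord \<delta>)" if d: "\<delta> \<in> weil" and w: "w \<in> rball (T J V) ?\<kappa> n" for \<delta> w n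
  proof -
    have wT: "w \<in> carrier (T J V)" "vanish n (?\<kappa> w)" using w by (auto simp: rball_def)
    have "tc c w = ?\<kappa> w \<star> u" using u(1) by (simp add: smult_assoc sinv_left)
    moreover have "?\<kappa> w \<in> laurent_over Fbar" using rcoordD(6)[OF W wT(1)] by (rule DD_Fbar)
    ultimately have "?\<kappa> (wact (T J V) \<delta> w) = ?\<kappa> w \<star> (twist \<delta> u \<star> sinv u)"
    proof -
      assume tw: "tc c w = ?\<kappa> w \<star> u" and F: "?\<kappa> w \<in> laurent_over Fbar"
      have "twist \<delta> (tc c w) = ?\<kappa> w \<star> twist \<delta> u" using twist_simps(4)[OF d F, of u] tw by simp
      then show ?thesis by (simp add: T_wact[OF d wT(1)] smult_assoc)
    qed
    moreover have "vanish (n + - ord \<delta>) (?\<kappa> w \<star> (twist \<delta> u \<star> sinv u))"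
      using u twist_simps(7,8)[OF d] by (intro vanish_smult wT vanish_subdegree) (simp add: subdegree_smult sinv_nonzero subdegree_sinv)
    ultimately show ?thesis using T_wact(1)[OF d wT(1)] by (simp add: rball_def)
  qed
  have main: "wact (T J V) (\<gamma> ^^ (nat (int r) * residue_degree)) ` ?\<Lambda> =
      (\<lambda>w. rmul (T J V) w (scalar J (z powi (- 1 * ord \<gamma>)))) ` ?\<Lambda>" if g: "\<gamma> \<in> weil" for \<gamma>
  proof -
  let ?\<delta> = "\<gamma> ^^ (nat (int r) * residue_degree)"
  have d: "?\<delta> \<in> weil" "ord ?\<delta> = e * ord \<gamma>" using weil_funpow[OF g] r by auto
  have "wact (T J V) ?\<delta> ` ?\<Lambda> = rball (T J V) ?\<kappa> (e * (- ord \<gamma>))"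
  proof
    show "wact (T J V) ?\<delta> ` ?\<Lambda> \<subseteq> rball (T J V) ?\<kappa> (e * (- ord \<gamma>))" using act[OF d(1), of _ 0] d(2) by auto
    \<comment> \<open>Surjectivity onto the shifted ball: the inverse group element shifts orders by
      the opposite amount.\<close>
    show "rball (T J V) ?\<kappa> (e * (- ord \<gamma>)) \<subseteq> wact (T J V) ?\<delta> ` ?\<Lambda>"
    proof
      fix w assume w: "w \<in> rball (T J V) ?\<kappa> (e * (- ord \<gamma>))"
      then have wT: "w \<in> carrier (T J V)" by (simp add: rball_def)
      have "wact (T J V) ?\<delta> (wact (T J V) (inv_into UNIV ?\<delta>) w) = wact (T J V) (?\<delta> \<circ> inv_into UNIV ?\<delta>) w"
        using T_representation(1) d(1) weil_inv[OF d(1)] wT by (simp add: representation_def)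
      also have "\<dots> = w"
        using T_representation(1) wT gal_inv(2)[OF weilD(1)[OF d(1)]] by (simp add: representation_def)
      finally show "w \<in> wact (T J V) ?\<delta> ` ?\<Lambda>"
        using act[OF weil_inv(1)[OF d(1)] w] weil_inv(2)[OF d(1)] d(2) by (intro image_eqI[of _ _ "wact (T J V) (inv_into UNIV ?\<delta>) w"]) auto
    qed
  qed
  moreover have "scmul (T J V) (z powi (- ord \<gamma>)) ` ?\<Lambda> = rball (T J V) ?\<kappa> (e * (- ord \<gamma>))"
    by (rule scmul_rball[OF W])
  ultimately show ?thesis by simp
  qed
  have "- (1 / of_nat r) = (of_int (- 1) / of_int (int r) :: rat)" "(0::int) < int r" using r by simp_all
  then show ?thesis unfolding admissible_def using rball_lattice[OF W, of 0] main by blast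
qed

end

end

section \<open>Galois theory of the algebraic closure\<close>

text \<open>Artin's argument: evaluating a relation at y x and subtracting \<chi>_i(y) times the
  relation at x removes the character i. The relation is only assumed on a submonoid
  \<open>E\<close>, later the elements fixed by the subgroup acting trivially on a finite
  set.\<close>

lemma dedekind_independence:
  fixes \<chi>' :: "'i \<Rightarrow> 'm::monoid_mult \<Rightarrow> 'k::field" and E :: "'m set"
  assumes "finite I" and E: "1 \<in> E" "\<And>x y. x \<in> E \<Longrightarrow> y \<in> E \<Longrightarrow> x * y \<in> E"
    and "\<And>i. i \<in> I \<Longrightarrow> \<chi>' i 1 = 1" "\<And>i x y. i \<in> I \<Longrightarrow> x \<in> E \<Longrightarrow> y \<in> E \<Longrightarrow> \<chi>' i (x * y) = \<chi>' i x * \<chi>' i y"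
    and "\<And>i j. i \<in> I \<Longrightarrow> j \<in> I \<Longrightarrow> i \<noteq> j \<Longrightarrow> \<exists>x\<in>E. \<chi>' i x \<noteq> \<chi>' j x"
    and "\<And>x. x \<in> E \<Longrightarrow> (\<Sum>i\<in>I. a i * \<chi>' i x) = 0"
  shows "\<forall>i\<in>I. a i = 0"
  using assms(1,4-7)
proof (induction I arbitrary: a rule: finite_induct)
  case (insert i I)
  have "\<forall>k\<in>I. a k * (\<chi>' k y - \<chi>' i y) = 0" if y: "y \<in> E" for y
  proof (rule insert.IH)
    fix x assume x: "x \<in> E"
    have "(\<Sum>k\<in>insert i I. a k * \<chi>' k (y * x)) = (\<Sum>k\<in>insert i I. a k * \<chi>' k y * \<chi>' k x)"
      using insert.prems(2) x y by (intro sum.cong) (auto simp: mult.assoc)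
    then have 1: "(\<Sum>k\<in>insert i I. a k * \<chi>' k y * \<chi>' k x) = 0" using insert.prems(4)[of "y * x"] E x y by simp
    have "(\<Sum>k\<in>insert i I. a k * \<chi>' k x) * \<chi>' i y = 0" using insert.prems(4)[OF x] by simp
    then have 2: "(\<Sum>k\<in>insert i I. a k * \<chi>' i y * \<chi>' k x) = 0"
      by (simp only: sum_distrib_right) (simp add: mult.commute mult.left_commute)
    have "(\<Sum>k\<in>I. a k * (\<chi>' k y - \<chi>' i y) * \<chi>' k x) =
      (\<Sum>k\<in>insert i I. a k * \<chi>' k y * \<chi>' k x) - (\<Sum>k\<in>insert i I. a k * \<chi>' i y * \<chi>' k x)"
      using insert(1,2) by (simp add: sum_subtractf left_diff_distrib right_diff_distrib)
    then show "(\<Sum>k\<in>I. a k * (\<chi>' k y - \<chi>' i y) * \<chi>' k x) = 0" using 1 2 by simp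
  qed (use insert.prems in auto)
  moreover have "\<exists>y\<in>E. \<chi>' k y \<noteq> \<chi>' i y" if "k \<in> I" for k
    using insert.prems(3)[of k i] that insert(2) by auto
  ultimately have "\<forall>k\<in>I. a k = 0" by (metis mult_eq_0_iff right_minus_eq)
  moreover from this have "a i = 0" using insert.prems(1)[of i] insert.prems(4)[OF E(1)] insert(1,2) by simp
  ultimately show ?case by simp
qed simp

context drinfeld_setting
begin

lemmas K_closed = perfect_subfield_closed[OF perfect_subfield_K]

lemma algebraic_over_K:
  obtains P where "P \<noteq> 0" "P \<in> polys_over K" "poly P (x::'c) = 0"
proof -
  interpret A: algebraic_closure "ring_of_type_algebra :: 'c ring" K by (rule Kbar)
  have "ring.algebraic ring_of_type_algebra K x" using A.algebraic_extension[of x] by (simp add: over_def)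
  then show ?thesis using algebraic_ring_of_type_algebra_iff[OF A.subring_axioms] that by blast
qed

text \<open>Partial embeddings over K, given by their graphs; the condition on \<open>(0, b)\<close> makes such a relation
  single-valued.\<close>

definition partial_emb :: "('c \<times> 'c) set \<Rightarrow> bool" where
  "partial_emb G \<longleftrightarrow> (\<forall>k\<in>K. (k, k) \<in> G) \<and>
    (\<forall>a b a' b'. (a, b) \<in> G \<longrightarrow> (a', b') \<in> G \<longrightarrow> (a + a', b + b') \<in> G \<and> (a * a', b * b') \<in> G) \<and>
    (\<forall>b. (0, b) \<in> G \<longrightarrow> b = 0)"

lemma partial_embD:
  assumes "partial_emb G"
  shows "k \<in> K \<Longrightarrow> (k, k) \<in> G" "(a, b) \<in> G \<Longrightarrow> (a', b') \<in> G \<Longrightarrow> (a + a', b + b') \<in> G"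
    "(a, b) \<in> G \<Longrightarrow> (a', b') \<in> G \<Longrightarrow> (a * a', b * b') \<in> G" "(0, b) \<in> G \<Longrightarrow> b = 0"
    "(a, b) \<in> G \<Longrightarrow> (- a, - b) \<in> G" "(a, b) \<in> G \<Longrightarrow> (a, b') \<in> G \<Longrightarrow> b = b'"
proof -
  show k: "\<And>k. k \<in> K \<Longrightarrow> (k, k) \<in> G" and add: "\<And>a b a' b'. (a, b) \<in> G \<Longrightarrow> (a', b') \<in> G \<Longrightarrow> (a + a', b + b') \<in> G"
    and mult: "\<And>a b a' b'. (a, b) \<in> G \<Longrightarrow> (a', b') \<in> G \<Longrightarrow> (a * a', b * b') \<in> G"
    and zero: "\<And>b. (0, b) \<in> G \<Longrightarrow> b = 0"
    using assms by (auto simp: partial_emb_def)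
  show neg: "(a, b) \<in> G \<Longrightarrow> (- a, - b) \<in> G" for a b
    using mult[OF k[OF K_closed(7)[OF K_closed(2)]], of a b] by simp
  show "(a, b) \<in> G \<Longrightarrow> (a, b') \<in> G \<Longrightarrow> b = b'"
    using add[of a b "- a" "- b'"] neg[of a b'] zero[of "b - b'"] by simp
qed

text \<open>As a is nonzero, factors X can be removed from an annihilator; a nonzero constant term
  then exhibits 1/a as a polynomial in a over \<open>K\<close>.\<close>

lemma pcompose_annihilator_inverse:
  fixes Q :: "'c poly"
  assumes "a \<noteq> 0" "Q \<noteq> 0" "poly Q a = 0" "Q \<in> polys_over K"
  shows "\<exists>R\<in>polys_over K. a * poly R a = 1"
  using assms(2-4)
proof (induction "Polynomial.degree Q" arbitrary: Q rule: less_induct)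
  case less
  obtain c R where Q: "Q = pCons c R" by (cases Q)
  have R: "R \<in> polys_over K" and c: "c \<in> K"
    using less.prems(3) by (auto simp: Q polys_over_def coeff_pCons split: nat.splits dest: spec[of _ "Suc _"] spec[of _ 0])
  show ?case
  proof (cases "c = 0")
    case True
    then have "R \<noteq> 0" "poly R a = 0" using less.prems assms(1) by (auto simp: Q)
    moreover have "Polynomial.degree R < Polynomial.degree Q" using \<open>R \<noteq> 0\<close> by (simp add: Q)
    ultimately show ?thesis using less.hyps R by blast
  next
    case False
    have "Polynomial.smult (- inverse c) R \<in> polys_over K"
      using R K_closed(6)[OF K_closed(7)[OF K_closed(8)[OF c]]] by (simp add: polys_over_def)
    moreover have "c + a * poly R a = 0" using less.prems by (simp add: Q)
    then have "a * poly R a = - c" by (simp add: eq_neg_iff_add_eq_0 add.commute)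
    then have "a * poly (Polynomial.smult (- inverse c) R) a = 1" using False
      by simp (metis minus_mult_minus left_inverse mult.left_commute mult_minus_left)
    ultimately show ?thesis by blast
  qed
qed

lemma partial_emb_poly:
  assumes G: "partial_emb G" and ab: "(a, b) \<in> G" and R: "R \<in> polys_over K"
  shows "(poly R a, poly R b) \<in> G"
proof -
  note G' = partial_embD[OF G]
  have pow: "(a ^ n, b ^ n) \<in> G" for n
    by (induction n) (use G'(1)[OF K_closed(2)] G'(3)[OF ab] in auto)
  have "(\<Sum>i\<in>A. Polynomial.coeff R i * a ^ i, \<Sum>i\<in>A. Polynomial.coeff R i * b ^ i) \<in> G" for A
    by (induction A rule: infinite_finite_induct)
      (use R G'(1)[OF K_closed(1)] G'(2) G'(3)[OF G'(1) pow] in \<open>auto simp: polys_over_def\<close>)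
  then show ?thesis by (simp add: poly_altdef)
qed

text \<open>Inverses are polynomials over \<open>K\<close>, so closure under sums and products
  already makes the domain of a partial embedding a field; and nonzero elements have nonzero
  images.\<close>

lemma partial_emb_inverse:
  assumes G: "partial_emb G" and ab: "(a, b) \<in> G" and a: "a \<noteq> 0"
  shows "(inverse a, inverse b) \<in> G" "b \<noteq> 0"
proof -
  note G' = partial_embD[OF G]
  obtain Q where "Q \<noteq> 0" "Q \<in> polys_over K" "poly Q a = 0" by (rule algebraic_over_K)
  then obtain R where R: "R \<in> polys_over K" "a * poly R a = 1" using pcompose_annihilator_inverse[OF a] by blast
  have m: "(poly R a, poly R b) \<in> G" by (rule partial_emb_poly[OF G ab R(1)])
  have "(1, b * poly R b) \<in> G" using G'(3)[OF ab m] R(2) by simp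
  then have bR: "b * poly R b = 1" using G'(6)[OF G'(1)[OF K_closed(2)]] by metis
  show "b \<noteq> 0" using bR by auto
  have "poly R a = inverse a" "poly R b = inverse b" using R(2) bR by (simp_all add: inverse_unique)
  then show "(inverse a, inverse b) \<in> G" using m by simp
qed

text \<open>Send g(a) to the value at b of the conjugated polynomial. This is well defined because a
  polynomial over the domain that kills a is, by division, a multiple of the minimal one, so its
  conjugate kills b.\<close>

lemma partial_emb_extend:
  assumes G: "partial_emb G"
  defines "D \<equiv> Domain G" and "\<sigma> \<equiv> (\<lambda>a. THE b. (a, b) \<in> G)"
  assumes p: "p \<in> polys_over D" "poly p a = 0" "Polynomial.lead_coeff p = 1"
    and min: "\<And>g. g \<in> polys_over D \<Longrightarrow> g \<noteq> 0 \<Longrightarrow> poly g a = 0 \<Longrightarrow> Polynomial.degree p \<le> Polynomial.degree g"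
    and b: "poly (map_poly \<sigma> p) b = 0"
  shows "\<exists>G'. partial_emb G' \<and> G \<subseteq> G' \<and> (a, b) \<in> G'"
proof -
  note G' = partial_embD[OF G]
  have sG: "(x, \<sigma> x) \<in> G" if "x \<in> D" for x
    using that G'(6) unfolding D_def \<sigma>_def by (metis Domain.cases theI)
  have sI: "\<sigma> x = y" if "(x, y) \<in> G" for x y
    using that G'(6) sG[of x] by (auto simp: D_def)
  have DK: "K \<subseteq> D" using G'(1) by (auto simp: D_def)
  have Dadd: "x + y \<in> D" "\<sigma> (x + y) = \<sigma> x + \<sigma> y" and Dmult: "x * y \<in> D" "\<sigma> (x * y) = \<sigma> x * \<sigma> y"
    if "x \<in> D" "y \<in> D" for x y
    using G'(2,3)[OF sG[OF that(1)] sG[OF that(2)]] sI by (auto simp: D_def)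
  have Dneg: "- x \<in> D" "\<sigma> (- x) = - \<sigma> x" if "x \<in> D" for x
    using G'(5)[OF sG[OF that]] sI by (auto simp: D_def)
  have s01: "\<sigma> 0 = 0" "\<sigma> 1 = 1" "0 \<in> D" "1 \<in> D" using sI G'(1) K_closed(1,2) DK by auto
  have Dinv: "inverse x \<in> D" if "x \<in> D" for x
    using partial_emb_inverse(1)[OF G sG[OF that]] s01 by (cases "x = 0") (auto simp: D_def)
  have Dsum: "sum h A \<in> D" "\<sigma> (sum h A) = (\<Sum>i\<in>A. \<sigma> (h i))" if "\<And>i. h i \<in> D" for h :: "nat \<Rightarrow> 'c" and A
    using that by (induction A rule: infinite_finite_induct) (auto simp: s01 Dadd)
  have co: "Polynomial.coeff (map_poly \<sigma> g) i = \<sigma> (Polynomial.coeff g i)" for g i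
    by (rule coeff_map_poly[where f = \<sigma>, OF s01(1)])
  have madd: "g + h \<in> polys_over D" "map_poly \<sigma> (g + h) = map_poly \<sigma> g + map_poly \<sigma> h"
    if "g \<in> polys_over D" "h \<in> polys_over D" for g h
    using that by (auto simp: polys_over_def Dadd co intro!: poly_eqI)
  have mneg: "- g \<in> polys_over D" "map_poly \<sigma> (- g) = - map_poly \<sigma> g" if "g \<in> polys_over D" for g
    using that by (auto simp: polys_over_def Dneg co intro!: poly_eqI)
  have mmult: "g * h \<in> polys_over D" "map_poly \<sigma> (g * h) = map_poly \<sigma> g * map_poly \<sigma> h"
    if gh: "g \<in> polys_over D" "h \<in> polys_over D" for g h
  proof -
    have t: "Polynomial.coeff g i * Polynomial.coeff h (n - i) \<in> D" for i n
      using gh by (auto simp: polys_over_def Dmult)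
    show "g * h \<in> polys_over D" using Dsum(1)[OF t] by (simp add: polys_over_def coeff_mult)
    show "map_poly \<sigma> (g * h) = map_poly \<sigma> g * map_poly \<sigma> h"
      using gh by (intro poly_eqI) (simp add: co coeff_mult Dsum(2)[OF t] Dmult polys_over_def)
  qed
  have mmon: "Polynomial.monom c n \<in> polys_over D" "map_poly \<sigma> (Polynomial.monom c n) = Polynomial.monom (\<sigma> c) n"
    if "c \<in> D" for c n
    using that s01 by (auto simp: polys_over_def map_poly_monom)
  have ann: "poly (map_poly \<sigma> g) b = 0" if "g \<in> polys_over D" "poly g a = 0" for g
    using that
  proof (induction "Polynomial.degree g" arbitrary: g rule: less_induct)
    case less
    show ?case
    proof (cases "g = 0")
      case False
      have le: "Polynomial.degree p \<le> Polynomial.degree g" using min less.prems False by blast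
      have lcD: "Polynomial.lead_coeff g \<in> D" using less.prems(1) by (simp add: polys_over_def)
      let ?m = "Polynomial.monom (Polynomial.lead_coeff g) (Polynomial.degree g - Polynomial.degree p)"
      \<comment> \<open>One step of division by the monic \<open>p\<close>: the leading term of
        \<open>g\<close> is cancelled while \<open>h\<close> still kills a.\<close>
      define h where "h = g + - (?m * p)"
      have hD: "h \<in> polys_over D" unfolding h_def by (intro madd mneg mmult mmon less.prems lcD p)
      have ha: "poly h a = 0" using less.prems p by (simp add: h_def)
      have eq: "map_poly \<sigma> g = map_poly \<sigma> h + map_poly \<sigma> ?m * map_poly \<sigma> p"
      proof -
        have "map_poly \<sigma> h = map_poly \<sigma> g + - (map_poly \<sigma> ?m * map_poly \<sigma> p)"
          unfolding h_def using less.prems(1) lcD p(1) by (simp only: madd mneg mmult mmon)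
        then show ?thesis by simp
      qed
      have "poly (map_poly \<sigma> h) b = 0"
      proof (cases "Polynomial.degree g = 0")
        case True
        then obtain k where k: "g = [:k:]" using degree_eq_zeroE by blast
        then show ?thesis using less.prems False by simp
      next
        case gt: False
        have dm: "Polynomial.degree (?m * p) \<le> Polynomial.degree g"
          using degree_mult_le[of ?m p] degree_monom_le[of "Polynomial.lead_coeff g" "Polynomial.degree g - Polynomial.degree p"] le
          by linarith
        have "Polynomial.coeff (?m * p) (Polynomial.degree g) = Polynomial.lead_coeff g"
          using le p(3) by (simp add: coeff_monom_mult)
        then have "Polynomial.coeff h (Polynomial.degree g) = 0" by (simp add: h_def)
        moreover have "Polynomial.degree h \<le> Polynomial.degree g"
          unfolding h_def using dm by (intro degree_add_le) auto
        ultimately have "Polynomial.degree h < Polynomial.degree g"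
          using gt by (metis leading_coeff_0_iff degree_0 le_neq_implies_less neq0_conv)
        then show ?thesis using less.hyps hD ha by blast
      qed
      then show ?thesis using eq b by simp
    qed simp
  qed
  define G2 where "G2 = {(poly g a, poly (map_poly \<sigma> g) b) | g. g \<in> polys_over D}"
  have inG2: "(poly g a, poly (map_poly \<sigma> g) b) \<in> G2" if "g \<in> polys_over D" for g
    using that by (auto simp: G2_def)
  have const: "(x, \<sigma> x) \<in> G2" if "x \<in> D" for x
    using inG2[OF mmon(1)[OF that, of 0]] mmon(2)[OF that, of 0] by (simp add: poly_monom)
  have "partial_emb G2"
    unfolding partial_emb_def
  proof (intro conjI ballI allI impI)
    show "(k, k) \<in> G2" if "k \<in> K" for k using const[of k] DK that sI[OF G'(1)[OF that]] by auto
  next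
    fix x y x' y' assume "(x, y) \<in> G2" "(x', y') \<in> G2"
    then obtain g h where g: "g \<in> polys_over D" "x = poly g a" "y = poly (map_poly \<sigma> g) b"
      and h: "h \<in> polys_over D" "x' = poly h a" "y' = poly (map_poly \<sigma> h) b" by (auto simp: G2_def)
    show "(x + x', y + y') \<in> G2" using inG2[OF madd(1)[OF g(1) h(1)]] madd(2)[OF g(1) h(1)] g h by simp
    show "(x * x', y * y') \<in> G2" using inG2[OF mmult(1)[OF g(1) h(1)]] mmult(2)[OF g(1) h(1)] g h by simp
  next
    fix y assume "(0, y) \<in> G2"
    then show "y = 0" using ann by (auto simp: G2_def)
  qed
  moreover have "G \<subseteq> G2"
  proof clarify
    fix x y assume "(x, y) \<in> G"
    then show "(x, y) \<in> G2" using const[of x] sI by (auto simp: D_def)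
  qed
  moreover have "(a, b) \<in> G2"
    using inG2[OF mmon(1)[OF s01(4), of 1]] mmon(2)[OF s01(4), of 1] s01(2) by (simp add: poly_monom)
  ultimately show ?thesis by blast
qed

lemma minimal_annihilator:
  assumes D: "K \<subseteq> D" "\<And>x y. x \<in> D \<Longrightarrow> y \<in> D \<Longrightarrow> x * y \<in> D" "\<And>x. x \<in> D \<Longrightarrow> inverse x \<in> D"
  obtains p where "p \<in> polys_over D" "poly p (a::'c) = 0" "Polynomial.lead_coeff p = 1"
    "\<And>g. g \<in> polys_over D \<Longrightarrow> g \<noteq> 0 \<Longrightarrow> poly g a = 0 \<Longrightarrow> Polynomial.degree p \<le> Polynomial.degree g"
proof -
  let ?P = "\<lambda>g. g \<in> polys_over D \<and> g \<noteq> 0 \<and> poly g a = 0"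
  obtain Q where "Q \<noteq> 0" "Q \<in> polys_over K" "poly Q a = 0" by (rule algebraic_over_K)
  then have "?P Q" using D(1) by (auto simp: polys_over_def)
  then obtain g where g: "?P g" "\<And>h. ?P h \<Longrightarrow> Polynomial.degree g \<le> Polynomial.degree h"
    using exists_least_iff[of "\<lambda>n. \<exists>g. ?P g \<and> Polynomial.degree g = n"] by (metis not_le_imp_less)
  let ?c = "inverse (Polynomial.lead_coeff g)"
  have c: "?c \<noteq> 0" using g by simp
  show ?thesis
  proof (rule that[of "Polynomial.smult ?c g"])
    show "Polynomial.smult ?c g \<in> polys_over D" using g D by (auto simp: polys_over_def)
  qed (use g c in auto)
qed

text \<open>If x were the only root, p would be a power of X - x; take the least positive power that
  lies over \<open>K\<close>. If the characteristic does not divide its exponent n, the coefficient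
  -n x puts x into \<open>K\<close>; if it does, perfectness extracts a root of the polynomial and
  gives a smaller power.\<close>

lemma exists_second_root:
  assumes x: "x \<notin> K" and p: "p \<in> polys_over K" "Polynomial.lead_coeff p = 1" "poly p x = 0"
  shows "\<exists>y. y \<noteq> x \<and> poly p y = 0"
proof (rule ccontr)
  assume no: "\<not> (\<exists>y. y \<noteq> x \<and> poly p y = 0)"
  let ?l = "[:- x, 1:]"
  have p0: "p \<noteq> 0" using p(2) by auto
  obtain g where g: "p = ?l ^ Polynomial.order x p * g" "\<not> ?l dvd g"
    using order_decomp[OF p0, of x] by blast
  have "Polynomial.degree g = 0"
  proof (rule ccontr)
    assume "Polynomial.degree g \<noteq> 0"
    then obtain y where y: "poly g y = 0" using has_root[of g] by auto
    then have "poly p y = 0" by (subst g(1)) simp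
    then have "y = x" using no by blast
    then show False using y g(2) by (simp add: poly_eq_0_iff_dvd)
  qed
  then obtain k where k: "g = [:k:]" using degree_eq_zeroE by blast
  have "Polynomial.lead_coeff p = Polynomial.lead_coeff (?l ^ Polynomial.order x p) * Polynomial.lead_coeff g"
    using arg_cong[OF g(1), of Polynomial.lead_coeff] by (simp only: lead_coeff_mult)
  then have "k = 1" using p(2) k by (simp add: lead_coeff_power)
  then have pl: "p = ?l ^ Polynomial.order x p" using g(1) k by simp
  have op: "Polynomial.order x p > 0" using p(3) p0 order_root[of p x] by auto
  define n where "n = (LEAST n. n > 0 \<and> ?l ^ n \<in> polys_over K)"
  have n: "n > 0" "?l ^ n \<in> polys_over K"
    using LeastI[of "\<lambda>n. n > 0 \<and> ?l ^ n \<in> polys_over K" "Polynomial.order x p"] op p(1) pl by (auto simp: n_def)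
  have least: "n \<le> m" if "m > 0" "?l ^ m \<in> polys_over K" for m
    unfolding n_def by (rule Least_le) (use that in simp)
  show False
  proof (cases "CHAR('c) dvd n")
    case False
    have "Polynomial.coeff (?l ^ n) (n - 1) = - (of_nat n * x)"
      using n(1) by (simp add: coeff_linear_poly_power binomial_symmetric[of 1 n, simplified, symmetric])
    then have "of_nat n * x \<in> K" using n(2) K_closed(7)[of "- (of_nat n * x)"] by (auto simp: polys_over_def) (metis minus_minus)
    moreover have "of_nat n \<in> K" for n by (induction n) (auto intro: K_closed)
    moreover have "of_nat n \<noteq> (0 :: 'c)" using False by (simp add: of_nat_eq_0_iff_char_dvd)
    ultimately have "inverse (of_nat n) * (of_nat n * x) \<in> K" using K_closed(6,8) by blast
    then show False using x \<open>of_nat n \<noteq> 0\<close> by (simp flip: mult.assoc)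
  next
    case True
    then obtain m where m: "n = m * CHAR('c)" by (metis dvd_def mult.commute)
    let ?g = "?l ^ m"
    have ch: "CHAR('c) > 1" using prime_CHAR_c prime_gt_1_nat by blast
    \<comment> \<open>In characteristic p the p-th power of a polynomial has the p-th powers of its
      coefficients, at degrees multiplied by p.\<close>
    have "?g ^ CHAR('c) = (\<Sum>i\<le>Polynomial.degree ?g. Polynomial.monom (Polynomial.coeff ?g i) i) ^ CHAR('c)"
      by (simp only: poly_as_sum_of_monoms)
    also have "\<dots> = (\<Sum>i\<le>Polynomial.degree ?g. Polynomial.monom (Polynomial.coeff ?g i) i ^ CHAR('c))"
      by (rule freshmans_dream_sum) (simp_all add: prime_CHAR_c)
    also have "\<dots> = (\<Sum>i\<le>Polynomial.degree ?g. Polynomial.monom (Polynomial.coeff ?g i ^ CHAR('c)) (i * CHAR('c)))"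
      by (simp add: monom_power mult.commute)
    finally have pw: "?l ^ n = (\<Sum>i\<le>Polynomial.degree ?g. Polynomial.monom (Polynomial.coeff ?g i ^ CHAR('c)) (i * CHAR('c)))"
      by (simp add: m power_mult)
    have "Polynomial.coeff ?g j \<in> K" for j
    proof (cases "j \<le> Polynomial.degree ?g")
      case True
      have "Polynomial.coeff (?l ^ n) (j * CHAR('c)) = (\<Sum>i\<le>Polynomial.degree ?g. if i = j then Polynomial.coeff ?g i ^ CHAR('c) else 0)"
        unfolding pw coeff_sum using ch by (intro sum.cong) auto
      also have "\<dots> = Polynomial.coeff ?g j ^ CHAR('c)" using True by simp
      finally have "Polynomial.coeff ?g j ^ CHAR('c) \<in> K" using n(2) by (metis (no_types, lifting) mem_Collect_eq polys_over_def)
      then obtain y where y: "y \<in> K" "y ^ CHAR('c) = Polynomial.coeff ?g j ^ CHAR('c)" using perfect by blast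
      have "(y + - Polynomial.coeff ?g j) ^ CHAR('c) + Polynomial.coeff ?g j ^ CHAR('c) = y ^ CHAR('c)"
        using freshmans_dream[OF prime_CHAR_c refl, of "y + - Polynomial.coeff ?g j" "Polynomial.coeff ?g j"] by simp
      then have "y = Polynomial.coeff ?g j" using y(2) by simp
      then show ?thesis using y by simp
    next
      case False
      then show ?thesis using K_closed(1) by (simp add: coeff_eq_0)
    qed
    then have "?g \<in> polys_over K" by (simp add: polys_over_def)
    moreover have "m > 0" using m n(1) by (cases m) auto
    ultimately have "n \<le> m" using least by blast
    then show False using m ch \<open>m > 0\<close> by (metis le_antisym mult.right_neutral mult_cancel1 less_irrefl mult_le_mono2 nat_less_le)
  qed
qed

text \<open>Start with the partial embedding sending x to another root of its minimal polynomial and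
  enlarge it by Zorn's lemma. A maximal one is total because the field is algebraically
  closed.\<close>

lemma gal_moves:
  assumes x: "x \<notin> K"
  obtains \<gamma> where "\<gamma> \<in> gal" "\<gamma> x \<noteq> x"
proof -
  let ?I = "Id_on K"
  have I: "partial_emb ?I" by (auto simp: partial_emb_def intro: K_closed)
  have DI: "Domain ?I = K" by auto
  obtain p where p: "p \<in> polys_over K" "poly p x = 0" "Polynomial.lead_coeff p = 1"
    "\<And>g. g \<in> polys_over K \<Longrightarrow> g \<noteq> 0 \<Longrightarrow> poly g x = 0 \<Longrightarrow> Polynomial.degree p \<le> Polynomial.degree g"
    using minimal_annihilator[of K x] K_closed(6,8) by blast
  obtain y where y: "y \<noteq> x" "poly p y = 0" using exists_second_root[OF x p(1,3,2)] by blast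
  have "map_poly (\<lambda>a. THE b. (a, b) \<in> ?I) p = p"
  proof (rule poly_eqI)
    have th: "(THE b. (a, b) \<in> ?I) = a" if "a \<in> K" for a using that by auto
    show "Polynomial.coeff (map_poly (\<lambda>a. THE b. (a, b) \<in> ?I) p) n = Polynomial.coeff p n" for n
      using p(1) th[of "Polynomial.coeff p n"] coeff_map_poly[where f = "\<lambda>a. THE b. (a, b) \<in> ?I" and p = p and n = n, OF th[OF K_closed(1)]]
      by (simp add: polys_over_def)
  qed
  then obtain G0 where G0: "partial_emb G0" "(x, y) \<in> G0"
    using partial_emb_extend[OF I, of p x y] p y(2) unfolding DI by auto
  let ?A = "{G. partial_emb G \<and> G0 \<subseteq> G}"
  have "\<exists>M\<in>?A. \<forall>N\<in>?A. M \<subseteq> N \<longrightarrow> N = M"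
  proof (rule subset_Zorn_nonempty)
    show "?A \<noteq> {}" using G0 by blast
    fix C assume C: "C \<noteq> {}" "subset.chain ?A C"
    then have CA: "C \<subseteq> ?A" and ch: "\<And>M N. M \<in> C \<Longrightarrow> N \<in> C \<Longrightarrow> M \<subseteq> N \<or> N \<subseteq> M"
      by (auto simp: subset_chain_def)
    have emb: "partial_emb M" if "M \<in> C" for M using CA that by blast
    have "partial_emb (\<Union>C)"
      unfolding partial_emb_def
    proof (intro conjI ballI allI impI)
      show "(k, k) \<in> \<Union>C" if "k \<in> K" for k using C(1) partial_embD(1)[OF emb that] by blast
      show "b = 0" if "(0, b) \<in> \<Union>C" for b using that partial_embD(4)[OF emb] by blast
      fix a b a' b' assume "(a, b) \<in> \<Union>C" "(a', b') \<in> \<Union>C"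
      then obtain M M' where "M \<in> C" "M' \<in> C" "(a, b) \<in> M" "(a', b') \<in> M'" by blast
      then obtain M where M: "M \<in> C" "(a, b) \<in> M" "(a', b') \<in> M" using ch[of M M'] by blast
      show "(a + a', b + b') \<in> \<Union>C" "(a * a', b * b') \<in> \<Union>C"
        using partial_embD(2,3)[OF emb[OF M(1)] M(2,3)] M(1) by blast+
    qed
    moreover have "G0 \<subseteq> \<Union>C" using C(1) CA by blast
    ultimately show "\<Union>C \<in> ?A" by blast
  qed
  then obtain G where GA: "G \<in> ?A" and max': "\<forall>N\<in>?A. G \<subseteq> N \<longrightarrow> N = G" by (rule bexE)
  have G: "partial_emb G" "G0 \<subseteq> G" using GA by simp_all
  have max: "N = G" if "partial_emb N" "G \<subseteq> N" for N
  proof -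
    have "N \<in> ?A" using that G(2) by simp
    from bspec[OF max' this] that(2) show ?thesis by (rule mp)
  qed
  note G' = partial_embD[OF G(1)]
  have total: "a \<in> Domain G" for a
  proof -
    let ?\<sigma> = "\<lambda>a. THE b. (a, b) \<in> G"
    have sI: "?\<sigma> a = b" if "(a, b) \<in> G" for a b using that G'(6) by blast
    obtain p where p: "p \<in> polys_over (Domain G)" "poly p a = 0" "Polynomial.lead_coeff p = 1"
      "\<And>g. g \<in> polys_over (Domain G) \<Longrightarrow> g \<noteq> 0 \<Longrightarrow> poly g a = 0 \<Longrightarrow> Polynomial.degree p \<le> Polynomial.degree g"
    proof (rule minimal_annihilator[of "Domain G" a])
      show "K \<subseteq> Domain G" using G'(1) by blast
      show "u * v \<in> Domain G" if "u \<in> Domain G" "v \<in> Domain G" for u v using that G'(3) by blast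
      show "inverse u \<in> Domain G" if "u \<in> Domain G" for u
        using that partial_emb_inverse(1)[OF G(1)] by (cases "u = 0") auto
    qed blast
    have s0: "?\<sigma> 0 = 0" "?\<sigma> 1 = 1" using sI G'(1) K_closed(1,2) by blast+
    have "Polynomial.degree p > 0"
    proof (rule ccontr)
      assume "\<not> Polynomial.degree p > 0"
      then obtain k where "p = [:k:]" using degree_eq_zeroE by blast
      then show False using p(2,3) by simp
    qed
    moreover have "Polynomial.coeff (map_poly ?\<sigma> p) (Polynomial.degree p) = 1"
      using coeff_map_poly[where f = ?\<sigma> and p = p, OF s0(1)] p(3) s0(2) by simp
    then have "Polynomial.degree p \<le> Polynomial.degree (map_poly ?\<sigma> p)" by (intro le_degree) simp
    ultimately obtain b where "poly (map_poly ?\<sigma> p) b = 0" using has_root[of "map_poly ?\<sigma> p"] by auto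
    then obtain N where "partial_emb N" "G \<subseteq> N" "(a, b) \<in> N"
      using partial_emb_extend[OF G(1), of p a b] p by blast
    then show ?thesis using max by blast
  qed
  define \<gamma> where "\<gamma> a = (THE b. (a, b) \<in> G)" for a
  have gI: "\<gamma> a = b" if "(a, b) \<in> G" for a b using that G'(6) unfolding \<gamma>_def by blast
  have gG: "(a, \<gamma> a) \<in> G" for a using total[of a] gI by (metis Domain.cases)
  have add: "\<gamma> (a + b) = \<gamma> a + \<gamma> b" and mult: "\<gamma> (a * b) = \<gamma> a * \<gamma> b" for a b
    using gI G'(2,3) gG by blast+
  have K: "\<gamma> k = k" if "k \<in> K" for k using gI G'(1) that by blast
  have inj: "inj \<gamma>"
  proof (rule injI, rule ccontr)
    fix a b assume ab: "\<gamma> a = \<gamma> b" "a \<noteq> b"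
    have "(a + - b, \<gamma> a + - \<gamma> b) \<in> G" using G'(2)[OF gG G'(5)[OF gG]] .
    then have "\<gamma> a + - \<gamma> b \<noteq> 0" using partial_emb_inverse(2)[OF G(1)] ab by (metis add.right_inverse add_eq_0_iff minus_minus)
    then show False using ab by simp
  qed
  \<comment> \<open>The finite root set of a polynomial over \<open>K\<close> is mapped injectively
    to itself, hence onto itself.\<close>
  have surj: "\<exists>a. \<gamma> a = b" for b
  proof -
    obtain Q where Q: "Q \<noteq> 0" "Q \<in> polys_over K" "poly Q b = 0" by (rule algebraic_over_K)
    let ?R = "{a. poly Q a = 0}"
    have "\<gamma> ` ?R \<subseteq> ?R"
    proof clarify
      fix a assume "poly Q a = 0"
      then show "poly Q (\<gamma> a) = 0" using partial_emb_poly[OF G(1) gG Q(2), of a] G'(4) by simp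
    qed
    moreover have "finite ?R" using Q(1) by (rule poly_roots_finite)
    ultimately have "\<gamma> ` ?R = ?R" using inj endo_inj_surj[of ?R \<gamma>] by (auto intro: inj_on_subset)
    then show ?thesis using Q(3) by (metis (mono_tags, lifting) imageE mem_Collect_eq)
  qed
  have "\<gamma> \<in> gal"
  proof (rule galI[of \<gamma>, OF add mult K[OF K_closed(2)] _ K])
    show "bij \<gamma>" using inj surj by (metis bijI surjI surj_def)
  qed
  moreover have "\<gamma> x \<noteq> x" using gI[of x y] G0(2) G(2) y(1) by auto
  ultimately show ?thesis by (rule that)
qed

text \<open>An automorphism moving x has a neighbourhood of automorphisms that agree with it at x;
  density puts a Weil element there.\<close>

lemma fixed_by_dense_weil:
  assumes dense: "krull_topology closure_of weil = gal" and fix': "\<And>\<gamma>. \<gamma> \<in> weil \<Longrightarrow> \<gamma> x = x"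
  shows "x \<in> K"
proof (rule ccontr)
  assume "x \<notin> K"
  then obtain \<gamma> where \<gamma>: "\<gamma> \<in> gal" "\<gamma> x \<noteq> x" by (rule gal_moves)
  let ?U = "{f :: 'c \<Rightarrow> 'c. f x = \<gamma> x}"
  have "openin (product_topology (\<lambda>_. discrete_topology UNIV) UNIV) ?U"
    unfolding openin_pointwise by (intro ballI exI[of _ "{x}"]) auto
  then have "openin krull_topology (?U \<inter> gal)" unfolding krull_topology_def openin_subtopology by blast
  moreover have "\<gamma> \<in> krull_topology closure_of weil" using \<gamma>(1) dense by simp
  moreover have "\<gamma> \<in> ?U \<inter> gal" using \<gamma>(1) by simp
  ultimately have "\<exists>\<delta>. \<delta> \<in> weil \<and> \<delta> \<in> ?U \<inter> gal"
    unfolding in_closure_of by (elim conjE allE[of _ "?U \<inter> gal"] impE) simp_all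
  then obtain \<delta> where d: "\<delta> \<in> weil" "\<delta> \<in> ?U \<inter> gal" by blast
  have "\<delta> x = \<gamma> x" using d(2) by blast
  then show False using fix'[OF d(1)] \<gamma>(2) by simp
qed

end

section \<open>Descent\<close>

context drinfeld_setting
begin

section \<open>Fixed points of powers of Frobenius\<close>

lemma card_simple_roots:
  fixes P :: "'c poly"
  assumes "P \<noteq> 0" "\<And>x. poly P x = 0 \<Longrightarrow> poly (pderiv P) x \<noteq> 0"
  shows "card {x. poly P x = 0} = Polynomial.degree P"
  using assms
proof (induction "Polynomial.degree P" arbitrary: P)
  case 0
  then obtain k where "P = [:k:]" using degree_eq_zeroE by metis
  then show ?case using 0 by simp
next
  case (Suc n)
  obtain a where a: "poly P a = 0" using has_root[of P] Suc(2) by auto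
  then obtain g where g: "P = [:- a, 1:] * g" by (metis poly_eq_0_iff_dvd dvd_def)
  have g0: "g \<noteq> 0" using Suc(3) g by auto
  have dg: "n = Polynomial.degree g" using Suc(2) g0 unfolding g by (subst (asm) degree_mult_eq) auto
  have pd: "poly (pderiv P) x = poly g x + (x - a) * poly (pderiv g) x" for x
    unfolding g pderiv_mult by (simp add: pderiv_pCons algebra_simps)
  have "card {x. poly g x = 0} = n" using Suc(1)[OF dg g0] Suc(4) pd dg by (force simp: g)
  moreover have "{x. poly P x = 0} = insert a {x. poly g x = 0}" unfolding g by auto
  moreover have "poly g a \<noteq> 0" using Suc(4)[OF a] pd[of a] by simp
  moreover have "finite {x. poly g x = 0}" using poly_roots_finite[OF g0] .
  ultimately show ?case using Suc(2) by simp
qed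

text \<open>The derivative of X^(q^n) - X is -1, so all its roots are simple.\<close>

lemma frob_fixed_roots:
  assumes "n > 0"
  shows "finite {x::'c. fr (int n) x = x}" "card {x::'c. fr (int n) x = x} = CARD('q) ^ n"
proof -
  define P :: "'c poly" where "P = Polynomial.monom 1 (CARD('q) ^ nat (int n)) + [:0, - 1:]"
  have P: "Polynomial.degree P = CARD('q) ^ n" "P \<noteq> 0" "poly P y = fr (int n) y - y" for y
    using degree_affine_frob[where e = "int n" and B = 1 and C = 0 and A = "- 1"] assms by (simp_all add: P_def)
  obtain m where m: "CARD('q) = CHAR('c) ^ m" using q_power_CHAR CHAR_c by metis
  then have "m > 0" using q_gt_1 by (cases m) auto
  then have "of_nat (CARD('q) ^ n) = (0 :: 'c)" using m assms by simp
  then have "pderiv P = [:- 1:]" by (simp add: P_def pderiv_add pderiv_monom pderiv_pCons)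
  then have "card {x. poly P x = 0} = CARD('q) ^ n" using card_simple_roots[OF P(2)] P(1) by simp
  then show "card {x::'c. fr (int n) x = x} = CARD('q) ^ n" by (simp add: P(3))
  show "finite {x::'c. fr (int n) x = x}" using poly_roots_finite[OF P(2)] by (simp add: P(3))
qed

text \<open>Otherwise the field with q^n elements would be contained in the one with q^k elements,
  where k with 0 < k < n is the remainder of the division by n.\<close>

lemma frob_fixes_roots_dvd:
  assumes n: "n > 0" and fx: "\<And>x::'c. fr (int n) x = x \<Longrightarrow> fr g x = x"
  shows "int n dvd g"
proof (rule ccontr)
  assume nd: "\<not> int n dvd g"
  define k where "k = nat (g mod int n)"
  have k: "k > 0" "k < n" "int k = g mod int n" using nd n by (auto simp: k_def mod_eq_0_iff_dvd nat_less_iff pos_mod_sign intro: order_neq_le_trans)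
  have it: "fr (int n * int j) x = x" if "fr (int n) x = x" for x :: 'c and j
  proof (induction j)
    case (Suc j)
    then show ?case using fr_fr[of "int n" "int n * int j" x] that by (simp add: algebra_simps)
  qed simp
  have it': "fr (int n * j) x = x" if "fr (int n) x = x" for x :: 'c and j
  proof (cases "j \<ge> 0")
    case True
    then show ?thesis using it[OF that, of "nat j"] by simp
  next
    case False
    then have "fr (int n * (- j)) x = x" using it[OF that, of "nat (- j)"] by simp
    then show ?thesis using fr_cancel(1)[of "int n * j" x] by simp
  qed
  have "{x::'c. fr (int n) x = x} \<subseteq> {x. fr (int k) x = x}"
  proof clarify
    fix x :: 'c assume x: "fr (int n) x = x"
    have "fr (g mod int n) (fr (int n * (g div int n)) x) = x" unfolding fr_fr using fx[OF x] by (simp add: mod_mult_div_eq)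
    then show "fr (int k) x = x" using it'[OF x] k(3) by simp
  qed
  then have "CARD('q) ^ n \<le> CARD('q) ^ k"
    using card_mono[OF frob_fixed_roots(1)[OF k(1)]] frob_fixed_roots(2) n k(1) by metis
  then show False using k(2) power_strict_increasing[OF k(2) q_gt_1] by simp
qed

lemma gal_poly:
  assumes "\<gamma> \<in> gal" "P \<in> polys_over K"
  shows "\<gamma> (poly P x) = poly P (\<gamma> x)"
proof -
  have pw: "\<gamma> (x ^ n) = \<gamma> x ^ n" for n by (induction n) (simp_all add: galD[OF assms(1)])
  have sm: "\<gamma> (sum h S) = (\<Sum>i\<in>S. \<gamma> (h i))" for h :: "nat \<Rightarrow> 'c" and S
    by (induction S rule: infinite_finite_induct) (simp_all add: galD[OF assms(1)])
  show ?thesis using assms by (simp add: poly_altdef sm pw galD[OF assms(1)] polys_over_def)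
qed

text \<open>Take all roots of annihilating polynomials over \<open>K\<close>; automorphisms over
  \<open>K\<close> map them to such roots.\<close>

lemma finite_gal_stable:
  assumes "finite S"
  obtains R where "finite R" "S \<subseteq> R" "\<And>\<gamma> x. \<gamma> \<in> gal \<Longrightarrow> x \<in> R \<Longrightarrow> \<gamma> x \<in> R"
proof -
  have "\<exists>P. P \<noteq> 0 \<and> P \<in> polys_over K \<and> poly P x = 0" for x by (rule algebraic_over_K) blast
  then obtain P where P: "\<And>x. P x \<noteq> 0" "\<And>x. P x \<in> polys_over K" "\<And>x. poly (P x) x = 0" by metis
  let ?R = "\<Union>x\<in>S. {y. poly (P x) y = 0}"
  show ?thesis
  proof (rule that[of ?R])
    show "finite ?R" using assms P(1) by (intro finite_UN_I poly_roots_finite)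
    show "S \<subseteq> ?R" using P(3) by auto
    show "\<gamma> y \<in> ?R" if g: "\<gamma> \<in> gal" and y: "y \<in> ?R" for \<gamma> y
    proof -
      obtain x where "x \<in> S" "poly (P x) y = 0" using y by blast
      then have "poly (P x) (\<gamma> y) = 0" using gal_poly[OF g P(2)[of x], of y] galD(4)[OF g] by simp
      then show ?thesis using \<open>x \<in> S\<close> by blast
    qed
  qed
qed

lemma vanish_coeffwise: "\<gamma> \<in> gal \<Longrightarrow> vanish n f \<Longrightarrow> vanish n (coeffwise \<gamma> f)"
  by (simp add: vanish_def coeffwise_gal(1) galD(4))

lemma coeffwise_eq_0:
  assumes "\<gamma> \<in> gal"
  shows "coeffwise \<gamma> f $$ n = 0 \<longleftrightarrow> f $$ n = 0"
proof -
  have "inj \<gamma>" using galD(5)[OF assms] by (rule bij_is_inj)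
  then show ?thesis using galD(4)[OF assms] by (simp add: coeffwise_gal(1)[OF assms]) (metis injD)
qed

lemma coeffwise_1: "\<gamma> \<in> gal \<Longrightarrow> coeffwise \<gamma> 1 = 1"
  by (rule fls_eqI) (simp add: coeffwise_gal(1) galD)

lemma coeffwise_diff: "\<gamma> \<in> gal \<Longrightarrow> coeffwise \<gamma> (f - g) = coeffwise \<gamma> f - coeffwise \<gamma> g"
  using coeffwise_gal(2)[of \<gamma> "f - g" g] by simp

lemma coeffwise_sum: "\<gamma> \<in> gal \<Longrightarrow> coeffwise \<gamma> (sum h S) = (\<Sum>i\<in>S. coeffwise \<gamma> (h i))"
proof (induction S rule: infinite_finite_induct)
  case empty
  then show ?case by (simp add: fls_eq_iff coeffwise_gal(1) galD)
qed (simp_all add: coeffwise_gal(2), simp add: fls_eq_iff coeffwise_gal(1) galD)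

lemma coeffwise_sinv:
  assumes "\<gamma> \<in> gal" "f \<noteq> 0"
  shows "coeffwise \<gamma> (sinv f) = sinv (coeffwise \<gamma> f)"
proof -
  have n: "coeffwise \<gamma> f \<noteq> 0" using assms coeffwise_eq_0[OF assms(1)] by (metis fls_eqI fls_zero_nth)
  have "coeffwise \<gamma> f \<star> coeffwise \<gamma> (sinv f) = 1"
    using coeffwise_gal(3)[OF assms(1), of f "sinv f"] sinv_right[OF assms(2)] coeffwise_1[OF assms(1)] by simp
  then show ?thesis using sinv_right[OF n] smult_left_cancel[OF n] by metis
qed

text \<open>The series of order exactly 0, i.e. the units of the valuation ring; multiplication by
  them preserves the filtration.\<close>

definition punit :: "'c fls \<Rightarrow> bool" where
  "punit f \<longleftrightarrow> vanish 0 f \<and> f $$ 0 \<noteq> 0"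

lemma punit_nonzero: "punit f \<Longrightarrow> f \<noteq> 0"
  by (auto simp: punit_def)

lemma punit_iff: "punit f \<longleftrightarrow> f \<noteq> 0 \<and> fls_subdegree f = 0"
proof
  assume f: "punit f"
  then have "0 \<le> fls_subdegree f" using subdegree_vanish punit_nonzero unfolding punit_def by metis
  moreover have "fls_subdegree f \<le> 0" using f by (simp add: punit_def fls_subdegree_leI)
  ultimately show "f \<noteq> 0 \<and> fls_subdegree f = 0" using punit_nonzero[OF f] by simp
next
  assume "f \<noteq> 0 \<and> fls_subdegree f = 0"
  then show "punit f" using vanish_subdegree[of 0 f] nth_fls_subdegree_nonzero[of f] by (simp add: punit_def)
qed

lemma punit_smult: "punit f \<Longrightarrow> punit g \<Longrightarrow> punit (f \<star> g)"
  by (simp add: punit_iff smult_eq_0_iff subdegree_smult)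

lemma punit_sinv: "punit f \<Longrightarrow> punit (sinv f)"
  by (simp add: punit_iff sinv_nonzero subdegree_sinv)

lemma punit_coeffwise: "\<gamma> \<in> gal \<Longrightarrow> punit f \<Longrightarrow> punit (coeffwise \<gamma> f)"
  by (simp add: punit_def vanish_coeffwise coeffwise_eq_0)

lemma vanish_smult_punit:
  "punit f \<Longrightarrow> vanish n g \<Longrightarrow> vanish n (f \<star> g)" "vanish n g \<Longrightarrow> punit f \<Longrightarrow> vanish n (g \<star> f)"
  using vanish_smult[of 0 f n g] vanish_smult[of n g 0 f] by (auto simp: punit_def)

lemma vanish_sinv_diff:
  assumes "punit f" "punit g" "vanish n (f - g)"
  shows "vanish n (sinv f - sinv g)"
proof -
  have "sinv f - sinv g = sinv f \<star> (g - f) \<star> sinv g"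
    using sinv_left[OF punit_nonzero[OF assms(1)]] sinv_right[OF punit_nonzero[OF assms(2)]]
    by (simp add: smult_diff_left smult_diff_right smult_assoc)
  then show ?thesis
    using vanish_smult_punit assms punit_sinv vanish_minus_commute by metis
qed

lemma vanish_trans: "vanish n (f - g) \<Longrightarrow> vanish n (g - h) \<Longrightarrow> vanish n (f - h)"
  for f g h :: "'m::ab_group_add fls"
  using vanish_add[of n "f - g" "g - h"] by simp

section \<open>Hilbert 90 for cocycles of units\<close>

context
  fixes C :: "('c \<Rightarrow> 'c) \<Rightarrow> 'c fls"
  assumes unit: "\<And>\<gamma>. \<gamma> \<in> weil \<Longrightarrow> punit (C \<gamma>)"
    and cocycle: "\<And>\<gamma> \<delta>. \<gamma> \<in> weil \<Longrightarrow> \<delta> \<in> weil \<Longrightarrow> C (\<gamma> \<circ> \<delta>) = coeffwise \<gamma> (C \<delta>) \<star> C \<gamma>"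
    and cont: "\<And>N. \<exists>S. finite S \<and> (\<forall>\<gamma>\<in>weil. (\<forall>x\<in>S. \<gamma> x = x) \<longrightarrow> vanish N (C \<gamma> - 1))"
    and dense: "krull_topology closure_of weil = gal"
begin

text \<open>The solution is a Poincare series over the finite quotient of the Weil group through which the
  cocycle factors modulo \<open>\<tau>\<^sup>-\<^sup>N\<close>; by Dedekind's lemma its leading coefficient can be made nonzero.\<close>

lemma cocycle_trivial_mod:
  obtains u where "punit u" "\<And>\<gamma>. \<gamma> \<in> weil \<Longrightarrow> vanish N (coeffwise \<gamma> u - C \<gamma> \<star> u)"
proof -
  obtain S where S: "finite S" "\<And>\<gamma>. \<gamma> \<in> weil \<Longrightarrow> (\<forall>x\<in>S. \<gamma> x = x) \<Longrightarrow> vanish N (C \<gamma> - 1)"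
    using cont[of N] by blast
  obtain R where R: "finite R" "S \<subseteq> R" "\<And>\<gamma> x. \<gamma> \<in> gal \<Longrightarrow> x \<in> R \<Longrightarrow> \<gamma> x \<in> R"
    by (rule finite_gal_stable[OF S(1)]) blast
  define H where "H = {\<gamma> \<in> weil. \<forall>x\<in>R. \<gamma> x = x}"
  define Q where "Q = (\<lambda>\<gamma>. restrict \<gamma> R) ` weil"
  \<comment> \<open>\<open>Q\<close> is the finite set of permutations of \<open>R\<close> induced
    by the Weil group, and \<rho> picks representatives; modulo order \<open>N\<close> their choice
    will not matter.\<close>
  define \<rho> where "\<rho> p = (SOME \<gamma>. \<gamma> \<in> weil \<and> restrict \<gamma> R = p)" for p
  \<comment> \<open>On these elements the value of a representative depends only on its class. They
    include \<open>R\<close>, so distinct classes still give distinct characters.\<close>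
  define E where "E = {\<theta>. \<forall>\<gamma>\<in>H. \<gamma> \<theta> = \<theta>}"
  define a where "a p = sinv (C (\<rho> p)) $$ 0" for p
  have \<rho>: "\<rho> p \<in> weil" "restrict (\<rho> p) R = p" if "p \<in> Q" for p
  proof -
    have "\<exists>\<gamma>. \<gamma> \<in> weil \<and> restrict \<gamma> R = p" using that by (auto simp: Q_def)
    then show "\<rho> p \<in> weil" "restrict (\<rho> p) R = p" unfolding \<rho>_def by (metis (mono_tags, lifting) someI_ex)+
  qed
  have "Q \<subseteq> R \<rightarrow>\<^sub>E R" using R(3) weilD(1) by (auto simp: Q_def)
  then have finQ: "finite Q" using R(1) finite_PiE[of R "\<lambda>_. R"] finite_subset by blast
  have g: "\<rho> p \<in> gal" if "p \<in> Q" for p using \<rho>(1)[OF that] weilD(1) by blast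
  have HE: "1 \<in> E" "\<And>x y. x \<in> E \<Longrightarrow> y \<in> E \<Longrightarrow> x * y \<in> E" "R \<subseteq> E"
  proof -
    have m: "\<gamma> (x * y) = \<gamma> x * \<gamma> y" "\<gamma> 1 = 1" if "\<gamma> \<in> H" for \<gamma> x y
      using that galD(2,3)[OF weilD(1)] by (auto simp: H_def)
    show "1 \<in> E" "R \<subseteq> E" using m(2) by (auto simp: E_def H_def)
    show "x * y \<in> E" if "x \<in> E" "y \<in> E" for x y
      unfolding E_def
    proof (intro CollectI ballI)
      fix \<gamma> assume h: "\<gamma> \<in> H"
      then have "\<gamma> x = x" "\<gamma> y = y" using that by (auto simp: E_def)
      then show "\<gamma> (x * y) = x * y" using m(1)[OF h, of x y] by simp
    qed
  qed
  have "\<exists>\<theta>\<in>E. (\<Sum>p\<in>Q. a p * \<rho> p \<theta>) \<noteq> 0"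
  proof (rule ccontr)
    assume "\<not> ?thesis"
    then have z: "(\<Sum>p\<in>Q. a p * \<rho> p \<theta>) = 0" if "\<theta> \<in> E" for \<theta> using that by blast
    have "\<forall>p\<in>Q. a p = 0"
    proof (rule dedekind_independence[OF finQ HE(1,2), of \<rho> a])
      show "\<exists>x\<in>E. \<rho> p x \<noteq> \<rho> p' x" if "p \<in> Q" "p' \<in> Q" "p \<noteq> p'" for p p'
      proof (rule ccontr)
        assume "\<not> ?thesis"
        then have "restrict (\<rho> p) R = restrict (\<rho> p') R" using HE(3) by (intro restrict_ext) blast
        then show False using that \<rho>(2) by metis
      qed
    qed (use g galD(2,3) z in auto)
    moreover have "restrict id R \<in> Q" using weil_id(1) by (auto simp: Q_def)
    moreover have "a p \<noteq> 0" if "p \<in> Q" for p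
      using punit_sinv[OF unit[OF \<rho>(1)[OF that]]] by (simp add: a_def punit_def)
    ultimately show False by blast
  qed
  then obtain \<theta> where \<theta>: "\<theta> \<in> E" "(\<Sum>p\<in>Q. a p * \<rho> p \<theta>) \<noteq> 0" by blast
  let ?u = "\<Sum>p\<in>Q. sinv (C (\<rho> p)) \<star> fls_const (\<rho> p \<theta>)"
  have vc: "vanish 0 (fls_const c)" for c :: 'c by (simp add: vanish_def)
  have "vanish 0 (sinv (C (\<rho> p)) \<star> fls_const (\<rho> p \<theta>))" if "p \<in> Q" for p
    using vanish_smult_punit(1)[OF punit_sinv[OF unit[OF \<rho>(1)[OF that]]] vc] .
  then have "?u $$ i = 0" if "i < 0" for i using that by (simp add: fls_sum_nth vanish_def)
  then have u1: "vanish 0 ?u" by (simp add: vanish_def)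
  have "(sinv (C (\<rho> p)) \<star> fls_const (\<rho> p \<theta>)) $$ 0 = a p * \<rho> p \<theta>" if "p \<in> Q" for p
    using smult_lead[OF _ vc, of 0 "sinv (C (\<rho> p))" "\<rho> p \<theta>"] punit_sinv[OF unit[OF \<rho>(1)[OF that]]]
    by (simp add: a_def punit_def)
  then have "?u $$ 0 = (\<Sum>p\<in>Q. a p * \<rho> p \<theta>)" by (simp add: fls_sum_nth)
  then have u: "punit ?u" using u1 \<theta>(2) by (simp add: punit_def)
  moreover have "vanish N (coeffwise \<gamma> ?u - C \<gamma> \<star> ?u)" if \<gamma>: "\<gamma> \<in> weil" for \<gamma>
  proof -
    note gg = weilD(1)[OF \<gamma>]
    \<comment> \<open>Left translation by \<gamma> permutes the classes, and \<gamma> takes the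
      summand at p to C(\<gamma>) times the summand at s p, to order \<open>N\<close>.\<close>
    define s where "s p = restrict (\<gamma> \<circ> p) R" for p
    have sQ: "s p \<in> Q" if "p \<in> Q" for p
    proof -
      have "p x = \<rho> p x" if "x \<in> R" for x using fun_cong[OF \<rho>(2)[OF \<open>p \<in> Q\<close>], of x] that by simp
      then have "s p = restrict (\<gamma> \<circ> \<rho> p) R" by (auto simp: s_def)
      then show ?thesis using weil_comp(1)[OF \<gamma> \<rho>(1)[OF that]] by (auto simp: Q_def)
    qed
    have "inj_on s Q"
    proof (rule inj_onI)
      fix p p' assume pp: "p \<in> Q" "p' \<in> Q" "s p = s p'"
      have inj: "inj \<gamma>" using galD(5)[OF gg] by (rule bij_is_inj)
      have "p x = p' x" if "x \<in> R" for x
        using fun_cong[OF pp(3), of x] that inj by (simp add: s_def inj_eq)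
      moreover have "p \<in> extensional R" "p' \<in> extensional R" using pp by (auto simp: Q_def)
      ultimately show "p = p'" by (rule extensionalityI[rotated 2])
    qed
    then have bij: "bij_betw s Q Q"
      using endo_inj_surj[OF finQ] sQ by (metis bij_betw_def image_subsetI)
    have summand: "vanish N (coeffwise \<gamma> (sinv (C (\<rho> p)) \<star> fls_const (\<rho> p \<theta>)) -
        C \<gamma> \<star> (sinv (C (\<rho> (s p))) \<star> fls_const (\<rho> (s p) \<theta>)))" if p: "p \<in> Q" for p
    proof -
      define \<sigma> where "\<sigma> = \<rho> (s p)"
      have \<sigma>: "\<sigma> \<in> weil" "restrict \<sigma> R = s p" using \<rho>[OF sQ[OF p]] by (simp_all add: \<sigma>_def)
      note gs = weilD(1)[OF \<sigma>(1)]
      \<comment> \<open>The representative of the translated class differs from \<gamma> \<rho>(p)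
        by an element acting trivially on \<open>R\<close>, where the cocycle is 1 to order
        \<open>N\<close>.\<close>
      let ?h = "inv_into UNIV \<sigma> \<circ> (\<gamma> \<circ> \<rho> p)"
      have h: "?h \<in> weil" using weil_inv(1)[OF \<sigma>(1)] weil_comp(1) \<gamma> \<rho>(1)[OF p] by blast
      have sh: "\<sigma> \<circ> ?h = \<gamma> \<circ> \<rho> p" using gal_inv(4)[OF gs] by (simp add: fun_eq_iff)
      have "?h x = x" if "x \<in> R" for x
      proof -
        have "\<gamma> (\<rho> p x) = \<sigma> x"
          using fun_cong[OF \<sigma>(2), of x] fun_cong[OF \<rho>(2)[OF p], of x] that by (simp add: s_def)
        then show ?thesis using gal_inv(5)[OF gs] by simp
      qed
      then have hH: "?h \<in> H" using h by (simp add: H_def)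
      then have hv: "vanish N (C ?h - 1)" using S(2)[OF h] R(2) by (auto simp: H_def)
      have "?h \<theta> = \<theta>" using \<theta>(1) hH unfolding E_def by blast
      then have th: "\<gamma> (\<rho> p \<theta>) = \<sigma> \<theta>" using fun_cong[OF sh, of \<theta>] by (simp only: o_apply)
      have "coeffwise \<sigma> (C ?h) \<star> C \<sigma> = coeffwise \<gamma> (C (\<rho> p)) \<star> C \<gamma>"
        using cocycle[OF \<sigma>(1) h] cocycle[OF \<gamma> \<rho>(1)[OF p]] sh by simp
      then have "coeffwise \<gamma> (C (\<rho> p)) \<star> C \<gamma> - C \<sigma> = (coeffwise \<sigma> (C ?h - 1)) \<star> C \<sigma>"
        by (simp add: coeffwise_diff[OF gs] coeffwise_1[OF gs] smult_diff_left)
      then have v: "vanish N (coeffwise \<gamma> (C (\<rho> p)) \<star> C \<gamma> - C \<sigma>)"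
        using vanish_smult_punit(2)[OF vanish_coeffwise[OF gs hv] unit[OF \<sigma>(1)]] by simp
      note up = punit_coeffwise[OF gg unit[OF \<rho>(1)[OF p]]]
      have "vanish N (sinv (coeffwise \<gamma> (C (\<rho> p)) \<star> C \<gamma>) - sinv (C \<sigma>))"
        using vanish_sinv_diff[OF punit_smult[OF up unit[OF \<gamma>]] unit[OF \<sigma>(1)] v] .
      then have "vanish N (C \<gamma> \<star> (sinv (coeffwise \<gamma> (C (\<rho> p)) \<star> C \<gamma>) - sinv (C \<sigma>)))"
        by (rule vanish_smult_punit(1)[OF unit[OF \<gamma>]])
      moreover have "C \<gamma> \<star> sinv (coeffwise \<gamma> (C (\<rho> p)) \<star> C \<gamma>) = sinv (coeffwise \<gamma> (C (\<rho> p)))"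
      proof -
        let ?x = "coeffwise \<gamma> (C (\<rho> p))"
        have x0: "?x \<noteq> 0" "C \<gamma> \<noteq> 0" "?x \<star> C \<gamma> \<noteq> 0" using punit_nonzero up unit[OF \<gamma>] by (auto simp: smult_eq_0_iff)
        have "?x \<star> (C \<gamma> \<star> sinv (?x \<star> C \<gamma>)) = ?x \<star> sinv ?x"
          using sinv_right[OF x0(3)] sinv_right[OF x0(1)] by (simp add: smult_assoc)
        then show ?thesis using smult_left_cancel[OF x0(1)] by blast
      qed
      ultimately have "vanish N (sinv (coeffwise \<gamma> (C (\<rho> p))) - C \<gamma> \<star> sinv (C \<sigma>))"
        by (simp add: smult_diff_right)
      then have "vanish N ((sinv (coeffwise \<gamma> (C (\<rho> p))) - C \<gamma> \<star> sinv (C \<sigma>)) \<star> fls_const (\<sigma> \<theta>))"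
        using vanish_smult[OF _ vc] by fastforce
      moreover have "coeffwise \<gamma> (fls_const (\<rho> p \<theta>)) = fls_const (\<sigma> \<theta>)"
        by (rule fls_eqI) (simp add: coeffwise_gal(1)[OF gg] th galD(4)[OF gg])
      ultimately show ?thesis
        using coeffwise_sinv[OF gg punit_nonzero[OF unit[OF \<rho>(1)[OF p]]]]
        by (simp add: coeffwise_gal(3)[OF gg] smult_diff_left smult_assoc flip: \<sigma>_def)
    qed
    have "C \<gamma> \<star> ?u = (\<Sum>p\<in>Q. C \<gamma> \<star> (sinv (C (\<rho> p)) \<star> fls_const (\<rho> p \<theta>)))" by (rule smult_sum_right)
    also have "\<dots> = (\<Sum>p\<in>Q. C \<gamma> \<star> (sinv (C (\<rho> (s p))) \<star> fls_const (\<rho> (s p) \<theta>)))"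
      using sum.reindex_bij_betw[OF bij, of "\<lambda>p. C \<gamma> \<star> (sinv (C (\<rho> p)) \<star> fls_const (\<rho> p \<theta>))"] by (rule sym)
    finally have "coeffwise \<gamma> ?u - C \<gamma> \<star> ?u = (\<Sum>p\<in>Q. coeffwise \<gamma> (sinv (C (\<rho> p)) \<star> fls_const (\<rho> p \<theta>)) -
        C \<gamma> \<star> (sinv (C (\<rho> (s p))) \<star> fls_const (\<rho> (s p) \<theta>)))"
      by (simp only: coeffwise_sum[OF gg] sum_subtractf)
    then show ?thesis using summand by (simp add: vanish_def fls_sum_nth)
  qed
  ultimately show ?thesis by (rule that)
qed

text \<open>Two solutions modulo \<open>\<tau>\<^sup>-\<^sup>n\<close> differ by an invariant factor, i.e. one over \<open>K\<close>, which can be lifted;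
  hence they can be chosen compatibly.\<close>

lemma cocycle_trivial:
  obtains u where "u \<noteq> 0" "\<And>\<gamma>. \<gamma> \<in> weil \<Longrightarrow> coeffwise \<gamma> u = C \<gamma> \<star> u"
proof -
  define good where "good N u \<longleftrightarrow> punit u \<and> (\<forall>\<gamma>\<in>weil. vanish N (coeffwise \<gamma> u - C \<gamma> \<star> u))" for N u
  have "\<exists>v. good (1 + int (Suc k)) v \<and> vanish (1 + int k) (v - u)" if gu: "good (1 + int k) u" for k u
  proof -
    obtain u' where u': "good (1 + int (Suc k)) u'" unfolding good_def by (rule cocycle_trivial_mod) blast
    define n where "n = 1 + int k"
    have pu: "punit u" "punit u'" using gu u' by (auto simp: good_def)
    \<comment> \<open>Both u and u' solve the equation to order n, so their quotient is invariant to
      that order and its coefficients below n lie in \<open>K\<close>.\<close>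
    define t where "t = sinv u \<star> u'"
    have pt: "punit t" unfolding t_def by (intro punit_smult punit_sinv pu)
    have ti: "t $$ i \<in> K" if i: "i < n" for i
    proof (rule fixed_by_dense_weil[OF dense])
      fix \<gamma> assume \<gamma>: "\<gamma> \<in> weil"
      note gg = weilD(1)[OF \<gamma>]
      have a: "vanish n (coeffwise \<gamma> u - C \<gamma> \<star> u)" using gu \<gamma> by (auto simp: good_def n_def)
      have "vanish (1 + int (Suc k)) (coeffwise \<gamma> u' - C \<gamma> \<star> u')" using u' \<gamma> by (auto simp: good_def)
      then have b: "vanish n (coeffwise \<gamma> u' - C \<gamma> \<star> u')" by (rule vanish_mono) (simp add: n_def)
      have c: "vanish n (sinv (coeffwise \<gamma> u) - sinv (C \<gamma> \<star> u))"
        by (intro vanish_sinv_diff punit_coeffwise[OF gg] punit_smult unit[OF \<gamma>] pu a)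
      have "vanish n (sinv (coeffwise \<gamma> u) \<star> (coeffwise \<gamma> u' - C \<gamma> \<star> u'))"
        by (intro vanish_smult_punit(1) punit_sinv punit_coeffwise[OF gg] pu b)
      moreover have "vanish n ((sinv (coeffwise \<gamma> u) - sinv (C \<gamma> \<star> u)) \<star> (C \<gamma> \<star> u'))"
        by (intro vanish_smult_punit(2) punit_smult unit[OF \<gamma>] pu c)
      ultimately have "vanish n (sinv (coeffwise \<gamma> u) \<star> coeffwise \<gamma> u' - sinv (C \<gamma> \<star> u) \<star> (C \<gamma> \<star> u'))"
        by (simp add: smult_diff_right smult_diff_left) (metis (no_types, lifting) diff_add_cancel add_diff_eq vanish_add)
      moreover have "sinv (C \<gamma> \<star> u) \<star> (C \<gamma> \<star> u') = t"
      proof -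
        have u0: "u \<noteq> 0" "C \<gamma> \<star> u \<noteq> 0" using punit_nonzero pu(1) unit[OF \<gamma>] by (auto simp: smult_eq_0_iff)
        have "C \<gamma> \<star> u \<star> t = C \<gamma> \<star> u'" unfolding t_def using sinv_right_assoc[OF u0(1)] by (simp add: smult_assoc)
        then show ?thesis using sinv_left_assoc[OF u0(2)] by metis
      qed
      moreover have "sinv (coeffwise \<gamma> u) \<star> coeffwise \<gamma> u' = coeffwise \<gamma> t"
        unfolding t_def using coeffwise_gal(3)[OF gg] coeffwise_sinv[OF gg punit_nonzero[OF pu(1)]] by simp
      ultimately have "vanish n (coeffwise \<gamma> t - t)" by simp
      then show "\<gamma> (t $$ i) = t $$ i" using i coeffwise_gal(1)[OF gg] by (simp add: vanish_def)
    qed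
    have "(if i < n then t $$ i else 0) = 0" if "i < 0" for i using that pt by (simp add: punit_def vanish_def)
    \<comment> \<open>\<open>w\<close> is t cut off at degree n. Being over \<open>K\<close>, it can
      be divided out of u' without disturbing the equation, and the result agrees with u to order
      n.\<close>
    then obtain w where w: "\<And>i. w $$ i = (if i < n then t $$ i else 0)"
      by (rule fls_of_bounded[of 0 "\<lambda>i. if i < n then t $$ i else 0"]) blast+
    have wK: "w \<in> laurent_over K" using ti w K_closed(1) by (simp add: laurent_over_def)
    have pw: "punit w" using pt by (auto simp: punit_def vanish_def w n_def)
    have tw: "vanish n (t - w)" by (simp add: vanish_def w)
    have swK: "sinv w \<in> laurent_over K" using sinv_in[OF perfect_subfield_K wK punit_nonzero[OF pw]] .
    have "good (1 + int (Suc k)) (u' \<star> sinv w)"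
      unfolding good_def
    proof (intro conjI ballI)
      show "punit (u' \<star> sinv w)" by (intro punit_smult punit_sinv pu pw)
      fix \<gamma> assume \<gamma>: "\<gamma> \<in> weil"
      note gg = weilD(1)[OF \<gamma>]
      have "coeffwise \<gamma> (u' \<star> sinv w) - C \<gamma> \<star> (u' \<star> sinv w) = (coeffwise \<gamma> u' - C \<gamma> \<star> u') \<star> sinv w"
        using coeffwise_gal(4)[OF gg swK] by (simp add: coeffwise_gal(3)[OF gg] smult_diff_left smult_assoc)
      then show "vanish (1 + int (Suc k)) (coeffwise \<gamma> (u' \<star> sinv w) - C \<gamma> \<star> (u' \<star> sinv w))"
        using vanish_smult_punit(2)[OF _ punit_sinv[OF pw]] u' \<gamma> by (auto simp: good_def)
    qed
    moreover have "vanish n (u' \<star> sinv w - u)"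
    proof -
      have "u \<star> (t - w) \<star> sinv w = u' \<star> sinv w - u"
        using sinv_right_assoc[OF punit_nonzero[OF pu(1)]] sinv_right[OF punit_nonzero[OF pw]]
        by (simp add: t_def smult_diff_right smult_diff_left smult_assoc)
      then show ?thesis
        using vanish_smult_punit(2)[OF vanish_smult_punit(1)[OF pu(1) tw] punit_sinv[OF pw]] by simp
    qed
    ultimately show ?thesis unfolding n_def by blast
  qed
  moreover have "\<exists>u. good (1 + int 0) u" unfolding good_def by (rule cocycle_trivial_mod) blast
  ultimately obtain U where U: "\<And>k. good (1 + int k) (U k)" "\<And>k. vanish (1 + int k) (U (Suc k) - U k)"
    using dependent_nat_choice[of "\<lambda>k u. good (1 + int k) u" "\<lambda>k u v. vanish (1 + int k) (v - u)"] by auto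
  obtain u where u: "\<And>k. vanish (1 + int k) (u - U k)" using fls_limit[of 1 U] U(2) by metis
  show ?thesis
  proof (rule that[of u])
    have "u $$ 0 = U 0 $$ 0" using u[of 0] by (simp add: vanish_def)
    then show "u \<noteq> 0" using U(1)[of 0] by (auto simp: good_def punit_def)
    fix \<gamma> assume \<gamma>: "\<gamma> \<in> weil"
    note gg = weilD(1)[OF \<gamma>]
    have "vanish (1 + int k) (coeffwise \<gamma> u - C \<gamma> \<star> u)" for k
    proof -
      have "vanish (1 + int k) (coeffwise \<gamma> u - coeffwise \<gamma> (U k))"
        using vanish_coeffwise[OF gg u[of k]] by (simp add: coeffwise_diff[OF gg])
      moreover have "vanish (1 + int k) (coeffwise \<gamma> (U k) - C \<gamma> \<star> U k)" using U(1)[of k] \<gamma> by (auto simp: good_def)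
      moreover have "vanish (1 + int k) (C \<gamma> \<star> U k - C \<gamma> \<star> u)"
        using vanish_smult_punit(1)[OF unit[OF \<gamma>] u[of k]] vanish_minus_commute[of _ "C \<gamma> \<star> u"] by (simp add: smult_diff_right)
      ultimately show ?thesis by (metis vanish_trans)
    qed
    then show "coeffwise \<gamma> u = C \<gamma> \<star> u" using vanish_all_imp_0[of 1] by fastforce
  qed
qed

end

text \<open>By Lang's theorem the cocycle takes the value \<open>\<tau>\<^sup>m\<close>, up to a coboundary, at an element of minimal positive
  order \<open>m\<close>. This makes it continuous for the topology induced from the Galois group, in which elements
  of nonzero order can be close to the identity.\<close>

lemma twisted_cocycle_trivial:
  assumes A: "\<And>\<gamma>. \<gamma> \<in> weil \<Longrightarrow> A \<gamma> \<in> laurent_over Fbar" "\<And>\<gamma>. \<gamma> \<in> weil \<Longrightarrow> A \<gamma> \<noteq> 0"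
    "\<And>\<gamma>. \<gamma> \<in> weil \<Longrightarrow> fls_subdegree (A \<gamma>) = - ord \<gamma>"
    and Acomp: "\<And>\<gamma> \<delta>. \<gamma> \<in> weil \<Longrightarrow> \<delta> \<in> weil \<Longrightarrow> A (\<gamma> \<circ> \<delta>) = A \<delta> \<star> A \<gamma>" and Aid: "A id = 1"
    and Acont: "\<And>N. \<exists>S. finite S \<and> (\<forall>\<iota>\<in>wfix S. vanish N (A \<iota> - 1))"
    and dense: "krull_topology closure_of weil = gal"
  obtains u where "u \<noteq> 0" "\<And>\<gamma>. \<gamma> \<in> weil \<Longrightarrow> twist \<gamma> u = A \<gamma> \<star> u"
proof -
  \<comment> \<open>Removing the power of \<tau> turns the twisted equation into a coefficientwise
    one and the values into units; because the values lie over \<open>Fbar\<close>, conjugation by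
    \<tau> becomes the Galois action in the cocycle relation.\<close>
  define C where "C \<gamma> = tau_pow (- ord \<gamma>) \<star> A \<gamma>" for \<gamma>
  have tn: "tau_pow m \<noteq> (0 :: 'c fls)" for m using tau_pow_right[of 1 m "- m"] by auto
  have sub: "fls_subdegree (tau_pow m :: 'c fls) = - m" for m by (simp add: tau_pow_def)
  have ct: "tau_pow (ord \<gamma>) \<star> C \<gamma> = A \<gamma>" for \<gamma>
    unfolding C_def smult_assoc[symmetric] tau_pow_add by simp
  have Cconj: "coeffwise \<gamma> s = tau_pow (- ord \<gamma>) \<star> s \<star> tau_pow (ord \<gamma>)" if "\<gamma> \<in> weil" "s \<in> laurent_over Fbar" for \<gamma> s
  proof -
    have "tau_pow (- ord \<gamma>) \<star> s \<star> tau_pow (ord \<gamma>) = (tau_pow (- ord \<gamma>) \<star> tau_pow (ord \<gamma>)) \<star> coeffwise \<gamma> s"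
      using tau_pow_Fbar[OF that] by (simp add: smult_assoc)
    then show ?thesis by (simp add: tau_pow_add)
  qed
  have C: "punit (C \<gamma>)" "C \<gamma> \<in> laurent_over Fbar" if "\<gamma> \<in> weil" for \<gamma>
    using A(1-3)[OF that] tn sub laurent_over_simps(6,7)[OF perfect_subfield_Fbar]
    by (simp_all add: punit_iff C_def smult_eq_0_iff subdegree_smult)
  have cocycle: "C (\<gamma> \<circ> \<delta>) = coeffwise \<gamma> (C \<delta>) \<star> C \<gamma>" if "\<gamma> \<in> weil" "\<delta> \<in> weil" for \<gamma> \<delta>
  proof -
    have "coeffwise \<gamma> (C \<delta>) \<star> C \<gamma> = tau_pow (- ord \<gamma>) \<star> (C \<delta> \<star> (tau_pow (ord \<gamma>) \<star> C \<gamma>))"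
      using Cconj[OF that(1) C(2)[OF that(2)]] by (simp only: smult_assoc)
    also have "\<dots> = (tau_pow (- ord \<gamma>) \<star> tau_pow (- ord \<delta>)) \<star> (A \<delta> \<star> A \<gamma>)"
      unfolding ct by (simp only: C_def smult_assoc)
    finally show ?thesis using weil_comp(2)[OF that] Acomp[OF that] by (simp add: C_def tau_pow_add add.commute)
  qed
  have cont: "\<exists>S. finite S \<and> (\<forall>\<gamma>\<in>weil. (\<forall>x\<in>S. \<gamma> x = x) \<longrightarrow> vanish N (C \<gamma> - 1))" for N
  proof (cases "\<forall>\<gamma>\<in>weil. ord \<gamma> = 0")
    case True
    obtain S where "finite S" "\<forall>\<iota>\<in>wfix S. vanish N (A \<iota> - 1)" using Acont by blast
    then show ?thesis using True by (intro exI[of _ S]) (auto simp: wfix_def C_def)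
  next
    case False
    have "\<exists>m::nat. m > 0 \<and> (\<exists>\<gamma>\<in>weil. ord \<gamma> = int m)"
    proof -
      obtain \<gamma> where \<gamma>: "\<gamma> \<in> weil" "ord \<gamma> \<noteq> 0" using False by blast
      show ?thesis
      proof (cases "ord \<gamma> > 0")
        case True
        then show ?thesis using \<gamma> by (intro exI[of _ "nat (ord \<gamma>)"]) auto
      next
        case False
        then show ?thesis using \<gamma> weil_inv[OF \<gamma>(1)]
          by (intro exI[of _ "nat (- ord \<gamma>)"] conjI bexI[of _ "inv_into UNIV \<gamma>"]) auto
      qed
    qed
    then obtain m :: nat where m: "m > 0" "\<exists>\<gamma>\<in>weil. ord \<gamma> = int m"
      and least: "\<And>k. k < m \<Longrightarrow> \<not> (k > 0 \<and> (\<exists>\<gamma>\<in>weil. ord \<gamma> = int k))"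
      unfolding exists_least_iff[of "\<lambda>m. m > 0 \<and> (\<exists>\<gamma>\<in>weil. ord \<gamma> = int m)"] by blast
    then obtain \<phi> where \<phi>: "\<phi> \<in> weil" "ord \<phi> = int m" by blast
    note gf = weilD(1)[OF \<phi>(1)]
    \<comment> \<open>A(\<phi>) has negative order -m; its inverse and \<tau>^(-m) have positive
      order m, as Lang's theorem demands.\<close>
    define P where "P = sinv (A \<phi>)"
    define Q :: "'c fls" where "Q = tau_pow (- int m)"
    have P: "P \<noteq> 0" "fls_subdegree P = int m" "P \<in> laurent_over Fbar"
      using A(1-3)[OF \<phi>(1)] \<phi>(2) sinv_in[OF perfect_subfield_Fbar] by (simp_all add: P_def sinv_nonzero subdegree_sinv)
    have P': "vanish (int m) P" "P $$ int m \<noteq> 0" using P vanish_subdegree[of "int m" P] nth_fls_subdegree_nonzero[of P] by auto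
    have Q: "vanish (int m) Q" "Q $$ int m \<noteq> 0" "Q \<in> laurent_over Fbar"
      using vanish_tau_pow[of "- int m"] laurent_over_simps(7)[OF perfect_subfield_Fbar, of "- int m"] by (simp_all add: Q_def tau_pow_mon)
    obtain u where u: "vanish 0 u" "u $$ 0 \<noteq> 0" "P \<star> u = u \<star> Q"
      using lang_conjugate[of "int m" P Q 0] m(1) P' Q by auto
    have uF: "u \<in> laurent_over Fbar" using conjugate_over_Fbar[OF _ P'(1) P(3) Q(1-3) u(3)] m(1) by simp
    have pu: "punit u" using u by (simp add: punit_def)
    have Au: "A \<phi> \<star> u = u \<star> tau_pow (int m)"
    proof -
      have "A \<phi> \<star> (P \<star> u) \<star> tau_pow (int m) = u \<star> tau_pow (int m)"
        using sinv_right_assoc[OF A(2)[OF \<phi>(1)]] by (simp add: P_def)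
      moreover have "A \<phi> \<star> (u \<star> Q) \<star> tau_pow (int m) = A \<phi> \<star> u" by (simp add: Q_def smult_assoc tau_pow_add)
      ultimately show ?thesis using u(3) by simp
    qed
    have Ak: "A (\<phi> ^^ k) \<star> u = u \<star> tau_pow (int m * int k)" for k
    proof (induction k)
      case 0
      then show ?case using Aid by (simp flip: id_def)
    next
      case (Suc k)
      have "A (\<phi> ^^ Suc k) = A (\<phi> ^^ k) \<star> A \<phi>"
        unfolding funpow.simps using Acomp[OF \<phi>(1), of "\<phi> ^^ k"] weil_funpow[OF \<phi>(1)] by blast
      then have "A (\<phi> ^^ Suc k) \<star> u = A (\<phi> ^^ k) \<star> u \<star> tau_pow (int m)" using Au by (simp only: smult_assoc)
      moreover have "int m * int k + int m = int m * int (Suc k)" by (simp add: algebra_simps)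
      ultimately show ?case using Suc by (simp only: smult_assoc tau_pow_add)
    qed
    obtain S0 where S0: "finite S0" "\<forall>\<iota>\<in>wfix S0. vanish N (A \<iota> - 1)" using Acont by blast
    obtain R where R: "finite R" "S0 \<subseteq> R" "\<And>\<gamma> x. \<gamma> \<in> gal \<Longrightarrow> x \<in> R \<Longrightarrow> \<gamma> x \<in> R"
      by (rule finite_gal_stable[OF S0(1)]) blast
    have "inj \<phi>" using galD(5)[OF gf] by (rule bij_is_inj)
    \<comment> \<open>The n-th power of \<phi> acts trivially on \<open>R\<close>, so powers of it
      can be removed from an element without changing its values on \<open>S0\<close>.\<close>
    then obtain n where n: "n > 0" "\<And>x. x \<in> R \<Longrightarrow> (\<phi> ^^ n) x = x"
      using finite_injective_periodic[of R \<phi>] R(1) R(3)[OF gf] by (metis image_subsetI inj_on_subset subset_UNIV)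
    have period: "(\<phi> ^^ (n * k)) x = x" if "x \<in> R" for k x
    proof (induction k)
      case (Suc k)
      then show ?case using n(2)[OF that] by (simp add: funpow_add)
    qed simp
    \<comment> \<open>The field with q^(m n) elements: an element of the Weil group fixing it has
      order divisible by m n, the order of \<phi>^n, so a power of \<phi>^n has the same
      order.\<close>
    define Z where "Z = {x::'c. fr (int (m * n)) x = x}"
    have mn: "m * n > 0" using m(1) n(1) by simp
    have ZF: "Z \<subseteq> Fbar"
    proof
      fix x assume "x \<in> Z"
      then have "x ^ (CARD('q) ^ (m * n)) = x" unfolding Z_def fr_nat by simp
      then show "x \<in> Fbar" unfolding Fbar_iff using mn by blast
    qed
    define S where "S = R \<union> (\<lambda>i. u $$ i) ` {0..N} \<union> Z"
    have finS: "finite S" using R(1) frob_fixed_roots(1)[OF mn] by (simp add: S_def Z_def)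
    have main: "vanish N (C \<gamma> - 1)" if \<gamma>: "\<gamma> \<in> weil" and fx: "\<And>x. x \<in> S \<Longrightarrow> \<gamma> x = x" and pos: "ord \<gamma> \<ge> 0" for \<gamma>
    proof -
      note gg = weilD(1)[OF \<gamma>]
      have "int (m * n) dvd - ord \<gamma>"
      proof (rule frob_fixes_roots_dvd[OF mn])
        fix x :: 'c assume "fr (int (m * n)) x = x"
        then have "x \<in> Z" by (simp add: Z_def)
        then show "fr (- ord \<gamma>) x = x" using weilD(3)[OF \<gamma>, of x] ZF fx[of x] by (auto simp: S_def)
      qed
      then have "int (m * n) dvd ord \<gamma>" by (simp only: dvd_minus_iff)
      then obtain j where "ord \<gamma> = int (m * n) * j" by (rule dvdE)
      moreover from this have "j \<ge> 0" using pos mn by (metis mult_less_0_iff not_less of_nat_0_less_iff)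
      ultimately obtain k where k: "ord \<gamma> = int m * int (n * k)" using nonneg_int_cases[of j] by (auto simp: mult.assoc)
      define K' where "K' = n * k"
      let ?p = "\<phi> ^^ K'"
      have p: "?p \<in> weil" "ord ?p = ord \<gamma>" using weil_funpow[OF \<phi>(1), of K'] \<phi>(2) k by (simp_all add: K'_def)
      note gp = weilD(1)[OF p(1)]
      \<comment> \<open>Removing the power of \<phi> from \<gamma> leaves an element of order 0 that
        fixes \<open>S0\<close>; there continuity for the topology of the Weil group
        applies.\<close>
      define \<iota> where "\<iota> = inv_into UNIV ?p \<circ> \<gamma>"
      have i: "\<iota> \<in> weil" "ord \<iota> = 0" using weil_comp[OF weil_inv(1)[OF p(1)] \<gamma>] weil_inv(2)[OF p(1)] p(2) by (simp_all add: \<iota>_def)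
      have pi: "?p \<circ> \<iota> = \<gamma>" using gal_inv(4)[OF gp] by (simp add: \<iota>_def fun_eq_iff)
      have "\<iota> x = x" if x: "x \<in> S0" for x
      proof -
        have xR: "x \<in> R" using x R(2) by blast
        then have "\<gamma> x = ?p x" using fx[of x] period[OF xR, of k] by (simp add: S_def K'_def)
        then show ?thesis using gal_inv(5)[OF gp, of x] by (simp add: \<iota>_def)
      qed
      then have "\<iota> \<in> wfix S0" using i by (simp add: wfix_def)
      then have vi: "vanish N (A \<iota> - 1)" using S0(2) by blast
      have "A \<gamma> = A \<iota> \<star> A ?p" using Acomp[OF p(1) i(1)] pi by simp
      then have "C \<gamma> - C ?p = tau_pow (- ord \<gamma>) \<star> ((A \<iota> - 1) \<star> (tau_pow (ord \<gamma>) \<star> C ?p))"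
        using ct[of ?p] p(2) by (simp add: C_def smult_diff_left smult_diff_right)
      moreover have "vanish (ord \<gamma> + (N + (- ord \<gamma> + 0))) (tau_pow (- ord \<gamma>) \<star> ((A \<iota> - 1) \<star> (tau_pow (ord \<gamma>) \<star> C ?p)))"
        using vanish_tau_pow[of "- ord \<gamma>"] vanish_tau_pow[of "ord \<gamma>"] vi C(1)[OF p(1)]
        by (intro vanish_smult) (auto simp: punit_def)
      ultimately have 1: "vanish N (C \<gamma> - C ?p)" by simp
      have "coeffwise \<gamma> u = tau_pow (- ord \<gamma>) \<star> (A ?p \<star> u)"
        using Cconj[OF \<gamma> uF] Ak[of K'] k by (simp add: smult_assoc K'_def)
      then have "coeffwise \<gamma> u = C ?p \<star> u" using p(2) by (simp add: C_def smult_assoc)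
      \<comment> \<open>On series over \<open>Fbar\<close> the power of \<phi> acts like \<gamma>,
        as both have the same order. Its cocycle value is thus the coboundary of u at \<gamma>,
        which is near 1 because \<gamma> fixes the low coefficients of u.\<close>
      then have "C ?p = coeffwise \<gamma> u \<star> sinv u" using sinv_right[OF punit_nonzero[OF pu]] by (simp add: smult_assoc)
      then have 2: "C ?p - 1 = (coeffwise \<gamma> u - u) \<star> sinv u"
        using sinv_right[OF punit_nonzero[OF pu]] by (simp add: smult_diff_left)
      have "vanish N (coeffwise \<gamma> u - u)"
        unfolding vanish_def
      proof (intro allI impI)
        fix j assume j: "j < N"
        show "(coeffwise \<gamma> u - u) $$ j = 0"
        proof (cases "j \<ge> 0")
          case True
          then have "u $$ j \<in> S" using j by (auto simp: S_def)
          then show ?thesis using fx by (simp add: coeffwise_gal(1)[OF gg])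
        next
          case False
          then show ?thesis using u(1) galD(4)[OF gg] by (simp add: coeffwise_gal(1)[OF gg] vanish_def)
        qed
      qed
      then have "vanish N (C ?p - 1)" unfolding 2 by (rule vanish_smult_punit(2)[OF _ punit_sinv[OF pu]])
      then show ?thesis using vanish_trans[OF 1] by blast
    qed
    have "vanish N (C \<gamma> - 1)" if \<gamma>: "\<gamma> \<in> weil" and fx: "\<forall>x\<in>S. \<gamma> x = x" for \<gamma>
    proof (cases "ord \<gamma> \<ge> 0")
      case True
      then show ?thesis using main[OF \<gamma>] fx by blast
    next
      case False
      note gg = weilD(1)[OF \<gamma>]
      \<comment> \<open>Negative orders are reduced to positive ones by the cocycle relation for
        \<gamma> and its inverse.\<close>
      let ?i = "inv_into UNIV \<gamma>"
      have "?i x = x" if "x \<in> S" for x using gal_inv(5)[OF gg, of x] fx that by simp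
      then have "vanish N (C ?i - 1)" using main[OF weil_inv(1)[OF \<gamma>]] weil_inv(2)[OF \<gamma>] False by simp
      then have "vanish N (coeffwise \<gamma> (C ?i - 1) \<star> C \<gamma>)"
        by (intro vanish_smult_punit(2) vanish_coeffwise gg C(1) \<gamma>)
      moreover have "coeffwise \<gamma> (C ?i) \<star> C \<gamma> = 1"
        using cocycle[OF \<gamma> weil_inv(1)[OF \<gamma>]] gal_inv(2)[OF gg] Aid weil_id(2) by (simp add: C_def)
      ultimately have "vanish N (1 - C \<gamma>)"
        by (simp add: coeffwise_diff[OF gg] coeffwise_1[OF gg] smult_diff_left)
      then show ?thesis using vanish_minus_commute by blast
    qed
    then show ?thesis using finS by blast
  qed
  obtain u where "u \<noteq> 0" "\<And>\<gamma>. \<gamma> \<in> weil \<Longrightarrow> coeffwise \<gamma> u = C \<gamma> \<star> u"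
    by (rule cocycle_trivial[of C, OF C(1) cocycle cont dense]) blast+
  then show ?thesis by (intro that[of u]) (simp_all add: twist_def ct flip: smult_assoc)
qed

end

section \<open>The cocycle of an admissible representation\<close>

context drinfeld_module
begin

text \<open>A(\<gamma>) is the coordinate of the image under \<gamma> of the basis vector with
  coordinate 1; being D-linear, the action of \<gamma> is right multiplication by it. Admissibility
  fixes the order of A(\<gamma>), and continuity makes A close to 1 near the identity.\<close>

lemma rep_cocycle:
  assumes rep: "representation J W" and rk: "has_rank (EndJ J) W (\<lambda>a w. rmul W w a) 1"
    and adm: "admissible J (- (1 / of_nat r)) W" and r: "r > 0" "e = int (r * residue_degree)"
  obtains c A where "rcoord W c" "\<And>\<gamma>. \<gamma> \<in> weil \<Longrightarrow> A \<gamma> \<in> DD" "\<And>\<gamma>. \<gamma> \<in> weil \<Longrightarrow> A \<gamma> \<noteq> 0"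
    "\<And>\<gamma>. \<gamma> \<in> weil \<Longrightarrow> fls_subdegree (A \<gamma>) = - ord \<gamma>"
    "\<And>\<gamma> \<delta>. \<gamma> \<in> weil \<Longrightarrow> \<delta> \<in> weil \<Longrightarrow> A (\<gamma> \<circ> \<delta>) = A \<delta> \<star> A \<gamma>" "A id = 1"
    "\<And>N. \<exists>S. finite S \<and> (\<forall>\<iota>\<in>wfix S. vanish N (A \<iota> - 1))"
    "\<And>\<gamma> w. \<gamma> \<in> weil \<Longrightarrow> w \<in> carrier W \<Longrightarrow> c (wact W \<gamma> w) = c w \<star> A \<gamma>"
proof -
  have rm: "right_module (EndJ J) W (rmul W)" using rep by (simp add: representation_def)
  obtain c where W: "rcoord W c" by (rule rank_one_rcoord[OF rm rk])
  note W' = rcoordD[OF W]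
  have wc: "wact W \<gamma> w \<in> carrier W" if "\<gamma> \<in> weil" "w \<in> carrier W" for \<gamma> w
    using rep that by (simp add: representation_def)
  have wr: "wact W \<gamma> (rmul W w a) = rmul W (wact W \<gamma> w) a"
    if "\<gamma> \<in> weil" "w \<in> carrier W" "a \<in> carrier (EndJ J)" for \<gamma> w a
    using rep that by (simp add: representation_def)
  have wid: "wact W id w = w" if "w \<in> carrier W" for w using rep that by (simp add: representation_def)
  have wcomp: "wact W (\<gamma> \<circ> \<delta>) w = wact W \<gamma> (wact W \<delta> w)" if "\<gamma> \<in> weil" "\<delta> \<in> weil" "w \<in> carrier W" for \<gamma> \<delta> w
    using rep that unfolding representation_def by blast
  have cm: "continuous_map (prod_topology weil_topology (vs_topology J W)) (vs_topology J W) (\<lambda>(\<gamma>, w). wact W \<gamma> w)"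
    using rep by (simp add: representation_def)
  obtain b where b: "b \<in> carrier W" "c b = 1" by (rule rcoord_surj[OF W DD_closed(2)])
  define A where "A \<gamma> = c (wact W \<gamma> b)" for \<gamma>
  have act: "c (wact W \<gamma> w) = c w \<star> A \<gamma>" if g: "\<gamma> \<in> weil" and w: "w \<in> carrier W" for \<gamma> w
  proof -
    obtain a where a: "a \<in> carrier (EndJ J)" "dcoord a = c w" by (rule dcoord_surj[OF W'(6)[OF w]])
    have "w = rmul W b a" using W'(7)[OF w W'(4)[OF b(1) a(1)]] W'(5)[OF b(1) a(1)] a(2) b(2) by simp
    then have "wact W \<gamma> w = rmul W (wact W \<gamma> b) a" using wr[OF g b(1) a(1)] by simp
    then show ?thesis using W'(5)[OF wc[OF g b(1)] a(1)] a(2) by (simp add: A_def)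
  qed
  have AD: "A \<gamma> \<in> DD" if "\<gamma> \<in> weil" for \<gamma> unfolding A_def by (intro W'(6) wc that b)
  have Acomp: "A (\<gamma> \<circ> \<delta>) = A \<delta> \<star> A \<gamma>" if "\<gamma> \<in> weil" "\<delta> \<in> weil" for \<gamma> \<delta>
    using wcomp[OF that b(1)] act[OF that(1) wc[OF that(2) b(1)]] by (simp add: A_def)
  have Aid: "A id = 1" using wid[OF b(1)] b(2) by (simp add: A_def)
  have A0: "A \<gamma> \<noteq> 0" if "\<gamma> \<in> weil" for \<gamma>
  proof
    assume "A \<gamma> = 0"
    then have "A (inv_into UNIV \<gamma> \<circ> \<gamma>) = 0" using Acomp[OF weil_inv(1)[OF that] that] by simp
    then show False using Aid gal_inv(3)[OF weilD(1)[OF that]] by simp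
  qed
  have Apow: "fls_subdegree (A (\<gamma> ^^ k)) = int k * fls_subdegree (A \<gamma>)" if "\<gamma> \<in> weil" for \<gamma> k
  proof (induction k)
    case 0
    then show ?case using Aid by (simp flip: id_def)
  next
    case (Suc k)
    have "A (\<gamma> ^^ Suc k) = A (\<gamma> ^^ k) \<star> A \<gamma>"
      unfolding funpow.simps using Acomp[OF that, of "\<gamma> ^^ k"] weil_funpow[OF that] by blast
    then show ?case using Suc subdegree_smult[of "A (\<gamma> ^^ k)" "A \<gamma>"] A0[OF that] A0[of "\<gamma> ^^ k"] weil_funpow[OF that]
      by (simp add: algebra_simps del: funpow.simps)
  qed
  obtain s r' :: int and \<Lambda> where adm: "0 < r'" "- (1 / of_nat r) = of_int s / (of_int r' :: rat)" "is_lattice J W \<Lambda>"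
    "\<And>\<gamma>. \<gamma> \<in> weil \<Longrightarrow> wact W (\<gamma> ^^ (nat r' * residue_degree)) ` \<Lambda> = (\<lambda>w. scmul W (z powi (s * ord \<gamma>)) w) ` \<Lambda>"
    using adm unfolding admissible_def by (elim exE conjE) blast
  have "of_int r' = (of_int (- (s * int r)) :: rat)" using adm(1,2) r(1) by (simp add: field_simps)
  then have rs: "r' = - (s * int r)" by (simp only: of_int_eq_iff)
  \<comment> \<open>The two sides of the admissibility condition are the same set. Comparing least
    orders of nonzero elements, r' d times the order of A(\<gamma>) is e s ord \<gamma>, and s r =
    -r'.\<close>
  have Asub: "fls_subdegree (A \<gamma>) = - ord \<gamma>" if \<gamma>: "\<gamma> \<in> weil" for \<gamma>
  proof -
    obtain n where n: "\<Lambda> \<subseteq> rball W c n" by (rule lattice_bounded[OF W adm(3)])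
    obtain n' where n': "rball W c n' \<subseteq> \<Lambda>" by (rule lattice_open[OF W adm(3)])
    define P where "P w \<longleftrightarrow> w \<in> \<Lambda> \<and> c w \<noteq> 0" for w
    have "\<exists>w. P w"
    proof -
      let ?m = "nat n'"
      have "vanish (e * int ?m) (\<phi>J (z powi int ?m))" by (rule vanish_z_powi)
      moreover have "n' \<le> e * int ?m"
      proof -
        have "1 * int ?m \<le> e * int ?m" using phiJ'(1) by (intro mult_right_mono) auto
        then show ?thesis by linarith
      qed
      ultimately have v: "vanish n' (\<phi>J (z powi int ?m))" by (rule vanish_mono)
      obtain w where w: "w \<in> carrier W" "c w = \<phi>J (z powi int ?m)" by (rule rcoord_surj[OF W DD_closed(8)])
      then have "w \<in> \<Lambda>" using v n' by (auto simp: rball_def)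
      moreover have "c w \<noteq> 0" unfolding w(2) by (rule phiJ'(14)) (use uniformizer in simp)
      ultimately show ?thesis by (auto simp: P_def)
    qed
    \<comment> \<open>Orders of nonzero lattice elements are at least n; after subtracting n they
      are natural numbers, so a least one exists.\<close>
    then obtain w0 where w0: "P w0" "\<And>w. P w \<Longrightarrow> nat (fls_subdegree (c w0) - n) \<le> nat (fls_subdegree (c w) - n)"
      using ex_has_least_nat[of P _ "\<lambda>w. nat (fls_subdegree (c w) - n)"] by blast
    have ge: "n \<le> fls_subdegree (c w)" if "P w" for w
      using that n subdegree_vanish by (auto simp: P_def rball_def)
    have least: "fls_subdegree (c w0) \<le> fls_subdegree (c w)" if "P w" for w
      using w0(2)[OF that] ge[OF that] ge[OF w0(1)] by simp
    define k where "k = nat r' * residue_degree"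
    let ?g = "\<gamma> ^^ k" and ?x = "z powi (s * ord \<gamma>)"
    have g: "?g \<in> weil" using weil_funpow[OF \<gamma>] by blast
    have xz: "?x \<noteq> 0" "val ?x = s * ord \<gamma>" using val_z_powi by auto
    have im: "wact W ?g ` \<Lambda> = (\<lambda>w. scmul W ?x w) ` \<Lambda>" using adm(4)[OF \<gamma>] by (simp add: k_def)
    have \<Lambda>W: "w \<in> carrier W" if "w \<in> \<Lambda>" for w using lattice_closed(1)[OF W adm(3)] that by blast
    have sl: "fls_subdegree (c (wact W ?g w)) = fls_subdegree (c w) + int k * fls_subdegree (A \<gamma>) \<and> c (wact W ?g w) \<noteq> 0"
      if "P w" for w
      using act[OF g \<Lambda>W, of w] that A0[OF g] by (simp add: P_def subdegree_smult smult_eq_0_iff Apow[OF \<gamma>])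
    have sr: "fls_subdegree (c (scmul W ?x w)) = e * (s * ord \<gamma>) + fls_subdegree (c w) \<and> c (scmul W ?x w) \<noteq> 0"
      if "P w" for w
      using W'(12)[OF \<Lambda>W, of w ?x] that phiJ'(14,16)[OF xz(1)] xz(2)
      by (simp add: P_def subdegree_smult smult_eq_0_iff)
    have zl: "c (wact W ?g w) = 0" if "w \<in> \<Lambda>" "c w = 0" for w using act[OF g \<Lambda>W[OF that(1)]] that(2) by simp
    have zr: "c (scmul W ?x w) = 0" if "w \<in> \<Lambda>" "c w = 0" for w using W'(12)[OF \<Lambda>W[OF that(1)]] that(2) by simp
    have w0L: "w0 \<in> \<Lambda>" using w0(1) by (simp add: P_def)
    obtain w1 where w1: "w1 \<in> \<Lambda>" "wact W ?g w0 = scmul W ?x w1" using im w0L by blast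
    have "P w1" using w1 sl[OF w0(1)] zr by (auto simp: P_def)
    then have 1: "e * (s * ord \<gamma>) \<le> int k * fls_subdegree (A \<gamma>)"
      using sl[OF w0(1)] sr[of w1] least[of w1] w1(2) by simp
    obtain w2 where w2: "w2 \<in> \<Lambda>" "scmul W ?x w0 = wact W ?g w2" using im w0L by blast
    have "P w2" using w2 sr[OF w0(1)] zl by (auto simp: P_def)
    then have 2: "int k * fls_subdegree (A \<gamma>) \<le> e * (s * ord \<gamma>)"
      using sr[OF w0(1)] sl[of w2] least[of w2] w2(2) by simp
    have "int k = r' * int residue_degree" using adm(1) by (simp add: k_def)
    moreover have "e * (s * ord \<gamma>) = r' * int residue_degree * (- ord \<gamma>)" unfolding r(2) rs by simp
    ultimately have "r' * int residue_degree * fls_subdegree (A \<gamma>) = r' * int residue_degree * (- ord \<gamma>)"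
      using 1 2 by simp
    moreover have "r' * int residue_degree \<noteq> 0" using phiJ'(1) r(2) adm(1) by (cases "residue_degree = 0") simp_all
    ultimately show ?thesis by (simp only: mult_cancel_left simp_thms)
  qed
  have Acont: "\<exists>S. finite S \<and> (\<forall>\<iota>\<in>wfix S. vanish N (A \<iota> - 1))" for N
  proof -
    define U where "U = {v \<in> carrier W. vanish N (c v - 1)}"
    have "openin (vs_topology J W) U"
      unfolding openin_vs_topology[OF W]
    proof (intro conjI ballI exI[of _ N] impI)
      fix w v assume "w \<in> U" "v \<in> carrier W" "vanish N (c v - c w)"
      then show "v \<in> U" using vanish_trans[of N "c v" "c w" 1] by (auto simp: U_def)
    qed (simp add: U_def)
    then have "openin (prod_topology weil_topology (vs_topology J W))
        {p \<in> topspace (prod_topology weil_topology (vs_topology J W)). (\<lambda>(\<gamma>, w). wact W \<gamma> w) p \<in> U}"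
      by (rule openin_continuous_map_preimage[OF cm])
    moreover have "(id, b) \<in> {p \<in> topspace (prod_topology weil_topology (vs_topology J W)). (\<lambda>(\<gamma>, w). wact W \<gamma> w) p \<in> U}"
      using weil_id(1) b wid[OF b(1)] by (simp add: topspace_weil_topology topspace_vs_topology[OF W] U_def)
    ultimately obtain Q R where QR: "openin weil_topology Q" "id \<in> Q" "b \<in> R"
      "Q \<times> R \<subseteq> {p \<in> topspace (prod_topology weil_topology (vs_topology J W)). (\<lambda>(\<gamma>, w). wact W \<gamma> w) p \<in> U}"
      unfolding openin_prod_topology_alt by meson
    obtain S where S: "finite S" "\<And>\<iota>. \<iota> \<in> wfix S \<Longrightarrow> id \<circ> \<iota> \<in> Q"
      using QR(1,2) unfolding openin_weil_topology by blast
    have "vanish N (A \<iota> - 1)" if "\<iota> \<in> wfix S" for \<iota>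
    proof -
      have "(\<iota>, b) \<in> Q \<times> R" using S(2)[OF that] QR(3) by simp
      then have "wact W \<iota> b \<in> U" using QR(4) by auto
      then show ?thesis by (simp add: U_def A_def)
    qed
    then show ?thesis using S(1) by blast
  qed
  show ?thesis by (rule that[OF W AD A0 Asub Acomp Aid Acont act])
qed

lemma rep_hom_of_rcoord:
  assumes W: "rcoord W c" and U: "rcoord U c'"
    and wW: "\<And>\<gamma> w. \<gamma> \<in> weil \<Longrightarrow> w \<in> carrier W \<Longrightarrow> wact W \<gamma> w \<in> carrier W \<and> c (wact W \<gamma> w) = c w \<star> A \<gamma>"
    and wU: "\<And>\<gamma> w. \<gamma> \<in> weil \<Longrightarrow> w \<in> carrier U \<Longrightarrow> wact U \<gamma> w \<in> carrier U \<and> c' (wact U \<gamma> w) = c' w \<star> A \<gamma>"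
  obtains h where "h \<in> rep_hom J W U" "\<And>w. w \<in> carrier W \<Longrightarrow> h w \<in> carrier U" "\<And>w. w \<in> carrier W \<Longrightarrow> c' (h w) = c w"
proof -
  note W' = rcoordD[OF W] and U' = rcoordD[OF U]
  have "\<exists>u. u \<in> carrier U \<and> c' u = c w" if "w \<in> carrier W" for w
    by (rule rcoord_surj[OF U W'(6)[OF that]]) blast
  then obtain h where h: "\<And>w. w \<in> carrier W \<Longrightarrow> h w \<in> carrier U" "\<And>w. w \<in> carrier W \<Longrightarrow> c' (h w) = c w"
    by metis
  have eq: "u = v" if "u \<in> carrier U" "v \<in> carrier U" "c' u = c' v" for u v using U'(7)[OF that(1,2)] that(3) by simp
  let ?h = "restrict h (carrier W)"
  have "?h \<in> rep_hom J W U"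
    unfolding rep_hom_def
  proof (intro CollectI conjI ballI)
    show "?h \<in> carrier W \<rightarrow>\<^sub>E carrier U" using h(1) by auto
    show "?h (v \<oplus>\<^bsub>W\<^esub> w) = ?h v \<oplus>\<^bsub>U\<^esub> ?h w" if "v \<in> carrier W" "w \<in> carrier W" for v w
      by (rule eq) (use that h W'(3,9) U'(3,9) in simp_all)
    show "?h (rmul W w a) = rmul U (?h w) a" if "w \<in> carrier W" "a \<in> carrier (EndJ J)" for w a
      by (rule eq) (use that h W'(4,5) U'(4,5) in simp_all)
    show "?h (wact W \<gamma> w) = wact U \<gamma> (?h w)" if "\<gamma> \<in> weil" "w \<in> carrier W" for \<gamma> w
      by (rule eq) (use that h wW wU in simp_all)
  qed
  then show ?thesis by (rule that) (simp_all add: h)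
qed

text \<open>For two representations with the same cocycle, matching coordinates in either direction
  gives mutually inverse morphisms.\<close>

lemma is_iso_of_rcoord:
  assumes obs: "W \<in> Ob (admissible_reps J l)" "U \<in> Ob (admissible_reps J l)" and W: "rcoord W c" and U: "rcoord U c'"
    and cW: "\<And>\<gamma> w. \<gamma> \<in> weil \<Longrightarrow> w \<in> carrier W \<Longrightarrow> c (wact W \<gamma> w) = c w \<star> A \<gamma>"
    and cU: "\<And>\<gamma> w. \<gamma> \<in> weil \<Longrightarrow> w \<in> carrier U \<Longrightarrow> c' (wact U \<gamma> w) = c' w \<star> A \<gamma>"
  shows "\<exists>f. Defs.is_iso (admissible_reps J l) W U f"
proof -
  note W' = rcoordD[OF W] and U' = rcoordD[OF U]
  have W2: "wact W \<gamma> w \<in> carrier W \<and> c (wact W \<gamma> w) = c w \<star> A \<gamma>" if "\<gamma> \<in> weil" "w \<in> carrier W" for \<gamma> w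
    using obs(1) that cW by (simp add: admissible_reps_def representation_def)
  have U2: "wact U \<gamma> w \<in> carrier U \<and> c' (wact U \<gamma> w) = c' w \<star> A \<gamma>" if "\<gamma> \<in> weil" "w \<in> carrier U" for \<gamma> w
    using obs(2) that cU by (simp add: admissible_reps_def representation_def)
  obtain f where f: "f \<in> rep_hom J W U" "\<And>w. w \<in> carrier W \<Longrightarrow> f w \<in> carrier U" "\<And>w. w \<in> carrier W \<Longrightarrow> c' (f w) = c w"
    by (rule rep_hom_of_rcoord[OF W U W2 U2]) blast+
  obtain g where g: "g \<in> rep_hom J U W" "\<And>w. w \<in> carrier U \<Longrightarrow> g w \<in> carrier W" "\<And>w. w \<in> carrier U \<Longrightarrow> c (g w) = c' w"
    by (rule rep_hom_of_rcoord[OF U W U2 W2]) blast+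
  have "g (f w) = w" if "w \<in> carrier W" for w using W'(7)[OF g(2)[OF f(2)[OF that]] that] f g that by simp
  moreover have "f (g w) = w" if "w \<in> carrier U" for w using U'(7)[OF f(2)[OF g(2)[OF that]] that] f g that by simp
  ultimately have "compose (carrier W) g f = (\<lambda>w\<in>carrier W. w)" "compose (carrier U) f g = (\<lambda>w\<in>carrier U. w)"
    by (auto simp: compose_def restrict_def fun_eq_iff)
  then show ?thesis
    unfolding Defs.is_iso_def admissible_reps_def by (intro exI[of _ f] conjI bexI[of _ g]) (simp_all add: f(1) g(1))
qed

section \<open>The functor on morphisms\<close>

lemma intertwiners_mono: "u \<in> intertwiners L \<phi> \<psi> \<Longrightarrow> u \<in> intertwiners UNIV \<phi> \<psi>"
  by (simp add: intertwiners_def)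

context
  fixes V :: "('c fls, 'f, 'v) bimod" and c :: "'v \<Rightarrow> 'c fls" and \<phi> :: "'f \<Rightarrow> 'c fls"
  fixes W :: "('c fls, 'f, 'v) bimod" and c' :: "'v \<Rightarrow> 'c fls" and \<psi> :: "'f \<Rightarrow> 'c fls"
  assumes V: "coord K V c \<phi>" and phi: "phom e K \<phi>" and W: "coord K W c' \<psi>" and psi: "phom e K \<psi>"
begin

lemma hcoord_K:
  assumes "h \<in> bimod_hom K V W"
  shows "hcoord V c c' h \<in> intertwiners K \<phi> \<psi>" "hcoord V c c' h \<in> laurent_over K"
  using hcoord(1)[OF perfect_subfield_K perfect_subfield_K subset_refl V W phomD(2)[OF phi] assms]
  by (simp_all add: intertwiners_def)

lemma T_map_app:
  assumes h: "h \<in> bimod_hom K V W" and f: "f \<in> carrier (T J V)"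
  shows "T_map J V W h f \<in> carrier (T J W)" "tc c' (T_map J V W h f) = tc c f \<star> hcoord V c c' h"
proof -
  have eq: "T_map J V W h f = compose (carrier J) (tensor_map V W (\<lambda>(b, v). (b, h v))) f"
    using f by (simp add: T_map_def)
  have u: "tc c f \<star> hcoord V c c' h \<in> intertwiners UNIV \<phi>J \<psi>"
    using intertwiners_smult[OF perfect_subfield_UNIV tc_mem[OF V phi f] intertwiners_mono[OF hcoord_K(1)[OF h]]] .
  note t = tensor_map_hom[OF V W phomD(2)[OF phi] h T_app[OF V phi f]]
  have y: "compose (carrier J) (tensor_map V W (\<lambda>(b, v). (b, h v))) f y \<in> carrier (base_change W)"
    "bcoord c' (compose (carrier J) (tensor_map V W (\<lambda>(b, v). (b, h v))) f y) = cJ y \<star> (tc c f \<star> hcoord V c c' h)"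
    if "y \<in> carrier J" for y
    using t[OF that] tc_app[OF V phi f that] that by (simp_all add: compose_eq smult_assoc)
  show "T_map J V W h f \<in> carrier (T J W)" "tc c' (T_map J V W h f) = tc c f \<star> hcoord V c c' h"
    unfolding eq using T_characterization[OF W psi u compose_extensional y] by simp_all
qed

lemma T_map_rep_hom:
  assumes h: "h \<in> bimod_hom K V W"
  shows "T_map J V W h \<in> rep_hom J (T J V) (T J W)"
  unfolding rep_hom_def
proof (intro CollectI conjI ballI)
  note m = T_map_app[OF h] and inj = tc_inject[OF W psi]
  show "T_map J V W h \<in> carrier (T J V) \<rightarrow>\<^sub>E carrier (T J W)" using m(1) by (auto simp: T_map_def)
  show "T_map J V W h (f \<oplus>\<^bsub>T J V\<^esub> g) = T_map J V W h f \<oplus>\<^bsub>T J W\<^esub> T_map J V W h g"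
    if "f \<in> carrier (T J V)" "g \<in> carrier (T J V)" for f g
    by (rule inj)
      (use that m T_add[OF V phi that] T_add[OF W psi m(1)[OF that(1)] m(1)[OF that(2)]] in \<open>simp_all add: smult_add_left\<close>)
  show "T_map J V W h (rmul (T J V) f a) = rmul (T J W) (T_map J V W h f) a"
    if "f \<in> carrier (T J V)" "a \<in> carrier (EndJ J)" for f a
    by (rule inj)
      (use that m T_rmul[OF V phi that] T_rmul[OF W psi m(1)[OF that(1)] that(2)] in \<open>simp_all add: smult_assoc\<close>)
  show "T_map J V W h (wact (T J V) \<gamma> f) = wact (T J W) \<gamma> (T_map J V W h f)"
    if "\<gamma> \<in> weil" "f \<in> carrier (T J V)" for \<gamma> f
    by (rule inj)
      (use that m T_wact[OF V phi that] T_wact[OF W psi that(1) m(1)[OF that(2)]] twist_simps(5)[OF that(1) hcoord_K(2)[OF h]] in simp_all)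
qed

text \<open>Being D-linear on a module of rank one, a morphism is right multiplication by a single
  intertwiner s; commuting with the Weil group means that it fixes the coefficients of s, which by
  density places them in \<open>K\<close>.\<close>

lemma T_map_bij:
  assumes dense: "krull_topology closure_of weil = gal"
  shows "bij_betw (T_map J V W) (bimod_hom K V W) (rep_hom J (T J V) (T J W))"
proof -
  obtain u where u: "u \<noteq> 0" "u \<in> intertwiners UNIV \<phi>J \<phi>" by (rule T_base[OF V phi])
  obtain f0 where f0: "f0 \<in> carrier (T J V)" "tc c f0 = u" by (rule tc_surj[OF V phi u(2)])
  have su: "sinv u \<in> intertwiners UNIV \<phi> \<phi>J" by (rule intertwiners_sinv[OF perfect_subfield_UNIV u(2,1)])
  have "inj_on (T_map J V W) (bimod_hom K V W)"
  proof (rule inj_onI)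
    fix h h' assume h: "h \<in> bimod_hom K V W" "h' \<in> bimod_hom K V W" "T_map J V W h = T_map J V W h'"
    have "u \<star> hcoord V c c' h = u \<star> hcoord V c c' h'"
      using T_map_app(2)[OF h(1) f0(1)] T_map_app(2)[OF h(2) f0(1)] f0(2) h(3) by simp
    then have "hcoord V c c' h = hcoord V c c' h'" using smult_left_cancel[OF u(1)] by blast
    then show "h = h'"
      by (rule hcoord_inject[OF perfect_subfield_K perfect_subfield_K subset_refl V W phomD(2)[OF phi] h(1,2)])
  qed
  moreover have "\<exists>h\<in>bimod_hom K V W. T_map J V W h = g" if g: "g \<in> rep_hom J (T J V) (T J W)" for g
  proof -
    have gc: "g f \<in> carrier (T J W)" if "f \<in> carrier (T J V)" for f using g that by (auto simp: rep_hom_def)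
    have gr: "g (rmul (T J V) f a) = rmul (T J W) (g f) a" if "f \<in> carrier (T J V)" "a \<in> carrier (EndJ J)" for f a
      using g that by (simp add: rep_hom_def)
    have gw: "g (wact (T J V) \<gamma> f) = wact (T J W) \<gamma> (g f)" if "\<gamma> \<in> weil" "f \<in> carrier (T J V)" for \<gamma> f
      using g that by (simp add: rep_hom_def)
    \<comment> \<open>Read off at the basis vector \<open>f0\<close>, whose coordinate is u.\<close>
    define s where "s = sinv u \<star> tc c' (g f0)"
    have gs: "tc c' (g f) = tc c f \<star> s" if f: "f \<in> carrier (T J V)" for f
    proof -
      have "tc c f \<star> sinv u \<in> DD"
        unfolding DD_eq by (rule intertwiners_smult[OF perfect_subfield_UNIV tc_mem[OF V phi f] su])
      then obtain a where a: "a \<in> carrier (EndJ J)" "dcoord a = tc c f \<star> sinv u" by (rule dcoord_surj)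
      have "tc c (rmul (T J V) f0 a) = tc c f"
        using T_rmul(2)[OF V phi f0(1) a(1)] a(2) f0(2) sinv_left[OF u(1)] by (simp add: smult_assoc)
      then have "f = rmul (T J V) f0 a" using tc_inject[OF V phi f T_rmul(1)[OF V phi f0(1) a(1)]] by simp
      then have "tc c' (g f) = dcoord a \<star> tc c' (g f0)"
        using gr[OF f0(1) a(1)] T_rmul(2)[OF W psi gc[OF f0(1)] a(1)] by simp
      then show ?thesis by (simp add: a(2) s_def smult_assoc)
    qed
    have s1: "s \<in> intertwiners UNIV \<phi> \<psi>"
      unfolding s_def by (rule intertwiners_smult[OF perfect_subfield_UNIV su tc_mem[OF W psi gc[OF f0(1)]]])
    have "s $$ n \<in> K" for n
    proof (rule fixed_by_dense_weil[OF dense])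
      fix \<gamma> assume \<gamma>: "\<gamma> \<in> weil"
      have "twist \<gamma> u \<star> coeffwise \<gamma> s = twist \<gamma> (u \<star> s)"
        unfolding twist_def coeffwise_gal(3)[OF weilD(1)[OF \<gamma>]] by (rule smult_assoc)
      also have "\<dots> = twist \<gamma> (tc c' (g f0))" using gs[OF f0(1)] f0(2) by simp
      also have "\<dots> = tc c' (g (wact (T J V) \<gamma> f0))" using gw[OF \<gamma> f0(1)] T_wact(2)[OF W psi \<gamma> gc[OF f0(1)]] by simp
      also have "\<dots> = twist \<gamma> u \<star> s" using gs[OF T_wact(1)[OF V phi \<gamma> f0(1)]] T_wact(2)[OF V phi \<gamma> f0(1)] f0(2) by simp
      finally have "coeffwise \<gamma> s = s" using smult_left_cancel twist_simps(7)[OF \<gamma>] u(1) by blast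
      then show "\<gamma> (s $$ n) = s $$ n" using coeffwise_gal(1)[OF weilD(1)[OF \<gamma>]] by metis
    qed
    then have s: "s \<in> intertwiners K \<phi> \<psi>" using s1 by (simp add: intertwiners_def laurent_over_def)
    let ?h = "hom_of V c W c' s"
    note h = hom_of[OF perfect_subfield_K perfect_subfield_K subset_refl V W phomD(2)[OF phi] phomD(2)[OF psi] s]
    have "T_map J V W ?h = g"
    proof (rule extensionalityI[of _ "carrier (T J V)"])
      show "T_map J V W ?h \<in> extensional (carrier (T J V))" by (simp add: T_map_def)
      show "g \<in> extensional (carrier (T J V))" using g by (auto simp: rep_hom_def PiE_def)
      show "T_map J V W ?h f = g f" if "f \<in> carrier (T J V)" for f
        by (rule tc_inject[OF W psi T_map_app(1)[OF h(1) that] gc[OF that]])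
          (simp add: T_map_app(2)[OF h(1) that] h(2) gs[OF that])
    qed
    then show ?thesis using h(1) by blast
  qed
  ultimately show ?thesis using T_map_rep_hom unfolding bij_betw_def by blast
qed

end

lemma T_map_id:
  assumes V: "coord K V c \<phi>" and phi: "phom e K \<phi>"
  shows "T_map J V V (\<lambda>v\<in>carrier V. v) = (\<lambda>f\<in>carrier (T J V). f)"
proof (rule extensionalityI[of _ "carrier (T J V)"])
  note h = bimod_hom_id[OF V]
  show "T_map J V V (\<lambda>v\<in>carrier V. v) \<in> extensional (carrier (T J V))" by (simp add: T_map_def)
  show "T_map J V V (\<lambda>v\<in>carrier V. v) f = (\<lambda>f\<in>carrier (T J V). f) f" if "f \<in> carrier (T J V)" for f
    using tc_inject[OF V phi T_map_app(1)[OF V phi V phi h that] that] T_map_app(2)[OF V phi V phi h that]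
      hcoord_id[OF perfect_subfield_K V] that by simp
qed simp

lemma T_map_compose:
  assumes V: "coord K V c \<phi>" "phom e K \<phi>" and W: "coord K W c' \<psi>" "phom e K \<psi>" and Y: "coord K Y c'' \<chi>'" "phom e K \<chi>'"
    and f: "f \<in> bimod_hom K V W" and g: "g \<in> bimod_hom K W Y"
  shows "T_map J V Y (compose (carrier V) g f) = compose (carrier (T J V)) (T_map J W Y g) (T_map J V W f)"
proof (rule extensionalityI[of _ "carrier (T J V)"])
  note h = bimod_hom_compose[OF V(1) f g subset_refl]
  let ?b = "inv_into (carrier V) c 1"
  have b: "?b \<in> carrier V" using coordD(11)[OF V(1)] laurent_over_simps(2)[OF perfect_subfield_K] by blast
  have "hcoord V c c'' (compose (carrier V) g f) = c'' (g (f ?b))" using b by (simp add: hcoord_def compose_eq)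
  also have "\<dots> = hcoord V c c' f \<star> hcoord W c' c'' g"
    using hcoord(2)[OF perfect_subfield_K perfect_subfield_K subset_refl W(1) Y(1) phomD(2)[OF W(2)] g bimod_homD(1)[OF f b]]
    by (simp add: hcoord_def)
  finally have hc: "hcoord V c c'' (compose (carrier V) g f) = hcoord V c c' f \<star> hcoord W c' c'' g" .
  show "T_map J V Y (compose (carrier V) g f) x = compose (carrier (T J V)) (T_map J W Y g) (T_map J V W f) x"
    if x: "x \<in> carrier (T J V)" for x
  proof (rule tc_inject[OF Y T_map_app(1)[OF V Y h x]])
    note 1 = T_map_app[OF V W f x]
    note 2 = T_map_app[OF W Y g 1(1)]
    show "compose (carrier (T J V)) (T_map J W Y g) (T_map J V W f) x \<in> carrier (T J Y)"
      using 2(1) x by (simp add: compose_eq)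
    show "tc c'' (T_map J V Y (compose (carrier V) g f) x) = tc c'' (compose (carrier (T J V)) (T_map J W Y g) (T_map J V W f) x)"
      using T_map_app(2)[OF V Y h x] 1(2) 2(2) x hc by (simp add: compose_eq smult_assoc)
  qed
qed (simp_all add: T_map_def)

end

section \<open>Motives with prescribed action of F\<close>

context drinfeld_setting
begin

text \<open>Elements of the finite field are fixed by every power of Frobenius, so the constants
  from it are central.\<close>

lemma fls_const_embK_commute: "fls_const (embK a) \<star> f = f \<star> fls_const (embK a)"
proof (rule fls_eqI)
  have 1: "fr 1 (embK a) = embK a" using range_embK_iff[of "embK a"] fr_nat[of 1 "embK a"] by simp
  have nat: "fr (int n) (embK a) = embK a" for n
  proof (induction n)
    case (Suc n)
    then show ?case using 1 fr_fr[of 1 "int n" "embK a"] by simp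
  qed simp
  have fr: "fr n (embK a) = embK a" for n
  proof (cases "n \<ge> 0")
    case True
    then show ?thesis using nat[of "nat n"] by simp
  next
    case False
    then show ?thesis using nat[of "nat (- n)"] fr_cancel(1)[of n "embK a"] by simp
  qed
  have m: "fls_const (embK a) = mon (embK a) 0" by (rule fls_eqI) simp
  show "(fls_const (embK a) \<star> f) $$ n = (f \<star> fls_const (embK a)) $$ n" for n
    unfolding m smult_mon_left smult_mon_right by (simp add: fr mult.commute)
qed

lemma ring_skew_laurent:
  assumes L: "perfect_subfield L"
  shows "ring (skew_laurent CARD('q) L)"
proof -
  note LL = laurent_over_simps[OF L]
  have s: "carrier (skew_laurent CARD('q) L) = laurent_over L" "\<zero>\<^bsub>skew_laurent CARD('q) L\<^esub> = 0"
    "\<one>\<^bsub>skew_laurent CARD('q) L\<^esub> = 1" "x \<oplus>\<^bsub>skew_laurent CARD('q) L\<^esub> y = x + y"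
    "x \<otimes>\<^bsub>skew_laurent CARD('q) L\<^esub> y = x \<star> y" for x y :: "'c fls"
    by (simp_all add: skew_laurent_def skew_mult_eq)
  show ?thesis
  proof (rule ringI)
    show "abelian_group (skew_laurent CARD('q) L)"
    proof (rule abelian_groupI)
      fix x assume x: "x \<in> carrier (skew_laurent CARD('q) L)"
      then show "\<exists>y\<in>carrier (skew_laurent CARD('q) L). y \<oplus>\<^bsub>skew_laurent CARD('q) L\<^esub> x = \<zero>\<^bsub>skew_laurent CARD('q) L\<^esub>"
        by (intro bexI[of _ "- x"]) (simp_all add: s LL)
    qed (simp_all add: s LL algebra_simps)
    show "monoid (skew_laurent CARD('q) L)"
      by (rule monoidI) (simp_all add: s LL smult_assoc)
  qed (simp_all add: s smult_add_left smult_add_right)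
qed

lemma openin_tau_topology:
  assumes L: "perfect_subfield L" and V: "coord L V c \<phi>"
  shows "openin (tau_topology L V) A \<longleftrightarrow>
    A \<subseteq> carrier V \<and> (\<forall>v\<in>A. \<exists>n. \<forall>w\<in>carrier V. vanish n (c w - c v) \<longrightarrow> w \<in> A)"
proof
  note V' = coordD[OF V] and LL = laurent_over_simps[OF L]
  let ?B = "{(\<lambda>s. lmul V s v) ` U | U v. openin (top_of_set (laurent_over L)) U \<and> v \<in> carrier V - {\<zero>\<^bsub>V\<^esub>}}"
  assume "openin (tau_topology L V) A"
  then have "generate_topology_on ?B A" by (simp add: tau_topology_def openin_topology_generated_by_iff)
  then show "A \<subseteq> carrier V \<and> (\<forall>v\<in>A. \<exists>n. \<forall>w\<in>carrier V. vanish n (c w - c v) \<longrightarrow> w \<in> A)"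
  proof (induction rule: generate_topology_on.induct)
    case (Int a b)
    show ?case
    proof (intro conjI ballI)
      fix v assume "v \<in> a \<inter> b"
      then obtain m n where mn: "\<And>w. w \<in> carrier V \<Longrightarrow> vanish m (c w - c v) \<Longrightarrow> w \<in> a"
        "\<And>w. w \<in> carrier V \<Longrightarrow> vanish n (c w - c v) \<Longrightarrow> w \<in> b"
        using Int by blast
      show "\<exists>n. \<forall>w\<in>carrier V. vanish n (c w - c v) \<longrightarrow> w \<in> a \<inter> b"
        by (intro exI[of _ "max m n"]) (auto intro!: mn elim: vanish_mono)
    qed (use Int in blast)
  next
    case (UN S)
    then show ?case by (meson Union_iff Union_least)
  next
    case (Basis A)
    then obtain U v where A: "A = (\<lambda>s. lmul V s v) ` U" and U: "openin (top_of_set (laurent_over L)) U"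
      and v: "v \<in> carrier V" "v \<noteq> \<zero>\<^bsub>V\<^esub>" by blast
    obtain U' where U': "open U'" "U = U' \<inter> laurent_over L" using U by (auto simp: openin_open)
    have cv: "c v \<noteq> 0" "c v \<in> laurent_over L" using v V'(8-10,14) by metis+
    show ?case
    proof (intro conjI ballI)
      show "A \<subseteq> carrier V" using v V'(4) by (auto simp: A U')
      fix w assume "w \<in> A"
      then obtain s where s: "s \<in> U" "w = lmul V s v" by (auto simp: A)
      have sL: "s \<in> laurent_over L" using s(1) U'(2) by simp
      obtain n where n: "\<And>t. vanish n (t - s) \<Longrightarrow> t \<in> U'" using s(1) U' unfolding open_fls_iff by blast
      obtain m where m: "vanish m (sinv (c v))" using vanish_ex by blast
      have "w' \<in> A" if w': "w' \<in> carrier V" "vanish (n - m) (c w' - c w)" for w'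
      proof -
        let ?t = "c w' \<star> sinv (c v)"
        have "?t - s = (c w' - c w) \<star> sinv (c v)"
          using V'(5)[OF sL v(1)] s(2) sinv_right[OF cv(1)] by (simp add: smult_diff_left smult_assoc)
        then have "vanish n (?t - s)" using vanish_smult[OF w'(2) m] by simp
        moreover have tL: "?t \<in> laurent_over L" using LL(6) V'(8)[OF w'(1)] sinv_in[OF L cv(2,1)] by blast
        ultimately have "?t \<in> U" using n U'(2) by blast
        moreover have "w' = lmul V ?t v"
          using V'(9)[OF w'(1) V'(4)[OF tL v(1)]] V'(5)[OF tL v(1)] sinv_left[OF cv(1)] by (simp add: smult_assoc)
        ultimately show ?thesis unfolding A by blast
      qed
      then show "\<exists>n. \<forall>w'\<in>carrier V. vanish n (c w' - c w) \<longrightarrow> w' \<in> A" by blast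
    qed
  qed auto
next
  note V' = coordD[OF V] and LL = laurent_over_simps[OF L]
  assume A: "A \<subseteq> carrier V \<and> (\<forall>v\<in>A. \<exists>n. \<forall>w\<in>carrier V. vanish n (c w - c v) \<longrightarrow> w \<in> A)"
  define b where "b = inv_into (carrier V) c 1"
  have b: "b \<in> carrier V" "c b = 1" using V'(11,12) LL(2) by (auto simp: b_def)
  have b0: "b \<noteq> \<zero>\<^bsub>V\<^esub>" using b(2) V'(10) by auto
  show "openin (tau_topology L V) A"
  proof (subst openin_subopen, intro ballI)
    fix v assume v: "v \<in> A"
    then obtain n where n: "\<And>w. w \<in> carrier V \<Longrightarrow> vanish n (c w - c v) \<Longrightarrow> w \<in> A" using A by blast
    have vV: "v \<in> carrier V" using A v by blast
    let ?U = "{s \<in> laurent_over L. vanish n (s - c v)}"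
    have "open {s. vanish n (s - c v)}"
      unfolding open_fls_iff using vanish_trans by blast
    then have "openin (top_of_set (laurent_over L)) ?U" by (auto simp: openin_open)
    then have "openin (tau_topology L V) ((\<lambda>s. lmul V s b) ` ?U)"
      unfolding tau_topology_def using b(1) b0 by (intro topology_generated_by_Basis) blast
    moreover have "v = lmul V (c v) b"
      using V'(9)[OF vV V'(4)[OF V'(8)[OF vV] b(1)]] V'(5)[OF V'(8)[OF vV] b(1)] b(2) by simp
    then have "v \<in> (\<lambda>s. lmul V s b) ` ?U" using V'(8)[OF vV] by (intro image_eqI[of _ _ "c v"]) auto
    moreover have "(\<lambda>s. lmul V s b) ` ?U \<subseteq> A" using n V'(4,5) b by auto
    ultimately show "\<exists>T. openin (tau_topology L V) T \<and> v \<in> T \<and> T \<subseteq> A" by blast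
  qed
qed

text \<open>The difference of products is (c w - c v) \<phi>(y) + c v (\<phi>(y) - \<phi>(x)). The
  second term is small by the estimate in \<open>phom\<close>, the first because the order of
  \<phi>(y) is bounded below for y near x.\<close>

lemma coord_continuous:
  assumes L: "perfect_subfield L" and V: "coord L V c \<phi>" and phi: "phom e L \<phi>"
  shows "continuous_map (prod_topology (val_topology val) (tau_topology L V)) (tau_topology L V) (\<lambda>(x, v). fmul V x v)"
proof -
  note V' = coordD[OF V] and P = phomD[OF phi] and op = openin_tau_topology[OF L V]
  have tv: "topspace (val_topology val) = UNIV"
    using openin_val_topology[of UNIV] openin_subset by blast
  have "openin (tau_topology L V) (carrier V)" unfolding op by blast
  then have tt: "topspace (tau_topology L V) = carrier V"
    using op[of "topspace (tau_topology L V)"] openin_subset openin_topspace by blast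
  show ?thesis
    unfolding continuous_map_def
  proof (intro conjI allI impI)
    show "(\<lambda>(x, v). fmul V x v) \<in> topspace (prod_topology (val_topology val) (tau_topology L V)) \<rightarrow> topspace (tau_topology L V)"
      using V'(6) by (auto simp: tv tt)
    fix U assume U: "openin (tau_topology L V) U"
    let ?P = "{p \<in> topspace (prod_topology (val_topology val) (tau_topology L V)). (\<lambda>(x, v). fmul V x v) p \<in> U}"
    show "openin (prod_topology (val_topology val) (tau_topology L V)) ?P"
      unfolding openin_prod_topology_alt
    proof (intro allI impI)
      fix x v assume "(x, v) \<in> ?P"
      then have v: "v \<in> carrier V" "fmul V x v \<in> U" by (simp_all add: tt)
      then obtain n where n: "\<And>w. w \<in> carrier V \<Longrightarrow> vanish n (c w - c (fmul V x v)) \<Longrightarrow> w \<in> U"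
        using U unfolding op by blast
      obtain a where a: "vanish a (c v)" using vanish_ex by blast
      obtain b where b: "vanish b (\<phi> x)" using vanish_ex by blast
      define m where "m = \<bar>n - a\<bar>"
      have "1 * m \<le> e * m" using P(1) by (intro mult_right_mono) (auto simp: m_def)
      then have em: "e * m + a \<ge> n" by (simp add: m_def)
      \<comment> \<open>A lower bound for the order of \<phi>(y), valid for all y in the ball of
        order m around x.\<close>
      define b' where "b' = min b (e * m)"
      let ?X = "{y. y - x \<in> vball m}" and ?Y = "{w \<in> carrier V. vanish (n - b') (c w - c v)}"
      have "openin (val_topology val) ?X" unfolding openin_val_topology using vball_diff_trans by blast
      moreover have "openin (tau_topology L V) ?Y" unfolding op using vanish_trans by blast
      moreover have "?X \<times> ?Y \<subseteq> ?P"
      proof clarify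
        fix y w assume y: "y - x \<in> vball m" and w: "w \<in> carrier V" "vanish (n - b') (c w - c v)"
        have py: "vanish (e * m) (\<phi> y - \<phi> x)" using P(7)[OF y] P(10) by simp
        have "vanish b' (\<phi> x)" using b by (rule vanish_mono) (simp add: b'_def)
        moreover have "vanish b' (\<phi> y - \<phi> x)" using py by (rule vanish_mono) (simp add: b'_def)
        ultimately have "vanish b' (\<phi> y)" using vanish_add[of b' "\<phi> y - \<phi> x" "\<phi> x"] by simp
        then have 1: "vanish n ((c w - c v) \<star> \<phi> y)" using vanish_smult[OF w(2)] by fastforce
        have 2: "vanish n (c v \<star> (\<phi> y - \<phi> x))" using vanish_smult[OF a py] em by (elim vanish_mono) simp
        have "c (fmul V y w) - c (fmul V x v) = (c w - c v) \<star> \<phi> y + c v \<star> (\<phi> y - \<phi> x)"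
          using V'(7) w(1) v(1) by (simp add: smult_diff_left smult_diff_right)
        then have "fmul V y w \<in> U" using n[OF V'(6)[OF w(1)]] vanish_add[OF 1 2] by simp
        then show "(y, w) \<in> topspace (prod_topology (val_topology val) (tau_topology L V)) \<and> fmul V y w \<in> U"
          using w(1) by (simp add: tv tt)
      qed
      moreover have "x \<in> ?X" "v \<in> ?Y" using v(1) by simp_all
      ultimately show "\<exists>A B. openin (val_topology val) A \<and> openin (tau_topology L V) B \<and> x \<in> A \<and> v \<in> B \<and> A \<times> B \<subseteq> ?P"
        by blast
    qed
  qed
qed

text \<open>Together with \<open>coord_height\<close> the converse of
  \<open>formal_motive_coord\<close>.\<close>

lemma coord_formal_motive:
  assumes L: "perfect_subfield L" and V: "coord L V c \<phi>" and phi: "phom e L \<phi>"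
  shows "formal_motive L V"
proof -
  note V' = coordD[OF V] and P = phomD[OF phi] and LL = laurent_over_simps[OF L]
  note V4 = V'(4)[rotated] and V5 = V'(5)[rotated]
  have s: "carrier (skew_laurent CARD('q) L) = laurent_over L" "\<one>\<^bsub>skew_laurent CARD('q) L\<^esub> = 1"
    "x \<oplus>\<^bsub>skew_laurent CARD('q) L\<^esub> y = x + y" "x \<otimes>\<^bsub>skew_laurent CARD('q) L\<^esub> y = x \<star> y" for x y :: "'c fls"
    by (simp_all add: skew_laurent_def skew_mult_eq)
  have eq: "u = v" if "u \<in> carrier V" "v \<in> carrier V" "c u = c v" for u v using V'(9)[OF that(1,2)] that(3) by simp
  have "left_module (skew_laurent CARD('q) L) V (lmul V)"
    unfolding left_module_def s
  proof (intro conjI ballI ring_skew_laurent[OF L] V'(1))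
  qed (simp add: V4 | rule eq; simp add: V4 V5 V'(3,13) LL smult_add_left smult_add_right smult_assoc)+
  moreover have "left_module (ring_of_type_algebra :: 'f ring) V (fmul V)"
    unfolding left_module_def
  proof (intro conjI ballI ring_from_type_algebra V'(1) V'(6))
    show "fmul V (a \<otimes>\<^bsub>ring_of_type_algebra\<^esub> b) v = fmul V a (fmul V b v)" if "v \<in> carrier V" for a b v
      by (rule eq) (use that P(4)[of a b] P(4)[of b a] in \<open>simp_all add: V'(6,7) smult_assoc mult.commute\<close>)
  qed (assumption | rule eq; simp add: V'(3,6,7,13) P smult_add_left smult_add_right)+
  moreover have "lmul V s (fmul V x v) = fmul V x (lmul V s v)" if "s \<in> laurent_over L" "v \<in> carrier V" for s x v
    by (rule eq) (use that in \<open>simp_all add: V4 V5 V'(6,7) smult_assoc\<close>)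
  moreover have "lmul V (fls_const (embK a)) v = fmul V (embF a) v" if "v \<in> carrier V" for a v
    by (rule eq) (use that in \<open>simp_all add: V4 V5 V'(6,7) LL P(6) fls_const_embK_commute\<close>)
  moreover have "has_rank (skew_laurent CARD('q) L) V (lmul V) 1"
  proof -
    define b where "b = inv_into (carrier V) c 1"
    have b: "b \<in> carrier V" "c b = 1" using V'(11,12) LL(2) by (auto simp: b_def)
    have fs: "finsum V (\<lambda>b. lmul V (k b) b) {b} = lmul V (k b) b" if "k b \<in> laurent_over L" for k
      by (rule finsum_singleton[OF V'(1)]) (use that V'(4) b(1) in blast)
    have "\<exists>!k. k \<in> {b} \<rightarrow>\<^sub>E laurent_over L \<and> v = finsum V (\<lambda>b. lmul V (k b) b) {b}" if v: "v \<in> carrier V" for v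
    proof (rule ex1I[of _ "\<lambda>x\<in>{b}. c v"])
      have "v = lmul V (c v) b" by (rule eq) (use v b in \<open>simp_all add: V4 V5 V'(8)\<close>)
      then show "(\<lambda>x\<in>{b}. c v) \<in> {b} \<rightarrow>\<^sub>E laurent_over L \<and> v = finsum V (\<lambda>x. lmul V ((\<lambda>x\<in>{b}. c v) x) x) {b}"
        using fs[of "\<lambda>x\<in>{b}. c v"] V'(8)[OF v] by simp
      fix k assume k: "k \<in> {b} \<rightarrow>\<^sub>E laurent_over L \<and> v = finsum V (\<lambda>b. lmul V (k b) b) {b}"
      then have kb: "k b \<in> laurent_over L" by auto
      then have "c v = k b" using k fs[of k, OF kb] V'(5)[OF kb b(1)] b(2) by simp
      then show "k = (\<lambda>x\<in>{b}. c v)" using k by (intro extensionalityI[of _ "{b}"]) (auto simp: PiE_def)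
    qed
    then show ?thesis
      unfolding has_rank_def is_basis_def s by (intro exI[of _ "{b}"] conjI) (use b in auto)
  qed
  ultimately show ?thesis
    using coord_continuous[OF L V phi] by (simp add: formal_motive_def)
qed

text \<open>A change of generator conjugates \<phi>, which preserves orders; so the arbitrary vector
  chosen by \<open>height\<close> does not matter.\<close>

lemma coord_height:
  assumes L: "perfect_subfield L" and V: "coord L V c \<phi>" and phi: "phom (int (r * residue_degree)) L \<phi>"
  shows "height L V = of_nat r"
proof -
  note V' = coordD[OF V] and P = phomD[OF phi] and LL = laurent_over_simps[OF L]
  define v where "v = (SOME v. v \<in> carrier V \<and> v \<noteq> \<zero>\<^bsub>V\<^esub>)"
  obtain b where "b \<in> carrier V" "c b = 1" using V'(11,12) LL(2) by blast
  then have "b \<in> carrier V \<and> b \<noteq> \<zero>\<^bsub>V\<^esub>" using V'(10) by auto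
  then have v: "v \<in> carrier V" "v \<noteq> \<zero>\<^bsub>V\<^esub>"
    unfolding v_def using someI[of "\<lambda>v. v \<in> carrier V \<and> v \<noteq> \<zero>\<^bsub>V\<^esub>"] by blast+
  have cv: "c v \<noteq> 0" "c v \<in> laurent_over L" using v V'(8-10,14) by metis+
  let ?s = "c v \<star> \<phi> z \<star> sinv (c v)"
  have sL: "?s \<in> laurent_over L" using LL(6) cv P(2) sinv_in[OF L cv(2,1)] by blast
  have "phi L V v z = ?s"
    unfolding phi_def
  proof (rule the_equality)
    show "?s \<in> laurent_over L \<and> lmul V ?s v = fmul V z v"
      using V'(9)[OF V'(4)[OF sL v(1)] V'(6)[OF v(1)]] V'(5)[OF sL v(1)] V'(7)[OF v(1)] sL sinv_left[OF cv(1)]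
      by (simp add: smult_assoc)
    fix s assume s: "s \<in> laurent_over L \<and> lmul V s v = fmul V z v"
    then have "s \<star> c v = c v \<star> \<phi> z" using V'(5)[of s v] V'(7)[OF v(1), of z] v(1) by simp
    then have "s \<star> c v \<star> sinv (c v) = ?s" by simp
    then show "s = ?s" using sinv_right[OF cv(1)] by (simp add: smult_assoc)
  qed
  moreover have "fls_subdegree ?s = int (r * residue_degree)"
    using cv(1) P(14,16)[OF uniformizer(1)] uniformizer(2)
    by (simp add: subdegree_smult smult_eq_0_iff sinv_nonzero subdegree_sinv)
  moreover have "residue_degree > 0" using P(1) by (cases "residue_degree = 0") auto
  ultimately show ?thesis by (simp add: height_def Let_def flip: v_def)
qed

text \<open>Conjugation does not change orders and fixes the central constants, while the field of
  coefficients may change: this is how a motive over \<open>K\<close> arises from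
  \<open>J\<close>.\<close>

lemma phom_conjugate:
  assumes phi: "phom e L \<phi>" and u: "u \<noteq> 0" and L': "\<And>x. sinv u \<star> \<phi> x \<star> u \<in> laurent_over L'"
  shows "phom e L' (\<lambda>x. sinv u \<star> \<phi> x \<star> u)"
  unfolding phom_def
proof (intro conjI allI ballI)
  note P = phomD[OF phi]
  show "sinv u \<star> \<phi> (x * y) \<star> u = sinv u \<star> \<phi> x \<star> u \<star> (sinv u \<star> \<phi> y \<star> u)" for x y
    using sinv_right_assoc[OF u] by (simp add: P(4) smult_assoc)
  show "sinv u \<star> \<phi> (embF a) \<star> u = fls_const (embK a)" for a
    using sinv_left_assoc[OF u] by (simp add: P(6) fls_const_embK_commute smult_assoc)
  show "vanish (e * n) (sinv u \<star> \<phi> x \<star> u)" if x: "x \<in> vball n" for n x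
  proof (cases "x = 0")
    case False
    then have "fls_subdegree (sinv u \<star> \<phi> x \<star> u) = e * val x"
      using u P(14,16)[OF False] by (simp add: subdegree_smult smult_eq_0_iff sinv_nonzero subdegree_sinv)
    moreover have "e * n \<le> e * val x" using x False P(1) by (simp add: vball_iff)
    ultimately show ?thesis by (intro vanish_subdegree) simp
  qed (simp add: P(8))
qed (use phomD[OF phi] L' sinv_left[OF u] in \<open>simp_all add: smult_add_left smult_add_right\<close>)

lemma motive_in_universe:
  fixes i :: "'c fls \<Rightarrow> 'v"
  assumes L: "perfect_subfield L" and i: "inj_on i (laurent_over L)" and phi: "phom e L \<phi>"
  obtains V :: "('c fls, 'f, 'v) bimod" and c where "coord L V c \<phi>"
proof -
  note LL = laurent_over_simps[OF L] and P = phomD[OF phi]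
  let ?c = "inv_into (laurent_over L) i"
  define V :: "('c fls, 'f, 'v) bimod" where
    "V = \<lparr>carrier = i ` laurent_over L, monoid.mult = undefined, one = undefined,
      ring.zero = i 0, add = (\<lambda>v w. i (?c v + ?c w)),
      lmul = (\<lambda>s v. i (s \<star> ?c v)), fmul = (\<lambda>x v. i (?c v \<star> \<phi> x))\<rparr>"
  have ci [simp]: "?c (i s) = s" if "s \<in> laurent_over L" for s using inv_into_f_f[OF i that] .
  have cV: "\<exists>s\<in>laurent_over L. v = i s" if "v \<in> carrier V" for v using that by (auto simp: V_def)
  have "coord L V ?c \<phi>"
    unfolding coord_def
  proof (intro conjI ballI allI)
    show "abelian_group V"
    proof (rule abelian_groupI)
      fix v assume "v \<in> carrier V"
      then obtain s where "s \<in> laurent_over L" "v = i s" using cV by blast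
      then show "\<exists>w\<in>carrier V. w \<oplus>\<^bsub>V\<^esub> v = \<zero>\<^bsub>V\<^esub>"
        by (intro bexI[of _ "i (- s)"]) (simp_all add: V_def LL)
    qed (auto simp: V_def LL algebra_simps)
    show "bij_betw ?c (carrier V) (laurent_over L)" using i by (auto simp: V_def bij_betw_def inj_on_inv_into)
  qed (auto simp: V_def LL P)
  then show ?thesis by (rule that)
qed

end

section \<open>The equivalence\<close>

context drinfeld_module
begin

lemma is_category_admissible_reps: "is_category (admissible_reps J l)"
proof -
  have homD: "h w \<in> carrier U" "h \<in> extensional (carrier W)"
    if "h \<in> rep_hom J W U" "w \<in> carrier W" for h w and W U :: "('j \<Rightarrow> 'j, 'c, 'w) wrep"
    using that by (auto simp: rep_hom_def PiE_def)
  have fs: "h \<in> carrier W \<rightarrow> carrier U" "h \<in> extensional (carrier W)"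
    if "h \<in> rep_hom J W U" for h and W U :: "('j \<Rightarrow> 'j, 'c, 'w) wrep"
    using that by (auto simp: rep_hom_def PiE_def)
  have cl: "v \<oplus>\<^bsub>W\<^esub> w \<in> carrier W" "a \<in> carrier (EndJ J) \<Longrightarrow> rmul W w a \<in> carrier W" "\<gamma> \<in> weil \<Longrightarrow> wact W \<gamma> w \<in> carrier W"
    if "representation J W" "v \<in> carrier W" "w \<in> carrier W" for v w \<gamma> a and W :: "('j \<Rightarrow> 'j, 'c, 'w) wrep"
  proof -
    have rm: "right_module (EndJ J) W (rmul W)" using that(1) by (simp add: representation_def)
    then show "a \<in> carrier (EndJ J) \<Longrightarrow> rmul W w a \<in> carrier W" using that by (simp add: right_module_def)
    show "\<gamma> \<in> weil \<Longrightarrow> wact W \<gamma> w \<in> carrier W" using that by (simp add: representation_def)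
    show "v \<oplus>\<^bsub>W\<^esub> w \<in> carrier W"
      using rm that abelian_monoid.a_closed[OF abelian_group.axioms(1)] by (auto simp: right_module_def)
  qed
  show ?thesis
    unfolding is_category_def admissible_reps_def
  proof (simp only: category.simps, intro conjI ballI)
    show "(\<lambda>w\<in>carrier W. w) \<in> rep_hom J W W"
      if "W \<in> {W :: ('j \<Rightarrow> 'j, 'c, 'w) wrep. representation J W \<and> has_rank (EndJ J) W (\<lambda>a w. rmul W w a) 1 \<and> admissible J l W}" for W
      using that cl[of W] by (simp add: rep_hom_def)
    show "compose (carrier P) g f \<in> rep_hom J P R"
      if P: "P \<in> {W :: ('j \<Rightarrow> 'j, 'c, 'w) wrep. representation J W \<and> has_rank (EndJ J) W (\<lambda>a w. rmul W w a) 1 \<and> admissible J l W}"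
        and f: "f \<in> rep_hom J P Q" and g: "g \<in> rep_hom J Q R" for P Q R :: "('j \<Rightarrow> 'j, 'c, 'w) wrep" and f g
      using P f g cl[of P] homD[OF f] homD[OF g] by (simp add: rep_hom_def compose_eq compose_def)
  qed (use fs in \<open>auto intro!: compose_Id Id_compose compose_assoc\<close>)
qed

context
  fixes r :: nat
  assumes r: "r > 0" and e: "e = int (r * residue_degree)"
begin

lemma motives_coord:
  assumes "V \<in> Ob (motives r)"
  obtains c \<phi> where "coord K V c \<phi>" "phom e K \<phi>"
  using formal_motive_coord[OF perfect_subfield_K, of V r] assms r unfolding e by (auto simp: motives_def)

lemma is_category_motives: "is_category (motives r :: (('c fls, 'f, 'v) bimod, 'v \<Rightarrow> 'v) category)"
proof -
  have fs: "h \<in> carrier V \<rightarrow> carrier W" "h \<in> extensional (carrier V)"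
    if "h \<in> bimod_hom K V W" for h and V W :: "('c fls, 'f, 'v) bimod"
    using that by (auto simp: bimod_hom_def PiE_def)
  have sel: "Arr (motives r) = bimod_hom K" "Comp (motives r) P Q R g f = compose (carrier P) g f"
    "Idn (motives r) P = (\<lambda>v\<in>carrier P. v)" for P Q R :: "('c fls, 'f, 'v) bimod" and f g
    by (simp_all add: motives_def)
  show ?thesis
    unfolding is_category_def sel
  proof (intro conjI ballI)
    fix P Q R :: "('c fls, 'f, 'v) bimod" and f g
    assume P: "P \<in> Ob (motives r)"
    obtain c \<phi> where c: "coord K P c \<phi>" by (rule motives_coord[OF P])
    show "(\<lambda>v\<in>carrier P. v) \<in> bimod_hom K P P" by (rule bimod_hom_id[OF c])
    show "compose (carrier P) g f \<in> bimod_hom K P R" if "f \<in> bimod_hom K P Q" "g \<in> bimod_hom K Q R"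
      by (rule bimod_hom_compose[OF c that subset_refl])
  qed (use fs in \<open>auto intro!: compose_Id Id_compose compose_assoc\<close>)
qed

lemma T_functor: "is_functor (motives r) (admissible_reps J (- (1 / of_nat r))) (T J) (T_map J)"
  unfolding is_functor_def
proof (intro conjI ballI is_category_motives is_category_admissible_reps)
  fix V assume V: "V \<in> Ob (motives r)"
  obtain c \<phi> where c: "coord K V c \<phi>" "phom e K \<phi>" by (rule motives_coord[OF V])
  show "T J V \<in> Ob (admissible_reps J (- (1 / of_nat r)))"
    using T_representation[OF c] T_admissible[OF c r e] by (simp add: admissible_reps_def)
  show "T_map J V V (Idn (motives r) V) = Idn (admissible_reps J (- (1 / of_nat r))) (T J V)"
    using T_map_id[OF c] by (simp add: motives_def admissible_reps_def)
  fix W f assume W: "W \<in> Ob (motives r)" and f: "f \<in> Arr (motives r) V W"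
  obtain c' \<psi> where c': "coord K W c' \<psi>" "phom e K \<psi>" by (rule motives_coord[OF W])
  show "T_map J V W f \<in> Arr (admissible_reps J (- (1 / of_nat r))) (T J V) (T J W)"
    using T_map_rep_hom[OF c c', of f] f by (simp add: motives_def admissible_reps_def)
  fix Y g assume Y: "Y \<in> Ob (motives r)" and g: "g \<in> Arr (motives r) W Y"
  obtain c'' \<chi>' where c'': "coord K Y c'' \<chi>'" "phom e K \<chi>'" by (rule motives_coord[OF Y])
  show "T_map J V Y (Comp (motives r) V W Y g f) = Comp (admissible_reps J (- (1 / of_nat r))) (T J V) (T J W) (T J Y)
      (T_map J W Y g) (T_map J V W f)"
    using T_map_compose[OF c c' c'', of f g] f g by (simp add: motives_def admissible_reps_def)
qed

text \<open>With twist \<gamma> u = A(\<gamma>) u, conjugate \<open>\<phi>J\<close> by u. Since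
  A(\<gamma>) commutes with the image of \<open>\<phi>J\<close>, the conjugate is fixed by the Weil
  group, hence has coefficients in \<open>K\<close>. Moreover u intertwines \<open>\<phi>J\<close>
  with it and, used as a basis vector of the representation of the new motive, gives back the
  cocycle A.\<close>

lemma T_essentially_surjective:
  assumes dense: "krull_topology closure_of weil = gal" and large: "large_universe TYPE('v)"
    and W: "W \<in> Ob (admissible_reps J (- (1 / of_nat r)))"
  shows "\<exists>V\<in>Ob (motives r :: (('c fls, 'f, 'v) bimod, 'v \<Rightarrow> 'v) category).
    \<exists>f. Defs.is_iso (admissible_reps J (- (1 / of_nat r))) (T J V) W f"
proof -
  have W': "representation J W" "has_rank (EndJ J) W (\<lambda>a w. rmul W w a) 1" "admissible J (- (1 / of_nat r)) W"
    using W by (simp_all add: admissible_reps_def)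
  obtain c A where c: "rcoord W c" and A: "\<And>\<gamma>. \<gamma> \<in> weil \<Longrightarrow> A \<gamma> \<in> DD" "\<And>\<gamma>. \<gamma> \<in> weil \<Longrightarrow> A \<gamma> \<noteq> 0"
    "\<And>\<gamma>. \<gamma> \<in> weil \<Longrightarrow> fls_subdegree (A \<gamma>) = - ord \<gamma>"
    "\<And>\<gamma> \<delta>. \<gamma> \<in> weil \<Longrightarrow> \<delta> \<in> weil \<Longrightarrow> A (\<gamma> \<circ> \<delta>) = A \<delta> \<star> A \<gamma>" "A id = 1"
    "\<And>N. \<exists>S. finite S \<and> (\<forall>\<iota>\<in>wfix S. vanish N (A \<iota> - 1))"
    and act: "\<And>\<gamma> w. \<gamma> \<in> weil \<Longrightarrow> w \<in> carrier W \<Longrightarrow> c (wact W \<gamma> w) = c w \<star> A \<gamma>"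
    by (rule rep_cocycle[OF W' r e]) blast
  obtain u where u: "u \<noteq> 0" "\<And>\<gamma>. \<gamma> \<in> weil \<Longrightarrow> twist \<gamma> u = A \<gamma> \<star> u"
    by (rule twisted_cocycle_trivial[of A, OF DD_Fbar[OF A(1)] A(2-6) dense]) blast+
  define \<phi> where "\<phi> x = sinv u \<star> \<phi>J x \<star> u" for x
  have uphi: "u \<star> \<phi> x = \<phi>J x \<star> u" for x using sinv_right_assoc[OF u(1)] by (simp add: \<phi>_def smult_assoc)
  have "\<phi> x $$ n \<in> K" for x n
  proof (rule fixed_by_dense_weil[OF dense])
    fix \<gamma> assume \<gamma>: "\<gamma> \<in> weil"
    have "twist \<gamma> u \<star> coeffwise \<gamma> (\<phi> x) = twist \<gamma> (u \<star> \<phi> x)"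
      unfolding twist_def coeffwise_gal(3)[OF weilD(1)[OF \<gamma>]] by (rule smult_assoc)
    also have "\<dots> = \<phi>J x \<star> (A \<gamma> \<star> u)" using twist_simps(4)[OF \<gamma> phiJ'(2)] u(2)[OF \<gamma>] by (simp add: uphi)
    also have "\<dots> = A \<gamma> \<star> u \<star> \<phi> x" using DD_comm[OF A(1)[OF \<gamma>]] by (simp add: uphi flip: smult_assoc) (simp add: uphi smult_assoc)
    finally have "coeffwise \<gamma> (\<phi> x) = \<phi> x" using smult_left_cancel twist_simps(7)[OF \<gamma>] u \<gamma> by metis
    then show "\<gamma> (\<phi> x $$ n) = \<phi> x $$ n" using coeffwise_gal(1)[OF weilD(1)[OF \<gamma>]] by metis
  qed
  then have phi: "phom e K \<phi>"
    unfolding \<phi>_def by (intro phom_conjugate[OF phiJ u(1)]) (simp add: laurent_over_def)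
  obtain i :: "'c fls \<Rightarrow> 'v" where i: "inj_on i (laurent_over K)" using large by (auto simp: large_universe_def)
  obtain V :: "('c fls, 'f, 'v) bimod" and cV where V: "coord K V cV \<phi>"
    by (rule motive_in_universe[OF perfect_subfield_K i phi])
  have VM: "V \<in> Ob (motives r)"
    using coord_formal_motive[OF perfect_subfield_K V phi] coord_height[OF perfect_subfield_K V phi[unfolded e]]
    by (simp add: motives_def)
  have uI: "u \<in> intertwiners UNIV \<phi>J \<phi>" by (simp add: intertwiners_def uphi)
  let ?k = "\<lambda>f. tc cV f \<star> sinv u"
  have k: "rcoord (T J V) ?k" by (rule rcoord_T[OF V phi u(1) uI])
  have "?k (wact (T J V) \<gamma> f) = ?k f \<star> A \<gamma>" if \<gamma>: "\<gamma> \<in> weil" and f: "f \<in> carrier (T J V)" for \<gamma> f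
  proof -
    have "?k f \<in> laurent_over Fbar" by (rule DD_Fbar[OF rcoordD(6)[OF k f]])
    then have "twist \<gamma> (?k f \<star> u) = ?k f \<star> (A \<gamma> \<star> u)" using twist_simps(4)[OF \<gamma>] u(2)[OF \<gamma>] by metis
    then have "twist \<gamma> (tc cV f) = ?k f \<star> A \<gamma> \<star> u" using sinv_left[OF u(1)] by (simp add: smult_assoc)
    then show ?thesis using T_wact(2)[OF V phi \<gamma> f] sinv_right[OF u(1)] by (simp add: smult_assoc)
  qed
  note kA = this
  have Tf: "is_functor (motives r :: (('c fls, 'f, 'v) bimod, 'v \<Rightarrow> 'v) category)
    (admissible_reps J (- (1 / of_nat r))) (T J) (T_map J)" by (rule T_functor)
  have TV: "T J V \<in> Ob (admissible_reps J (- (1 / of_nat r)))" using Tf VM by (simp add: is_functor_def)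
  have "\<exists>f. Defs.is_iso (admissible_reps J (- (1 / of_nat r))) (T J V) W f"
    by (rule is_iso_of_rcoord[OF TV W k c]) (fact kA act)+
  then show ?thesis using VM by blast
qed

lemma T_equivalence:
  assumes dense: "krull_topology closure_of weil = gal" and large: "large_universe TYPE('v)"
  shows "is_equivalence (motives r :: (('c fls, 'f, 'v) bimod, 'v \<Rightarrow> 'v) category)
    (admissible_reps J (- (1 / of_nat r))) (T J) (T_map J)"
proof (rule is_equivalenceI_fully_faithful[OF T_functor])
  fix V W :: "('c fls, 'f, 'v) bimod" assume V: "V \<in> Ob (motives r)" and W: "W \<in> Ob (motives r)"
  obtain c \<phi> where c: "coord K V c \<phi>" "phom e K \<phi>" by (rule motives_coord[OF V])
  obtain c' \<psi> where c': "coord K W c' \<psi>" "phom e K \<psi>" by (rule motives_coord[OF W])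
  show "bij_betw (T_map J V W) (Arr (motives r) V W) (Arr (admissible_reps J (- (1 / of_nat r))) (T J V) (T J W))"
    using T_map_bij[OF c c' dense] by (simp add: motives_def admissible_reps_def)
qed (rule T_essentially_surjective[OF dense large])

end

end

theorem theorem7p17:
  fixes embK :: "'q::{finite, field} \<Rightarrow> 'c::field"
    and embF :: "'q \<Rightarrow> 'f::field"
    and K :: "'c set"
    and val :: "'f \<Rightarrow> int"
    and z :: 'f
    and r :: nat
    and J :: "('c fls, 'f, 'j) bimod"
  defines "Mot \<equiv> (drinfeld_setting.motives embK embF K val z r ::
             (('c fls, 'f, 'v) bimod, 'v \<Rightarrow> 'v) category)"
    and "Rep \<equiv> drinfeld_setting.admissible_reps embK embF K val z J (- (1 / of_nat r))"
  assumes "drinfeld_setting embK embF K val z"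
    and "0 < r"
    and "drinfeld_setting.formal_motive embK embF val (drinfeld_setting.Fbar embK) J"
    and "drinfeld_setting.height embF val z (drinfeld_setting.Fbar embK) J = of_nat r"
  shows "is_functor Mot Rep
           (drinfeld_setting.T embK K J) (drinfeld_setting.T_map embK K J) \<and>
         (drinfeld_setting.krull_topology K closure_of drinfeld_setting.weil embK K
            = drinfeld_setting.gal K \<longrightarrow>
          drinfeld_setting.large_universe K TYPE('v) \<longrightarrow>
          is_equivalence Mot Rep
            (drinfeld_setting.T embK K J) (drinfeld_setting.T_map embK K J))"
proof -
  interpret drinfeld_setting embK embF K val z by fact
  note J = formal_motive_coord[OF perfect_subfield_Fbar assms(5,6,4)]
  interpret drinfeld_module embK embF K val z J "motive_coord Fbar J" "phi Fbar J (motive_base J)"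
    "int (r * residue_degree)"
    by unfold_locales (fact J)+
  show ?thesis
    unfolding Mot_def Rep_def using T_functor[OF assms(4) refl] T_equivalence[OF assms(4) refl] by blast
qed
end
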